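(* Let $(\Delta^{1,0},\Delta^{0,1})$ be a $q$-constrained Willmore surface admitting $V$ as a $(q,d)$-central sphere congruence, and let $\rho=\pi_V-\pi_{V^\perp}$. Let $\lambda\mapsto r(\lambda)\in\Gamma(O(\underline{\mathbb{C}}^{n+2}))$ be rational in $\lambda$, holomorphic and invertible at $\lambda=0$ and $\lambda=\infty$, with $1\in\mathrm{dom}(r)$ and $\rho\,r(\lambda)\,\rho^{-1}=r(-\lambda)$ for $\lambda\in\mathrm{dom}(r)$. Suppose that $\lambda\mapsto r(\lambda)\circ d^{\lambda,q}_V\circ r(\lambda)^{-1}$ admits a holomorphic extension to $\lambda\in\mathbb{C}\backslash\{0\}$ through metric connections on $\underline{\mathbb{C}}^{n+2}$, and that $\det r(0)|_V=\det r(\infty)|_V$. Set $\hat\Delta^{1,0}:=r(\infty)\Delta^{1,0}$, $\hat\Delta^{0,1}:=r(0)\Delta^{0,1}$, $\hat q^{1,0}:=\mathrm{Ad}_{r(0)}q^{1,0}$, $\hat q^{0,1}:=\mathrm{Ad}_{r(\infty)}q^{0,1}$ and $\hat q:=\hat q^{1,0}+\hat q^{0,1}$. Then $(r(1)^{-1}\hat\Delta^{1,0},r(1)^{-1}\hat\Delta^{0,1})$ is an $(\mathrm{Ad}_{r(1)^{-1}}\hat q)$-constrained Willmore surface admitting $r(1)^{-1}V$ as an $(\mathrm{Ad}_{r(1)^{-1}}\hat q,d)$-central sphere congruence.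
   Context: $M$ is an oriented surface with a fixed conformal structure; $J$ is the induced complex structure, all $(1,0)$- and $(0,1)$-parts refer to it, and $*\omega=-\omega\circ J$ on $1$-forms. $\mathbb{R}^{n+1,1}$ ($n\ge 3$) has metric $(\,,\,)$ of signature $(n+1,1)$, extended complex bilinearly to $\mathbb{C}^{n+2}=(\mathbb{R}^{n+1,1})^{\mathbb{C}}$; $\underline{\mathbb{C}}^{n+2}=M\times\mathbb{C}^{n+2}$ with trivial flat connection $d$. We identify $\wedge^{2}\mathbb{C}^{n+2}\cong o(\mathbb{C}^{n+2})$ by $(v_1\wedge v_2)(w)=(w,v_1)v_2-(w,v_2)v_1$. For $1$-forms with values in a bundle of Lie algebras, $[\mu\wedge\eta](X,Y)=[\mu_X,\eta_Y]-[\mu_Y,\eta_X]$. $d^\nabla$ is the exterior derivative on endomorphism-valued forms. A metric connection is one for which $(\,,\,)$ is parallel. For a non-degenerate subbundle $V$ with orthogonal projections $\pi_V,\pi_{V^\perp}$: $\mathcal{D}_V:=\pi_V\circ d\circ\pi_V+\pi_{V^\perp}\circ d\circ\pi_{V^\perp}$, $\mathcal{N}_V:=d-\mathcal{D}_V$, and for $q\in\Omega^1(\wedge^2V\oplus\wedge^2V^\perp)$, $\lambda\in\mathbb{C}\backslash\{0\}$, $d^{\lambda,q}_V:=\mathcal{D}_V+\lambda^{-1}\mathcal{N}_V^{1,0}+\lambda\mathcal{N}_V^{0,1}+(\lambda^{-2}-1)q^{1,0}+(\lambda^2-1)q^{0,1}$. $V$ is $q$-constrained harmonic if $d^{\mathcal{D}_V}q^{1,0}=\frac12[q\wedge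 q]=d^{\mathcal{D}_V}q^{0,1}$ and $d^{\mathcal{D}_V}*\mathcal{N}_V=2[q\wedge*\mathcal{N}_V]$. A (complexified) surface is a pair $(\Delta^{1,0},\Delta^{0,1})$ of isotropic rank $2$ subbundles of $\underline{\mathbb{C}}^{n+2}$ intersecting in a rank $1$ bundle $\Delta=\Delta^{1,0}\cap\Delta^{0,1}$ with $d^{1,0}\Gamma(\Delta)\subset\Omega^{1,0}(\Delta^{1,0})$ and $d^{0,1}\Gamma(\Delta)\subset\Omega^{0,1}(\Delta^{0,1})$. A central sphere congruence of it is a non-degenerate rank $4$ subbundle $V\supset\Delta^{1,0}+\Delta^{0,1}$ with $\mathcal{N}_V^{1,0}\Delta^{0,1}=0=\mathcal{N}_V^{0,1}\Delta^{1,0}$. The pair is a $q$-constrained Willmore surface, $q=q^{1,0}+q^{0,1}$, if $q^{1,0}\in\Omega^{1,0}(\wedge^2\Delta^{0,1})$, $q^{0,1}\in\Omega^{0,1}(\wedge^2\Delta^{1,0})$ and it admits a $q$-constrained harmonic central sphere congruence $V$; such a $V$ is called a $(q,d)$-central sphere congruence. The twisting condition makes $r(0)$ and $r(\infty)$ commute with $\rho$, hence preserve $V$. *)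

theory Defs
  imports "HOL-Analysis.Analysis" "HOL-Computational_Algebra.Polynomial"
begin

text \<open>The surface is the whole type \<open>'m\<close>. A chart is a pair of its domain and its coordinate map.\<close>

type_synonym 'm chart = "'m set \<times> ('m \<Rightarrow> real^2)"

abbreviation coord_inv :: "'m chart \<Rightarrow> real^2 \<Rightarrow> 'm" where
  "coord_inv c \<equiv> inv_into (fst c) (snd c)"

text \<open>\<open>Ck_on\<close> is only meant for open sets, where \<open>at z\<close> and \<open>at z within S\<close> agree.\<close>

primrec Ck_on :: "nat \<Rightarrow> (real^2) set \<Rightarrow> (real^2 \<Rightarrow> 'b::real_normed_vector) \<Rightarrow> bool" where
  "Ck_on 0 S f \<longleftrightarrow> continuous_on S f"
| "Ck_on (Suc k) S f \<longleftrightarrow>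
     f differentiable_on S \<and> (\<forall>v. Ck_on k S (\<lambda>z. frechet_derivative f (at z) v))"

definition smooth_on :: "(real^2) set \<Rightarrow> (real^2 \<Rightarrow> 'b::real_normed_vector) \<Rightarrow> bool" where
  "smooth_on S f \<longleftrightarrow> (\<forall>k. Ck_on k S f)"

definition transition :: "'m chart \<Rightarrow> 'm chart \<Rightarrow> real^2 \<Rightarrow> real^2" where
  "transition c c' = snd c' \<circ> coord_inv c"

definition transition_deriv :: "'m chart \<Rightarrow> 'm chart \<Rightarrow> 'm \<Rightarrow> real^2 \<Rightarrow> real^2" where
  "transition_deriv c c' p = frechet_derivative (transition c c') (at (snd c p))"

definition oriented_surface ::
  "'m::{t2_space,second_countable_topology} chart set \<Rightarrow> bool" where
  "oriented_surface \<A> \<longleftrightarrow>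
     (\<Union>c\<in>\<A>. fst c) = UNIV \<and>
     (\<forall>c\<in>\<A>. open (fst c) \<and> open (snd c ` fst c) \<and>
        homeomorphism (fst c) (snd c ` fst c) (snd c) (coord_inv c)) \<and>
     (\<forall>c\<in>\<A>. \<forall>c'\<in>\<A>. smooth_on (snd c ` (fst c \<inter> fst c')) (transition c c') \<and>
        (\<forall>p\<in>fst c \<inter> fst c'. det (matrix (transition_deriv c c' p)) > 0))"

text \<open>A conformal structure is given by a representative Riemannian metric \<open>g\<close>, written in
  charts. It enters all later notions only through \<open>rot90\<close>, which is the same for all metrics
  in the conformal class of \<open>g\<close>.\<close>

type_synonym 'm metric = "'m chart \<Rightarrow> 'm \<Rightarrow> real^2 \<Rightarrow> real^2 \<Rightarrow> real"

definition riemannian_metric ::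
  "'m::{t2_space,second_countable_topology} chart set \<Rightarrow> 'm metric \<Rightarrow> bool" where
  "riemannian_metric \<A> g \<longleftrightarrow>
     (\<forall>c\<in>\<A>. \<forall>p\<in>fst c. bilinear (g c p) \<and> (\<forall>v w. g c p v w = g c p w v) \<and>
        (\<forall>v. v \<noteq> 0 \<longrightarrow> g c p v v > 0)) \<and>
     (\<forall>c\<in>\<A>. \<forall>v w. smooth_on (snd c ` fst c) (\<lambda>x. g c (coord_inv c x) v w)) \<and>
     (\<forall>c\<in>\<A>. \<forall>c'\<in>\<A>. \<forall>p\<in>fst c \<inter> fst c'. \<forall>v w.
        g c p v w = g c' p (transition_deriv c c' p v) (transition_deriv c c' p w))"

text \<open>The complex structure \<open>J\<close>: rotation by \<open>+90\<close> degrees for \<open>g\<close> and the orientation of the atlas.\<close>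

definition rot90 :: "'m metric \<Rightarrow> 'm chart \<Rightarrow> 'm \<Rightarrow> real^2 \<Rightarrow> real^2" where
  "rot90 g c p v =
     (THE w. g c p v w = 0 \<and> g c p w w = g c p v v \<and> v$1 * w$2 - v$2 * w$1 \<ge> 0)"

text \<open>With \<open>n + 1 = CARD('k)\<close>, the space of real vectors indexed by \<open>'k option\<close>
  is \<open>\<real>\<^sup>n\<^sup>+\<^sup>1\<^sup>,\<^sup>1\<close>; the index \<open>None\<close> is the time direction.\<close>

type_synonym 'k cvec = "complex^('k option)"
type_synonym 'k cmat = "complex^('k option)^('k option)"

definition scale_mat :: "complex \<Rightarrow> 'k::finite cmat \<Rightarrow> 'k cmat" (infixl "\<odot>" 75) where
  "a \<odot> X = (\<chi> i j. a * X $ i $ j)"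

definition mink :: "'k::finite cvec \<Rightarrow> 'k cvec \<Rightarrow> complex" where
  "mink x y = (\<Sum>i\<in>UNIV. x $ Some i * y $ Some i) - x $ None * y $ None"

definition orth_group :: "'k::finite cmat set" where
  "orth_group = {T. \<forall>x y. mink (T *v x) (T *v y) = mink x y}"

definition perp :: "'k::finite cvec set \<Rightarrow> 'k cvec set" where
  "perp E = {x. \<forall>y\<in>E. mink x y = 0}"

definition isotropic :: "'k::finite cvec set \<Rightarrow> bool" where
  "isotropic E \<longleftrightarrow> (\<forall>x\<in>E. \<forall>y\<in>E. mink x y = 0)"

definition nondegenerate :: "'k::finite cvec set \<Rightarrow> bool" where
  "nondegenerate E \<longleftrightarrow> E \<inter> perp E = {0}"

definition oproj :: "'k::finite cvec set \<Rightarrow> 'k cmat" where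
  "oproj E = matrix (\<lambda>x. THE y. y \<in> E \<and> x - y \<in> perp E)"

definition wedge :: "'k::finite cvec \<Rightarrow> 'k cvec \<Rightarrow> 'k cmat" where
  "wedge v1 v2 = matrix (\<lambda>w. mink w v1 *s v2 - mink w v2 *s v1)"

text \<open>For a complex subspace \<open>E\<close> the generators are closed under complex scaling, so the real span
  is the complex one.\<close>

definition wedge2 :: "'k::finite cvec set \<Rightarrow> 'k cmat set" where
  "wedge2 E = span {wedge v1 v2 | v1 v2. v1 \<in> E \<and> v2 \<in> E}"

definition Ad :: "'k::finite cmat \<Rightarrow> 'k cmat \<Rightarrow> 'k cmat" where
  "Ad T X = T ** X ** matrix_inv T"

text \<open>The determinant of the restriction of \<open>T\<close> to a \<open>T\<close>-invariant subspace \<open>E\<close> of dimension 4: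
  \<open>B\<close> is the matrix of the restriction in the basis \<open>e\<close>.\<close>

definition det_on4 :: "'k::finite cvec set \<Rightarrow> 'k cmat \<Rightarrow> complex" where
  "det_on4 E T =
     (THE \<delta>. \<exists>(e :: 4 \<Rightarrow> 'k cvec) (B :: complex^4^4).
        inj e \<and> vec.independent (range e) \<and> vec.span (range e) = E \<and>
        (\<forall>j. T *v e j = (\<Sum>i\<in>UNIV. B $ i $ j *s e i)) \<and> \<delta> = det B)"

definition smooth_map ::
  "'m chart set \<Rightarrow> 'm set \<Rightarrow> ('m \<Rightarrow> 'b::real_normed_vector) \<Rightarrow> bool" where
  "smooth_map \<A> W f \<longleftrightarrow> (\<forall>c\<in>\<A>. smooth_on (snd c ` (fst c \<inter> W)) (f \<circ> coord_inv c))"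

definition subbundle ::
  "'m::topological_space chart set \<Rightarrow> nat \<Rightarrow> ('m \<Rightarrow> 'k::finite cvec set) \<Rightarrow> bool" where
  "subbundle \<A> k E \<longleftrightarrow>
     (\<forall>p. vec.subspace (E p) \<and> vec.dim (E p) = k) \<and>
     (\<forall>p. \<exists>W s. open W \<and> p \<in> W \<and> (\<forall>i<k. smooth_map \<A> W (s i)) \<and>
        (\<forall>x\<in>W. E x = vec.span ((\<lambda>i. s i x) ` {..<k})))"

text \<open>A tangent vector is given by its components in a chart, and a form by its values on
  such components in every chart. Values for charts outside the atlas, or at points outside the
  domain of the chart, are irrelevant.\<close>

type_synonym ('m, 'b) form1 = "'m chart \<Rightarrow> 'm \<Rightarrow> real^2 \<Rightarrow> 'b"
type_synonym ('m, 'b) form2 = "'m chart \<Rightarrow> 'm \<Rightarrow> real^2 \<Rightarrow> real^2 \<Rightarrow> 'b"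

definition one_form :: "'m chart set \<Rightarrow> ('m, 'b::real_normed_vector) form1 \<Rightarrow> bool" where
  "one_form \<A> \<omega> \<longleftrightarrow>
     (\<forall>c\<in>\<A>. \<forall>p\<in>fst c. linear (\<omega> c p)) \<and>
     (\<forall>c\<in>\<A>. \<forall>v. smooth_on (snd c ` fst c) (\<lambda>x. \<omega> c (coord_inv c x) v)) \<and>
     (\<forall>c\<in>\<A>. \<forall>c'\<in>\<A>. \<forall>p\<in>fst c \<inter> fst c'. \<forall>v. \<omega> c p v = \<omega> c' p (transition_deriv c c' p v))"

definition differential :: "('m \<Rightarrow> 'b::real_normed_vector) \<Rightarrow> ('m, 'b) form1" where
  "differential f c p v = frechet_derivative (f \<circ> coord_inv c) (at (snd c p)) v"

definition hodge :: "'m metric \<Rightarrow> ('m, 'b::uminus) form1 \<Rightarrow> ('m, 'b) form1" where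
  "hodge g \<omega> c p v = - \<omega> c p (rot90 g c p v)"

text \<open>A form is of type (1,0) if \<open>\<omega> \<circ> J = \<i> \<omega>\<close>, and of type (0,1) if \<open>\<omega> \<circ> J = - \<i> \<omega>\<close>. The
  parameter \<open>sc\<close> is the complex scaling of the values; the suffixes \<open>v\<close> and \<open>m\<close> stand for
  vector-valued and matrix-valued forms.\<close>

definition part10 ::
  "(complex \<Rightarrow> 'b \<Rightarrow> 'b::ab_group_add) \<Rightarrow> 'm metric \<Rightarrow> ('m, 'b) form1 \<Rightarrow> ('m, 'b) form1" where
  "part10 sc g \<omega> c p v = sc (1/2) (\<omega> c p v - sc \<i> (\<omega> c p (rot90 g c p v)))"

definition part01 ::
  "(complex \<Rightarrow> 'b \<Rightarrow> 'b::ab_group_add) \<Rightarrow> 'm metric \<Rightarrow> ('m, 'b) form1 \<Rightarrow> ('m, 'b) form1" where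
  "part01 sc g \<omega> c p v = sc (1/2) (\<omega> c p v + sc \<i> (\<omega> c p (rot90 g c p v)))"

abbreviation "part10v \<equiv> part10 (\<lambda>a (x :: 'k::finite cvec). a *s x)"
abbreviation "part01v \<equiv> part01 (\<lambda>a (x :: 'k::finite cvec). a *s x)"
abbreviation "part10m \<equiv> part10 (\<lambda>a (X :: 'k::finite cmat). a \<odot> X)"
abbreviation "part01m \<equiv> part01 (\<lambda>a (X :: 'k::finite cmat). a \<odot> X)"

definition lie :: "'k::finite cmat \<Rightarrow> 'k cmat \<Rightarrow> 'k cmat" where
  "lie X Y = X ** Y - Y ** X"

definition wedge_bracket ::
  "('m, 'k::finite cmat) form1 \<Rightarrow> ('m, 'k cmat) form1 \<Rightarrow> ('m, 'k cmat) form2" where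
  "wedge_bracket \<mu> \<eta> c p v w = lie (\<mu> c p v) (\<eta> c p w) - lie (\<mu> c p w) (\<eta> c p v)"

definition form2_eq ::
  "'m chart set \<Rightarrow> ('m, 'b) form2 \<Rightarrow> ('m, 'b) form2 \<Rightarrow> bool" where
  "form2_eq \<A> \<alpha> \<beta> \<longleftrightarrow> (\<forall>c\<in>\<A>. \<forall>p\<in>fst c. \<forall>v w. \<alpha> c p v w = \<beta> c p v w)"

definition map_bundle ::
  "('m \<Rightarrow> 'k::finite cmat) \<Rightarrow> ('m \<Rightarrow> 'k cvec set) \<Rightarrow> 'm \<Rightarrow> 'k cvec set" where
  "map_bundle T E p = (\<lambda>u. T p *v u) ` E p"

text \<open>Connections act on (local) sections; every connection on the trivial bundle is
  \<open>d + \<Gamma>\<close> for a matrix-valued 1-form \<open>\<Gamma>\<close>.\<close>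

type_synonym ('m, 'k) operator = "('m \<Rightarrow> 'k cvec) \<Rightarrow> ('m, 'k cvec) form1"

definition conn :: "('m, 'k::finite cmat) form1 \<Rightarrow> ('m, 'k) operator" where
  "conn \<Gamma> \<sigma> c p v = differential \<sigma> c p v + \<Gamma> c p v *v \<sigma> p"

definition metric_connection ::
  "'m::topological_space chart set \<Rightarrow> ('m, 'k::finite) operator \<Rightarrow> bool" where
  "metric_connection \<A> nab \<longleftrightarrow>
     (\<forall>W \<sigma> \<tau>. open W \<longrightarrow> smooth_map \<A> W \<sigma> \<longrightarrow> smooth_map \<A> W \<tau> \<longrightarrow>
        (\<forall>c\<in>\<A>. \<forall>p\<in>fst c \<inter> W. \<forall>v.
           differential (\<lambda>x. mink (\<sigma> x) (\<tau> x)) c p v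
             = mink (nab \<sigma> c p v) (\<tau> p) + mink (\<sigma> p) (nab \<tau> c p v)))"

text \<open>The induced connection on endomorphisms, \<open>(nab T) u = nab (T u) - T (nab u)\<close>, evaluated on constant
  sections \<open>u\<close>, which suffices as it is tensorial; and the exterior derivative, evaluated
  on coordinate vector fields, whose Lie bracket vanishes.\<close>

definition end_conn ::
  "('m, 'k::finite) operator \<Rightarrow> ('m \<Rightarrow> 'k cmat) \<Rightarrow> ('m, 'k cmat) form1" where
  "end_conn nab T c p v = matrix (\<lambda>u. nab (\<lambda>x. T x *v u) c p v - T p *v nab (\<lambda>_. u) c p v)"

definition ext_deriv ::
  "('m, 'k::finite) operator \<Rightarrow> ('m, 'k cmat) form1 \<Rightarrow> ('m, 'k cmat) form2" where
  "ext_deriv nab \<omega> c p v w =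
     end_conn nab (\<lambda>x. \<omega> c x w) c p v - end_conn nab (\<lambda>x. \<omega> c x v) c p w"

definition conn_D :: "('m \<Rightarrow> 'k::finite cvec set) \<Rightarrow> ('m, 'k) operator" where
  "conn_D V \<sigma> c p v =
     oproj (V p) *v differential (\<lambda>x. oproj (V x) *v \<sigma> x) c p v +
     oproj (perp (V p)) *v differential (\<lambda>x. oproj (perp (V x)) *v \<sigma> x) c p v"

text \<open>\<open>d - \<D>\<^sub>V\<close> is tensorial, so its matrix can be read off from constant sections.\<close>

definition form_N :: "('m \<Rightarrow> 'k::finite cvec set) \<Rightarrow> ('m, 'k cmat) form1" where
  "form_N V c p v = matrix (\<lambda>u. differential (\<lambda>_. u) c p v - conn_D V (\<lambda>_. u) c p v)"

definition conn_lambda ::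
  "'m metric \<Rightarrow> ('m \<Rightarrow> 'k::finite cvec set) \<Rightarrow> ('m, 'k cmat) form1 \<Rightarrow> complex \<Rightarrow>
   ('m, 'k) operator" where
  "conn_lambda g V q \<zeta> \<sigma> c p v = conn_D V \<sigma> c p v +
     (inverse \<zeta> \<odot> part10m g (form_N V) c p v + \<zeta> \<odot> part01m g (form_N V) c p v
      + (inverse (\<zeta>\<^sup>2) - 1) \<odot> part10m g q c p v
      + (\<zeta>\<^sup>2 - 1) \<odot> part01m g q c p v) *v \<sigma> p"

definition gauge_conj ::
  "('m \<Rightarrow> 'k::finite cmat) \<Rightarrow> ('m, 'k) operator \<Rightarrow> ('m, 'k) operator" where
  "gauge_conj T nab \<sigma> c p v = T p *v nab (\<lambda>x. matrix_inv (T x) *v \<sigma> x) c p v"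

definition constrained_harmonic ::
  "'m chart set \<Rightarrow> 'm metric \<Rightarrow> ('m \<Rightarrow> 'k::finite cvec set) \<Rightarrow> ('m, 'k cmat) form1 \<Rightarrow> bool" where
  "constrained_harmonic \<A> g V q \<longleftrightarrow>
     one_form \<A> q \<and>
     (\<forall>c\<in>\<A>. \<forall>p\<in>fst c. \<forall>v.
        q c p v \<in> {X + Y | X Y. X \<in> wedge2 (V p) \<and> Y \<in> wedge2 (perp (V p))}) \<and>
     form2_eq \<A> (ext_deriv (conn_D V) (part10m g q))
       (\<lambda>c p v w. (1/2) \<odot> wedge_bracket q q c p v w) \<and>
     form2_eq \<A> (ext_deriv (conn_D V) (part01m g q))
       (\<lambda>c p v w. (1/2) \<odot> wedge_bracket q q c p v w) \<and>
     form2_eq \<A> (ext_deriv (conn_D V) (hodge g (form_N V)))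
       (\<lambda>c p v w. 2 \<odot> wedge_bracket q (hodge g (form_N V)) c p v w)"

text \<open>\<open>\<Gamma>(\<Delta>)\<close> is read as the sheaf of smooth sections, so that the derivative conditions range
  over sections on arbitrary open sets.\<close>

definition complexified_surface ::
  "'m::topological_space chart set \<Rightarrow> 'm metric \<Rightarrow>
   ('m \<Rightarrow> 'k::finite cvec set) \<Rightarrow> ('m \<Rightarrow> 'k cvec set) \<Rightarrow> bool" where
  "complexified_surface \<A> g \<Delta>10 \<Delta>01 \<longleftrightarrow>
     subbundle \<A> 2 \<Delta>10 \<and> subbundle \<A> 2 \<Delta>01 \<and>
     (\<forall>p. isotropic (\<Delta>10 p) \<and> isotropic (\<Delta>01 p)) \<and>
     subbundle \<A> 1 (\<lambda>p. \<Delta>10 p \<inter> \<Delta>01 p) \<and>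
     (\<forall>W \<sigma>. open W \<longrightarrow> smooth_map \<A> W \<sigma> \<longrightarrow> (\<forall>x\<in>W. \<sigma> x \<in> \<Delta>10 x \<inter> \<Delta>01 x) \<longrightarrow>
        (\<forall>c\<in>\<A>. \<forall>p\<in>fst c \<inter> W. \<forall>v.
           part10v g (differential \<sigma>) c p v \<in> \<Delta>10 p \<and>
           part01v g (differential \<sigma>) c p v \<in> \<Delta>01 p))"

definition central_sphere_congruence ::
  "'m::topological_space chart set \<Rightarrow> 'm metric \<Rightarrow>
   ('m \<Rightarrow> 'k::finite cvec set) \<Rightarrow> ('m \<Rightarrow> 'k cvec set) \<Rightarrow> ('m \<Rightarrow> 'k cvec set) \<Rightarrow> bool" where
  "central_sphere_congruence \<A> g \<Delta>10 \<Delta>01 V \<longleftrightarrow>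
     subbundle \<A> 4 V \<and> (\<forall>p. nondegenerate (V p)) \<and>
     (\<forall>p. {x + y | x y. x \<in> \<Delta>10 p \<and> y \<in> \<Delta>01 p} \<subseteq> V p) \<and>
     (\<forall>c\<in>\<A>. \<forall>p\<in>fst c. \<forall>v.
        (\<forall>u\<in>\<Delta>01 p. part10m g (form_N V) c p v *v u = 0) \<and>
        (\<forall>u\<in>\<Delta>10 p. part01m g (form_N V) c p v *v u = 0))"

definition qd_central_sphere_congruence ::
  "'m::topological_space chart set \<Rightarrow> 'm metric \<Rightarrow>
   ('m \<Rightarrow> 'k::finite cvec set) \<Rightarrow> ('m \<Rightarrow> 'k cvec set) \<Rightarrow> ('m, 'k cmat) form1 \<Rightarrow>
   ('m \<Rightarrow> 'k cvec set) \<Rightarrow> bool" where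
  "qd_central_sphere_congruence \<A> g \<Delta>10 \<Delta>01 q V \<longleftrightarrow>
     central_sphere_congruence \<A> g \<Delta>10 \<Delta>01 V \<and> constrained_harmonic \<A> g V q"

definition constrained_Willmore ::
  "'m::topological_space chart set \<Rightarrow> 'm metric \<Rightarrow>
   ('m \<Rightarrow> 'k::finite cvec set) \<Rightarrow> ('m \<Rightarrow> 'k cvec set) \<Rightarrow> ('m, 'k cmat) form1 \<Rightarrow> bool" where
  "constrained_Willmore \<A> g \<Delta>10 \<Delta>01 q \<longleftrightarrow>
     complexified_surface \<A> g \<Delta>10 \<Delta>01 \<and> one_form \<A> q \<and>
     (\<forall>c\<in>\<A>. \<forall>p\<in>fst c. \<forall>v.
        part10m g q c p v \<in> wedge2 (\<Delta>01 p) \<and> part01m g q c p v \<in> wedge2 (\<Delta>10 p)) \<and>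
     (\<exists>V. qd_central_sphere_congruence \<A> g \<Delta>10 \<Delta>01 q V)"

text \<open>A rational function of \<open>\<zeta>\<close> with values in the space of smooth sections of the endomorphism
  bundle: a polynomial with smooth matrix coefficients \<open>P k\<close>, over a complex polynomial \<open>Q\<close>, in
  lowest terms. \<open>D\<close> is the finite part of its domain, i.e. the complement of the poles.\<close>

definition rational_family ::
  "'m chart set \<Rightarrow> (complex \<Rightarrow> 'm \<Rightarrow> 'k::finite cmat) \<Rightarrow> complex set \<Rightarrow> bool" where
  "rational_family \<A> r D \<longleftrightarrow>
     (\<exists>(P :: nat \<Rightarrow> 'm \<Rightarrow> 'k cmat) (d :: nat) (Q :: complex poly).
        Q \<noteq> 0 \<and> (\<forall>k. smooth_map \<A> UNIV (P k)) \<and>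
        (\<forall>\<zeta>. poly Q \<zeta> = 0 \<longrightarrow> (\<exists>p. (\<Sum>k\<le>d. \<zeta> ^ k \<odot> P k p) \<noteq> 0)) \<and>
        D = {\<zeta>. poly Q \<zeta> \<noteq> 0} \<and>
        (\<forall>\<zeta>\<in>D. \<forall>p. r \<zeta> p = inverse (poly Q \<zeta>) \<odot> (\<Sum>k\<le>d. \<zeta> ^ k \<odot> P k p)))"

text \<open>The extension is the family \<open>d + \<Gamma> \<zeta>\<close>; holomorphic dependence on \<open>\<zeta>\<close> means that of the
  components of the connection form.\<close>

definition extends_by_metric_connections ::
  "'m::topological_space chart set \<Rightarrow> complex set \<Rightarrow> (complex \<Rightarrow> ('m, 'k::finite) operator) \<Rightarrow> bool"
where
  "extends_by_metric_connections \<A> D F \<longleftrightarrow>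
     (\<exists>\<Gamma> :: complex \<Rightarrow> ('m, 'k cmat) form1.
        (\<forall>\<zeta>. \<zeta> \<noteq> 0 \<longrightarrow> one_form \<A> (\<Gamma> \<zeta>) \<and> metric_connection \<A> (conn (\<Gamma> \<zeta>))) \<and>
        (\<forall>c\<in>\<A>. \<forall>p\<in>fst c. \<forall>v i j. (\<lambda>\<zeta>. \<Gamma> \<zeta> c p v $ i $ j) holomorphic_on - {0}) \<and>
        (\<forall>\<zeta>\<in>D - {0}. \<forall>W \<sigma>. open W \<longrightarrow> smooth_map \<A> W \<sigma> \<longrightarrow>
           (\<forall>c\<in>\<A>. \<forall>p\<in>fst c \<inter> W. \<forall>v. conn (\<Gamma> \<zeta>) \<sigma> c p v = F \<zeta> \<sigma> c p v)))"

end

theory Submission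
  imports Defs "HOL-Complex_Analysis.Cauchy_Integral_Formula"
begin

text \<open>Put \<open>s(\<lambda>) = r(1)\<^sup>-\<^sup>1 r(\<lambda>)\<close>. The \<open>(1,0)\<close>- and \<open>(0,1)\<close>-parts of the gauged connections
\<open>s(\<lambda>) \<circ> d\<^sup>\<lambda> \<circ> s(\<lambda>)\<^sup>-\<^sup>1\<close> are holomorphic on the punctured plane, bounded at one puncture and with at most a double
pole at the other, so by Liouville's theorem each is a Laurent polynomial with three coefficients. These
are determined by the double pole, which is the gauged \<open>q\<close>, by the value \<open>d\<close> at \<open>\<lambda> = 1\<close> and by
the twisting condition, which expresses the value at \<open>\<lambda> = -1\<close> through the reflection in
\<open>r(1)\<^sup>-\<^sup>1 V\<close>. Hence the gauged connections are the family associated with \<open>r(1)\<^sup>-\<^sup>1 V\<close> and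
the new \<open>q\<close>. Comparing coefficients in \<open>\<lambda>\<close>, constrained harmonicity of \<open>V\<close> amounts to flatness
of the family, which is invariant under gauge transformations and, by continuity, survives at the
values of \<open>\<lambda>\<close> where \<open>r\<close> is not defined. The conditions on the new isotropic bundles come from
the same limits at \<open>0\<close> and \<open>\<infinity>\<close>, and the determinant condition keeps their intersection a line.\<close>

section \<open>Smooth maps in the plane\<close>

text \<open>All notions of surface, sphere congruence and harmonicity refer to the trivial
  connection d, whereas gauging by r(\<lambda>) moves d to another flat connection. The factor
  r(1)^-1 undoes this: s(1) = 1, so the gauged family passes through d at \<lambda> = 1. Splitting
  by type is what makes both punctures manageable. The (1,0)-part of the original family contains
  the powers 0, -1, -2 of \<lambda> and the (0,1)-part the powers 0, 1, 2, so each part is bounded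
  at one end, and there its value can be computed in two ways: from the Laurent polynomial and from
  the limit of s. The first use of the coefficients is to recognise the family of the new bundle.
  The second is this identity at the bounded end, which ties the derivative of s(\<infinity>), for
  type (1,0), or of s(0), for type (0,1), to the new data; it carries over the derivative conditions
  on the isotropic line. That the new N vanishes on the new planes is not an identity of
  coefficients but a parity argument at the pole, where the twisting condition makes a divergent
  term odd.\<close>

abbreviation pd :: "(real^2 \<Rightarrow> 'b::real_normed_vector) \<Rightarrow> real^2 \<Rightarrow> real^2 \<Rightarrow> 'b" where
  "pd f z v \<equiv> frechet_derivative f (at z) v"

lemma pd_has_derivative:
  "f differentiable (at z) \<Longrightarrow> (f has_derivative (\<lambda>v. pd f z v)) (at z)"
  by (metis frechet_derivative_works)

lemma pd_eqI: "(f has_derivative f') (at z) \<Longrightarrow> pd f z v = f' v"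
  by (metis frechet_derivative_at)

lemma pd_cong:
  assumes "open S" "z \<in> S" "\<And>x. x \<in> S \<Longrightarrow> f x = g x"
  shows "pd f z v = pd g z v"
proof -
  have "(f has_derivative D) (at z) = (g has_derivative D) (at z)" for D
    using has_derivative_transform_within_open[OF _ assms(1,2), of f D UNIV g]
      has_derivative_transform_within_open[OF _ assms(1,2), of g D UNIV f] assms(3) by auto
  then show ?thesis unfolding frechet_derivative_def by simp
qed

lemma differentiable_cong_open:
  assumes "open S" "z \<in> S" "\<And>x. x \<in> S \<Longrightarrow> f x = g x" "f differentiable (at z)"
  shows "g differentiable (at z)"
  using has_derivative_transform_within_open[OF _ assms(1,2), of f _ UNIV g] assms(3,4)
  unfolding differentiable_def by auto

lemma linear_pd: "f differentiable (at z) \<Longrightarrow> linear (pd f z)"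
  by (metis frechet_derivative_works has_derivative_linear)

lemma differentiable_bilinear:
  assumes "bounded_bilinear B" "f differentiable (at z)" "g differentiable (at z)"
  shows "(\<lambda>y. B (f y) (g y)) differentiable (at z)"
  using bounded_bilinear.FDERIV[OF assms(1)] assms(2,3) unfolding differentiable_def by blast

lemma pd_bilinear:
  assumes "bounded_bilinear B" "f differentiable (at z)" "g differentiable (at z)"
  shows "pd (\<lambda>y. B (f y) (g y)) z v = B (f z) (pd g z v) + B (pd f z v) (g z)"
  by (rule pd_eqI[OF bounded_bilinear.FDERIV[OF assms(1) pd_has_derivative[OF assms(2)]
        pd_has_derivative[OF assms(3)]]])

lemma differentiable_bounded_linear:
  assumes "bounded_linear L" "f differentiable (at z)"
  shows "(\<lambda>y. L (f y)) differentiable (at z)"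
  using bounded_linear.has_derivative[OF assms(1)] assms(2) unfolding differentiable_def by blast

lemma pd_bounded_linear:
  assumes "bounded_linear L" "f differentiable (at z)"
  shows "pd (\<lambda>y. L (f y)) z v = L (pd f z v)"
  by (rule pd_eqI[OF bounded_linear.has_derivative[OF assms(1) pd_has_derivative[OF assms(2)]]])

lemma pd_add:
  assumes "f differentiable (at z)" "g differentiable (at z)"
  shows "pd (\<lambda>y. f y + g y) z v = pd f z v + pd g z v"
  by (rule pd_eqI[OF has_derivative_add[OF pd_has_derivative[OF assms(1)] pd_has_derivative[OF assms(2)]]])

lemma pd_diff:
  assumes "f differentiable (at z)" "g differentiable (at z)"
  shows "pd (\<lambda>y. f y - g y) z v = pd f z v - pd g z v"
  by (rule pd_eqI[OF has_derivative_diff[OF pd_has_derivative[OF assms(1)] pd_has_derivative[OF assms(2)]]])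

lemma pd_uminus:
  assumes "f differentiable (at z)"
  shows "pd (\<lambda>y. - f y) z v = - pd f z v"
  by (rule pd_eqI[OF has_derivative_minus[OF pd_has_derivative[OF assms]]])

lemma pd_sum:
  assumes "\<And>i. i \<in> I \<Longrightarrow> f i differentiable (at z)"
  shows "pd (\<lambda>y. \<Sum>i\<in>I. f i y) z v = (\<Sum>i\<in>I. pd (f i) z v)"
  by (rule pd_eqI[OF has_derivative_sum]) (simp add: assms pd_has_derivative)

text \<open>\<open>Ck_on\<close> iterates the total function \<open>frechet_derivative\<close>,
  while the product rule and its relatives hold only at points of S. This lemma lets the iteration
  continue with the right-hand side of such a rule.\<close>

lemma Ck_on_cong:
  assumes "open S" "\<And>z. z \<in> S \<Longrightarrow> f z = g z" "Ck_on k S f"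
  shows "Ck_on k S g"
  using assms(2,3)
proof (induction k arbitrary: f g)
  case 0
  then show ?case by (metis Ck_on.simps(1) continuous_on_cong)
next
  case (Suc k)
  have "g differentiable_on S"
    unfolding differentiable_on_eq_differentiable_at[OF assms(1)]
  proof
    fix z assume "z \<in> S"
    then show "g differentiable (at z)"
      using Suc.prems differentiable_cong_open[OF assms(1), of z f g]
      by (simp add: differentiable_on_eq_differentiable_at[OF assms(1)])
  qed
  moreover have "Ck_on k S (\<lambda>z. pd g z v)" for v
    using Suc.IH[of "\<lambda>z. pd f z v" "\<lambda>z. pd g z v"] Suc.prems pd_cong[OF assms(1), of _ f g] by auto
  ultimately show ?case by simp
qed

lemma Ck_on_Suc_imp: "Ck_on (Suc k) S f \<Longrightarrow> Ck_on k S f"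
proof (induction k arbitrary: f)
  case 0
  then show ?case by (simp add: differentiable_imp_continuous_on)
next
  case (Suc k)
  then show ?case by (metis Ck_on.simps(2))
qed

lemma Ck_on_mono_set: "T \<subseteq> S \<Longrightarrow> Ck_on k S f \<Longrightarrow> Ck_on k T f"
  by (induction k arbitrary: f) (auto intro: continuous_on_subset differentiable_on_subset)

lemma Ck_on_const: "Ck_on k S (\<lambda>_. c)"
  by (induction k arbitrary: c) (auto simp: differentiable_on_def)

lemma Ck_on_add:
  assumes "open S" "Ck_on k S f" "Ck_on k S g"
  shows "Ck_on k S (\<lambda>z. f z + g z)"
  using assms(2,3)
proof (induction k arbitrary: f g)
  case 0
  then show ?case by (simp add: continuous_on_add)
next
  case (Suc k)
  have d: "f differentiable (at z)" "g differentiable (at z)" if "z \<in> S" for z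
    using Suc.prems that differentiable_on_eq_differentiable_at[OF assms(1)] by auto
  have "Ck_on k S (\<lambda>z. pd (\<lambda>y. f y + g y) z v)" for v
    by (rule Ck_on_cong[OF assms(1) _ Suc.IH[of "\<lambda>z. pd f z v" "\<lambda>z. pd g z v"]])
      (use d Suc.prems in \<open>auto simp: pd_add\<close>)
  then show ?case using Suc.prems by simp
qed

lemma Ck_on_bilinear:
  assumes "open S" "bounded_bilinear B" "Ck_on k S f" "Ck_on k S g"
  shows "Ck_on k S (\<lambda>z. B (f z) (g z))"
  using assms(3,4)
proof (induction k arbitrary: f g)
  case 0
  then show ?case by (simp add: bounded_bilinear.continuous_on[OF assms(2)])
next
  case (Suc k)
  have d: "f differentiable (at z)" "g differentiable (at z)" if "z \<in> S" for z
    using Suc.prems that differentiable_on_eq_differentiable_at[OF assms(1)] by auto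
  have "Ck_on k S (\<lambda>z. pd (\<lambda>y. B (f y) (g y)) z v)" for v
    by (rule Ck_on_cong[OF assms(1) _ Ck_on_add[OF assms(1)
         Suc.IH[of f "\<lambda>z. pd g z v"] Suc.IH[of "\<lambda>z. pd f z v" g]]])
      (use d Suc.prems Ck_on_Suc_imp[of k S f] Ck_on_Suc_imp[of k S g]
        pd_bilinear[OF assms(2)] in auto)
  then show ?case using d differentiable_bilinear[OF assms(2), of f _ g]
    by (auto simp: differentiable_on_eq_differentiable_at[OF assms(1)])
qed

lemma Ck_on_bounded_linear:
  assumes "open S" "bounded_linear L" "Ck_on k S f"
  shows "Ck_on k S (\<lambda>z. L (f z))"
  using assms(3)
proof (induction k arbitrary: f)
  case 0
  then show ?case by (simp add: bounded_linear.continuous_on[OF assms(2)])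
next
  case (Suc k)
  have d: "f differentiable (at z)" if "z \<in> S" for z
    using Suc.prems that differentiable_on_eq_differentiable_at[OF assms(1)] by auto
  have "Ck_on k S (\<lambda>z. pd (\<lambda>y. L (f y)) z v)" for v
    by (rule Ck_on_cong[OF assms(1) _ Suc.IH[of "\<lambda>z. pd f z v"]])
      (use d Suc.prems pd_bounded_linear[OF assms(2)] in auto)
  then show ?case using d differentiable_bounded_linear[OF assms(2), of f]
    by (auto simp: differentiable_on_eq_differentiable_at[OF assms(1)])
qed

text \<open>The derivative of 1/f is a product of 1/f, taken twice, and the derivative of f, so the
  conclusion at level k is fed back in to reach level k + 1.\<close>

lemma Ck_on_inverse:
  fixes f :: "real^2 \<Rightarrow> 'b::real_normed_field"
  assumes "open S" "\<And>z. z \<in> S \<Longrightarrow> f z \<noteq> 0" "Ck_on k S f"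
  shows "Ck_on k S (\<lambda>z. inverse (f z))"
  using assms(3)
proof (induction k)
  case 0
  then show ?case by (simp add: assms(2) continuous_on_inverse)
next
  case (Suc k)
  have d: "f differentiable (at z)" if "z \<in> S" for z
    using Suc.prems that differentiable_on_eq_differentiable_at[OF assms(1)] by auto
  have h: "((\<lambda>y. inverse (f y)) has_derivative (\<lambda>v. - (inverse (f z) * pd f z v * inverse (f z)))) (at z)"
    if "z \<in> S" for z
    using Deriv.has_derivative_inverse[OF assms(2)[OF that] pd_has_derivative[OF d[OF that]]] .
  have i: "Ck_on k S (\<lambda>z. inverse (f z))"
    using Suc.IH Ck_on_Suc_imp[OF Suc.prems] by blast
  have mb: "bounded_linear (\<lambda>x::'b. - x)" by (simp add: bounded_linear_minus bounded_linear_ident)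
  have "Ck_on k S (\<lambda>z. - (inverse (f z) * pd f z v * inverse (f z)))" for v
    using Suc.prems i
    by (intro Ck_on_bounded_linear[OF assms(1) mb] Ck_on_bilinear[OF assms(1) bounded_bilinear_mult])
      auto
  then have "Ck_on k S (\<lambda>z. pd (\<lambda>y. inverse (f y)) z v)" for v
    by (rule Ck_on_cong[OF assms(1), rotated]) (rule pd_eqI[OF h, symmetric])
  then show ?case using h
    by (auto simp: differentiable_on_eq_differentiable_at[OF assms(1)] differentiable_def)
qed

text \<open>Meant for the area density of the metric. The derivative contains the inverse of the
  same root, so the induction closes as for \<open>Ck_on_inverse\<close>.\<close>

lemma Ck_on_sqrt:
  fixes f :: "real^2 \<Rightarrow> real"
  assumes "open S" "\<And>z. z \<in> S \<Longrightarrow> f z > 0" "Ck_on k S f"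
  shows "Ck_on k S (\<lambda>z. sqrt (f z))"
  using assms(3)
proof (induction k)
  case 0
  then show ?case by (simp add: continuous_on_real_sqrt)
next
  case (Suc k)
  have d: "f differentiable (at z)" if "z \<in> S" for z
    using Suc.prems that differentiable_on_eq_differentiable_at[OF assms(1)] by auto
  have h: "((\<lambda>y. sqrt (f y)) has_derivative (\<lambda>v. pd f z v * (inverse (sqrt (f z)) / 2))) (at z)"
    if "z \<in> S" for z
    using has_derivative_real_sqrt[OF assms(2)[OF that] pd_has_derivative[OF d[OF that]]]
    by (simp add: field_simps)
  have i: "Ck_on k S (\<lambda>z. sqrt (f z))"
    using Suc.IH Ck_on_Suc_imp[OF Suc.prems] by blast
  have "Ck_on k S (\<lambda>z. pd f z v * (inverse (sqrt (f z)) / 2))" for v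
    using Suc.prems assms(2)
    by (intro Ck_on_bounded_linear[OF assms(1) bounded_linear_divide]
        Ck_on_bilinear[OF assms(1) bounded_bilinear_mult] Ck_on_inverse[OF assms(1) _ i]) force+
  then have "Ck_on k S (\<lambda>z. pd (\<lambda>y. sqrt (f y)) z v)" for v
    by (rule Ck_on_cong[OF assms(1), rotated]) (rule pd_eqI[OF h, symmetric])
  then show ?case using h
    by (auto simp: differentiable_on_eq_differentiable_at[OF assms(1)] differentiable_def)
qed

lemma smooth_on_cong:
  "open S \<Longrightarrow> (\<And>z. z \<in> S \<Longrightarrow> f z = g z) \<Longrightarrow> smooth_on S f \<Longrightarrow> smooth_on S g"
  unfolding smooth_on_def using Ck_on_cong by blast

lemma smooth_on_subset: "smooth_on S f \<Longrightarrow> T \<subseteq> S \<Longrightarrow> smooth_on T f"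
  unfolding smooth_on_def using Ck_on_mono_set by blast

lemma smooth_on_const [simp]: "smooth_on S (\<lambda>_. c)"
  by (simp add: smooth_on_def Ck_on_const)

lemma smooth_on_add:
  "open S \<Longrightarrow> smooth_on S f \<Longrightarrow> smooth_on S g \<Longrightarrow> smooth_on S (\<lambda>z. f z + g z)"
  by (simp add: smooth_on_def Ck_on_add)

lemma smooth_on_bilinear:
  "open S \<Longrightarrow> bounded_bilinear B \<Longrightarrow> smooth_on S f \<Longrightarrow> smooth_on S g
    \<Longrightarrow> smooth_on S (\<lambda>z. B (f z) (g z))"
  by (simp add: smooth_on_def Ck_on_bilinear)

lemma smooth_on_bounded_linear:
  "open S \<Longrightarrow> bounded_linear L \<Longrightarrow> smooth_on S f \<Longrightarrow> smooth_on S (\<lambda>z. L (f z))"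
  by (simp add: smooth_on_def Ck_on_bounded_linear)

lemma smooth_on_uminus: "open S \<Longrightarrow> smooth_on S f \<Longrightarrow> smooth_on S (\<lambda>z. - f z)"
  by (rule smooth_on_bounded_linear) (simp_all add: bounded_linear_minus bounded_linear_ident)

lemma smooth_on_diff:
  "open S \<Longrightarrow> smooth_on S f \<Longrightarrow> smooth_on S g \<Longrightarrow> smooth_on S (\<lambda>z. f z - g z)"
  using smooth_on_add[OF _ _ smooth_on_uminus, of S f g] by simp

lemma smooth_on_mult:
  fixes f g :: "real^2 \<Rightarrow> 'b::real_normed_algebra"
  shows "open S \<Longrightarrow> smooth_on S f \<Longrightarrow> smooth_on S g \<Longrightarrow> smooth_on S (\<lambda>z. f z * g z)"
  by (rule smooth_on_bilinear[OF _ bounded_bilinear_mult])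

lemma smooth_on_inverse:
  fixes f :: "real^2 \<Rightarrow> 'b::real_normed_field"
  shows "open S \<Longrightarrow> (\<And>z. z \<in> S \<Longrightarrow> f z \<noteq> 0) \<Longrightarrow> smooth_on S f \<Longrightarrow> smooth_on S (\<lambda>z. inverse (f z))"
  by (simp add: smooth_on_def Ck_on_inverse)

lemma smooth_on_divide:
  fixes f g :: "real^2 \<Rightarrow> 'b::real_normed_field"
  shows "open S \<Longrightarrow> (\<And>z. z \<in> S \<Longrightarrow> g z \<noteq> 0) \<Longrightarrow> smooth_on S f \<Longrightarrow> smooth_on S g
    \<Longrightarrow> smooth_on S (\<lambda>z. f z / g z)"
  unfolding divide_inverse by (intro smooth_on_mult smooth_on_inverse) auto

lemma smooth_on_sqrt:
  "open S \<Longrightarrow> (\<And>z. z \<in> S \<Longrightarrow> f z > 0) \<Longrightarrow> smooth_on S f \<Longrightarrow> smooth_on S (\<lambda>z. sqrt (f z))"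
  by (simp add: smooth_on_def Ck_on_sqrt)

lemma smooth_on_sum:
  assumes "open S" "\<And>i. i \<in> I \<Longrightarrow> smooth_on S (f i)"
  shows "smooth_on S (\<lambda>z. \<Sum>i\<in>I. f i z)"
  using assms(2) by (induction I rule: infinite_finite_induct) (auto intro: smooth_on_add[OF assms(1)])

lemma smooth_on_prod:
  fixes f :: "'i \<Rightarrow> real^2 \<Rightarrow> 'b::real_normed_field"
  assumes "open S" "\<And>i. i \<in> I \<Longrightarrow> smooth_on S (f i)"
  shows "smooth_on S (\<lambda>z. \<Prod>i\<in>I. f i z)"
  using assms(2) by (induction I rule: infinite_finite_induct) (auto intro: smooth_on_mult[OF assms(1)])

lemma smooth_on_det:
  fixes A :: "real^2 \<Rightarrow> 'b::real_normed_field^'n^'n"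
  assumes "open S" "\<And>i j. smooth_on S (\<lambda>z. A z $ i $ j)"
  shows "smooth_on S (\<lambda>z. det (A z))"
  unfolding det_def
  by (intro smooth_on_sum[OF assms(1)] smooth_on_mult[OF assms(1)] smooth_on_prod[OF assms(1)]
      assms(2) smooth_on_const)

lemma bounded_linear_axis: "bounded_linear (\<lambda>x. axis i x)"
proof (rule bounded_linear_intro[where K = 1])
  show "norm (axis i x) \<le> norm x * 1" for x :: 'a
    by (simp add: norm_vec_def L2_set_def axis_def if_distrib[of norm] if_distrib[of "\<lambda>t. t\<^sup>2"] cong: if_cong)
qed (simp_all add: vec_eq_iff axis_def)

lemma smooth_on_vec:
  fixes f :: "real^2 \<Rightarrow> ('b::real_normed_vector)^'n"
  assumes "open S" "\<And>i. smooth_on S (\<lambda>z. f z $ i)"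
  shows "smooth_on S f"
proof -
  have "f z = (\<Sum>i\<in>UNIV. axis i (f z $ i))" for z
    by (simp add: vec_eq_iff axis_def)
  moreover have "smooth_on S (\<lambda>z. \<Sum>i\<in>UNIV. axis i (f z $ i))"
    by (intro smooth_on_sum[OF assms(1)] smooth_on_bounded_linear[OF assms(1) bounded_linear_axis] assms(2))
  ultimately show ?thesis using smooth_on_cong[OF assms(1)] by simp
qed

lemma smooth_on_nth: "open S \<Longrightarrow> smooth_on S f \<Longrightarrow> smooth_on S (\<lambda>z. f z $ i)"
  by (rule smooth_on_bounded_linear[OF _ bounded_linear_vec_nth])

lemma smooth_on_differentiable:
  assumes "open S" "smooth_on S f" "z \<in> S"
  shows "f differentiable (at z)"
proof -
  have "Ck_on (Suc 0) S f" using assms(2) unfolding smooth_on_def by blast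
  then show ?thesis using assms(1,3) by (simp add: differentiable_on_eq_differentiable_at)
qed

lemma smooth_on_pd: "smooth_on S f \<Longrightarrow> smooth_on S (\<lambda>z. pd f z v)"
  unfolding smooth_on_def by (metis Ck_on.simps(2))

lemma smooth_on_continuous: "smooth_on S f \<Longrightarrow> continuous_on S f"
  unfolding smooth_on_def by (metis Ck_on.simps(1))

text \<open>The second difference is symmetric in v and w, the iterated derivative on the right is
  not yet known to be; using the lemma for both orders gives Schwarz's theorem. The mean value
  theorem is applied once in direction v and once in direction w.\<close>

lemma second_difference_mvt:
  fixes f :: "real^2 \<Rightarrow> real"
  assumes "open S" "smooth_on S f" "t > 0"
    and seg: "\<And>a b. a \<in> {0..t} \<Longrightarrow> b \<in> {0..t} \<Longrightarrow> z + a *\<^sub>R v + b *\<^sub>R w \<in> S"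
  shows "\<exists>a\<in>{0..t}. \<exists>b\<in>{0..t}.
    f (z + t *\<^sub>R v + t *\<^sub>R w) - f (z + t *\<^sub>R v) - f (z + t *\<^sub>R w) + f z
      = t * t * pd (\<lambda>y. pd f y v) (z + a *\<^sub>R v + b *\<^sub>R w) w"
proof -
  have line: "((\<lambda>a. h (y + a *\<^sub>R u)) has_real_derivative pd h (y + a *\<^sub>R u) u) (at a)"
    if "h differentiable (at (y + a *\<^sub>R u))" for h :: "real^2 \<Rightarrow> real" and y u a
  proof -
    have l: "((\<lambda>a. y + a *\<^sub>R u) has_derivative (\<lambda>k. k *\<^sub>R u)) (at a)"
      by (auto intro!: derivative_eq_intros)
    have "((\<lambda>a. h (y + a *\<^sub>R u)) has_derivative (\<lambda>k. pd h (y + a *\<^sub>R u) (k *\<^sub>R u))) (at a)"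
      by (rule has_derivative_compose[OF l pd_has_derivative[OF that]])
    moreover have "(\<lambda>k. pd h (y + a *\<^sub>R u) (k *\<^sub>R u)) = (*) (pd h (y + a *\<^sub>R u) u)"
      using linear_pd[OF that] by (auto simp: linear_cmul)
    ultimately show ?thesis by (simp add: has_field_derivative_def)
  qed
  note df = smooth_on_differentiable[OF assms(1,2)]
  note df2 = smooth_on_differentiable[OF assms(1) smooth_on_pd[OF assms(2)]]
  have s0: "z + a *\<^sub>R v \<in> S" if "a \<in> {0..t}" for a
    using seg[of a 0] that assms(3) by simp
  have s1: "z + t *\<^sub>R w + a *\<^sub>R v \<in> S" if "a \<in> {0..t}" for a
    using seg[of a t] that assms(3) by (simp add: algebra_simps)
  \<comment> \<open>The difference of f along two parallel edges in direction v; its increment over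
    [0, t] is the second difference.\<close>
  define \<phi> where "\<phi> a = f (z + t *\<^sub>R w + a *\<^sub>R v) - f (z + a *\<^sub>R v)" for a
  have "(\<phi> has_real_derivative (pd f (z + t *\<^sub>R w + a *\<^sub>R v) v - pd f (z + a *\<^sub>R v) v)) (at a)"
    if "0 \<le> a" "a \<le> t" for a
    unfolding \<phi>_def using that s0[of a] s1[of a] by (intro DERIV_diff line df) simp_all
  then obtain a where a: "0 < a" "a < t"
    "\<phi> t - \<phi> 0 = (t - 0) * (pd f (z + t *\<^sub>R w + a *\<^sub>R v) v - pd f (z + a *\<^sub>R v) v)"
    using MVT2[OF assms(3), of \<phi> "\<lambda>a. pd f (z + t *\<^sub>R w + a *\<^sub>R v) v - pd f (z + a *\<^sub>R v) v"]
    by (metis add_0 diff_zero)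
  define \<psi> where "\<psi> b = pd f (z + a *\<^sub>R v + b *\<^sub>R w) v" for b
  have "(\<psi> has_real_derivative pd (\<lambda>y. pd f y v) (z + a *\<^sub>R v + b *\<^sub>R w) w) (at b)"
    if "0 \<le> b" "b \<le> t" for b
    unfolding \<psi>_def using that a seg[of a b] by (intro line df2) simp_all
  then obtain b where b: "0 < b" "b < t"
    "\<psi> t - \<psi> 0 = (t - 0) * pd (\<lambda>y. pd f y v) (z + a *\<^sub>R v + b *\<^sub>R w) w"
    using MVT2[OF assms(3), of \<psi> "\<lambda>b. pd (\<lambda>y. pd f y v) (z + a *\<^sub>R v + b *\<^sub>R w) w"]
    by (metis add_0 diff_zero)
  have "\<phi> t - \<phi> 0 = t * (\<psi> t - \<psi> 0)"
    using a(3) by (simp add: \<psi>_def algebra_simps)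
  with b have "\<phi> t - \<phi> 0 = t * t * pd (\<lambda>y. pd f y v) (z + a *\<^sub>R v + b *\<^sub>R w) w"
    by simp
  moreover have "\<phi> t - \<phi> 0 = f (z + t *\<^sub>R v + t *\<^sub>R w) - f (z + t *\<^sub>R v) - f (z + t *\<^sub>R w) + f z"
    by (simp add: \<phi>_def algebra_simps)
  ultimately show ?thesis using a(1,2) b(1,2) by (intro bexI[of _ a] bexI[of _ b]) auto
qed

lemma pd_pd_commute_real:
  fixes f :: "real^2 \<Rightarrow> real"
  assumes "open S" "smooth_on S f" "z \<in> S"
  shows "pd (\<lambda>y. pd f y v) z w = pd (\<lambda>y. pd f y w) z v"
proof (rule ccontr)
  assume ne: "\<not> ?thesis"
  define F G where "F = (\<lambda>y. pd (\<lambda>y. pd f y v) y w)" and "G = (\<lambda>y. pd (\<lambda>y. pd f y w) y v)"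
  \<comment> \<open>Half of the supposed gap: values closer than e to F z and to G z cannot
    coincide.\<close>
  define e where "e = \<bar>F z - G z\<bar> / 2"
  have e: "e > 0" using ne by (simp add: e_def F_def G_def)
  have "continuous_on S F" "continuous_on S G"
    unfolding F_def G_def by (intro smooth_on_continuous smooth_on_pd assms(2))+
  then have "isCont F z" "isCont G z"
    using assms by (simp_all add: continuous_on_eq_continuous_at)
  then have "eventually (\<lambda>y. dist (F y) (F z) < e) (nhds z)" "eventually (\<lambda>y. dist (G y) (G z) < e) (nhds z)"
    using e unfolding isCont_def tendsto_at_iff_tendsto_nhds by (auto dest: tendstoD)
  moreover have "eventually (\<lambda>y. y \<in> S) (nhds z)"
    using assms eventually_nhds_in_open by blast
  ultimately have "eventually (\<lambda>y. y \<in> S \<and> dist (F y) (F z) < e \<and> dist (G y) (G z) < e) (nhds z)"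
    by eventually_elim auto
  then obtain d where d: "d > 0" and D: "\<And>y. dist y z < d \<Longrightarrow> y \<in> S \<and> dist (F y) (F z) < e \<and> dist (G y) (G z) < e"
    unfolding eventually_nhds_metric by blast
  \<comment> \<open>Small enough for the parallelogram with edges t v and t w to stay in the d-ball;
    the summand 1 guards against v = w = 0.\<close>
  define t where "t = d / (2 * (norm v + norm w + 1))"
  have t: "t > 0" using d by (simp add: t_def add_nonneg_pos)
  have near: "dist (z + a *\<^sub>R v + b *\<^sub>R w) z < d" if "a \<in> {0..t}" "b \<in> {0..t}" for a b
  proof -
    have "dist (z + a *\<^sub>R v + b *\<^sub>R w) z = norm (a *\<^sub>R v + b *\<^sub>R w)"
      by (simp add: dist_norm)
    also have "\<dots> \<le> norm (a *\<^sub>R v) + norm (b *\<^sub>R w)"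
      by (rule norm_triangle_ineq)
    also have "\<dots> \<le> t * norm v + t * norm w"
      using that by (auto intro!: add_mono mult_right_mono)
    also have "\<dots> = t * (norm v + norm w)" by (simp add: algebra_simps)
    also have "\<dots> < t * (2 * (norm v + norm w + 1))"
    proof (rule mult_strict_left_mono[OF _ t])
      define m where "m = norm v + norm w"
      have "m \<ge> 0" by (simp add: m_def)
      then have "m < 2 * (m + 1)" by simp
      then show "norm v + norm w < 2 * (norm v + norm w + 1)" by (simp only: m_def)
    qed
    also have "\<dots> = d"
    proof -
      have "norm v + norm w + 1 > 0" by (simp add: add_nonneg_pos)
      then show ?thesis by (simp add: t_def)
    qed
    finally show ?thesis .
  qed
  obtain a b where ab: "a \<in> {0..t}" "b \<in> {0..t}"
    "f (z + t *\<^sub>R v + t *\<^sub>R w) - f (z + t *\<^sub>R v) - f (z + t *\<^sub>R w) + f z = t * t * F (z + a *\<^sub>R v + b *\<^sub>R w)"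
    using second_difference_mvt[OF assms(1,2) t, of z v w] near D unfolding F_def by blast
  have near': "dist (z + b *\<^sub>R w + a *\<^sub>R v) z < d" if "a \<in> {0..t}" "b \<in> {0..t}" for a b
    using near[OF that] by (simp add: algebra_simps)
  obtain a' b' where ab': "a' \<in> {0..t}" "b' \<in> {0..t}"
    "f (z + t *\<^sub>R w + t *\<^sub>R v) - f (z + t *\<^sub>R w) - f (z + t *\<^sub>R v) + f z = t * t * G (z + a' *\<^sub>R w + b' *\<^sub>R v)"
    using second_difference_mvt[OF assms(1,2) t, of z w v] near' D unfolding G_def by blast
  have "t * t * F (z + a *\<^sub>R v + b *\<^sub>R w) = t * t * G (z + a' *\<^sub>R w + b' *\<^sub>R v)"
    using ab(3) ab'(3) by (simp add: algebra_simps)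
  then have eq: "F (z + a *\<^sub>R v + b *\<^sub>R w) = G (z + a' *\<^sub>R w + b' *\<^sub>R v)" using t by simp
  have "dist (F (z + a *\<^sub>R v + b *\<^sub>R w)) (F z) < e" "dist (G (z + a' *\<^sub>R w + b' *\<^sub>R v)) (G z) < e"
    using D near[OF ab(1,2)] near'[OF ab'(2,1)] by blast+
  with eq have "\<bar>F z - G z\<bar> < 2 * e" unfolding dist_real_def by linarith
  then show False by (simp add: e_def)
qed

lemma pd_pd_commute:
  fixes f :: "real^2 \<Rightarrow> 'b::euclidean_space"
  assumes "open S" "smooth_on S f" "z \<in> S"
  shows "pd (\<lambda>y. pd f y v) z w = pd (\<lambda>y. pd f y w) z v"
proof (rule euclidean_eqI)
  fix b :: 'b assume "b \<in> Basis"
  have L: "bounded_linear (\<lambda>x. x \<bullet> b)" by (rule bounded_linear_inner_left)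
  have *: "pd (\<lambda>y. pd f y v) z w \<bullet> b = pd (\<lambda>y. pd (\<lambda>x. f x \<bullet> b) y v) z w" for v w
  proof -
    have "pd (\<lambda>y. pd f y v) z w \<bullet> b = pd (\<lambda>y. pd f y v \<bullet> b) z w"
      by (rule pd_bounded_linear[OF L, symmetric])
        (rule smooth_on_differentiable[OF assms(1) smooth_on_pd[OF assms(2)] assms(3)])
    also have "\<dots> = pd (\<lambda>y. pd (\<lambda>x. f x \<bullet> b) y v) z w"
      by (rule pd_cong[OF assms(1,3)])
        (simp add: pd_bounded_linear[OF L smooth_on_differentiable[OF assms(1,2)]])
    finally show ?thesis .
  qed
  show "pd (\<lambda>y. pd f y v) z w \<bullet> b = pd (\<lambda>y. pd f y w) z v \<bullet> b"
    unfolding * by (rule pd_pd_commute_real[OF assms(1) smooth_on_bounded_linear[OF assms(1) L assms(2)] assms(3)])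
qed

section \<open>Complex Minkowski algebra\<close>

lemma matrix_add_rdistrib_gen: "((B::'a::semiring_1^'n^'m) + C) ** A = B ** A + C ** A"
  by (simp add: vec_eq_iff matrix_matrix_mult_def sum.distrib distrib_right)

lemma matrix_diff_ldistrib: "(A::'a::ring_1^'n^'m) ** (B - C) = A ** B - A ** C"
  by (simp add: vec_eq_iff matrix_matrix_mult_def sum_subtractf right_diff_distrib)

lemma matrix_diff_rdistrib: "((B::'a::ring_1^'n^'m) - C) ** A = B ** A - C ** A"
  by (simp add: vec_eq_iff matrix_matrix_mult_def sum_subtractf left_diff_distrib)

lemma matrix_minus_left: "(- (A::'a::ring_1^'n^'m)) ** B = - (A ** B)"
  by (simp add: vec_eq_iff matrix_matrix_mult_def sum_negf)

lemma matrix_minus_right: "(A::'a::ring_1^'n^'m) ** (- B) = - (A ** B)"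
  by (simp add: vec_eq_iff matrix_matrix_mult_def sum_negf)

lemma matrix_vector_minus_left: "(- (A::'a::ring_1^'n^'m)) *v x = - (A *v x)"
  by (simp add: vec_eq_iff matrix_vector_mult_def sum_negf)

lemma matrix_vector_minus_right: "(A::'a::ring_1^'n^'m) *v (- x) = - (A *v x)"
  by (simp add: vec_eq_iff matrix_vector_mult_def sum_negf)

lemma matrix_vector_scale: "(A::'a::comm_ring_1^'n^'m) *v (a *s x) = a *s (A *v x)"
  by (simp add: vec_eq_iff matrix_vector_mult_def sum_distrib_left mult_ac)

lemma scale_mat_nth [simp]: "(a \<odot> X) $ i $ j = a * X $ i $ j"
  by (simp add: scale_mat_def)

lemma scale_mat_mult_left: "(a \<odot> X) ** Y = a \<odot> (X ** Y)"
  by (simp add: vec_eq_iff matrix_matrix_mult_def sum_distrib_left mult_ac)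

lemma scale_mat_mult_right: "X ** (a \<odot> Y) = a \<odot> (X ** Y)"
  by (simp add: vec_eq_iff matrix_matrix_mult_def sum_distrib_left mult_ac)

lemma scale_mat_vector: "(a \<odot> X) *v u = a *s (X *v u)"
  by (simp add: vec_eq_iff matrix_vector_mult_def sum_distrib_left mult_ac)

lemma scale_mat_add: "a \<odot> (X + Y) = a \<odot> X + a \<odot> Y"
  by (simp add: vec_eq_iff distrib_left)

lemma scale_mat_diff: "a \<odot> (X - Y) = a \<odot> X - a \<odot> Y"
  by (simp add: vec_eq_iff right_diff_distrib)

lemma scale_mat_minus: "a \<odot> (- X) = - (a \<odot> X)"
  by (simp add: vec_eq_iff)

lemma scale_mat_scale: "a \<odot> (b \<odot> X) = (a * b) \<odot> X"
  by (simp add: vec_eq_iff mult.assoc)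

lemma scale_mat_one [simp]: "1 \<odot> X = X"
  by (simp add: vec_eq_iff)

lemma scale_mat_zero [simp]: "0 \<odot> X = 0" "a \<odot> 0 = 0"
  by (simp_all add: vec_eq_iff)

lemma scaleR_eq_scale: "c *\<^sub>R x = of_real c *s (x :: complex^'n)"
  by (simp add: vec_eq_iff scaleR_conv_of_real[where 'a = complex])

lemma scaleR_eq_scale_mat: "c *\<^sub>R X = of_real c \<odot> (X :: 'k::finite cmat)"
  by (simp add: vec_eq_iff scaleR_conv_of_real[where 'a = complex])

lemmas matrix_ring_simps = matrix_add_ldistrib matrix_add_rdistrib_gen matrix_diff_ldistrib
  matrix_diff_rdistrib matrix_minus_left matrix_minus_right matrix_mul_assoc
  scale_mat_mult_left scale_mat_mult_right

lemma matrix_eq_vectorI: "(\<And>x. A *v x = B *v (x :: 'a::semiring_1^'n)) \<Longrightarrow> A = B"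
  by (simp add: matrix_eq)

section \<open>The complex bilinear Minkowski form and its orthogonal group\<close>

lemma mink_add_left: "mink (x + y) z = mink x z + mink y z"
  by (simp add: mink_def sum.distrib algebra_simps)

lemma mink_add_right: "mink z (x + y) = mink z x + mink z y"
  by (simp add: mink_def sum.distrib algebra_simps)

lemma mink_diff_left: "mink (x - y) z = mink x z - mink y z"
  by (simp add: mink_def sum_subtractf algebra_simps)

lemma mink_diff_right: "mink z (x - y) = mink z x - mink z y"
  by (simp add: mink_def sum_subtractf algebra_simps)

lemma mink_scale_left: "mink (a *s x) y = a * mink x y"
  by (simp add: mink_def sum_distrib_left algebra_simps)

lemma mink_scale_right: "mink x (a *s y) = a * mink x y"
  by (simp add: mink_def sum_distrib_left algebra_simps)

lemma mink_zero [simp]: "mink 0 x = 0" "mink x 0 = 0"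
  by (simp_all add: mink_def)

lemma mink_uminus: "mink (- x) y = - mink x y" "mink x (- y) = - mink x y"
  by (simp_all add: mink_def sum_negf)

lemmas mink_simps = mink_add_left mink_add_right mink_diff_left mink_diff_right mink_scale_left
  mink_scale_right mink_uminus

lemma mink_commute: "mink x y = mink y x"
  by (simp add: mink_def mult.commute)

definition eta :: "'k::finite option \<Rightarrow> complex" where
  "eta i = (if i = None then - 1 else 1)"

lemma eta_eta [simp]: "eta i * eta i = 1" "eta i * (eta i * x) = x"
  by (simp_all add: eta_def)

lemma mink_eta: "mink x y = (\<Sum>i\<in>UNIV. eta i * x $ i * y $ i)"
proof -
  have "(\<Sum>i\<in>UNIV. f i) = (\<Sum>i\<in>UNIV. f (Some i)) + f None" for f :: "'a option \<Rightarrow> complex"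
    by (simp add: UNIV_option_conv sum.reindex)
  then show ?thesis by (simp add: mink_def eta_def)
qed

lemma mink_axis: "mink x (axis i 1) = eta i * x $ i"
  by (simp add: mink_eta axis_def if_distrib cong: if_cong)

lemma mink_nondegenerate: "(\<And>y. mink x y = 0) \<Longrightarrow> x = 0"
proof -
  assume "\<And>y. mink x y = 0"
  then have "eta i * x $ i = 0" for i
    using mink_axis[of x i] by simp
  moreover have "eta i \<noteq> 0" for i :: "'a option" by (simp add: eta_def)
  ultimately show "x = 0" by (simp add: vec_eq_iff)
qed

text \<open>The transpose with respect to \<open>mink\<close>. On \<open>orth_group\<close> it is
  the inverse, and since it is linear in T, smoothness and limits of inverses reduce to those of T
  itself.\<close>

definition adj :: "'k::finite cmat \<Rightarrow> 'k cmat" where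
  "adj T = (\<chi> i j. eta i * eta j * T $ j $ i)"

lemma mink_adj: "mink (T *v x) y = mink x (adj T *v y)"
proof -
  have "mink (T *v x) y = (\<Sum>i\<in>UNIV. \<Sum>j\<in>UNIV. eta i * T $ i $ j * x $ j * y $ i)"
    by (simp add: mink_eta matrix_vector_mult_def sum_distrib_left sum_distrib_right mult_ac)
  also have "\<dots> = (\<Sum>j\<in>UNIV. \<Sum>i\<in>UNIV. eta i * T $ i $ j * x $ j * y $ i)"
    by (rule sum.swap)
  also have "\<dots> = mink x (adj T *v y)"
    by (simp add: mink_eta matrix_vector_mult_def adj_def sum_distrib_left mult_ac)
  finally show ?thesis .
qed

lemma orth_group_mink: "T \<in> orth_group \<Longrightarrow> mink (T *v x) (T *v y) = mink x y"
  by (simp add: orth_group_def)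

lemma orth_group_adj_left:
  assumes "T \<in> orth_group" shows "adj T ** T = mat 1"
proof (rule matrix_eq_vectorI)
  fix y
  have "mink ((adj T ** T) *v y - mat 1 *v y) x = 0" for x
  proof -
    have "mink x (adj T *v (T *v y)) = mink x y"
      using orth_group_mink[OF assms, of x y] by (simp add: mink_adj)
    then show ?thesis
      by (simp add: mink_diff_right matrix_vector_mul_assoc[symmetric] mink_commute[of _ x])
  qed
  then have "(adj T ** T) *v y - mat 1 *v y = 0" by (rule mink_nondegenerate)
  then show "(adj T ** T) *v y = mat 1 *v y" by simp
qed

lemma orth_group_adj_right: "T \<in> orth_group \<Longrightarrow> T ** adj T = mat 1"
  using orth_group_adj_left matrix_left_right_inverse by blast

lemma matrix_inv_unique:
  fixes A :: "'a::field^'n^'n"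
  assumes "A ** B = mat 1" shows "matrix_inv A = B"
proof -
  have "B ** A = mat 1" using assms matrix_left_right_inverse by blast
  then have "A ** matrix_inv A = mat 1 \<and> matrix_inv A ** A = mat 1"
    unfolding matrix_inv_def using assms by (metis (mono_tags, lifting) someI)
  then show ?thesis using \<open>B ** A = mat 1\<close> by (metis matrix_mul_assoc matrix_mul_lid matrix_mul_rid)
qed

lemma matrix_inv_orth: "T \<in> orth_group \<Longrightarrow> matrix_inv T = adj T"
  using matrix_inv_unique orth_group_adj_right by blast

lemma matrix_inv_right: "T \<in> orth_group \<Longrightarrow> T ** matrix_inv T = mat 1"
  by (simp add: matrix_inv_orth orth_group_adj_right)

lemma matrix_inv_left: "T \<in> orth_group \<Longrightarrow> matrix_inv T ** T = mat 1"
  by (simp add: matrix_inv_orth orth_group_adj_left)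

lemma orth_group_matrix_inv: "T \<in> orth_group \<Longrightarrow> matrix_inv T \<in> orth_group"
  unfolding orth_group_def mem_Collect_eq
proof (intro allI)
  fix x y assume T: "\<forall>x y. mink (T *v x) (T *v y) = mink x y"
  then have "T \<in> orth_group" by (simp add: orth_group_def)
  then have "T *v (matrix_inv T *v x) = x" for x
    by (simp add: matrix_vector_mul_assoc matrix_inv_right)
  then show "mink (matrix_inv T *v x) (matrix_inv T *v y) = mink x y" using T by metis
qed

lemma matrix_inv_matrix_inv: "T \<in> orth_group \<Longrightarrow> matrix_inv (matrix_inv T) = T"
  by (simp add: matrix_inv_left matrix_inv_unique)

lemma orth_group_mult: "S \<in> orth_group \<Longrightarrow> T \<in> orth_group \<Longrightarrow> S ** T \<in> orth_group"
  by (simp add: orth_group_def matrix_vector_mul_assoc[symmetric])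

lemma matrix_inv_mult_orth:
  "S \<in> orth_group \<Longrightarrow> T \<in> orth_group \<Longrightarrow> matrix_inv (S ** T) = matrix_inv T ** matrix_inv S"
  by (rule matrix_inv_unique)
    (metis matrix_inv_right matrix_mul_assoc matrix_mul_rid)

section \<open>Orthogonal projections onto non-degenerate subspaces\<close>

lemma perp_subspace: "vec.subspace (perp E)"
  by (auto simp: perp_def vec.subspace_def mink_simps)

text \<open>\<open>oproj\<close> is given by a description and is meaningful only if every vector
  decomposes. That existence is made part of the notion here; for the subspaces at hand it comes
  from Cramer's rule in \<open>frame_splits\<close>.\<close>

definition splits :: "'k::finite cvec set \<Rightarrow> bool" where
  "splits E \<longleftrightarrow> vec.subspace E \<and> nondegenerate E \<and> (\<forall>x. \<exists>y\<in>E. x - y \<in> perp E)"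

lemma splits_unique:
  assumes "splits E" "y \<in> E" "x - y \<in> perp E" "y' \<in> E" "x - y' \<in> perp E"
  shows "y = y'"
proof -
  have "y - y' \<in> E" using assms vec.subspace_diff unfolding splits_def by blast
  moreover have "y - y' = (x - y') - (x - y)" by simp
  then have "y - y' \<in> perp E" using vec.subspace_diff[OF perp_subspace assms(5,3)] by simp
  ultimately have "y - y' = 0" using assms(1) unfolding splits_def nondegenerate_def by blast
  then show ?thesis by simp
qed

lemma oproj_the:
  assumes "splits E"
  shows "(THE y. y \<in> E \<and> x - y \<in> perp E) \<in> E \<and> x - (THE y. y \<in> E \<and> x - y \<in> perp E) \<in> perp E"
proof -
  obtain y where "y \<in> E \<and> x - y \<in> perp E" using assms unfolding splits_def by blast
  then show ?thesis
    by (rule theI[of "\<lambda>y. y \<in> E \<and> x - y \<in> perp E"]) (use splits_unique[OF assms] \<open>y \<in> E \<and> x - y \<in> perp E\<close> in blast)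
qed

text \<open>Uniqueness of the decomposition makes the described map linear, so it agrees with
  multiplication by its matrix.\<close>

lemma oproj_works:
  fixes E :: "'k::finite cvec set"
  assumes "splits E"
  shows "oproj E *v x = (THE y. y \<in> E \<and> x - y \<in> perp E)"
proof -
  let ?f = "\<lambda>x. THE y. y \<in> E \<and> x - y \<in> perp E"
  have s: "vec.subspace E" using assms by (simp add: splits_def)
  note f = oproj_the[OF assms]
  have "Vector_Spaces.linear (*s) (*s) ?f"
  proof unfold_locales
    fix a b :: "'k cvec" and c :: complex
    have "a + b - (?f a + ?f b) \<in> perp E"
      using vec.subspace_add[OF perp_subspace, of "a - ?f a" E "b - ?f b"] f[of a] f[of b]
      by (simp add: algebra_simps)
    moreover have "?f a + ?f b \<in> E" using f[of a] f[of b] vec.subspace_add[OF s] by blast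
    ultimately show "?f (a + b) = ?f a + ?f b"
      using splits_unique[OF assms] f[of "a + b"] by blast
    have "c *s a - c *s ?f a \<in> perp E"
      using vec.subspace_scale[OF perp_subspace, of "a - ?f a" E c] f[of a]
      by (simp add: vec.scale_right_diff_distrib)
    moreover have "c *s ?f a \<in> E" using f[of a] vec.subspace_scale[OF s] by blast
    ultimately show "?f (c *s a) = c *s ?f a"
      using splits_unique[OF assms] f[of "c *s a"] by blast
  qed
  then show ?thesis unfolding oproj_def by (rule matrix_works)
qed

lemma oproj_in: "splits E \<Longrightarrow> oproj E *v x \<in> E"
  and oproj_perp_in: "splits E \<Longrightarrow> x - oproj E *v x \<in> perp E"
  using oproj_the[of E x] by (simp_all add: oproj_works)

lemma oproj_eqI: "splits E \<Longrightarrow> y \<in> E \<Longrightarrow> x - y \<in> perp E \<Longrightarrow> oproj E *v x = y"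
  using splits_unique oproj_in oproj_perp_in by blast

lemma oproj_fix: "splits E \<Longrightarrow> x \<in> E \<Longrightarrow> oproj E *v x = x"
  by (rule oproj_eqI) (auto simp: perp_def)

lemma oproj_fix_iff: "splits E \<Longrightarrow> oproj E *v x = x \<longleftrightarrow> x \<in> E"
  by (metis oproj_fix oproj_in)

lemma oproj_kill: "splits E \<Longrightarrow> x \<in> perp E \<Longrightarrow> oproj E *v x = 0"
  by (rule oproj_eqI) (auto simp: splits_def vec.subspace_0)

lemma oproj_kill_iff: "splits E \<Longrightarrow> oproj E *v x = 0 \<longleftrightarrow> x \<in> perp E"
  by (metis oproj_kill oproj_perp_in diff_zero)

lemma oproj_idem: "splits E \<Longrightarrow> oproj E ** oproj E = oproj E"
  by (rule matrix_eq_vectorI) (simp add: matrix_vector_mul_assoc[symmetric] oproj_fix oproj_in)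

lemma splits_perp:
  assumes "splits E" shows "splits (perp E)"
proof -
  have z: "z = 0" if "z \<in> perp E" "z \<in> perp (perp E)" for z
  proof (rule mink_nondegenerate)
    fix w
    have "mink z w = mink z (oproj E *v w) + mink z (w - oproj E *v w)"
      by (simp add: mink_add_right[symmetric])
    then show "mink z w = 0"
      using that oproj_in[OF assms, of w] oproj_perp_in[OF assms, of w] by (auto simp: perp_def)
  qed
  have "\<exists>y\<in>perp E. x - y \<in> perp (perp E)" for x
  proof
    show "x - oproj E *v x \<in> perp E" by (rule oproj_perp_in[OF assms])
    show "x - (x - oproj E *v x) \<in> perp (perp E)"
      using oproj_in[OF assms, of x] by (auto simp: perp_def mink_commute)
  qed
  then show ?thesis
    unfolding splits_def nondegenerate_def
    using z perp_subspace vec.subspace_0[OF perp_subspace] by blast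
qed

lemma oproj_perp:
  assumes "splits E" shows "oproj (perp E) = mat 1 - oproj E"
proof (rule matrix_eq_vectorI)
  fix x
  have "oproj (perp E) *v x = x - oproj E *v x"
  proof (rule oproj_eqI[OF splits_perp[OF assms] oproj_perp_in[OF assms]])
    show "x - (x - oproj E *v x) \<in> perp (perp E)"
      using oproj_in[OF assms, of x] by (auto simp: perp_def mink_commute)
  qed
  then show "oproj (perp E) *v x = (mat 1 - oproj E) *v x"
    by (simp add: matrix_vector_mult_diff_rdistrib)
qed

lemma orth_group_perp_image:
  assumes "T \<in> orth_group" "x \<in> perp E" shows "T *v x \<in> perp ((*v) T ` E)"
  using assms by (auto simp: perp_def orth_group_mink)

lemma splits_image:
  assumes "T \<in> orth_group" "splits E" shows "splits ((*v) T ` E)"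
    and "oproj ((*v) T ` E) = T ** oproj E ** matrix_inv T"
proof -
  have dec: "T *v (oproj E *v (matrix_inv T *v x)) \<in> (*v) T ` E"
    "x - T *v (oproj E *v (matrix_inv T *v x)) \<in> perp ((*v) T ` E)" for x
  proof -
    show "T *v (oproj E *v (matrix_inv T *v x)) \<in> (*v) T ` E" using oproj_in[OF assms(2)] by blast
    have "x = T *v (matrix_inv T *v x)"
      by (simp add: matrix_vector_mul_assoc matrix_inv_right[OF assms(1)])
    then have "x - T *v (oproj E *v (matrix_inv T *v x))
        = T *v (matrix_inv T *v x - oproj E *v (matrix_inv T *v x))"
      by (metis matrix_vector_mult_diff_distrib)
    then show "x - T *v (oproj E *v (matrix_inv T *v x)) \<in> perp ((*v) T ` E)"
      using orth_group_perp_image[OF assms(1) oproj_perp_in[OF assms(2)]] by simp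
  qed
  have "vec.subspace ((*v) T ` E)"
    using assms(2) vec.linear_subspace_image[OF matrix_vector_mul_linear_gen] by (auto simp: splits_def)
  moreover have "nondegenerate ((*v) T ` E)"
  proof -
    have "T *v x = 0" if "x \<in> E" "\<forall>y\<in>(*v) T ` E. mink (T *v x) y = 0" for x
    proof -
      have "x \<in> perp E" using that orth_group_mink[OF assms(1), of x] by (auto simp: perp_def)
      then have "x = 0" using assms(2) that(1) unfolding splits_def nondegenerate_def by blast
      then show ?thesis by simp
    qed
    moreover have "0 \<in> (*v) T ` E"
      using assms(2) vec.subspace_0[of E] by (auto simp: splits_def intro!: image_eqI[of _ _ 0])
    ultimately show ?thesis by (auto simp: nondegenerate_def perp_def)
  qed
  ultimately show s: "splits ((*v) T ` E)"
    unfolding splits_def using dec by blast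
  show "oproj ((*v) T ` E) = T ** oproj E ** matrix_inv T"
    by (rule matrix_eq_vectorI) (use oproj_eqI[OF s dec] in \<open>simp add: matrix_vector_mul_assoc matrix_mul_assoc\<close>)
qed

section \<open>Bivectors as endomorphisms\<close>

lemma wedge_works: "wedge a b *v w = mink w a *s b - mink w b *s a"
  unfolding wedge_def
  by (rule matrix_works, unfold_locales) (simp_all add: vec_eq_iff mink_simps algebra_simps)

lemma Ad_wedge:
  assumes "T \<in> orth_group"
  shows "Ad T (wedge a b) = wedge (T *v a) (T *v b)"
proof (rule matrix_eq_vectorI)
  fix x
  have m: "mink (matrix_inv T *v x) c = mink x (T *v c)" for c
    using orth_group_mink[OF assms, of "matrix_inv T *v x" c]
    by (simp add: matrix_vector_mul_assoc matrix_inv_right[OF assms])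
  show "Ad T (wedge a b) *v x = wedge (T *v a) (T *v b) *v x"
    by (simp add: Ad_def matrix_vector_mul_assoc[symmetric] wedge_works m
        matrix_vector_mult_diff_distrib matrix_vector_scale)
qed

lemma Ad_scaleR: "Ad T (c *\<^sub>R X) = c *\<^sub>R Ad T X"
  by (simp add: Ad_def matrix_scalar_ac scalar_matrix_assoc)

lemma Ad_add: "Ad T (X + Y) = Ad T X + Ad T Y"
  by (simp add: Ad_def matrix_ring_simps)

lemma Ad_scale_mat: "Ad T (a \<odot> X) = a \<odot> Ad T X"
  by (simp add: Ad_def matrix_ring_simps)

lemma linear_Ad: "linear (Ad T)"
  by (rule linearI) (simp_all add: Ad_add Ad_scaleR)

lemma Ad_wedge2:
  assumes "T \<in> orth_group" "X \<in> wedge2 E"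
  shows "Ad T X \<in> wedge2 ((*v) T ` E)"
proof -
  have "Ad T ` span {wedge a b |a b. a \<in> E \<and> b \<in> E} = span (Ad T ` {wedge a b |a b. a \<in> E \<and> b \<in> E})"
    by (rule span_linear_image[OF linear_Ad, symmetric])
  also have "\<dots> \<subseteq> span {wedge a b |a b. a \<in> (*v) T ` E \<and> b \<in> (*v) T ` E}"
    by (rule span_mono) (use Ad_wedge[OF assms(1)] in blast)
  finally show ?thesis using assms(2) unfolding wedge2_def by blast
qed

lemma wedge2_mono: "E \<subseteq> F \<Longrightarrow> wedge2 E \<subseteq> wedge2 F"
  unfolding wedge2_def by (rule span_mono) blast

lemma wedge2_zero: "0 \<in> wedge2 E"
  by (simp add: wedge2_def span_zero)

text \<open>\<open>wedge2\<close> is a real span, so it suffices to check generators: the complex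
  subspace F absorbs sums and real multiples of their values at u.\<close>

lemma wedge2_induct:
  assumes "X \<in> wedge2 E" "\<And>a b. a \<in> E \<Longrightarrow> b \<in> E \<Longrightarrow> wedge a b *v u \<in> F" "vec.subspace F"
  shows "X *v u \<in> F"
  using assms(1) unfolding wedge2_def
proof (induction rule: span_induct)
  case base
  have sc: "(c *\<^sub>R A) *v u = (of_real c) *s (A *v u)" for c and A :: "'a cmat"
    by (simp add: scaleR_eq_scale_mat scale_mat_vector)
  show ?case
    unfolding subspace_def mem_Collect_eq
    using vec.subspace_0[OF assms(3)] vec.subspace_add[OF assms(3)] vec.subspace_scale[OF assms(3)]
    by (auto simp: matrix_vector_mult_add_rdistrib sc)
next
  case (step x)
  then show ?case using assms(2) by auto
qed

lemma wedge2_kill_perp: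
  assumes "X \<in> wedge2 E" "u \<in> perp E" shows "X *v u = 0"
  using wedge2_induct[OF assms(1), of u "{0}"] assms(2)
  by (auto simp: wedge_works perp_def)

lemma bounded_bilinear_matrix_mult: "bounded_bilinear ((**) :: 'k::finite cmat \<Rightarrow> 'k cmat \<Rightarrow> 'k cmat)"
  unfolding bilinear_conv_bounded_bilinear[symmetric] bilinear_def
  by (auto intro!: linearI simp: matrix_ring_simps matrix_scalar_ac scalar_matrix_assoc)

lemma bounded_bilinear_matrix_vector: "bounded_bilinear ((*v) :: 'k::finite cmat \<Rightarrow> 'k cvec \<Rightarrow> 'k cvec)"
  unfolding bilinear_conv_bounded_bilinear[symmetric] bilinear_def
  by (auto intro!: linearI simp: matrix_vector_right_distrib matrix_vector_mult_add_rdistrib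
      scaleR_eq_scale scaleR_eq_scale_mat scale_mat_vector matrix_vector_scale)

lemma bounded_bilinear_mink: "bounded_bilinear (mink :: 'k::finite cvec \<Rightarrow> 'k cvec \<Rightarrow> complex)"
  unfolding bilinear_conv_bounded_bilinear[symmetric] bilinear_def
  by (auto intro!: linearI simp: mink_simps scaleR_eq_scale scaleR_conv_of_real[where 'a = complex])

lemma bounded_bilinear_scale: "bounded_bilinear ((*s) :: complex \<Rightarrow> complex^'n \<Rightarrow> complex^'n)"
  unfolding bilinear_conv_bounded_bilinear[symmetric] bilinear_def
  by (auto intro!: linearI simp: vec_eq_iff algebra_simps)

lemma bounded_bilinear_scale_mat: "bounded_bilinear ((\<odot>) :: complex \<Rightarrow> 'k::finite cmat \<Rightarrow> 'k cmat)"
  unfolding bilinear_conv_bounded_bilinear[symmetric] bilinear_def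
  by (auto intro!: linearI simp: vec_eq_iff algebra_simps)

lemma bounded_linear_adj: "bounded_linear (adj :: 'k::finite cmat \<Rightarrow> 'k cmat)"
  by (rule linear_conv_bounded_linear[THEN iffD1], rule linearI)
    (auto simp: vec_eq_iff adj_def algebra_simps)

section \<open>Isotropic planes in four dimensions\<close>

text \<open>The Leibniz expansion, with which the Gram determinants in
  \<open>hyperbolic_meet\<close> are evaluated entry by entry.\<close>

lemma det_4:
  "det (A::'a::comm_ring_1^4^4) =
    A$1$1 * (A$2$2 * (A$3$3 * A$4$4)) -
    A$1$1 * (A$2$2 * (A$3$4 * A$4$3)) +
    (A$1$1 * (A$2$3 * (A$3$4 * A$4$2)) -
    A$1$1 * (A$2$3 * (A$3$2 * A$4$4)) +
    (A$1$1 * (A$2$4 * (A$3$2 * A$4$3)) -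
    A$1$1 * (A$2$4 * (A$3$3 * A$4$2)))) +
    (A$1$2 * (A$2$1 * (A$3$4 * A$4$3)) -
    A$1$2 * (A$2$1 * (A$3$3 * A$4$4)) +
    (A$1$2 * (A$2$3 * (A$3$1 * A$4$4)) -
    A$1$2 * (A$2$3 * (A$3$4 * A$4$1)) +
    (A$1$2 * (A$2$4 * (A$3$3 * A$4$1)) -
    A$1$2 * (A$2$4 * (A$3$1 * A$4$3)))) +
    (A$1$3 * (A$2$2 * (A$3$4 * A$4$1)) -
    A$1$3 * (A$2$2 * (A$3$1 * A$4$4)) +
    (A$1$3 * (A$2$1 * (A$3$2 * A$4$4)) -
    A$1$3 * (A$2$1 * (A$3$4 * A$4$2)) +
    (A$1$3 * (A$2$4 * (A$3$1 * A$4$2)) -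
    A$1$3 * (A$2$4 * (A$3$2 * A$4$1)))) +
    (A$1$4 * (A$2$2 * (A$3$1 * A$4$3)) -
    A$1$4 * (A$2$2 * (A$3$3 * A$4$1)) +
    (A$1$4 * (A$2$3 * (A$3$2 * A$4$1)) -
    A$1$4 * (A$2$3 * (A$3$1 * A$4$2)) +
    (A$1$4 * (A$2$1 * (A$3$3 * A$4$2)) -
    A$1$4 * (A$2$1 * (A$3$2 * A$4$3)))))))"
proof -
  have f1: "finite {2::4, 3, 4}" "1 \<notin> {2::4, 3, 4}" by auto
  have f2: "finite {3::4, 4}" "2 \<notin> {3::4, 4}" by auto
  have f3: "finite {4::4}" "3 \<notin> {4::4}" by auto
  show ?thesis
    unfolding det_def UNIV_4
    unfolding sum_over_permutations_insert[OF f1]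
    unfolding sum_over_permutations_insert[OF f2]
    unfolding sum_over_permutations_insert[OF f3]
    unfolding permutes_sing
    by (simp add: sign_swap_id permutation_swap_id sign_compose swap_id_eq permutation_compose)
qed

section \<open>Frames, Gram matrices and determinants of restrictions\<close>

definition frame :: "complex^'b::finite^'k::finite option \<Rightarrow> 'k cvec set \<Rightarrow> bool" where
  "frame M E \<longleftrightarrow> E = range ((*v) M) \<and> (\<forall>c. M *v c = 0 \<longrightarrow> c = 0)"

lemma frame_inj:
  assumes "frame M E" "M *v c = M *v d" shows "c = d"
proof -
  have "M *v (c - d) = 0" using assms(2) by (simp add: matrix_vector_mult_diff_distrib)
  then have "c - d = 0" using assms(1) unfolding frame_def by blast
  then show ?thesis by simp
qed

lemma frame_inj_mat:
  fixes A B :: "complex^'c::finite^'b::finite"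
  assumes "frame M E" "M ** A = M ** B" shows "A = B"
  by (rule matrix_eq_vectorI) (metis assms frame_inj matrix_vector_mul_assoc)

lemma range_eq_span_columns: "range ((*v) (M :: complex^'b::finite^'a)) = vec.span (range (\<lambda>j. column j M))"
proof
  show "range ((*v) M) \<subseteq> vec.span (range (\<lambda>j. column j M))"
  proof clarify
    fix x
    show "M *v x \<in> vec.span (range (\<lambda>j. column j M))"
      unfolding matrix_mult_sum by (intro vec.span_sum vec.span_scale vec.span_base) auto
  qed
  have "vec.subspace (range ((*v) M))"
    using vec.linear_subspace_image[OF matrix_vector_mul_linear_gen vec.subspace_UNIV] by blast
  moreover have "column j M \<in> range ((*v) M)" for j
  proof -
    have "column j M = M *v axis j 1"
      by (simp add: vec_eq_iff column_def matrix_vector_mult_def axis_def if_distrib cong: if_cong)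
    then show ?thesis by simp
  qed
  ultimately show "vec.span (range (\<lambda>j. column j M)) \<subseteq> range ((*v) M)"
    by (intro vec.span_minimal) auto
qed

lemma frame_iff:
  fixes M :: "complex^'b::finite^'k::finite option"
  shows "frame M E \<longleftrightarrow> inj (\<lambda>j. column j M) \<and> vec.independent (range (\<lambda>j. column j M))
    \<and> vec.span (range (\<lambda>j. column j M)) = E"
proof
  assume F: "frame M E"
  have col: "column j M = M *v axis j 1" for j
    by (simp add: vec_eq_iff column_def matrix_vector_mult_def axis_def if_distrib cong: if_cong)
  have inj: "inj (\<lambda>j. column j M)"
    by (rule injI) (metis col frame_inj[OF F] axis_eq_axis one_neq_zero)
  have "vec.independent (range (\<lambda>j. column j M))"
  proof (rule vec.independent_if_scalars_zero)
    fix f x assume s: "(\<Sum>x\<in>range (\<lambda>j. column j M). f x *s x) = 0" and x: "x \<in> range (\<lambda>j. column j M)"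
    have "M *v (\<chi> j. f (column j M)) = 0"
      using s by (simp add: sum.reindex[OF inj] matrix_mult_sum)
    then have "(\<chi> j. f (column j M)) = 0" using F unfolding frame_def by blast
    then show "f x = 0" using x by (auto simp: vec_eq_iff)
  qed simp
  then show "inj (\<lambda>j. column j M) \<and> vec.independent (range (\<lambda>j. column j M))
    \<and> vec.span (range (\<lambda>j. column j M)) = E"
    using F inj by (simp add: frame_def range_eq_span_columns)
next
  assume F: "inj (\<lambda>j. column j M) \<and> vec.independent (range (\<lambda>j. column j M))
    \<and> vec.span (range (\<lambda>j. column j M)) = E"
  have "c = 0" if "M *v c = 0" for c
  proof -
    have inj: "inj (\<lambda>j. column j M)" using F by blast
    have "(\<Sum>x\<in>range (\<lambda>j. column j M). c $ (inv (\<lambda>j. column j M) x) *s x) = 0"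
      using that by (simp add: sum.reindex[OF inj] matrix_mult_sum inv_f_f[OF inj])
    then have "c $ (inv (\<lambda>j. column j M) (column j M)) = 0" for j
      using vec.independentD[of "range (\<lambda>j. column j M)" "range (\<lambda>j. column j M)"
          "\<lambda>x. c $ (inv (\<lambda>j. column j M) x)"] F by auto
    then show ?thesis by (simp add: inv_f_f[OF inj] vec_eq_iff)
  qed
  then show "frame M E" using F by (simp add: frame_def range_eq_span_columns)
qed

text \<open>A spanning family with as many members as the dimension has neither repetitions nor
  relations. The bijection h moves the indices below n to a finite type, over which determinants are
  available.\<close>

lemma frame_of_spanning:
  fixes s :: "nat \<Rightarrow> 'k::finite cvec" and h :: "'b::finite \<Rightarrow> nat"
  assumes h: "bij_betw h UNIV {..<n}" and E: "E = vec.span (s ` {..<n})" and d: "vec.dim E = n"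
  shows "frame (\<chi> i j. s (h j) $ i) E"
proof -
  have le: "card (s ` {..<n}) \<le> n" using card_image_le[of "{..<n}" s] by simp
  have ge: "n \<le> card (s ` {..<n})" using d E vec.dim_le_card[of E "s ` {..<n}"] by simp
  have inj: "inj_on s {..<n}" using le ge by (intro eq_card_imp_inj_on) auto
  have ind: "vec.independent (s ` {..<n})"
    by (rule vec.card_le_dim_spanning[of _ E]) (use E d le vec.span_superset in \<open>force+\<close>)
  have col: "(\<lambda>j. column j (\<chi> i j. s (h j) $ i)) = s \<circ> h" by (auto simp: column_def)
  have hr: "h ` UNIV = {..<n}" using h by (simp add: bij_betw_def)
  have "inj (s \<circ> h)" using inj h hr by (auto simp: bij_betw_def intro: comp_inj_on)
  moreover have "range (s \<circ> h) = s ` {..<n}" using hr by (metis image_comp)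
  ultimately show ?thesis unfolding frame_iff col using ind E by simp
qed

definition gram :: "complex^'a::finite^'k::finite option \<Rightarrow> complex^'b::finite^'k option \<Rightarrow> complex^'b^'a" where
  "gram X Y = (\<chi> i j. mink (column i X) (column j Y))"

lemma mink_sum_right: "mink y (\<Sum>i\<in>I. f i) = (\<Sum>i\<in>I. mink y (f i))"
  by (induction I rule: infinite_finite_induct) (auto simp: mink_simps)

lemma column_mult: "column j (M ** A) = M *v column j A"
  by (simp add: vec_eq_iff column_def matrix_matrix_mult_def matrix_vector_mult_def)

lemma gram_vector: "(gram X Y *v c) $ i = mink (column i X) (Y *v c)"
  unfolding matrix_vector_mult_def[of "gram X Y"] matrix_mult_sum[of Y] mink_sum_right mink_scale_right
  by (simp add: gram_def mult.commute)

lemma gram_mult_right: "gram X (Y ** A) = gram X Y ** A"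
  by (rule matrix_eq_vectorI) (simp add: vec_eq_iff gram_vector matrix_vector_mul_assoc[symmetric])

lemma gram_transpose: "transpose (gram X Y) = gram Y X"
  by (simp add: vec_eq_iff transpose_def gram_def mink_commute)

lemma gram_mult_left: "gram (X ** A) Y = transpose A ** gram X Y"
  by (metis gram_mult_right gram_transpose matrix_transpose_mul)

lemma gram_orth: "T \<in> orth_group \<Longrightarrow> gram (T ** X) (T ** Y) = gram X Y"
  by (simp add: vec_eq_iff gram_def column_mult orth_group_mink)

text \<open>A kernel vector of the Gram matrix is the coordinate vector of an element of E that is
  orthogonal to all of E.\<close>

lemma det_gram_nonzero:
  assumes "frame M E" "nondegenerate E" shows "det (gram M M) \<noteq> 0"
proof -
  have "c = 0" if "gram M M *v c = 0" for c
  proof -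
    have "mink (column i M) (M *v c) = 0" for i
      using that gram_vector[of M M c i] by simp
    then have "mink (M *v c) (M *v x) = 0" for x
      by (simp add: matrix_mult_sum[of M x] mink_sum_right mink_scale_right mink_commute)
    then have "M *v c \<in> E \<inter> perp E" using assms(1) by (auto simp: frame_def perp_def)
    then show "c = 0" using assms by (auto simp: nondegenerate_def frame_def)
  qed
  then have "\<exists>B. B ** gram M M = mat 1" unfolding matrix_left_invertible_ker by blast
  then show ?thesis using invertible_det_nz invertible_left_inverse by blast
qed

text \<open>Orthogonal projection with coefficients from Cramer's rule: they solve the system with
  the Gram matrix on the left and the pairings of x with the frame on the right. Quotients of
  determinants make the smooth dependence on the frame evident.\<close>

definition frame_proj :: "complex^'b::finite^'k::finite option \<Rightarrow> 'k cvec \<Rightarrow> 'k cvec" where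
  "frame_proj M x = M *v (\<chi> k. det (\<chi> i j. if j = k then mink (column i M) x else gram M M $ i $ j)
      / det (gram M M))"

lemma frame_proj:
  assumes "frame M E" "nondegenerate E"
  shows "frame_proj M x \<in> E" "x - frame_proj M x \<in> perp E"
proof -
  show "frame_proj M x \<in> E" using assms(1) by (simp add: frame_def frame_proj_def)
  let ?c = "(\<chi> k. det (\<chi> i j. if j = k then mink (column i M) x else gram M M $ i $ j) / det (gram M M))"
  have "gram M M *v ?c = (\<chi> i. mink (column i M) x)"
    unfolding cramer[OF det_gram_nonzero[OF assms], of ?c "\<chi> i. mink (column i M) x"]
    by (simp cong: if_cong)
  then have "mink (column i M) (M *v ?c) = mink (column i M) x" for i
    using gram_vector[of M M ?c i] by simp
  then have "mink (column i M) (x - frame_proj M x) = 0" for i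
    by (simp add: frame_proj_def mink_diff_right)
  then have "mink (x - frame_proj M x) (M *v c) = 0" for c
    by (simp add: matrix_mult_sum[of M c] mink_sum_right mink_scale_right mink_commute)
  then show "x - frame_proj M x \<in> perp E" using assms(1) by (auto simp: frame_def perp_def)
qed

lemma frame_subspace: "frame M E \<Longrightarrow> vec.subspace E"
  by (auto simp: frame_iff)

lemma frame_splits: "frame M E \<Longrightarrow> nondegenerate E \<Longrightarrow> splits E"
  unfolding splits_def using frame_proj frame_subspace by blast

lemma oproj_frame: "frame M E \<Longrightarrow> nondegenerate E \<Longrightarrow> oproj E *v x = frame_proj M x"
  using oproj_eqI[OF frame_splits frame_proj] .

lemma frame_restrict:
  fixes M :: "complex^'b::finite^'k::finite option"
  assumes "frame M E" "(*v) T ` E \<subseteq> E"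
  obtains B where "T ** M = M ** B"
proof -
  have "\<exists>c. T *v column j M = M *v c" for j
  proof -
    have "column j M \<in> E" using assms(1) unfolding frame_iff by (auto intro: vec.span_base)
    then have "T *v column j M \<in> E" using assms(2) by blast
    then show ?thesis using assms(1) by (auto simp: frame_def)
  qed
  then obtain c where c: "\<And>j. T *v column j M = M *v c j" by metis
  have "T ** M = M ** (\<chi> i j. c j $ i)"
  proof -
    have "column j (T ** M) = column j (M ** (\<chi> i j. c j $ i))" for j
    proof -
      have "column j (\<chi> i j. c j $ i) = c j" by (simp add: vec_eq_iff column_def)
      then show ?thesis by (simp add: column_mult c)
    qed
    then show ?thesis by (simp add: vec_eq_iff column_def)
  qed
  then show thesis by (rule that)
qed

text \<open>Two frames of E differ by an invertible matrix C, so the matrices of the restriction are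
  similar and the description in \<open>det_on4\<close> has exactly one solution.\<close>

lemma det_on4_frame:
  fixes M :: "complex^4^'k::finite option"
  assumes F: "frame M E" and TM: "T ** M = M ** B"
  shows "det_on4 E T = det B"
proof -
  have conv: "(\<forall>j. T *v e j = (\<Sum>i\<in>UNIV. A $ i $ j *s e i)) \<longleftrightarrow> T ** N = N ** A"
    if "N = (\<chi> i j. e j $ i)" for e :: "4 \<Rightarrow> 'k cvec" and N A
  proof -
    have col: "column j N = e j" for j by (simp add: that vec_eq_iff column_def)
    have "T *v e j = column j (T ** N)" "(\<Sum>i\<in>UNIV. A $ i $ j *s e i) = column j (N ** A)" for j
      by (simp_all add: column_mult col matrix_mult_sum[of N]) (simp add: column_def)
    then show ?thesis by (simp add: vec_eq_iff column_def) blast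
  qed
  have unique: "det A = det B" if "frame N E" "T ** N = N ** A" for N :: "complex^4^'k option" and A
  proof -
    have "\<exists>C. N = M ** C"
    proof -
      have "\<exists>c. column j N = M *v c" for j
      proof -
        have "column j N \<in> E" using that(1) unfolding frame_iff by (auto intro: vec.span_base)
        then show ?thesis using F by (auto simp: frame_def)
      qed
      then obtain c where c: "\<And>j. column j N = M *v c j" by metis
      have "column j (\<chi> i j. c j $ i) = c j" for j by (simp add: vec_eq_iff column_def)
      then have "column j N = column j (M ** (\<chi> i j. c j $ i))" for j by (simp add: column_mult c)
      then have "N = M ** (\<chi> i j. c j $ i)" by (simp add: vec_eq_iff column_def)
      then show ?thesis ..
    qed
    then obtain C where C: "N = M ** C" ..
    have "x = 0" if "C *v x = 0" for x
    proof -
      have "N *v x = 0" using that by (simp add: C matrix_vector_mul_assoc[symmetric])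
      then show ?thesis using \<open>frame N E\<close> unfolding frame_def by blast
    qed
    then have "\<exists>B. B ** C = mat 1" unfolding matrix_left_invertible_ker by blast
    then have dC: "det C \<noteq> 0" using invertible_det_nz invertible_left_inverse by blast
    have "M ** (B ** C) = M ** (C ** A)"
      using that(2) TM by (metis C matrix_mul_assoc)
    then have "B ** C = C ** A" using frame_inj_mat[OF F] by blast
    then have "det B * det C = det C * det A" by (metis det_mul)
    then show ?thesis using dC by simp
  qed
  show ?thesis
    unfolding det_on4_def
  proof (rule the_equality)
    define e where "e j = column j M" for j
    have M: "M = (\<chi> i j. e j $ i)" by (simp add: e_def column_def vec_eq_iff)
    show "\<exists>(e :: 4 \<Rightarrow> 'k cvec) (B' :: complex^4^4). inj e \<and> vec.independent (range e) \<and> vec.span (range e) = E \<and>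
        (\<forall>j. T *v e j = (\<Sum>i\<in>UNIV. B' $ i $ j *s e i)) \<and> det B = det B'"
    proof (intro exI conjI)
      show "inj e" "vec.independent (range e)" "vec.span (range e) = E"
        using F unfolding frame_iff e_def by blast+
      show "\<forall>j. T *v e j = (\<Sum>i\<in>UNIV. B $ i $ j *s e i)" using conv[OF M] TM by blast
    qed simp
  next
    fix \<delta>
    assume "\<exists>(e :: 4 \<Rightarrow> 'k cvec) (B' :: complex^4^4). inj e \<and> vec.independent (range e) \<and> vec.span (range e) = E \<and>
        (\<forall>j. T *v e j = (\<Sum>i\<in>UNIV. B' $ i $ j *s e i)) \<and> \<delta> = det B'"
    then obtain e A where e: "inj e" "vec.independent (range e)" "vec.span (range e) = E"
      "\<forall>j. T *v e j = (\<Sum>i\<in>UNIV. A $ i $ j *s e i)" "\<delta> = det (A :: complex^4^4)" by blast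
    have "(\<lambda>j. column j (\<chi> i j. e j $ i)) = e" by (auto simp: column_def)
    then have "frame (\<chi> i j. e j $ i) E" unfolding frame_iff using e(1-3) by (simp only: simp_thms)
    then show "\<delta> = det B" using unique conv[OF refl] e(4,5) by blast
  qed
qed

section \<open>Hyperbolic bases and the two families of isotropic planes\<close>

definition hyperbolic :: "'k::finite cvec \<Rightarrow> 'k cvec \<Rightarrow> 'k cvec \<Rightarrow> 'k cvec \<Rightarrow> bool" where
  "hyperbolic e1 e2 f1 f2 \<longleftrightarrow> mink e1 e1 = 0 \<and> mink e1 e2 = 0 \<and> mink e2 e2 = 0 \<and>
     mink f1 f1 = 0 \<and> mink f1 f2 = 0 \<and> mink f2 f2 = 0 \<and>
     mink e1 f1 = 1 \<and> mink e1 f2 = 0 \<and> mink e2 f1 = 0 \<and> mink e2 f2 = 1"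

definition cols4 :: "'k::finite cvec \<Rightarrow> 'k cvec \<Rightarrow> 'k cvec \<Rightarrow> 'k cvec \<Rightarrow> complex^4^'k option" where
  "cols4 a b c d = (\<chi> i j. if j = 1 then a $ i else if j = 2 then b $ i else if j = 3 then c $ i else d $ i)"

lemma column_cols4 [simp]:
  "column 1 (cols4 a b c d) = a" "column 2 (cols4 a b c d) = b"
  "column 3 (cols4 a b c d) = c" "column 4 (cols4 a b c d) = d"
  by (simp_all add: cols4_def column_def)

lemma range_column_cols4: "range (\<lambda>j. column j (cols4 a b c d)) = {a, b, c, d}"
  by (simp add: UNIV_4)

lemma cols4_vector: "cols4 a b c d *v x = x $ 1 *s a + x $ 2 *s b + x $ 3 *s c + x $ 4 *s d"
  by (simp add: matrix_mult_sum sum_4)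

lemma mult_cols4: "T ** cols4 a b c d = cols4 (T *v a) (T *v b) (T *v c) (T *v d)"
  by (simp add: vec_eq_iff cols4_def matrix_matrix_mult_def matrix_vector_mult_def)

lemma hyperbolic_frame:
  assumes "hyperbolic e1 e2 f1 f2"
  shows "frame (cols4 e1 e2 f1 f2) (vec.span {e1, e2, f1, f2})"
proof -
  have "c = 0" if c: "cols4 e1 e2 f1 f2 *v c = 0" for c
  proof -
    have "mink (cols4 e1 e2 f1 f2 *v c) y = 0" for y using c by simp
    note this[of e1] this[of e2] this[of f1] this[of f2]
    then have "c $ i = 0" if "i = 1 \<or> i = 2 \<or> i = 3 \<or> i = 4" for i
      using that assms unfolding hyperbolic_def cols4_vector mink_simps
      by (auto simp: mink_commute)
    then show ?thesis using exhaust_4 by (simp add: vec_eq_iff)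
  qed
  then show ?thesis
    unfolding frame_def range_eq_span_columns range_column_cols4 by blast
qed

text \<open>The Gram matrices of the four vectors S e1, S e2, T e1, T f2 against the frames
  transported by S and by T have determinants det A det P and det B det P. Computed directly they
  are opposite numbers, so det A = det B, which is not zero, forces det P = 0: the four vectors are
  dependent.\<close>

lemma hyperbolic_meet:
  assumes hyp: "hyperbolic e1 e2 f1 f2" and V: "V = vec.span {e1, e2, f1, f2}"
    and S: "S \<in> orth_group" "(*v) S ` V \<subseteq> V" and T: "T \<in> orth_group" "(*v) T ` V \<subseteq> V"
    and det: "det_on4 V S = det_on4 V T"
  shows "\<exists>x y z w. (x, y) \<noteq> (0, 0) \<and> x *s (S *v e1) + y *s (S *v e2) = z *s (T *v e1) + w *s (T *v f2)"
proof -
  let ?M = "cols4 e1 e2 f1 f2"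
  let ?X = "cols4 (S *v e1) (S *v e2) (T *v e1) (T *v f2)"
  have F: "frame ?M V" using hyperbolic_frame[OF hyp] V by simp
  obtain A where A: "S ** ?M = ?M ** A" using frame_restrict[OF F S(2)] .
  obtain B where B: "T ** ?M = ?M ** B" using frame_restrict[OF F T(2)] .
  have dAB: "det A = det B" using det det_on4_frame[OF F A] det_on4_frame[OF F B] by simp
  \<comment> \<open>The coordinates of the four vectors in the hyperbolic basis.\<close>
  define P where "P = ((\<chi> i j. if j = 1 then A $ i $ 1 else if j = 2 then A $ i $ 2
    else if j = 3 then B $ i $ 1 else B $ i $ 4) :: complex^4^4)"
  have X: "?X = ?M ** P"
  proof -
    have "column j ?X = column j (?M ** P)" for j
    proof -
      have "column 1 P = column 1 A" "column 2 P = column 2 A" "column 3 P = column 1 B" "column 4 P = column 4 B"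
        by (simp_all add: P_def column_def vec_eq_iff)
      moreover have "S *v e1 = ?M *v column 1 A" "S *v e2 = ?M *v column 2 A"
        "T *v e1 = ?M *v column 1 B" "T *v f2 = ?M *v column 4 B"
        using arg_cong[OF A, of "column 1"] arg_cong[OF A, of "column 2"]
          arg_cong[OF B, of "column 1"] arg_cong[OF B, of "column 4"]
        unfolding column_mult by simp_all
      ultimately show ?thesis using exhaust_4[of j] by (auto simp: column_mult)
    qed
    then show ?thesis by (simp add: vec_eq_iff column_def)
  qed
  have H: "det (gram ?M ?M) = 1"
    using hyp unfolding det_4 gram_def hyperbolic_def by (simp add: mink_commute)
  define g1 g2 g3 g4 where "g1 = mink (S *v e1) (T *v e1)" and "g2 = mink (S *v e1) (T *v f2)"
    and "g3 = mink (S *v e2) (T *v e1)" and "g4 = mink (S *v e2) (T *v f2)"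
  note g = g1_def g2_def g3_def g4_def
  note h = hyp[unfolded hyperbolic_def]
  have 1: "det (gram (S ** ?M) ?X) = det A * det P"
    unfolding A X gram_mult_left gram_mult_right by (simp add: det_mul H)
  have 2: "det (gram (T ** ?M) ?X) = det B * det P"
    unfolding B X gram_mult_left gram_mult_right by (simp add: det_mul H)
  \<comment> \<open>S e1 and S e2 pair with S f1 and S f2 to an identity block; the determinant is
    that of the complementary block of the g's.\<close>
  have "det (gram (S ** ?M) ?X) = g1 * g4 - g2 * g3"
    using h unfolding det_4 gram_def mult_cols4 g
    by (simp add: orth_group_mink[OF S(1)] mink_commute[of f1 e1] mink_commute[of f1 e2]
        mink_commute[of f2 e1] mink_commute[of f2 e2] mink_commute[of e2 e1])
  \<comment> \<open>Now the constant entries come from the dual pairs e1, f1 and f2, e2, which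
    places them by a permutation of the other parity. This sign is the whole point.\<close>
  moreover have "det (gram (T ** ?M) ?X) = - (g1 * g4 - g2 * g3)"
    using h unfolding det_4 gram_def mult_cols4 g
    by (simp add: orth_group_mink[OF T(1)] mink_commute[of f1 e1] mink_commute[of f1 e2]
        mink_commute[of f2 e1] mink_commute[of f2 e2] mink_commute[of e2 e1] mink_commute[of "T *v x" "S *v y" for x y]
        mink_commute[of f2 f1])
  ultimately have "det A * det P = 0" using 1 2 dAB by simp
  moreover have "det A \<noteq> 0"
  proof -
    have "gram (S ** ?M) (S ** ?M) = gram ?M ?M" by (rule gram_orth[OF S(1)])
    then have "det A * det A = 1"
      using H unfolding A gram_mult_left gram_mult_right by (metis det_mul det_transpose mult_1_right)
    then show ?thesis by auto
  qed
  ultimately have "det P = 0" by simp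
  then have "\<not> (\<exists>B. B ** P = mat 1)" using invertible_det_nz invertible_left_inverse by blast
  then obtain c where c: "P *v c = 0" "c \<noteq> 0" unfolding matrix_left_invertible_ker by blast
  have "?X *v c = 0" by (simp add: X matrix_vector_mul_assoc[symmetric] c(1))
  then have eq: "c $ 1 *s (S *v e1) + c $ 2 *s (S *v e2) + c $ 3 *s (T *v e1) + c $ 4 *s (T *v f2) = 0"
    unfolding cols4_vector .
  have "(c $ 1, c $ 2) \<noteq> (0, 0)"
  proof
    assume a: "(c $ 1, c $ 2) = (0, 0)"
    then have "T *v (c $ 3 *s e1 + c $ 4 *s f2) = 0"
      using eq by (simp add: matrix_vector_right_distrib matrix_vector_scale)
    then have m: "mink (c $ 3 *s e1 + c $ 4 *s f2) y = 0" for y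
      using orth_group_mink[OF T(1), of "c $ 3 *s e1 + c $ 4 *s f2" y] by simp
    have "c $ 3 = 0" "c $ 4 = 0" using m[of f1] m[of e2] h by (auto simp: mink_simps mink_commute)
    then have "c $ i = 0" for i using a exhaust_4[of i] by auto
    then show False using c(2) by (simp add: vec_eq_iff)
  qed
  moreover have "c $ 1 *s (S *v e1) + c $ 2 *s (S *v e2) = (- c $ 3) *s (T *v e1) + (- c $ 4) *s (T *v f2)"
    using eq by (simp add: vec.scale_minus_left eq_diff_eq eq_neg_iff_add_eq_0 add_ac)
  ultimately show ?thesis by blast
qed

lemma span_perp:
  assumes "\<And>y. y \<in> S \<Longrightarrow> mink x y = 0" "y \<in> vec.span S" shows "mink x y = 0"
proof -
  have "vec.subspace {y. mink x y = 0}" by (auto simp: vec.subspace_def mink_simps)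
  from vec.span_minimal[OF _ this, of S] show ?thesis using assms by auto
qed

lemma vec_span_insert_iff: "x \<in> vec.span {a, b} \<longleftrightarrow> (\<exists>s t. x = s *s a + t *s (b :: complex^'n))"
proof
  assume "x \<in> vec.span {a, b}"
  then obtain k where "x - k *s a \<in> vec.span {b}" unfolding vec.span_breakdown_eq ..
  then obtain l where "x - k *s a - l *s b = 0" unfolding vec.span_breakdown_eq by auto
  then have "x = k *s a + l *s b" by (simp add: algebra_simps)
  then show "\<exists>s t. x = s *s a + t *s b" by blast
next
  assume "\<exists>s t. x = s *s a + t *s b"
  then obtain s t where "x = s *s a + t *s b" by blast
  then show "x \<in> vec.span {a, b}"
    by (simp add: vec.span_add vec.span_scale vec.span_base)
qed

text \<open>The pairing with a vanishes on a, b and c but not on d, which separates d from their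
  span.\<close>

lemma independent4:
  assumes a: "a \<noteq> 0" and b: "b \<notin> vec.span {a}" and c: "c \<notin> vec.span {a, b}"
    and d: "mink a a = 0" "mink a b = 0" "mink a c = 0" "mink a d \<noteq> 0"
  shows "vec.independent {a, b, c, d}" "card {a, b, c, d} = 4"
proof -
  have "d \<notin> vec.span {a, b, c}" using span_perp[of "{a, b, c}" a d] d by auto
  then have d': "d \<notin> vec.span {c, b, a}" by (simp add: insert_commute)
  have c': "c \<notin> vec.span {b, a}" using c by (simp add: insert_commute)
  have "vec.independent {d, c, b, a}"
    using a b c' d' by (intro vec.independent_insertI vec.independent_empty) auto
  moreover have "{a, b, c, d} = {d, c, b, a}" by blast
  ultimately show "vec.independent {a, b, c, d}" by (simp only: not_False_eq_True)
  have "d \<notin> {c, b, a}" "c \<notin> {b, a}" "b \<notin> {a}"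
    using d' c' b vec.span_superset[of "{c, b, a}"] vec.span_superset[of "{b, a}"]
      vec.span_superset[of "{a}"] by blast+
  then have "card {d, c, b, a} = Suc (card {c, b, a})" "card {c, b, a} = Suc (card {b, a})"
    "card {b, a} = Suc (card {a})"
    by (simp_all only: card_insert_disjoint finite.intros not_False_eq_True)
  moreover have "card {a} = 1" by simp
  ultimately have "card {d, c, b, a} = 4" by linarith
  then show "card {a, b, c, d} = 4" by (simp only: \<open>{a, b, c, d} = {d, c, b, a}\<close>)
qed

lemma span_eq_of_card:
  assumes "vec.subspace V" "S \<subseteq> V" "vec.independent S" "card S = vec.dim V"
  shows "vec.span S = V"
  using vec.card_ge_dim_independent[of S V] vec.span_minimal[of S V] assms by auto

text \<open>A Witt completion: e1 spans the common line, e2 and f complete it to L and M, and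
  non-degeneracy supplies a vector h that pairs with e1. It remains to rescale f and h and to
  correct h inside the span.\<close>

lemma hyperbolic_basis:
  fixes V L M :: "'k::finite cvec set"
  assumes V: "vec.subspace V" "vec.dim V = 4" "nondegenerate V"
    and L: "vec.subspace L" "vec.dim L = 2" "isotropic L" "L \<subseteq> V"
    and M: "vec.subspace M" "vec.dim M = 2" "isotropic M" "M \<subseteq> V"
    and LM: "vec.dim (L \<inter> M) = 1"
  obtains e1 e2 f1 f2 where "hyperbolic e1 e2 f1 f2" "L = vec.span {e1, e2}" "M = vec.span {e1, f2}"
    "V = vec.span {e1, e2, f1, f2}"
proof -
  have nd: "x = 0" if "x \<in> V" "\<And>y. y \<in> V \<Longrightarrow> mink x y = 0" for x
    using V(3) that by (auto simp: nondegenerate_def perp_def)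
  obtain B where B: "B \<subseteq> L \<inter> M" "vec.independent B" "card B = 1"
    using vec.basis_exists[of "L \<inter> M"] LM by metis
  then obtain e1 where e1: "B = {e1}" using card_1_singletonE by blast
  have e1L: "e1 \<in> L" "e1 \<in> M" "e1 \<noteq> 0" using B e1 by auto
  have ex: "\<exists>x\<in>W. x \<notin> vec.span {e1}" if "vec.dim W = 2" for W
  proof (rule ccontr)
    assume "\<not> ?thesis"
    then have "vec.dim W \<le> card {e1}" by (intro vec.dim_le_card) auto
    then show False using that by simp
  qed
  obtain e2 where e2: "e2 \<in> L" "e2 \<notin> vec.span {e1}" using ex[OF L(2)] by blast
  obtain f where f: "f \<in> M" "f \<notin> vec.span {e1}" using ex[OF M(2)] by blast
  have span2: "W = vec.span {e1, x}" if "vec.subspace W" "vec.dim W = 2" "e1 \<in> W" "x \<in> W" "x \<notin> vec.span {e1}" for W x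
  proof -
    have "x \<noteq> e1" using that(5) vec.span_base by blast
    moreover have "vec.independent {x, e1}" using that(5) e1L by (intro vec.independent_insertI vec.independent_empty) auto
    ultimately have "vec.span {x, e1} = W" using that by (intro span_eq_of_card) auto
    then show ?thesis by (simp add: insert_commute)
  qed
  have Ls: "L = vec.span {e1, e2}" using span2 L e1L e2 by blast
  have Ms: "M = vec.span {e1, f}" using span2 M e1L f by blast
  have fL: "f \<notin> L"
  proof
    assume "f \<in> L"
    then have "vec.span {e1, f} \<subseteq> L \<inter> M" using e1L f L(1) M(1)
      by (intro vec.span_minimal) (auto simp: vec.subspace_inter)
    then have "M \<subseteq> L \<inter> M" using Ms by simp
    then show False using vec.dim_subset[of M "L \<inter> M"] M(2) LM by simp
  qed
  have isoL: "mink x y = 0" if "x \<in> L" "y \<in> L" for x y using L(3) that by (auto simp: isotropic_def)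
  have isoM: "mink x y = 0" if "x \<in> M" "y \<in> M" for x y using M(3) that by (auto simp: isotropic_def)
  have "\<exists>h\<in>V. mink e1 h \<noteq> 0" using nd[of e1] e1L L(4) by blast
  then obtain h where h: "h \<in> V" "mink e1 h \<noteq> 0" by blast
  have sp: "V = vec.span {e1, e2, f, h}"
    using independent4[of e1 e2 f h] span_eq_of_card[OF V(1), of "{e1, e2, f, h}"] e1L e2 f fL Ls h L(4) M(4) V(2)
      isoL[of e1 e1] isoL[of e1 e2] isoM[of e1 f] by auto
  \<comment> \<open>Otherwise e2, corrected by a multiple of e1 so as to be orthogonal to h, would
    lie in the radical of V.\<close>
  have ef: "mink e2 f \<noteq> 0"
  proof
    assume 0: "mink e2 f = 0"
    define w where "w = e2 - (mink e2 h / mink e1 h) *s e1"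
    have "mink w y = 0" if "y \<in> {e1, e2, f, h}" for y
      using that 0 h(2) isoL e1L e2 isoM f by (auto simp: w_def mink_simps)
    then have "mink w y = 0" if "y \<in> V" for y using span_perp sp that by blast
    moreover have "w \<in> V" using e1L e2 L(4) V(1) by (auto simp: w_def intro!: vec.subspace_diff vec.subspace_scale)
    ultimately have "w = 0" using nd by blast
    then have "e2 = (mink e2 h / mink e1 h) *s e1" by (simp add: w_def)
    then have "e2 \<in> vec.span {e1}" by (metis vec.span_base vec.span_scale insertI1)
    then show False using e2(2) by blast
  qed
  define f2 where "f2 = (1 / mink e2 f) *s f"
  define h1 where "h1 = (1 / mink e1 h) *s h"
  \<comment> \<open>The value that makes f1 isotropic; the last two terms of f1 remove its pairings
    with f2 and with e2.\<close>
  define a where "a = - mink h1 h1 / 2 + mink h1 f2 * mink h1 e2"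
  define f1 where "f1 = h1 + a *s e1 - mink h1 f2 *s e2 - mink h1 e2 *s f2"
  have f2M: "f2 \<in> M" using f M(1) by (simp add: f2_def vec.subspace_scale)
  have h1V: "h1 \<in> V" using h V(1) by (simp add: h1_def vec.subspace_scale)
  have b: "mink e1 e1 = 0" "mink e1 e2 = 0" "mink e2 e1 = 0" "mink e2 e2 = 0" "mink f2 f2 = 0" "mink e1 f2 = 0" "mink f2 e1 = 0"
    using isoL isoM e1L e2 f2M by auto
  have c: "mink e2 f2 = 1" "mink f2 e2 = 1" "mink e1 h1 = 1" "mink h1 e1 = 1"
    using ef h by (simp_all add: f2_def h1_def mink_simps mink_commute[of f e2] mink_commute[of h e1])
  have hyp: "hyperbolic e1 e2 f1 f2"
    unfolding hyperbolic_def
    by (simp add: b c f1_def mink_simps mink_commute[of e2 h1] mink_commute[of f2 h1] a_def field_simps)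
  have f2n: "f2 \<notin> vec.span {e1, e2}"
  proof
    assume "f2 \<in> vec.span {e1, e2}"
    then have "mink e2 f2 = 0" using Ls isoL e2 by blast
    then show False using c by simp
  qed
  have f1V: "f1 \<in> V"
    unfolding f1_def using h1V e1L e2 f2M L(4) M(4) V(1)
    by (intro vec.subspace_diff vec.subspace_add vec.subspace_scale) auto
  have "vec.span {e1, e2, f2, f1} = V"
    using independent4[of e1 e2 f2 f1] span_eq_of_card[OF V(1), of "{e1, e2, f2, f1}"] e1L e2 f2n f2M f1V hyp L(4) M(4) V(2)
    by (auto simp: hyperbolic_def)
  then have Vs: "V = vec.span {e1, e2, f1, f2}" by (simp add: insert_commute)
  have "f2 \<notin> vec.span {e1}" using f2n vec.span_mono[of "{e1}" "{e1, e2}"] by blast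
  then have "M = vec.span {e1, f2}" using span2 M e1L f2M by blast
  then show thesis using that hyp Ls Vs by blast
qed

text \<open>In a hyperbolic basis adapted to L, the coefficients of x along f1 and f2 are its
  pairings with e1 and e2. The second plane M provides the basis.\<close>

lemma isotropic_maximal:
  assumes V: "vec.subspace V" "vec.dim V = 4" "nondegenerate V"
    and L: "vec.subspace L" "vec.dim L = 2" "isotropic L" "L \<subseteq> V"
    and M: "vec.subspace M" "vec.dim M = 2" "isotropic M" "M \<subseteq> V"
    and LM: "vec.dim (L \<inter> M) = 1"
    and x: "x \<in> V" "\<And>y. y \<in> L \<Longrightarrow> mink x y = 0"
  shows "x \<in> L"
proof -
  obtain e1 e2 f1 f2 where b: "hyperbolic e1 e2 f1 f2" "L = vec.span {e1, e2}"
    "V = vec.span {e1, e2, f1, f2}" using hyperbolic_basis[OF V L M LM] by metis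
  obtain c where c: "x = cols4 e1 e2 f1 f2 *v c"
    using x(1) hyperbolic_frame[OF b(1)] b(3) unfolding frame_def by auto
  have "e1 \<in> L" "e2 \<in> L" using vec.span_superset[of "{e1, e2}"] b(2) by auto
  then have "mink x e1 = 0" "mink x e2 = 0" using x(2) by auto
  then have "c $ 3 = 0" "c $ 4 = 0"
    using b(1) by (auto simp: c cols4_vector mink_simps hyperbolic_def mink_commute)
  then show ?thesis unfolding c cols4_vector b(2) vec_span_insert_iff by auto
qed

lemma hyperbolic_swap: "hyperbolic e1 e2 f1 f2 \<Longrightarrow> hyperbolic e2 e1 f2 f1"
  by (auto simp: hyperbolic_def mink_commute)

lemma orth_group_image:
  assumes "T \<in> orth_group"
  shows "vec.subspace E \<Longrightarrow> vec.subspace ((*v) T ` E)" "vec.dim ((*v) T ` E) = vec.dim E"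
    "isotropic E \<Longrightarrow> isotropic ((*v) T ` E)"
proof -
  show "vec.subspace E \<Longrightarrow> vec.subspace ((*v) T ` E)"
    using vec.linear_subspace_image[OF matrix_vector_mul_linear_gen] by blast
  have "inj ((*v) T)"
    by (rule inj_on_inverseI[of _ "(*v) (adj T)"])
      (simp add: matrix_vector_mul_assoc orth_group_adj_left[OF assms])
  then show "vec.dim ((*v) T ` E) = vec.dim E"
    by (intro vec.dim_image_eq) (auto intro: inj_on_subset)
  show "isotropic E \<Longrightarrow> isotropic ((*v) T ` E)"
    by (auto simp: isotropic_def orth_group_mink[OF assms])
qed

text \<open>Intersection in a line means that \<open>L\<close> and \<open>M\<close> belong to opposite families of maximal isotropic
  subspaces of \<open>V\<close>, and two orthogonal maps with the same determinant permute the families alike.\<close>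

lemma opposite_families:
  assumes V: "vec.subspace V" "vec.dim V = 4" "nondegenerate V"
    and L: "vec.subspace L" "vec.dim L = 2" "isotropic L" "L \<subseteq> V"
    and M: "vec.subspace M" "vec.dim M = 2" "isotropic M" "M \<subseteq> V"
    and LM: "vec.dim (L \<inter> M) = 1"
    and S: "S \<in> orth_group" "(*v) S ` V \<subseteq> V" and T: "T \<in> orth_group" "(*v) T ` V \<subseteq> V"
    and det: "det_on4 V S = det_on4 V T"
  shows "vec.dim ((*v) S ` L \<inter> (*v) T ` M) = 1"
proof -
  obtain e1 e2 f1 f2 where b: "hyperbolic e1 e2 f1 f2" "L = vec.span {e1, e2}" "M = vec.span {e1, f2}"
    "V = vec.span {e1, e2, f1, f2}" using hyperbolic_basis[OF V L M LM] by metis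
  let ?SL = "(*v) S ` L" and ?TM = "(*v) T ` M"
  have pos: "\<exists>u\<in>(*v) S ` vec.span {a1, a2} \<inter> (*v) T ` vec.span {a1, b2}. u \<noteq> 0"
    if h: "hyperbolic a1 a2 b1 b2" "V = vec.span {a1, a2, b1, b2}" for a1 a2 b1 b2
  proof -
    obtain x y z w where xy: "(x, y) \<noteq> (0, 0)"
      "x *s (S *v a1) + y *s (S *v a2) = z *s (T *v a1) + w *s (T *v b2)"
      using hyperbolic_meet[OF h S T det] by blast
    let ?u = "x *s a1 + y *s a2"
    have "S *v ?u = T *v (z *s a1 + w *s b2)"
      using xy(2) by (simp add: matrix_vector_right_distrib matrix_vector_scale)
    moreover have "?u \<in> vec.span {a1, a2}" "z *s a1 + w *s b2 \<in> vec.span {a1, b2}"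
      unfolding vec_span_insert_iff by blast+
    moreover have "S *v ?u \<noteq> 0"
    proof
      assume "S *v ?u = 0"
      then have m: "mink ?u y = 0" for y using orth_group_mink[OF S(1), of ?u y] by simp
      show False using m[of b1] m[of b2] h(1) xy(1) by (auto simp: hyperbolic_def mink_simps)
    qed
    ultimately show ?thesis by (metis IntI image_eqI)
  qed
  obtain u where u: "u \<in> ?SL \<inter> ?TM" "u \<noteq> 0" using pos[OF b(1,4)] b(2,3) by blast
  have sub: "vec.subspace ?SL" "vec.subspace ?TM"
    using orth_group_image(1)[OF S(1) L(1)] orth_group_image(1)[OF T(1) M(1)] .
  have dims: "vec.dim ?SL = 2" "vec.dim ?TM = 2" using orth_group_image(2) S T L M by metis+
  have "vec.dim {u} \<le> vec.dim (?SL \<inter> ?TM)" using u by (intro vec.dim_subset) auto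
  moreover have "vec.dim {u} = 1" using u(2) by (simp add: vec.dim_eq_card_independent)
  moreover have "vec.dim (?SL \<inter> ?TM) \<le> 2" using vec.dim_subset[of "?SL \<inter> ?TM" ?SL] dims by simp
  moreover have "vec.dim (?SL \<inter> ?TM) \<noteq> 2"
  proof
    assume d2: "vec.dim (?SL \<inter> ?TM) = 2"
    have "?SL \<inter> ?TM = ?SL" "?SL \<inter> ?TM = ?TM"
      using d2 dims sub by (intro vec.subspace_dim_equal vec.subspace_inter; simp)+
    then have eq: "?SL = ?TM" by simp
    \<comment> \<open>If the images agreed, the same statement with the indices 1 and 2 exchanged
      would give a common nonzero vector of the images under T of span {e1, f2} and span {e2, f1},
      which are complementary.\<close>
    have "V = vec.span {e2, e1, f2, f1}" using b(4) by (simp add: insert_commute)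
    from pos[OF hyperbolic_swap[OF b(1)] this]
    obtain v where v: "v \<in> (*v) S ` vec.span {e2, e1}" "v \<in> (*v) T ` vec.span {e2, f1}" "v \<noteq> 0" by blast
    have "v \<in> ?TM" using v(1) eq b(2) by (simp add: insert_commute)
    then obtain m where m: "m \<in> M" "v = T *v m" by blast
    obtain m' where m': "m' \<in> vec.span {e2, f1}" "v = T *v m'" using v(2) by blast
    have "adj T *v (T *v y) = y" for y by (simp add: matrix_vector_mul_assoc orth_group_adj_left[OF T(1)])
    then have "m = m'" using m(2) m'(2) by metis
    then obtain x y z w where xy: "m = x *s e1 + y *s f2" "m = z *s e2 + w *s f1"
      using m(1) m'(1) unfolding b(3) vec_span_insert_iff by blast
    have "mink m f1 = x" "mink m e2 = y" using xy(1) b(1) by (auto simp: hyperbolic_def mink_simps mink_commute)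
    moreover have "mink m f1 = 0" "mink m e2 = 0" using xy(2) b(1) by (auto simp: hyperbolic_def mink_simps mink_commute)
    ultimately have "m = 0" using xy(1) by simp
    then show False using v(3) m(2) by simp
  qed
  ultimately show ?thesis by linarith
qed

text \<open>Up to scale one combination of a1 and a2 is orthogonal to b, and the formula for it is
  smooth in the three vectors, so \<open>subbundle_meet\<close> can use it as a local section. Some
  b pairs nontrivially, since otherwise L would be orthogonal to M and hence contained in it by
  maximality.\<close>

lemma isotropic_meet:
  assumes V: "vec.subspace V" "vec.dim V = 4" "nondegenerate V"
    and L: "vec.subspace L" "vec.dim L = 2" "isotropic L" "L \<subseteq> V"
    and M: "vec.subspace M" "vec.dim M = 2" "isotropic M" "M \<subseteq> V"
    and LM: "vec.dim (L \<inter> M) = 1"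
    and La: "L = vec.span {a1, a2}" and Mb: "M = vec.span {b1, b2}"
  shows "\<exists>b\<in>{b1, b2}. mink a1 b \<noteq> 0 \<or> mink a2 b \<noteq> 0"
    and "b \<in> {b1, b2} \<Longrightarrow> mink a1 b \<noteq> 0 \<or> mink a2 b \<noteq> 0 \<Longrightarrow>
      L \<inter> M = vec.span {mink a2 b *s a1 - mink a1 b *s a2}"
proof -
  have ml: "vec.dim (M \<inter> L) = 1" using LM by (simp add: Int_commute)
  show "\<exists>b\<in>{b1, b2}. mink a1 b \<noteq> 0 \<or> mink a2 b \<noteq> 0"
  proof (rule ccontr)
    assume n: "\<not> ?thesis"
    have "a \<in> M" if "a \<in> {a1, a2}" for a
    proof (rule isotropic_maximal[OF V M L ml])
      show "a \<in> V" using that La L(4) vec.span_base by blast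
      show "mink a y = 0" if "y \<in> M" for y
        using span_perp[of "{b1, b2}" a y] n \<open>a \<in> {a1, a2}\<close> \<open>y \<in> M\<close> Mb by auto
    qed
    then have "L \<subseteq> M" using La vec.span_minimal[OF _ M(1), of "{a1, a2}"] by auto
    then show False using L(2) LM by (simp add: Int_absorb2)
  qed
  assume b: "b \<in> {b1, b2}" and nz: "mink a1 b \<noteq> 0 \<or> mink a2 b \<noteq> 0"
  let ?\<sigma> = "mink a2 b *s a1 - mink a1 b *s a2"
  have "L \<inter> M \<subseteq> vec.span {?\<sigma>}"
  proof
    fix x assume x: "x \<in> L \<inter> M"
    then have "x \<in> vec.span {a1, a2}" using La by blast
    then obtain s t where st: "x = s *s a1 + t *s a2" unfolding vec_span_insert_iff by blast
    have "b \<in> M" using b Mb vec.span_base by blast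
    then have "mink x b = 0" using x M(3) by (auto simp: isotropic_def)
    then have e: "s * mink a1 b + t * mink a2 b = 0" by (simp add: st mink_simps)
    have "\<exists>k. x = k *s ?\<sigma>"
    proof (cases "mink a1 b = 0")
      case True
      then have "t = 0" using e nz by simp
      then have "x = (s / mink a2 b) *s ?\<sigma>" using True nz by (simp add: st)
      then show ?thesis ..
    next
      case False
      then have "s = - t / mink a1 b * mink a2 b" using e by (simp add: field_simps eq_neg_iff_add_eq_0)
      then have "x = (- t / mink a1 b) *s ?\<sigma>" using False
        by (simp add: st vec_eq_iff right_diff_distrib mult.assoc[symmetric])
      then show ?thesis ..
    qed
    then show "x \<in> vec.span {?\<sigma>}" by (metis vec.span_base vec.span_scale insertI1)
  qed
  moreover have "vec.dim (vec.span {?\<sigma>}) \<le> 1" using vec.dim_le_card[of "{?\<sigma>}" "{?\<sigma>}"] vec.span_superset by auto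
  ultimately show "L \<inter> M = vec.span {?\<sigma>}"
    using L(1) M(1) LM by (intro vec.subspace_dim_equal vec.subspace_inter vec.subspace_span) auto
qed

text \<open>The bivectors of M are multiples of e1 wedge f2. As e1 is orthogonal to L and f2 pairs
  in L only with e2, such a bivector sends L into the line of e1. Consequently q, whose values are
  bivectors of one plane, preserves the other plane as well.\<close>

lemma wedge2_swap_family:
  assumes V: "vec.subspace V" "vec.dim V = 4" "nondegenerate V"
    and L: "vec.subspace L" "vec.dim L = 2" "isotropic L" "L \<subseteq> V"
    and M: "vec.subspace M" "vec.dim M = 2" "isotropic M" "M \<subseteq> V"
    and LM: "vec.dim (L \<inter> M) = 1"
    and X: "X \<in> wedge2 M" and u: "u \<in> L"
  shows "X *v u \<in> L \<inter> M"
proof (rule wedge2_induct[OF X _ vec.subspace_inter[OF L(1) M(1)]])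
  fix a b assume ab: "a \<in> M" "b \<in> M"
  obtain e1 e2 f1 f2 where h: "hyperbolic e1 e2 f1 f2" "L = vec.span {e1, e2}" "M = vec.span {e1, f2}"
    "V = vec.span {e1, e2, f1, f2}" using hyperbolic_basis[OF V L M LM] by metis
  obtain a1 a2 where a: "a = a1 *s e1 + a2 *s f2" using ab(1) unfolding h(3) vec_span_insert_iff by blast
  obtain b1 b2 where b: "b = b1 *s e1 + b2 *s f2" using ab(2) unfolding h(3) vec_span_insert_iff by blast
  obtain u1 u2 where u': "u = u1 *s e1 + u2 *s e2" using u unfolding h(2) vec_span_insert_iff by blast
  have "mink u a = u2 * a2" "mink u b = u2 * b2"
    using h(1) by (auto simp: u' a b hyperbolic_def mink_simps mink_commute)
  then have "wedge a b *v u = (u2 * (a2 * b1 - b2 * a1)) *s e1"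
    by (simp add: wedge_works a b vec_eq_iff algebra_simps)
  moreover have "e1 \<in> L \<inter> M"
    using h(2,3) vec.span_superset[of "{e1, e2}"] vec.span_superset[of "{e1, f2}"] by auto
  ultimately show "wedge a b *v u \<in> L \<inter> M"
    using vec.subspace_scale[OF vec.subspace_inter[OF L(1) M(1)]] by metis
qed

lemma wedge2_kill_isotropic:
  assumes "isotropic E" "X \<in> wedge2 E" "u \<in> E" shows "X *v u = 0"
  using wedge2_kill_perp[OF assms(2), of u] assms(1,3) by (auto simp: perp_def isotropic_def)

section \<open>Laurent polynomials and limits\<close>

text \<open>The function z^2 h extends over 0 by its limit and becomes entire with at most quadratic
  growth, hence a polynomial. Its coefficients of degree 0 and 2 are the two given limits, and only
  the middle one stays undetermined.\<close>

lemma laurent_of_limits: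
  fixes h :: "complex \<Rightarrow> complex"
  assumes hol: "h holomorphic_on - {0}"
    and lim0: "((\<lambda>z. z\<^sup>2 * h z) \<longlongrightarrow> a2) (at 0)" and liminf: "(h \<longlongrightarrow> a0) at_infinity"
  shows "\<exists>a1. \<forall>z. z \<noteq> 0 \<longrightarrow> h z = a0 + inverse z * a1 + inverse (z\<^sup>2) * a2"
proof -
  define k where "k z = (if z = 0 then a2 else z\<^sup>2 * h z)" for z
  have "k holomorphic_on - {0}"
    by (rule holomorphic_transform[of "\<lambda>z. z\<^sup>2 * h z"]) (auto simp: k_def intro!: holomorphic_intros hol)
  then have kh: "k holomorphic_on UNIV - {0}" by (simp add: Compl_eq_Diff_UNIV)
  have "(k \<longlongrightarrow> k 0) (at 0)"
    using Lim_transform_within_open[OF lim0, of UNIV k] by (simp add: k_def)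
  then have "isCont k 0" by (simp add: isCont_def)
  moreover have "isCont k z" if "z \<noteq> 0" for z
    using holomorphic_on_imp_continuous_on[OF kh] that
    by (simp add: continuous_on_eq_continuous_at open_Diff)
  ultimately have "continuous_on UNIV k" by (metis continuous_at_imp_continuous_on)
  then have hk: "k holomorphic_on UNIV"
    using no_isolated_singularity[of UNIV k "{0}"] kh by simp
  have "eventually (\<lambda>z. dist (h z) a0 < 1) at_infinity" using liminf tendstoD zero_less_one by blast
  then obtain A where A: "\<And>z. A \<le> norm z \<Longrightarrow> dist (h z) a0 < 1"
    unfolding eventually_at_infinity by blast
  have "norm (k z) \<le> (norm a0 + 1) * norm z ^ 2" if "max A 1 \<le> norm z" for z
  proof -
    have "norm (h z) \<le> norm (h z - a0) + norm a0" using norm_triangle_ineq[of "h z - a0" a0] by simp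
    also have "\<dots> \<le> norm a0 + 1" using A[of z] that by (simp add: dist_norm)
    finally have "norm z ^ 2 * norm (h z) \<le> norm z ^ 2 * (norm a0 + 1)" by (rule mult_left_mono) simp
    then show ?thesis using that by (auto simp: k_def norm_mult norm_power mult.commute)
  qed
  then have L: "k z = (\<Sum>i\<le>2. (deriv ^^ i) k 0 / fact i * z ^ i)" for z
    by (rule Liouville_polynomial[OF hk])
  define c where "c i = (deriv ^^ i) k 0 / fact i" for i
  have kz: "k z = c 0 + c 1 * z + c 2 * z\<^sup>2" for z
    using L[of z] by (simp add: c_def numeral_2_eq_2)
  have hz: "h z = c 2 + inverse z * c 1 + inverse (z\<^sup>2) * c 0" if "z \<noteq> 0" for z
    using kz[of z] that by (simp add: k_def field_simps power2_eq_square)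
  have "((\<lambda>z. c 2 + inverse z * c 1 + inverse z * inverse z * c 0) \<longlongrightarrow> c 2 + 0 * c 1 + 0 * 0 * c 0) at_infinity"
    by (intro tendsto_intros tendsto_inverse_0)
  moreover have "eventually (\<lambda>z. c 2 + inverse z * c 1 + inverse z * inverse z * c 0 = h z) at_infinity"
    unfolding eventually_at_infinity
  proof (rule exI[of _ 1], intro allI impI)
    fix z :: complex assume "1 \<le> norm z"
    then have "z \<noteq> 0" by auto
    from hz[OF this] show "c 2 + inverse z * c 1 + inverse z * inverse z * c 0 = h z"
      by (simp add: power2_eq_square)
  qed
  ultimately have "(h \<longlongrightarrow> c 2) at_infinity" using Lim_transform_eventually by fastforce
  then have "c 2 = a0" using liminf tendsto_unique trivial_limit_at_infinity by blast
  moreover have "c 0 = a2" using kz[of 0] by (simp add: k_def)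
  ultimately show ?thesis using hz by (intro exI[of _ "c 1"]) auto
qed

lemma tendsto_matrixI:
  assumes "\<And>i j. ((\<lambda>x. f x $ i $ j) \<longlongrightarrow> L $ i $ j) F"
  shows "(f \<longlongrightarrow> (L :: 'k::finite cmat)) F"
  by (intro vec_tendstoI assms)

lemma laurent_matrix:
  fixes G :: "complex \<Rightarrow> 'k::finite cmat"
  assumes "\<And>i j. (\<lambda>z. G z $ i $ j) holomorphic_on - {0}"
    and "((\<lambda>z. z\<^sup>2 \<odot> G z) \<longlongrightarrow> A2) (at 0)" and "(G \<longlongrightarrow> A0) at_infinity"
  obtains A1 where "\<And>z. z \<noteq> 0 \<Longrightarrow> G z = A0 + inverse z \<odot> A1 + inverse (z\<^sup>2) \<odot> A2"
proof -
  have "\<exists>a1. \<forall>z. z \<noteq> 0 \<longrightarrow> G z $ i $ j = A0 $ i $ j + inverse z * a1 + inverse (z\<^sup>2) * A2 $ i $ j" for i j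
  proof (rule laurent_of_limits[OF assms(1)])
    show "((\<lambda>z. z\<^sup>2 * G z $ i $ j) \<longlongrightarrow> A2 $ i $ j) (at 0)"
      using tendsto_vec_nth[OF tendsto_vec_nth[OF assms(2)], of i j] by simp
    show "((\<lambda>z. G z $ i $ j) \<longlongrightarrow> A0 $ i $ j) at_infinity"
      by (intro tendsto_vec_nth assms(3))
  qed
  then obtain a where "\<And>i j z. z \<noteq> 0 \<Longrightarrow> G z $ i $ j = A0 $ i $ j + inverse z * a i j + inverse (z\<^sup>2) * A2 $ i $ j"
    by metis
  then show thesis by (intro that[of "\<chi> i j. a i j"]) (simp add: vec_eq_iff)
qed

section \<open>Rational matrix families and their value at infinity\<close>

lemma eventually_poly_nonzero:
  fixes q :: "complex poly"
  assumes "q \<noteq> 0" shows "eventually (\<lambda>z. poly q z \<noteq> 0) at_infinity"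
proof -
  have "bounded {z. poly q z = 0}" using poly_roots_finite[OF assms] by (rule finite_imp_bounded)
  then obtain B where B: "\<And>z. poly q z = 0 \<Longrightarrow> norm z \<le> B" unfolding bounded_iff by blast
  show ?thesis unfolding eventually_at_infinity by (rule exI[of _ "B + 1"]) (use B in fastforce)
qed

text \<open>A numerator of larger degree makes the reciprocal quotient tend to 0, so that 1 would be
  a limit of 0; one of equal degree leaves the nonzero quotient of the leading coefficients.\<close>

lemma poly_quotient_limit_zero:
  fixes p Q :: "complex poly"
  assumes "Q \<noteq> 0" "((\<lambda>z. poly p z / poly Q z) \<longlongrightarrow> 0) at_infinity"
  shows "\<forall>k\<ge>degree Q. coeff p k = 0"
proof (rule ccontr)
  assume n: "\<not> ?thesis"
  then obtain k where k: "degree Q \<le> k" "coeff p k \<noteq> 0" by blast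
  then have p: "p \<noteq> 0" "degree Q \<le> degree p" using le_degree[of p k] by auto
  have ev: "eventually (\<lambda>z. poly q z \<noteq> 0) at_infinity" if "q \<noteq> 0" for q :: "complex poly"
    using that by (rule eventually_poly_nonzero)
  show False
  proof (cases "degree Q < degree p")
    case True
    then have "((\<lambda>z. poly Q z / poly p z) \<longlongrightarrow> 0) at_infinity"
      by (rule poly_divide_tendsto_0_at_infinity)
    then have "((\<lambda>z. (poly p z / poly Q z) * (poly Q z / poly p z)) \<longlongrightarrow> 0 * 0) at_infinity"
      by (intro tendsto_mult assms(2))
    moreover have "eventually (\<lambda>z. (poly p z / poly Q z) * (poly Q z / poly p z) = 1) at_infinity"
      using ev[OF p(1)] ev[OF assms(1)] by eventually_elim simp
    ultimately have "((\<lambda>z :: complex. 1 :: complex) \<longlongrightarrow> 0) at_infinity"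
      using Lim_transform_eventually by fastforce
    then have "(1::complex) = 0"
      by (rule tendsto_unique[OF trivial_limit_at_infinity tendsto_const])
    then show False by simp
  next
    case False
    then have d: "degree Q = degree p" using p(2) by simp
    have "((\<lambda>z. (poly p z / z ^ degree p) / (poly Q z / z ^ degree Q)) \<longlongrightarrow> lead_coeff p / lead_coeff Q) at_infinity"
      using assms(1) by (intro tendsto_divide poly_divide_tendsto_aux) auto
    moreover have "eventually (\<lambda>z. (poly p z / z ^ degree p) / (poly Q z / z ^ degree Q) = poly p z / poly Q z) at_infinity"
      unfolding eventually_at_infinity by (rule exI[of _ 1]) (auto simp: d)
    ultimately have "((\<lambda>z. poly p z / poly Q z) \<longlongrightarrow> lead_coeff p / lead_coeff Q) at_infinity"
      using Lim_transform_eventually by fastforce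
    then have "lead_coeff p / lead_coeff Q = 0"
      using assms(2) tendsto_unique trivial_limit_at_infinity by blast
    then show False using p(1) assms(1) by simp
  qed
qed

lemma poly_quotient_limit:
  fixes p Q :: "complex poly"
  assumes "Q \<noteq> 0" "((\<lambda>z. poly p z / poly Q z) \<longlongrightarrow> L) at_infinity"
  shows "degree p \<le> degree Q" "L = coeff p (degree Q) / lead_coeff Q"
proof -
  have ev: "eventually (\<lambda>z. poly Q z \<noteq> 0) at_infinity"
    using assms(1) by (rule eventually_poly_nonzero)
  have "((\<lambda>z. poly p z / poly Q z - L) \<longlongrightarrow> L - L) at_infinity"
    by (intro tendsto_intros assms)
  moreover have "eventually (\<lambda>z. poly p z / poly Q z - L = poly (p - smult L Q) z / poly Q z) at_infinity"
    using ev by eventually_elim (simp add: field_simps)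
  ultimately have "((\<lambda>z. poly (p - smult L Q) z / poly Q z) \<longlongrightarrow> 0) at_infinity"
    using Lim_transform_eventually by fastforce
  then have c: "coeff p k = L * coeff Q k" if "k \<ge> degree Q" for k
    using poly_quotient_limit_zero[OF assms(1)] that by fastforce
  show "degree p \<le> degree Q"
    by (rule degree_le) (use c coeff_eq_0[of Q] in auto)
  show "L = coeff p (degree Q) / lead_coeff Q" using c[of "degree Q"] assms(1) by simp
qed

lemma poly_quotient_tendsto:
  fixes p Q :: "complex poly"
  assumes "Q \<noteq> 0" "degree p \<le> degree Q"
  shows "((\<lambda>z. poly p z / poly Q z) \<longlongrightarrow> coeff p (degree Q) / lead_coeff Q) at_infinity"
proof -
  define L where "L = coeff p (degree Q) / lead_coeff Q"
  have ev: "eventually (\<lambda>z. poly Q z \<noteq> 0) at_infinity"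
    using assms(1) by (rule eventually_poly_nonzero)
  have top: "coeff (p - smult L Q) (degree Q) = 0" using assms(1) by (simp add: L_def)
  have "((\<lambda>z. poly (p - smult L Q) z / poly Q z) \<longlongrightarrow> 0) at_infinity"
  proof (cases "p - smult L Q = 0")
    case False
    have "degree (p - smult L Q) \<le> degree Q"
      using assms(2) degree_smult_le[of L Q] by (intro degree_diff_le) auto
    moreover have "degree (p - smult L Q) \<noteq> degree Q"
      using top False leading_coeff_0_iff by metis
    ultimately show ?thesis by (intro poly_divide_tendsto_0_at_infinity) simp
  qed simp
  then have "((\<lambda>z. poly (p - smult L Q) z / poly Q z + L) \<longlongrightarrow> 0 + L) at_infinity"
    by (intro tendsto_intros)
  moreover have "eventually (\<lambda>z. poly (p - smult L Q) z / poly Q z + L = poly p z / poly Q z) at_infinity"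
    using ev by eventually_elim (simp add: field_simps)
  ultimately show ?thesis unfolding L_def[symmetric] using Lim_transform_eventually by fastforce
qed

definition coeff_poly :: "nat \<Rightarrow> (nat \<Rightarrow> complex) \<Rightarrow> complex poly" where
  "coeff_poly d a = (\<Sum>k\<le>d. monom (a k) k)"

lemma poly_coeff_poly: "poly (coeff_poly d a) z = (\<Sum>k\<le>d. z ^ k * a k)"
  by (simp add: coeff_poly_def poly_sum poly_monom mult.commute)

lemma coeff_coeff_poly: "coeff (coeff_poly d a) k = (if k \<le> d then a k else 0)"
  by (simp add: coeff_poly_def coeff_sum)

definition rat_mat :: "complex poly \<Rightarrow> nat \<Rightarrow> (nat \<Rightarrow> 'k::finite cmat) \<Rightarrow> complex \<Rightarrow> 'k cmat" where
  "rat_mat Q d P \<zeta> = inverse (poly Q \<zeta>) \<odot> (\<Sum>k\<le>d. \<zeta> ^ k \<odot> P k)"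

text \<open>The coefficient of degree \<open>degree Q\<close> over the leading coefficient of Q; the
  numerator has no such coefficient if d is smaller. Being a formula in the coefficients, it can be
  differentiated along the surface.\<close>

definition rat_mat_inf :: "complex poly \<Rightarrow> nat \<Rightarrow> (nat \<Rightarrow> 'k::finite cmat) \<Rightarrow> 'k cmat" where
  "rat_mat_inf Q d P = inverse (lead_coeff Q) \<odot> (if degree Q \<le> d then P (degree Q) else 0)"

lemma rat_mat_nth: "rat_mat Q d P \<zeta> $ i $ j = poly (coeff_poly d (\<lambda>k. P k $ i $ j)) \<zeta> / poly Q \<zeta>"
  by (simp add: rat_mat_def poly_coeff_poly divide_inverse mult.commute)

lemma rat_mat_tendsto:
  assumes "poly Q a \<noteq> 0" shows "(rat_mat Q d P \<longlongrightarrow> rat_mat Q d P a) (at a)"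
  by (rule tendsto_matrixI) (auto simp: rat_mat_nth intro!: tendsto_intros assms)

lemma rat_mat_tendsto_infinity:
  assumes "Q \<noteq> 0" "\<And>k. k \<le> d \<Longrightarrow> degree Q < k \<Longrightarrow> P k = 0"
  shows "(rat_mat Q d P \<longlongrightarrow> rat_mat_inf Q d P) at_infinity"
proof (rule tendsto_matrixI)
  fix i j
  have "degree (coeff_poly d (\<lambda>k. P k $ i $ j)) \<le> degree Q"
    by (rule degree_le) (auto simp: coeff_coeff_poly assms(2))
  from poly_quotient_tendsto[OF assms(1) this]
  show "((\<lambda>\<zeta>. rat_mat Q d P \<zeta> $ i $ j) \<longlongrightarrow> rat_mat_inf Q d P $ i $ j) at_infinity"
    by (auto simp: rat_mat_nth rat_mat_inf_def coeff_coeff_poly divide_inverse mult.commute)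
qed

text \<open>Used at every point of the surface, this turns the pointwise limit \<open>rinf\<close>
  into an explicit section, whose smoothness is then visible.\<close>

lemma rat_mat_limit_infinity:
  assumes "Q \<noteq> 0" "(rat_mat Q d P \<longlongrightarrow> L) at_infinity"
  shows "k \<le> d \<Longrightarrow> degree Q < k \<Longrightarrow> P k = 0" "L = rat_mat_inf Q d P"
proof -
  have lim: "((\<lambda>z. poly (coeff_poly d (\<lambda>k. P k $ i $ j)) z / poly Q z) \<longlongrightarrow> L $ i $ j) at_infinity" for i j
    using tendsto_vec_nth[OF tendsto_vec_nth[OF assms(2)], of i j] by (simp add: rat_mat_nth)
  note q = poly_quotient_limit[OF assms(1) lim]
  show "P k = 0" if "k \<le> d" "degree Q < k"
  proof -
    have "coeff (coeff_poly d (\<lambda>k. P k $ i $ j)) k = 0" for i j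
      using q(1)[of i j] that by (intro coeff_eq_0) simp
    then show ?thesis using that by (simp add: coeff_coeff_poly vec_eq_iff)
  qed
  show "L = rat_mat_inf Q d P"
    using q(2) by (simp add: vec_eq_iff rat_mat_inf_def coeff_coeff_poly divide_inverse mult.commute)
qed

lemma smooth_on_rat_mat:
  assumes "open S" "\<And>k. smooth_on S (P k)"
  shows "smooth_on S (\<lambda>z. rat_mat Q d (\<lambda>k. P k z) \<zeta>)"
  unfolding rat_mat_def
  by (intro smooth_on_bounded_linear[OF assms(1) bounded_bilinear.bounded_linear_right[OF bounded_bilinear_scale_mat]]
      smooth_on_sum assms)

lemma smooth_on_rat_mat_inf:
  assumes "open S" "\<And>k. smooth_on S (P k)"
  shows "smooth_on S (\<lambda>z. rat_mat_inf Q d (\<lambda>k. P k z))"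
  unfolding rat_mat_inf_def
  by (intro smooth_on_bounded_linear[OF assms(1) bounded_bilinear.bounded_linear_right[OF bounded_bilinear_scale_mat]])
    (cases "degree Q \<le> d"; simp add: assms(2))

text \<open>The denominator does not depend on the point of the surface, so differentiation acts on
  the coefficients only. This is why limits in \<zeta> may be exchanged with derivatives along the
  surface.\<close>

lemma pd_rat_mat:
  assumes "\<And>k. P k differentiable (at z)"
  shows "pd (\<lambda>z. rat_mat Q d (\<lambda>k. P k z) \<zeta>) z v = rat_mat Q d (\<lambda>k. pd (P k) z v) \<zeta>"
  unfolding rat_mat_def
  using assms
  by (simp add: pd_bounded_linear[OF bounded_bilinear.bounded_linear_right[OF bounded_bilinear_scale_mat]]
      differentiable_bounded_linear[OF bounded_bilinear.bounded_linear_right[OF bounded_bilinear_scale_mat]]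
      pd_sum differentiable_sum)

lemma pd_rat_mat_inf:
  assumes "\<And>k. P k differentiable (at z)"
  shows "pd (\<lambda>z. rat_mat_inf Q d (\<lambda>k. P k z)) z v = rat_mat_inf Q d (\<lambda>k. pd (P k) z v)"
  unfolding rat_mat_inf_def
  using assms
  by (auto simp: pd_bounded_linear[OF bounded_bilinear.bounded_linear_right[OF bounded_bilinear_scale_mat]])

section \<open>The complex structure\<close>

lemma vec2_eq_iff: "(v :: real^2) = w \<longleftrightarrow> v $ 1 = w $ 1 \<and> v $ 2 = w $ 2"
  by (simp add: vec_eq_iff forall_2)

definition gcoef :: "'m metric \<Rightarrow> 'm chart \<Rightarrow> 'm \<Rightarrow> 2 \<Rightarrow> 2 \<Rightarrow> real" where
  "gcoef g c p i j = g c p (axis i 1) (axis j 1)"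

lemma bilinear_expand:
  assumes "bilinear (b :: real^2 \<Rightarrow> real^2 \<Rightarrow> real)"
  shows "b v w = v$1 * w$1 * b (axis 1 1) (axis 1 1) + v$1 * w$2 * b (axis 1 1) (axis 2 1)
    + v$2 * w$1 * b (axis 2 1) (axis 1 1) + v$2 * w$2 * b (axis 2 1) (axis 2 1)"
proof -
  have "v = v$1 *\<^sub>R axis 1 1 + v$2 *\<^sub>R axis 2 1" "w = w$1 *\<^sub>R axis 1 1 + w$2 *\<^sub>R axis 2 1"
    by (simp_all add: vec2_eq_iff axis_def)
  then have "b v w = b (v$1 *\<^sub>R axis 1 1 + v$2 *\<^sub>R axis 2 1) (w$1 *\<^sub>R axis 1 1 + w$2 *\<^sub>R axis 2 1)"
    by simp
  also have "\<dots> = v$1 * w$1 * b (axis 1 1) (axis 1 1) + v$1 * w$2 * b (axis 1 1) (axis 2 1)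
    + v$2 * w$1 * b (axis 2 1) (axis 1 1) + v$2 * w$2 * b (axis 2 1) (axis 2 1)"
    using assms by (simp add: bilinear_ladd bilinear_radd bilinear_lmul bilinear_rmul algebra_simps)
  finally show ?thesis .
qed

text \<open>The rotation for the first fundamental form E, F, G: the metric dual covector of v,
  turned by a quarter in the coordinate plane and divided by the area density.\<close>

definition rotc :: "real \<Rightarrow> real \<Rightarrow> real \<Rightarrow> real^2 \<Rightarrow> real^2" where
  "rotc E F G v = (\<chi> i. if i = 1 then (- F * v$1 - G * v$2) / sqrt (E * G - F\<^sup>2)
     else (E * v$1 + F * v$2) / sqrt (E * G - F\<^sup>2))"

lemma rotc_nth [simp]:
  "rotc E F G v $ 1 = (- F * v$1 - G * v$2) / sqrt (E * G - F\<^sup>2)"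
  "rotc E F G v $ 2 = (E * v$1 + F * v$2) / sqrt (E * G - F\<^sup>2)"
  by (simp_all add: rotc_def)

text \<open>Multiplication by E permits completing the square.\<close>

lemma quad_form_pos:
  fixes E F G :: real
  assumes "E > 0" "E * G - F\<^sup>2 > 0" "x \<noteq> 0 \<or> y \<noteq> 0"
  shows "E * x\<^sup>2 + 2 * F * x * y + G * y\<^sup>2 > 0"
proof -
  have "E * (E * x\<^sup>2 + 2 * F * x * y + G * y\<^sup>2) = (E * x + F * y)\<^sup>2 + (E * G - F\<^sup>2) * y\<^sup>2"
    by (simp add: power2_eq_square algebra_simps)
  moreover have "(E * x + F * y)\<^sup>2 + (E * G - F\<^sup>2) * y\<^sup>2 > 0"
  proof (cases "y = 0")
    case True
    then show ?thesis using assms by simp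
  next
    case False
    then have "(E * G - F\<^sup>2) * y\<^sup>2 > 0" using assms(2) by simp
    then show ?thesis using zero_le_power2[of "E * x + F * y"] by linarith
  qed
  ultimately have "0 < E * (E * x\<^sup>2 + 2 * F * x * y + G * y\<^sup>2)" by simp
  then show ?thesis using assms(1) by (simp add: zero_less_mult_iff)
qed

text \<open>Orthogonality makes w a multiple t of the turned covector (-b, a), equality of lengths
  gives t^2 (E G - F^2) = 1, and the orientation selects the positive root. Thus the description in
  \<open>rot90\<close> becomes a formula that is linear in v and smooth in the metric.\<close>

lemma rotc_unique:
  fixes E F G :: real
  assumes E: "E > 0" and d: "E * G - F\<^sup>2 > 0"
    and o: "E * v$1 * w$1 + F * (v$1 * w$2 + v$2 * w$1) + G * v$2 * w$2 = 0"
    and n: "E * (w$1)\<^sup>2 + 2 * F * w$1 * w$2 + G * (w$2)\<^sup>2 = E * (v$1)\<^sup>2 + 2 * F * v$1 * v$2 + G * (v$2)\<^sup>2"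
    and c: "v$1 * w$2 - v$2 * w$1 \<ge> 0"
  shows "w = rotc E F G v"
proof (cases "v$1 = 0 \<and> v$2 = 0")
  case True
  then have "w$1 = 0 \<and> w$2 = 0" using quad_form_pos[OF E d, of "w$1" "w$2"] n by auto
  then show ?thesis using True by (simp add: vec2_eq_iff)
next
  case False
  define s where "s = sqrt (E * G - F\<^sup>2)"
  have s: "s > 0" "s\<^sup>2 = E * G - F\<^sup>2" using d by (simp_all add: s_def)
  define a b where "a = E * v$1 + F * v$2" and "b = F * v$1 + G * v$2"
  define qv where "qv = E * (v$1)\<^sup>2 + 2 * F * v$1 * v$2 + G * (v$2)\<^sup>2"
  have q: "qv > 0" using quad_form_pos[OF E d] False by (auto simp: qv_def)
  have qab: "v$1 * a + v$2 * b = qv" by (simp add: a_def b_def qv_def power2_eq_square algebra_simps)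
  have ab: "a * w$1 + b * w$2 = 0" using o by (simp add: a_def b_def algebra_simps)
  have "\<exists>t. w$1 = - t * b \<and> w$2 = t * a"
  proof (cases "a = 0")
    case True
    then have "b \<noteq> 0" using qab q by auto
    then show ?thesis using True ab by (intro exI[of _ "- (w$1) / b"]) simp
  next
    case False
    then show ?thesis using ab by (intro exI[of _ "w$2 / a"]) (simp add: field_simps)
  qed
  then obtain t where t: "w$1 = - t * b" "w$2 = t * a" by blast
  have "E * (w$1)\<^sup>2 + 2 * F * w$1 * w$2 + G * (w$2)\<^sup>2 = t\<^sup>2 * ((E * G - F\<^sup>2) * qv)"
    unfolding t a_def b_def qv_def by (simp add: power2_eq_square algebra_simps)
  then have "(t\<^sup>2 * s\<^sup>2) * qv = qv" using n by (simp add: s(2) qv_def mult.assoc)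
  then have "(t * s)\<^sup>2 = 1" using q by (simp add: power_mult_distrib)
  moreover have "t \<ge> 0"
  proof -
    have "v$1 * w$2 - v$2 * w$1 = t * qv" using qab by (simp add: t qab[symmetric] algebra_simps)
    then show ?thesis using c q by (simp add: zero_le_mult_iff)
  qed
  ultimately have "t * s = 1" using s(1) by (simp add: power2_eq_1_iff)
     (metis less_eq_real_def mult_nonneg_nonneg not_one_le_zero neg_0_le_iff_le)
  then have "t = 1 / s" using s(1) by (simp add: field_simps)
  then show ?thesis unfolding vec2_eq_iff using t by (simp add: a_def b_def s_def[symmetric] algebra_simps diff_divide_distrib add_divide_distrib)
qed

lemma rotc_props:
  fixes E F G :: real and v :: "real^2"
  assumes E: "E > 0" and d: "E * G - F\<^sup>2 > 0"
  defines "w \<equiv> rotc E F G v"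
  shows "E * v$1 * w$1 + F * (v$1 * w$2 + v$2 * w$1) + G * v$2 * w$2 = 0"
    and "E * (w$1)\<^sup>2 + 2 * F * w$1 * w$2 + G * (w$2)\<^sup>2 = E * (v$1)\<^sup>2 + 2 * F * v$1 * v$2 + G * (v$2)\<^sup>2"
    and "v$1 * w$2 - v$2 * w$1 \<ge> 0"
    and "rotc E F G w = - v"
proof -
  define s where "s = sqrt (E * G - F\<^sup>2)"
  have s: "s > 0" "s * s = E * G - F * F" using d by (simp_all add: s_def power2_eq_square)
  have w: "w$1 = (- F * v$1 - G * v$2) / s" "w$2 = (E * v$1 + F * v$2) / s"
    by (simp_all add: w_def s_def)
  show "E * v$1 * w$1 + F * (v$1 * w$2 + v$2 * w$1) + G * v$2 * w$2 = 0"
    unfolding w using s(1) by (simp add: field_simps)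
  have "s * s * (E * (w$1)\<^sup>2 + 2 * F * w$1 * w$2 + G * (w$2)\<^sup>2)
    = E * (- F * v$1 - G * v$2)\<^sup>2 + 2 * F * (- F * v$1 - G * v$2) * (E * v$1 + F * v$2) + G * (E * v$1 + F * v$2)\<^sup>2"
    unfolding w using s(1) by (simp add: field_simps power2_eq_square)
  also have "\<dots> = (E * G - F * F) * (E * (v$1)\<^sup>2 + 2 * F * v$1 * v$2 + G * (v$2)\<^sup>2)"
    by (simp add: power2_eq_square algebra_simps)
  finally show "E * (w$1)\<^sup>2 + 2 * F * w$1 * w$2 + G * (w$2)\<^sup>2 = E * (v$1)\<^sup>2 + 2 * F * v$1 * v$2 + G * (v$2)\<^sup>2"
    unfolding s(2)[symmetric] using s(1) by simp
  have "v$1 * w$2 - v$2 * w$1 = (E * (v$1)\<^sup>2 + 2 * F * v$1 * v$2 + G * (v$2)\<^sup>2) / s"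
    unfolding w using s(1) by (simp add: field_simps power2_eq_square)
  moreover have "E * (v$1)\<^sup>2 + 2 * F * v$1 * v$2 + G * (v$2)\<^sup>2 \<ge> 0"
    using quad_form_pos[OF E d, of "v$1" "v$2"] by (cases "v$1 = 0 \<and> v$2 = 0") auto
  ultimately show "v$1 * w$2 - v$2 * w$1 \<ge> 0" using s(1) by simp
  have "- F * w$1 - G * w$2 = - s * v$1" "E * w$1 + F * w$2 = - s * v$2"
  proof -
    have "(- F * w$1 - G * w$2) * s = - (s * s) * v$1" "(E * w$1 + F * w$2) * s = - (s * s) * v$2"
      unfolding s(2) unfolding w using s(1) by (simp_all add: field_simps)
    then have "(- F * w$1 - G * w$2) * s = (- s * v$1) * s" "(E * w$1 + F * w$2) * s = (- s * v$2) * s"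
      by (simp_all add: mult_ac)
    then show "- F * w$1 - G * w$2 = - s * v$1" "E * w$1 + F * w$2 = - s * v$2"
      using s(1) mult_right_cancel[of s] by blast+
  qed
  then show "rotc E F G w = - v" using s(1) by (simp add: vec2_eq_iff s_def[symmetric])
qed

context
  fixes \<A> :: "'m::{t2_space,second_countable_topology} chart set" and g :: "'m metric"
  assumes g: "riemannian_metric \<A> g"
begin

lemma metric_expand:
  assumes "c \<in> \<A>" "p \<in> fst c"
  shows "g c p v w = gcoef g c p 1 1 * v$1 * w$1 + gcoef g c p 1 2 * (v$1 * w$2 + v$2 * w$1)
    + gcoef g c p 2 2 * v$2 * w$2"
    and "gcoef g c p 1 1 > 0" "gcoef g c p 1 1 * gcoef g c p 2 2 - (gcoef g c p 1 2)\<^sup>2 > 0"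
proof -
  have b: "bilinear (g c p)" and sy: "g c p v w = g c p w v" and pos: "v \<noteq> 0 \<Longrightarrow> g c p v v > 0" for v w
    using g assms unfolding riemannian_metric_def by blast+
  show e: "g c p v w = gcoef g c p 1 1 * v$1 * w$1 + gcoef g c p 1 2 * (v$1 * w$2 + v$2 * w$1)
    + gcoef g c p 2 2 * v$2 * w$2" for v w
    using bilinear_expand[OF b, of v w] sy[of "axis 2 1" "axis 1 1"] by (simp add: gcoef_def algebra_simps)
  show E: "gcoef g c p 1 1 > 0"
    using pos[of "axis 1 1"] by (simp add: gcoef_def)
  \<comment> \<open>On (F, -E) the metric takes the value E (E G - F^2), so positivity yields the
    sign of the determinant.\<close>
  define v :: "real^2" where "v = (\<chi> i. if i = 1 then gcoef g c p 1 2 else - gcoef g c p 1 1)"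
  have "v $ 1 = gcoef g c p 1 2" "v $ 2 = - gcoef g c p 1 1" by (simp_all add: v_def)
  moreover from this have "v \<noteq> 0" using E by (auto simp: vec2_eq_iff)
  ultimately have "0 < gcoef g c p 1 1 * (gcoef g c p 1 1 * gcoef g c p 2 2 - (gcoef g c p 1 2)\<^sup>2)"
    using pos[of v] e[of v v] by (simp add: algebra_simps power2_eq_square)
  then show "gcoef g c p 1 1 * gcoef g c p 2 2 - (gcoef g c p 1 2)\<^sup>2 > 0"
    using E by (simp add: zero_less_mult_iff)
qed

lemma rot90_unique:
  assumes "c \<in> \<A>" "p \<in> fst c"
    and "g c p v w = 0" "g c p w w = g c p v v" "v$1 * w$2 - v$2 * w$1 \<ge> 0"
  shows "w = rotc (gcoef g c p 1 1) (gcoef g c p 1 2) (gcoef g c p 2 2) v"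
  using assms(3-5) metric_expand[OF assms(1,2)]
  by (intro rotc_unique) (auto simp: power2_eq_square algebra_simps)

lemma rot90_eq:
  assumes "c \<in> \<A>" "p \<in> fst c"
  shows "rot90 g c p v = rotc (gcoef g c p 1 1) (gcoef g c p 1 2) (gcoef g c p 2 2) v"
  unfolding rot90_def
proof (rule the_equality)
  let ?w = "rotc (gcoef g c p 1 1) (gcoef g c p 1 2) (gcoef g c p 2 2) v"
  note r = rotc_props[OF metric_expand(2,3)[OF assms], of v]
  show "g c p v ?w = 0 \<and> g c p ?w ?w = g c p v v \<and> 0 \<le> v $ 1 * ?w $ 2 - v $ 2 * ?w $ 1"
    unfolding metric_expand(1)[OF assms] using r(1-3)
    by (simp add: power2_eq_square algebra_simps del: rotc_nth)
qed (use rot90_unique[OF assms] in blast)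

lemma rot90_props:
  assumes "c \<in> \<A>" "p \<in> fst c"
  shows "g c p v (rot90 g c p v) = 0" "g c p (rot90 g c p v) (rot90 g c p v) = g c p v v"
    "v$1 * rot90 g c p v $ 2 - v$2 * rot90 g c p v $ 1 \<ge> 0"
    "rot90 g c p (rot90 g c p v) = - v"
  unfolding rot90_eq[OF assms] metric_expand(1)[OF assms]
  using rotc_props[OF metric_expand(2,3)[OF assms], of v]
  by (simp_all add: power2_eq_square algebra_simps del: rotc_nth)

lemma linear_rot90:
  assumes "c \<in> \<A>" "p \<in> fst c" shows "linear (rot90 g c p)"
  unfolding rot90_eq[OF assms]
  by (rule linearI) (simp_all add: vec2_eq_iff rot90_eq[OF assms] algebra_simps add_divide_distrib diff_divide_distrib)

lemma smooth_rot90: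
  assumes "c \<in> \<A>" "open (snd c ` fst c)"
  shows "smooth_on (snd c ` fst c) (\<lambda>x. rot90 g c (coord_inv c x) v)"
proof -
  let ?U = "snd c ` fst c"
  have sm: "smooth_on ?U (\<lambda>x. gcoef g c (coord_inv c x) i j)" for i j
    using g assms(1) unfolding riemannian_metric_def gcoef_def by blast
  have mem: "coord_inv c x \<in> fst c" if "x \<in> ?U" for x using that by (rule inv_into_into)
  have ne: "sqrt (gcoef g c (coord_inv c x) 1 1 * gcoef g c (coord_inv c x) 2 2 - gcoef g c (coord_inv c x) 1 2 * gcoef g c (coord_inv c x) 1 2) \<noteq> 0"
    and pos: "gcoef g c (coord_inv c x) 1 1 * gcoef g c (coord_inv c x) 2 2 - gcoef g c (coord_inv c x) 1 2 * gcoef g c (coord_inv c x) 1 2 > 0"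
    if "x \<in> ?U" for x
    using metric_expand(3)[OF assms(1) mem[OF that]] by (simp_all add: power2_eq_square)
  have "smooth_on ?U (\<lambda>x. rotc (gcoef g c (coord_inv c x) 1 1) (gcoef g c (coord_inv c x) 1 2) (gcoef g c (coord_inv c x) 2 2) v)"
  proof (rule smooth_on_vec[OF assms(2)])
    fix i
    show "smooth_on ?U (\<lambda>x. rotc (gcoef g c (coord_inv c x) 1 1) (gcoef g c (coord_inv c x) 1 2) (gcoef g c (coord_inv c x) 2 2) v $ i)"
    proof (cases "i = 1")
      case True
      then show ?thesis unfolding True rotc_nth power2_eq_square
        by (intro smooth_on_divide smooth_on_diff smooth_on_add smooth_on_mult smooth_on_uminus smooth_on_sqrt sm smooth_on_const assms(2) pos ne)
    next
      case False
      then have i2: "i = 2" using exhaust_2 by blast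
      show ?thesis unfolding i2 rotc_nth power2_eq_square
        by (intro smooth_on_divide smooth_on_diff smooth_on_add smooth_on_mult smooth_on_uminus smooth_on_sqrt sm smooth_on_const assms(2) pos ne)
    qed
  qed
  then show ?thesis
    by (rule smooth_on_cong[OF assms(2), rotated]) (simp add: rot90_eq[OF assms(1) mem])
qed

text \<open>The differential of a transition map is an isometry of positive determinant, and such a
  map respects the orthogonality, length and orientation by which the rotated vector is
  characterised.\<close>

lemma rot90_transition:
  assumes A: "oriented_surface \<A>" and c: "c \<in> \<A>" "c' \<in> \<A>" "p \<in> fst c \<inter> fst c'"
  shows "transition_deriv c c' p (rot90 g c p v) = rot90 g c' p (transition_deriv c c' p v)"
proof -
  let ?T = "transition_deriv c c' p"
  have p: "p \<in> fst c" "p \<in> fst c'" using c by auto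
  have op: "open (fst c)" "open (fst c')" "homeomorphism (fst c) (snd c ` fst c) (snd c) (coord_inv c)" "open (snd c ` fst c)"
    and sm: "smooth_on (snd c ` (fst c \<inter> fst c')) (transition c c')" and det: "det (matrix ?T) > 0"
    using A c unfolding oriented_surface_def by blast+
  have "openin (top_of_set (snd c ` fst c)) (snd c ` (fst c \<inter> fst c'))"
    by (rule homeomorphism_imp_open_map[OF op(3)]) (auto simp: openin_open_Int op(2))
  then have "open (snd c ` (fst c \<inter> fst c'))" using op(4) openin_open_trans by blast
  then have "transition c c' differentiable (at (snd c p))"
    using smooth_on_differentiable[OF _ sm] c(3) by blast
  then have lin: "linear ?T" unfolding transition_deriv_def by (rule linear_pd)
  have iso: "g c p v w = g c' p (?T v) (?T w)" for v w
    using g c unfolding riemannian_metric_def by blast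
  have cross: "?T v $ 1 * ?T w $ 2 - ?T v $ 2 * ?T w $ 1 = det (matrix ?T) * (v$1 * w$2 - v$2 * w$1)" for v w
  proof -
    have e: "?T x = matrix ?T *v x" for x using matrix_vector_mul(2)[OF lin] by metis
    show ?thesis unfolding e[of v] e[of w] det_2 by (simp add: matrix_vector_mult_def sum_2 algebra_simps)
  qed
  note r = rot90_props[OF c(1) p(1), of v]
  have "?T (rot90 g c p v) = rotc (gcoef g c' p 1 1) (gcoef g c' p 1 2) (gcoef g c' p 2 2) (?T v)"
  proof (rule rot90_unique[OF c(2) p(2)])
    show "g c' p (?T v) (?T (rot90 g c p v)) = 0" using r(1) iso by simp
    show "g c' p (?T (rot90 g c p v)) (?T (rot90 g c p v)) = g c' p (?T v) (?T v)" using r(2) iso by simp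
    show "0 \<le> ?T v $ 1 * ?T (rot90 g c p v) $ 2 - ?T v $ 2 * ?T (rot90 g c p v) $ 1"
      unfolding cross using r(3) det by simp
  qed
  then show ?thesis unfolding rot90_eq[OF c(2) p(2)] .
qed

end

section \<open>Curvature and gauge transformations\<close>

lemma lie_add: "lie (X + X') Y = lie X Y + lie X' Y" "lie X (Y + Y') = lie X Y + lie X Y'"
  by (simp_all add: lie_def matrix_ring_simps)

lemma lie_minus: "lie (- X) Y = - lie X Y" "lie X (- Y) = - lie X Y"
  by (simp_all add: lie_def matrix_ring_simps)

lemma lie_scale: "lie (a \<odot> X) Y = a \<odot> lie X Y" "lie X (a \<odot> Y) = a \<odot> lie X Y"
  by (simp_all add: lie_def matrix_ring_simps scale_mat_diff)

lemma lie_commute: "lie X Y = - lie Y X"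
  by (simp add: lie_def)

lemma lie_self [simp]: "lie X X = 0" "lie 0 X = 0" "lie X 0 = 0"
  by (simp_all add: lie_def)

lemmas lie_simps = lie_add lie_minus lie_scale

lemma bounded_linear_scale_mat: "bounded_linear (\<lambda>X. a \<odot> X)"
  by (rule bounded_bilinear.bounded_linear_right[OF bounded_bilinear_scale_mat])

lemma differentiable_scale_mat: "f differentiable (at z) \<Longrightarrow> (\<lambda>y. a \<odot> f y) differentiable (at z)"
  by (rule differentiable_bounded_linear[OF bounded_linear_scale_mat])

lemma pd_scale_mat: "f differentiable (at z) \<Longrightarrow> pd (\<lambda>y. a \<odot> f y) z v = a \<odot> pd f z v"
  by (rule pd_bounded_linear[OF bounded_linear_scale_mat])

lemma differentiable_matrix_mult:
  "f differentiable (at z) \<Longrightarrow> g differentiable (at z) \<Longrightarrow> (\<lambda>y. (f y :: 'k::finite cmat) ** (g y :: 'k cmat)) differentiable (at z)"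
  by (rule differentiable_bilinear[OF bounded_bilinear_matrix_mult])

lemma pd_matrix_mult:
  "f differentiable (at z) \<Longrightarrow> g differentiable (at z) \<Longrightarrow>
    pd (\<lambda>y. (f y :: 'k::finite cmat) ** (g y :: 'k cmat)) z v = f z ** pd g z v + pd f z v ** g z"
  by (rule pd_bilinear[OF bounded_bilinear_matrix_mult])

lemma differentiable_matrix_vector:
  "f differentiable (at z) \<Longrightarrow> g differentiable (at z) \<Longrightarrow> (\<lambda>y. (f y :: 'k::finite cmat) *v g y) differentiable (at z)"
  by (rule differentiable_bilinear[OF bounded_bilinear_matrix_vector])

lemma pd_matrix_vector:
  "f differentiable (at z) \<Longrightarrow> g differentiable (at z) \<Longrightarrow>
    pd (\<lambda>y. (f y :: 'k::finite cmat) *v g y) z v = f z *v pd g z v + pd f z v *v g z"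
  by (rule pd_bilinear[OF bounded_bilinear_matrix_vector])

lemma smooth_on_matrix_mult:
  "open S \<Longrightarrow> smooth_on S f \<Longrightarrow> smooth_on S g \<Longrightarrow> smooth_on S (\<lambda>y. (f y :: 'k::finite cmat) ** (g y :: 'k cmat))"
  by (rule smooth_on_bilinear[OF _ bounded_bilinear_matrix_mult])

lemma smooth_on_scale_mat: "open S \<Longrightarrow> smooth_on S f \<Longrightarrow> smooth_on S (\<lambda>y. a \<odot> f y)"
  by (rule smooth_on_bounded_linear[OF _ bounded_linear_scale_mat])

lemma smooth_on_mink:
  "open S \<Longrightarrow> smooth_on S f \<Longrightarrow> smooth_on S g \<Longrightarrow> smooth_on S (\<lambda>y. mink (f y) (g y :: 'k::finite cvec))"
  by (rule smooth_on_bilinear[OF _ bounded_bilinear_mink])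

text \<open>This is N_V when \<rho> is the reflection in V, as \<open>form_N_nform\<close> shows. In
  this shape its properties follow from \<rho>^2 = 1 alone.\<close>

definition nform :: "(real^2 \<Rightarrow> 'k::finite cmat) \<Rightarrow> real^2 \<Rightarrow> real^2 \<Rightarrow> 'k cmat" where
  "nform \<rho> z v = (- 1/2) \<odot> (\<rho> z ** pd \<rho> z v)"

lemma involution_pd:
  fixes \<rho> :: "real^2 \<Rightarrow> 'k::finite cmat"
  assumes "open U" "z \<in> U" "\<And>y. y \<in> U \<Longrightarrow> \<rho> y ** \<rho> y = mat 1" "\<rho> differentiable (at z)"
  shows "pd \<rho> z v ** \<rho> z = - (\<rho> z ** pd \<rho> z v)"
proof -
  have "pd (\<lambda>y. \<rho> y ** \<rho> y) z v = pd (\<lambda>y. mat 1) z v"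
    using assms by (intro pd_cong[of U]) auto
  then have "\<rho> z ** pd \<rho> z v + pd \<rho> z v ** \<rho> z = 0"
    by (simp add: pd_matrix_mult[OF assms(4,4)])
  then show ?thesis by (simp add: eq_neg_iff_add_eq_0 add.commute)
qed

context
  fixes U :: "(real^2) set" and \<rho> :: "real^2 \<Rightarrow> 'k::finite cmat"
  assumes U: "open U" and \<rho>: "smooth_on U \<rho>" and inv: "\<And>y. y \<in> U \<Longrightarrow> \<rho> y ** \<rho> y = mat 1"
begin

lemma rho_differentiable: "z \<in> U \<Longrightarrow> \<rho> differentiable (at z)"
  by (rule smooth_on_differentiable[OF U \<rho>])

lemma rho_pd: "z \<in> U \<Longrightarrow> pd \<rho> z v ** \<rho> z = - (\<rho> z ** pd \<rho> z v)"
  by (rule involution_pd[OF U _ inv rho_differentiable])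

lemma smooth_nform: "smooth_on U (\<lambda>z. nform \<rho> z v)"
  unfolding nform_def by (intro smooth_on_scale_mat smooth_on_matrix_mult smooth_on_pd \<rho> U)

lemma linear_nform: "z \<in> U \<Longrightarrow> linear (nform \<rho> z)"
  using linear_pd[OF rho_differentiable, of z]
  by (intro linearI) (simp_all add: nform_def linear_add linear_cmul matrix_ring_simps scale_mat_add
      scaleR_eq_scale_mat scale_mat_scale mult.commute)

lemma rho_rho_mult: "z \<in> U \<Longrightarrow> \<rho> z ** (\<rho> z ** X) = X"
  by (simp add: matrix_mul_assoc inv)

lemma nform_nform:
  assumes "z \<in> U"
  shows "nform \<rho> z v ** nform \<rho> z w = (- 1/4) \<odot> (pd \<rho> z v ** pd \<rho> z w)"
proof -
  have "(\<rho> z ** pd \<rho> z v) ** (\<rho> z ** pd \<rho> z w) = \<rho> z ** (pd \<rho> z v ** \<rho> z) ** pd \<rho> z w"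
    by (simp add: matrix_mul_assoc)
  also have "\<dots> = - (\<rho> z ** (\<rho> z ** pd \<rho> z v) ** pd \<rho> z w)"
    by (simp add: rho_pd[OF assms] matrix_ring_simps)
  also have "\<dots> = - (pd \<rho> z v ** pd \<rho> z w)" by (simp add: rho_rho_mult[OF assms])
  finally show ?thesis
    by (simp add: nform_def scale_mat_mult_left scale_mat_mult_right scale_mat_scale scale_mat_minus vec_eq_iff)
qed

text \<open>The second derivatives of \<rho> are symmetric and cancel; the commutator of first
  derivatives that remains is rewritten by \<open>nform_nform\<close>. The Gauss and the Codazzi
  equation of V are both read off from this identity.\<close>

lemma nform_codazzi:
  assumes "z \<in> U"
  shows "pd (\<lambda>y. nform \<rho> y w) z v - pd (\<lambda>y. nform \<rho> y v) z w
    = 2 \<odot> lie (nform \<rho> z v) (nform \<rho> z w)"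
proof -
  have d: "pd (\<lambda>y. nform \<rho> y w) z v = (- 1/2) \<odot> (\<rho> z ** pd (\<lambda>y. pd \<rho> y w) z v + pd \<rho> z v ** pd \<rho> z w)" for v w
  proof -
    have "(\<lambda>y. pd \<rho> y w) differentiable (at z)"
      by (rule smooth_on_differentiable[OF U smooth_on_pd[OF \<rho>] assms])
    then show ?thesis unfolding nform_def
      by (simp add: pd_scale_mat pd_matrix_mult rho_differentiable[OF assms] differentiable_matrix_mult)
  qed
  have comm: "pd (\<lambda>y. pd \<rho> y w) z v = pd (\<lambda>y. pd \<rho> y v) z w"
    by (rule pd_pd_commute[OF U \<rho> assms])
  show ?thesis
    unfolding d lie_def nform_nform[OF assms] comm by (simp add: vec_eq_iff field_simps)
qed


end

section \<open>Curvature of a connection form\<close>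

definition curv :: "(real^2 \<Rightarrow> real^2 \<Rightarrow> 'k::finite cmat) \<Rightarrow> real^2 \<Rightarrow> real^2 \<Rightarrow> real^2 \<Rightarrow> 'k cmat" where
  "curv \<Gamma> z v w = pd (\<lambda>y. \<Gamma> y w) z v - pd (\<lambda>y. \<Gamma> y v) z w + lie (\<Gamma> z v) (\<Gamma> z w)"

lemma curv_cong:
  assumes "open U" "z \<in> U" "\<And>y v. y \<in> U \<Longrightarrow> \<Gamma> y v = \<Gamma>' y v"
  shows "curv \<Gamma> z v w = curv \<Gamma>' z v w"
  using assms(2,3) pd_cong[OF assms(1,2), of "\<lambda>y. \<Gamma> y w" "\<lambda>y. \<Gamma>' y w"] pd_cong[OF assms(1,2), of "\<lambda>y. \<Gamma> y v" "\<lambda>y. \<Gamma>' y v"]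
  by (simp add: curv_def)

text \<open>The inverse T is kept as a map of its own because the gauged form contains its
  derivative. Differentiating S T = 1 eliminates the derivative of S, and the second derivatives of
  T cancel by symmetry.\<close>

lemma curv_gauge:
  fixes S T :: "real^2 \<Rightarrow> 'k::finite cmat"
  assumes U: "open U" and z: "z \<in> U" and S: "smooth_on U S" and T: "smooth_on U T"
    and ST: "\<And>y. y \<in> U \<Longrightarrow> S y ** T y = mat 1" "\<And>y. y \<in> U \<Longrightarrow> T y ** S y = mat 1"
    and \<Gamma>: "\<And>v. (\<lambda>y. \<Gamma> y v) differentiable (at z)"
  shows "curv (\<lambda>y v. S y ** \<Gamma> y v ** T y + S y ** pd T y v) z v w = S z ** curv \<Gamma> z v w ** T z"
proof -
  have dS: "S differentiable (at z)" and dT: "T differentiable (at z)"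
    and dT': "(\<lambda>y. pd T y v) differentiable (at z)" for v
    using smooth_on_differentiable[OF U _ z] S T smooth_on_pd by blast+
  have pdS: "pd S z v = - (S z ** pd T z v ** S z)" for v
  proof -
    have "pd (\<lambda>y. S y ** T y) z v = pd (\<lambda>y. mat 1) z v"
      using ST by (intro pd_cong[OF U z]) auto
    then have e: "S z ** pd T z v + pd S z v ** T z = 0" by (simp add: pd_matrix_mult[OF dS dT])
    then have "(S z ** pd T z v + pd S z v ** T z) ** S z = 0" by simp
    then have "S z ** pd T z v ** S z + pd S z v ** (T z ** S z) = 0"
      by (simp add: matrix_ring_simps)
    then show ?thesis using ST(2)[OF z] by (simp add: eq_neg_iff_add_eq_0 add.commute)
  qed
  have d: "pd (\<lambda>y. S y ** \<Gamma> y w ** T y + S y ** pd T y w) z v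
    = S z ** \<Gamma> z w ** pd T z v + (S z ** pd (\<lambda>y. \<Gamma> y w) z v + pd S z v ** \<Gamma> z w) ** T z
      + (S z ** pd (\<lambda>y. pd T y w) z v + pd S z v ** pd T z w)" for v w
    by (simp add: pd_add pd_matrix_mult differentiable_matrix_mult differentiable_add dS dT dT' \<Gamma>)
  have comm: "pd (\<lambda>y. pd T y w) z v = pd (\<lambda>y. pd T y v) z w"
    by (rule pd_pd_commute[OF U T z])
  have c1: "X ** T z ** S z = X" for X using ST(2)[OF z] by (metis matrix_mul_assoc matrix_mul_rid)
  show ?thesis
    unfolding curv_def d comm pdS lie_def
    by (simp add: matrix_ring_simps c1 algebra_simps)
qed

definition wb :: "(real^2 \<Rightarrow> 'k::finite cmat) \<Rightarrow> (real^2 \<Rightarrow> 'k cmat) \<Rightarrow> real^2 \<Rightarrow> real^2 \<Rightarrow> 'k cmat" where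
  "wb \<alpha> \<beta> v w = lie (\<alpha> v) (\<beta> w) - lie (\<alpha> w) (\<beta> v)"

definition extd :: "(real^2 \<Rightarrow> real^2 \<Rightarrow> 'k::finite cmat) \<Rightarrow> (real^2 \<Rightarrow> real^2 \<Rightarrow> 'k cmat) \<Rightarrow> real^2 \<Rightarrow> real^2 \<Rightarrow> real^2 \<Rightarrow> 'k cmat" where
  "extd \<Theta> \<omega> z v w = pd (\<lambda>y. \<omega> y w) z v - pd (\<lambda>y. \<omega> y v) z w + wb (\<Theta> z) (\<omega> z) v w"

text \<open>A real eigenvalue x of J would satisfy x^2 = -1, so v and J v are independent and form a
  basis of the plane.\<close>

lemma almost_complex_span:
  fixes J :: "real^2 \<Rightarrow> real^2"
  assumes J: "linear J" "\<And>v. J (J v) = - v" and v: "v \<noteq> 0"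
  shows "\<exists>x y. w = x *\<^sub>R v + y *\<^sub>R J v"
proof -
  define D where "D = v$1 * J v $ 2 - v$2 * J v $ 1"
  have "D \<noteq> 0"
  proof
    assume "D = 0"
    then have e: "v$1 * J v $ 2 = v$2 * J v $ 1" by (simp add: D_def)
    have "\<exists>x. J v = x *\<^sub>R v"
    proof (cases "v $ 1 = 0")
      case True
      then have "v $ 2 \<noteq> 0" using v by (auto simp: vec_eq_iff forall_2)
      then show ?thesis using e True by (intro exI[of _ "J v $ 2 / v $ 2"]) (auto simp: vec_eq_iff forall_2)
    next
      case False
      then show ?thesis using e by (intro exI[of _ "J v $ 1 / v $ 1"]) (auto simp: vec_eq_iff forall_2 field_simps)
    qed
    then obtain x where x: "J v = x *\<^sub>R v" ..
    then have "- v = x *\<^sub>R x *\<^sub>R v" using J(2)[of v] linear_cmul[OF J(1)] by metis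
    then have "(x * x) *\<^sub>R v + v = 0" by (metis add.left_inverse add.commute scaleR_scaleR)
    then have "(x * x + 1) *\<^sub>R v = 0" by (simp add: algebra_simps)
    then have "x * x + 1 = 0" using v by simp
    then show False using zero_le_square[of x] by linarith
  qed
  then have "w = ((w$1 * J v $ 2 - w$2 * J v $ 1) / D) *\<^sub>R v + ((v$1 * w$2 - v$2 * w$1) / D) *\<^sub>R J v"
    by (simp add: vec_eq_iff forall_2 field_simps) (simp add: D_def algebra_simps)
  then show ?thesis by blast
qed

text \<open>On a surface a form of pure type is determined by one value: \<alpha> (J v) is a
  multiple of \<alpha> v, so all values at the point are proportional and commute.\<close>

lemma typed_form_lie:
  fixes J :: "real^2 \<Rightarrow> real^2"
  assumes J: "linear J" "\<And>v. J (J v) = - v" and \<alpha>: "linear \<alpha>" "\<And>v. \<alpha> (J v) = \<iota> \<odot> \<alpha> v"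
  shows "lie (\<alpha> v) (\<alpha> w) = 0"
proof (cases "v = 0")
  case True
  then show ?thesis using linear_0[OF \<alpha>(1)] by simp
next
  case False
  then obtain x y where w: "w = x *\<^sub>R v + y *\<^sub>R J v" using almost_complex_span[OF J] by blast
  have "\<alpha> w = x *\<^sub>R \<alpha> v + y *\<^sub>R (\<iota> \<odot> \<alpha> v)"
    unfolding w using \<alpha> by (simp add: linear_add linear_cmul)
  then show ?thesis by (simp add: lie_simps scaleR_eq_scale_mat)
qed

text \<open>Brackets within one type vanish, so only mixed brackets survive. Their coefficients,
  products of an \<zeta>^-1-term and an \<zeta>-term, are combinations of the same functions 1,
  \<zeta>^-1, \<zeta>, \<zeta>^-2 - 1 and \<zeta>^2 - 1; collecting them produces the harmonicity
  equations as coefficients.\<close>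

lemma curv_lambda:
  fixes J :: "real^2 \<Rightarrow> real^2" and n m a b :: "real^2 \<Rightarrow> real^2 \<Rightarrow> 'k::finite cmat"
  assumes J: "linear J" "\<And>v. J (J v) = - v"
    and lin: "linear (n z)" "linear (m z)" "linear (a z)" "linear (b z)"
    and type: "\<And>v. n z (J v) = \<iota> \<odot> n z v" "\<And>v. a z (J v) = \<iota> \<odot> a z v"
      "\<And>v. m z (J v) = \<kappa> \<odot> m z v" "\<And>v. b z (J v) = \<kappa> \<odot> b z v"
    and diff: "\<And>v. (\<lambda>y. n y v) differentiable (at z)" "\<And>v. (\<lambda>y. m y v) differentiable (at z)"
      "\<And>v. (\<lambda>y. a y v) differentiable (at z)" "\<And>v. (\<lambda>y. b y v) differentiable (at z)"
      "\<And>v. (\<lambda>y. \<Theta> y v) differentiable (at z)"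
    and \<zeta>: "\<zeta> \<noteq> 0"
  shows "curv (\<lambda>y v. \<Theta> y v + (inverse \<zeta> \<odot> n y v + \<zeta> \<odot> m y v
        + (inverse (\<zeta>\<^sup>2) - 1) \<odot> a y v + (\<zeta>\<^sup>2 - 1) \<odot> b y v)) z v w
    = (curv \<Theta> z v w + wb (n z) (m z) v w)
      + inverse \<zeta> \<odot> (extd \<Theta> n z v w - wb (n z) (b z) v w + wb (a z) (m z) v w)
      + \<zeta> \<odot> (extd \<Theta> m z v w + wb (n z) (b z) v w - wb (a z) (m z) v w)
      + (inverse (\<zeta>\<^sup>2) - 1) \<odot> (extd \<Theta> a z v w - wb (a z) (b z) v w)
      + (\<zeta>\<^sup>2 - 1) \<odot> (extd \<Theta> b z v w - wb (a z) (b z) v w)"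
proof -
  define l where "l = inverse \<zeta>"
  have l: "l * \<zeta> = 1" "inverse (\<zeta>\<^sup>2) = l\<^sup>2" using \<zeta> by (simp_all add: l_def power_inverse)
  define A where "A v = l \<odot> n z v + (l\<^sup>2 - 1) \<odot> a z v" for v
  define B where "B v = \<zeta> \<odot> m z v + (\<zeta>\<^sup>2 - 1) \<odot> b z v" for v
  have lA: "linear A" unfolding A_def
    by (rule linearI) (simp_all add: linear_add[OF lin(1)] linear_add[OF lin(3)] linear_cmul[OF lin(1)]
        linear_cmul[OF lin(3)] scale_mat_add scaleR_eq_scale_mat scale_mat_scale mult.commute)
  have lB: "linear B" unfolding B_def
    by (rule linearI) (simp_all add: linear_add[OF lin(2)] linear_add[OF lin(4)] linear_cmul[OF lin(2)]
        linear_cmul[OF lin(4)] scale_mat_add scaleR_eq_scale_mat scale_mat_scale mult.commute)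
  have AA: "lie (A v) (A w) = 0"
    by (rule typed_form_lie[OF J lA, where \<iota> = \<iota>])
      (simp add: A_def type scale_mat_scale scale_mat_add mult.commute)
  have BB: "lie (B v) (B w) = 0"
    by (rule typed_form_lie[OF J lB, where \<iota> = \<kappa>])
      (simp add: B_def type scale_mat_scale scale_mat_add mult.commute)
  have G: "\<Theta> z v + (l \<odot> n z v + \<zeta> \<odot> m z v + (l\<^sup>2 - 1) \<odot> a z v + (\<zeta>\<^sup>2 - 1) \<odot> b z v) = \<Theta> z v + (A v + B v)" for v
    by (simp add: A_def B_def)
  have "lie (A v + B v) (A w + B w) = wb A B v w"
    using AA BB lie_commute[of "B v" "A w"] by (simp add: lie_simps wb_def)
  also have "\<dots> = (l * \<zeta>) \<odot> wb (n z) (m z) v w + (l * (\<zeta>\<^sup>2 - 1)) \<odot> wb (n z) (b z) v w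
      + ((l\<^sup>2 - 1) * \<zeta>) \<odot> wb (a z) (m z) v w + ((l\<^sup>2 - 1) * (\<zeta>\<^sup>2 - 1)) \<odot> wb (a z) (b z) v w"
    by (simp add: wb_def A_def B_def lie_simps vec_eq_iff algebra_simps)
  also have "l * (\<zeta>\<^sup>2 - 1) = \<zeta> - l" using l(1) by (simp add: power2_eq_square algebra_simps)
  also have "(l\<^sup>2 - 1) * \<zeta> = l - \<zeta>" using l(1) by (simp add: power2_eq_square algebra_simps)
  also have "(l\<^sup>2 - 1) * (\<zeta>\<^sup>2 - 1) = - (l\<^sup>2 - 1) - (\<zeta>\<^sup>2 - 1)"
  proof -
    have "l\<^sup>2 * \<zeta>\<^sup>2 = 1" using l(1) by (metis power_mult_distrib power_one)
    then show ?thesis by (simp add: algebra_simps)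
  qed
  finally have AB: "lie (A v + B v) (A w + B w) = wb (n z) (m z) v w + (\<zeta> - l) \<odot> wb (n z) (b z) v w
      + (l - \<zeta>) \<odot> wb (a z) (m z) v w + (- (l\<^sup>2 - 1) - (\<zeta>\<^sup>2 - 1)) \<odot> wb (a z) (b z) v w"
    by (simp add: l(1))
  have P: "pd (\<lambda>y. \<Theta> y w + (l \<odot> n y w + \<zeta> \<odot> m y w + (l\<^sup>2 - 1) \<odot> a y w + (\<zeta>\<^sup>2 - 1) \<odot> b y w)) z v
    = pd (\<lambda>y. \<Theta> y w) z v + (l \<odot> pd (\<lambda>y. n y w) z v + \<zeta> \<odot> pd (\<lambda>y. m y w) z v
      + (l\<^sup>2 - 1) \<odot> pd (\<lambda>y. a y w) z v + (\<zeta>\<^sup>2 - 1) \<odot> pd (\<lambda>y. b y w) z v)" for v w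
    by (simp add: pd_add pd_scale_mat differentiable_add differentiable_scale_mat diff)
  have mixed: "lie (\<Theta> z v) (A w + B w) + lie (A v + B v) (\<Theta> z w)
    = l \<odot> wb (\<Theta> z) (n z) v w + \<zeta> \<odot> wb (\<Theta> z) (m z) v w + (l\<^sup>2 - 1) \<odot> wb (\<Theta> z) (a z) v w + (\<zeta>\<^sup>2 - 1) \<odot> wb (\<Theta> z) (b z) v w"
    unfolding A_def B_def wb_def lie_simps lie_commute[of _ "\<Theta> z w"]
    by (simp add: vec_eq_iff algebra_simps)
  have "lie (\<Theta> z v + (A v + B v)) (\<Theta> z w + (A w + B w)) = lie (\<Theta> z v) (\<Theta> z w)
    + (lie (\<Theta> z v) (A w + B w) + lie (A v + B v) (\<Theta> z w)) + lie (A v + B v) (A w + B w)"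
    by (simp add: lie_simps)
  then show ?thesis
    unfolding l(2) l_def[symmetric] unfolding curv_def P G mixed AB
    by (simp add: extd_def vec_eq_iff algebra_simps)
qed

section \<open>Surfaces and bundles\<close>

lemma Ck_on_local:
  assumes "open S" "\<And>z. z \<in> S \<Longrightarrow> \<exists>T. open T \<and> z \<in> T \<and> Ck_on k T f"
  shows "Ck_on k S f"
  using assms(2)
proof (induction k arbitrary: f)
  case 0
  have "isCont f z" if "z \<in> S" for z
    using 0[OF that] continuous_on_eq_continuous_at by auto
  then show ?case by (simp add: continuous_at_imp_continuous_on)
next
  case (Suc k)
  have "f differentiable (at z)" if "z \<in> S" for z
    using Suc.prems[OF that] differentiable_on_eq_differentiable_at by auto
  moreover have "Ck_on k S (\<lambda>z. pd f z v)" for v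
    by (rule Suc.IH) (use Suc.prems in fastforce)
  ultimately show ?case by (simp add: differentiable_on_eq_differentiable_at[OF assms(1)])
qed

lemma smooth_on_local:
  assumes "open S" "\<And>z. z \<in> S \<Longrightarrow> \<exists>T. open T \<and> z \<in> T \<and> smooth_on T f"
  shows "smooth_on S f"
  unfolding smooth_on_def
  by (intro allI Ck_on_local[OF assms(1)]) (use assms(2) smooth_on_def in blast)

text \<open>The (1,0)-part for \<iota> = \<i> and the (0,1)-part for \<iota> = -\<i>; the parameter
  lets both types share their lemmas.\<close>

definition typed_part :: "(complex \<Rightarrow> 'b \<Rightarrow> 'b::ab_group_add) \<Rightarrow> complex \<Rightarrow> (real^2 \<Rightarrow> real^2) \<Rightarrow> (real^2 \<Rightarrow> 'b) \<Rightarrow> real^2 \<Rightarrow> 'b" where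
  "typed_part sc \<iota> J \<omega> v = sc (1/2) (\<omega> v - sc \<iota> (\<omega> (J v)))"

abbreviation "typm \<equiv> typed_part (\<lambda>a (X :: 'k::finite cmat). a \<odot> X)"
abbreviation "typv \<equiv> typed_part (\<lambda>a (x :: 'k::finite cvec). a *s x)"

lemma part10_typ: "part10 sc g \<omega> c p v = typed_part sc \<i> (rot90 g c p) (\<omega> c p) v"
  by (simp add: part10_def typed_part_def)

lemma part01m_typ: "part01m g \<omega> c p v = typm (- \<i>) (rot90 g c p) (\<omega> c p) v"
  by (simp add: part01_def typed_part_def vec_eq_iff)

lemma part01v_typ: "part01v g \<omega> c p v = typv (- \<i>) (rot90 g c p) (\<omega> c p) v"
  by (simp add: part01_def typed_part_def vec_eq_iff)

lemma typm_sum: "typm \<i> J \<omega> v + typm (- \<i>) J \<omega> v = \<omega> v"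
  by (simp add: typed_part_def vec_eq_iff field_simps)

lemma typm_J:
  assumes "\<iota> * \<iota> = - 1" "linear \<omega>" "\<And>v. J (J v) = - v"
  shows "typm \<iota> J \<omega> (J v) = \<iota> \<odot> typm \<iota> J \<omega> v"
proof -
  have e: "\<iota> * (h * (x - \<iota> * y)) = h * (y + \<iota> * x)" for h x y
    using assms(1) by algebra
  have "typm \<iota> J \<omega> (J v) = (1/2) \<odot> (\<omega> (J v) + \<iota> \<odot> \<omega> v)"
    by (simp add: typed_part_def assms(3) linear_neg[OF assms(2)] scale_mat_minus)
  also have "\<dots> = \<iota> \<odot> typm \<iota> J \<omega> v"
  proof -
    have "((1/2) \<odot> (\<omega> (J v) + \<iota> \<odot> \<omega> v)) $ i $ j = (\<iota> \<odot> typm \<iota> J \<omega> v) $ i $ j" for i j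
      using e[of "1/2" "\<omega> v $ i $ j" "\<omega> (J v) $ i $ j"] by (simp add: typed_part_def del: times_divide_eq_left)
    then show ?thesis unfolding vec_eq_iff by blast
  qed
  finally show ?thesis .
qed

lemma typm_same:
  assumes "\<iota> * \<iota> = - 1" "\<omega> (J v) = \<iota> \<odot> \<omega> v"
  shows "typm \<iota> J \<omega> v = \<omega> v" "typm (- \<iota>) J \<omega> v = 0"
proof -
  have "\<iota> * (\<iota> * x) = - x" for x using assms(1) by (simp add: mult.assoc[symmetric])
  then show "typm \<iota> J \<omega> v = \<omega> v" "typm (- \<iota>) J \<omega> v = 0"
    by (simp_all add: typed_part_def assms(2) vec_eq_iff)
qed

lemma typm_add: "typm \<iota> J (\<lambda>v. \<alpha> v + \<beta> v) v = typm \<iota> J \<alpha> v + typm \<iota> J \<beta> v"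
  by (simp add: typed_part_def vec_eq_iff algebra_simps)

lemma typm_minus: "typm \<iota> J (\<lambda>v. - \<alpha> v) v = - typm \<iota> J \<alpha> v"
  by (simp add: typed_part_def vec_eq_iff algebra_simps)

lemma typm_diff: "typm \<iota> J (\<lambda>v. \<alpha> v - \<beta> v) v = typm \<iota> J \<alpha> v - typm \<iota> J \<beta> v"
  by (simp add: typed_part_def vec_eq_iff algebra_simps)

lemma typm_scale: "typm \<iota> J (\<lambda>v. a \<odot> \<alpha> v) v = a \<odot> typm \<iota> J \<alpha> v"
  by (simp add: typed_part_def vec_eq_iff algebra_simps)

lemma typm_mult: "typm \<iota> J (\<lambda>v. X ** \<alpha> v ** Y) v = (X :: 'k::finite cmat) ** typm \<iota> J \<alpha> v ** (Y :: 'k cmat)"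
  by (simp add: typed_part_def matrix_ring_simps scale_mat_diff scale_mat_scale)

lemma linear_typm:
  assumes "linear \<omega>" "linear J" shows "linear (typm \<iota> J \<omega>)"
  by (rule linearI)
    (simp_all add: typed_part_def linear_add[OF assms(1)] linear_add[OF assms(2)] linear_cmul[OF assms(1)]
      linear_cmul[OF assms(2)] vec_eq_iff scaleR_conv_of_real[where 'a = complex] algebra_simps)

section \<open>Charts, smooth maps and subbundles of the surface\<close>

locale surface =
  fixes \<A> :: "'m::{t2_space,second_countable_topology} chart set" and g :: "'m metric"
  assumes oriented: "oriented_surface \<A>" and metric: "riemannian_metric \<A> g"
begin

lemma chart_open: "c \<in> \<A> \<Longrightarrow> open (fst c)" "c \<in> \<A> \<Longrightarrow> open (snd c ` fst c)"
  using oriented unfolding oriented_surface_def by blast+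

lemma chart_homeo: "c \<in> \<A> \<Longrightarrow> homeomorphism (fst c) (snd c ` fst c) (snd c) (coord_inv c)"
  using oriented unfolding oriented_surface_def by blast

lemma chart_cover: "\<exists>c\<in>\<A>. p \<in> fst c"
  using oriented unfolding oriented_surface_def by blast

lemma coord_inv_snd: "c \<in> \<A> \<Longrightarrow> p \<in> fst c \<Longrightarrow> coord_inv c (snd c p) = p"
  using chart_homeo unfolding homeomorphism_def by blast

lemma coord_inv_in: "z \<in> snd c ` fst c \<Longrightarrow> coord_inv c z \<in> fst c"
  by (rule inv_into_into)

lemma coord_inv_in': "c \<in> \<A> \<Longrightarrow> z \<in> snd c ` (fst c \<inter> W) \<Longrightarrow> coord_inv c z \<in> W"
  using coord_inv_snd by auto

lemma snd_coord_inv: "z \<in> snd c ` fst c \<Longrightarrow> snd c (coord_inv c z) = z"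
  by (rule f_inv_into_f)

lemma chart_open_image:
  assumes "c \<in> \<A>" "open W" shows "open (snd c ` (fst c \<inter> W))"
proof -
  have "openin (top_of_set (snd c ` fst c)) (snd c ` (fst c \<inter> W))"
    by (rule homeomorphism_imp_open_map[OF chart_homeo[OF assms(1)]]) (auto simp: openin_open_Int assms(2))
  then show ?thesis using chart_open(2)[OF assms(1)] openin_open_trans by blast
qed

lemma smooth_map_on: "smooth_map \<A> W f \<Longrightarrow> c \<in> \<A> \<Longrightarrow> smooth_on (snd c ` (fst c \<inter> W)) (\<lambda>z. f (coord_inv c z))"
  unfolding smooth_map_def by (simp add: o_def)

lemma smooth_map_on_UNIV: "smooth_map \<A> UNIV f \<Longrightarrow> c \<in> \<A> \<Longrightarrow> smooth_on (snd c ` fst c) (\<lambda>z. f (coord_inv c z))"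
  using smooth_map_on[of UNIV f c] by simp

lemma smooth_mapI:
  "(\<And>c. c \<in> \<A> \<Longrightarrow> smooth_on (snd c ` (fst c \<inter> W)) (\<lambda>z. f (coord_inv c z))) \<Longrightarrow> smooth_map \<A> W f"
  unfolding smooth_map_def by (simp add: o_def)

lemma smooth_map_subset: "smooth_map \<A> W f \<Longrightarrow> W' \<subseteq> W \<Longrightarrow> smooth_map \<A> W' f"
  unfolding smooth_map_def by (meson image_mono Int_mono order_refl smooth_on_subset)

lemma smooth_map_local:
  assumes "\<And>p. \<exists>W. open W \<and> p \<in> W \<and> smooth_map \<A> W f" shows "smooth_map \<A> UNIV f"
proof (rule smooth_mapI)
  fix c assume c: "c \<in> \<A>"
  have "\<exists>T. open T \<and> z \<in> T \<and> smooth_on T (\<lambda>z. f (coord_inv c z))" if z: "z \<in> snd c ` fst c" for z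
  proof -
    obtain W where W: "open W" "coord_inv c z \<in> W" "smooth_map \<A> W f" using assms by blast
    have "z \<in> snd c ` (fst c \<inter> W)"
      using W(2) coord_inv_in[OF z] snd_coord_inv[OF z] by (metis IntI image_eqI)
    then show ?thesis using chart_open_image[OF c W(1)] smooth_map_on[OF W(3) c] by blast
  qed
  then show "smooth_on (snd c ` (fst c \<inter> UNIV)) (\<lambda>z. f (coord_inv c z))"
    using smooth_on_local[OF chart_open(2)[OF c], of "\<lambda>z. f (coord_inv c z)"] by simp
qed

lemma smooth_map_const: "smooth_map \<A> W (\<lambda>_. a)"
  by (rule smooth_mapI) simp

lemma smooth_map_diff: "open W \<Longrightarrow> smooth_map \<A> W f \<Longrightarrow> smooth_map \<A> W h \<Longrightarrow> smooth_map \<A> W (\<lambda>x. f x - h x)"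
  by (rule smooth_mapI) (rule smooth_on_diff[OF chart_open_image smooth_map_on smooth_map_on])

lemma smooth_map_add: "open W \<Longrightarrow> smooth_map \<A> W f \<Longrightarrow> smooth_map \<A> W h \<Longrightarrow> smooth_map \<A> W (\<lambda>x. f x + h x)"
  by (rule smooth_mapI) (rule smooth_on_add[OF chart_open_image smooth_map_on smooth_map_on])

lemma smooth_map_bounded_linear: "open W \<Longrightarrow> bounded_linear L \<Longrightarrow> smooth_map \<A> W f \<Longrightarrow> smooth_map \<A> W (\<lambda>x. L (f x))"
  by (rule smooth_mapI) (rule smooth_on_bounded_linear[OF chart_open_image _ smooth_map_on])

lemma smooth_map_bilinear: "open W \<Longrightarrow> bounded_bilinear B \<Longrightarrow> smooth_map \<A> W f \<Longrightarrow> smooth_map \<A> W h \<Longrightarrow> smooth_map \<A> W (\<lambda>x. B (f x) (h x))"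
  by (rule smooth_mapI) (rule smooth_on_bilinear[OF chart_open_image _ smooth_map_on smooth_map_on])

lemmas smooth_map_matrix_mult = smooth_map_bilinear[OF _ bounded_bilinear_matrix_mult]
lemmas smooth_map_matrix_vector = smooth_map_bilinear[OF _ bounded_bilinear_matrix_vector]
lemmas smooth_map_mink = smooth_map_bilinear[OF _ bounded_bilinear_mink]
lemmas smooth_map_scale = smooth_map_bilinear[OF _ bounded_bilinear_scale]
lemmas smooth_map_scale_mat = smooth_map_bounded_linear[OF _ bounded_linear_scale_mat]

lemma smooth_map_inv_orth:
  assumes "open W" "smooth_map \<A> W T" "\<And>p. T p \<in> orth_group"
  shows "smooth_map \<A> W (\<lambda>p. matrix_inv (T p))"
  using smooth_map_bounded_linear[OF assms(1) bounded_linear_adj assms(2)]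
  by (simp add: matrix_inv_orth[OF assms(3)])

lemma smooth_map_differentiable:
  assumes "smooth_map \<A> W f" "open W" "c \<in> \<A>" "p \<in> fst c \<inter> W"
  shows "(\<lambda>z. f (coord_inv c z)) differentiable (at (snd c p))"
  using smooth_on_differentiable[OF chart_open_image[OF assms(3,2)] smooth_map_on[OF assms(1,3)]] assms(4)
  by blast

lemma differential_pd: "differential f c p v = pd (\<lambda>z. f (coord_inv c z)) (snd c p) v"
  by (simp add: differential_def o_def)

lemma differential_matrix_vector:
  assumes "(\<lambda>z. T (coord_inv c z)) differentiable (at (snd c p))"
    and "(\<lambda>z. \<sigma> (coord_inv c z)) differentiable (at (snd c p))" and "c \<in> \<A>" "p \<in> fst c"
  shows "differential (\<lambda>x. (T x :: 'k::finite cmat) *v \<sigma> x) c p v = T p *v differential \<sigma> c p v + differential T c p v *v \<sigma> p"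
  unfolding differential_pd pd_matrix_vector[OF assms(1,2)] by (simp add: coord_inv_snd assms)

lemma differential_matrix_mult:
  assumes "(\<lambda>z. T (coord_inv c z)) differentiable (at (snd c p))"
    and "(\<lambda>z. S (coord_inv c z)) differentiable (at (snd c p))" and "c \<in> \<A>" "p \<in> fst c"
  shows "differential (\<lambda>x. T x ** (S x :: 'k::finite cmat)) c p v = (T p :: 'k cmat) ** differential S c p v + differential T c p v ** S p"
  unfolding differential_pd pd_matrix_mult[OF assms(1,2)] by (simp add: coord_inv_snd assms)

lemma subbundle_local:
  assumes "subbundle \<A> n E"
  obtains W s where "open W" "p \<in> W" "\<And>i. i < n \<Longrightarrow> smooth_map \<A> W (s i)"
    "\<And>x. x \<in> W \<Longrightarrow> E x = vec.span ((\<lambda>i. s i x) ` {..<n})"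
proof -
  have "\<exists>W s. open W \<and> p \<in> W \<and> (\<forall>i<n. smooth_map \<A> W (s i)) \<and>
      (\<forall>x\<in>W. E x = vec.span ((\<lambda>i. s i x) ` {..<n}))"
    using assms unfolding subbundle_def by (rule conjunct2[THEN spec])
  then obtain W s where *: "open W \<and> p \<in> W \<and> (\<forall>i<n. smooth_map \<A> W (s i)) \<and>
      (\<forall>x\<in>W. E x = vec.span ((\<lambda>i. s i x) ` {..<n}))" by (elim exE)
  show thesis by (rule that[of W s]) (use * in simp_all)
qed

lemma subbundle_frame:
  fixes E :: "'m \<Rightarrow> 'k::finite cvec set"
  assumes "subbundle \<A> n E" "CARD('b::finite) = n"
  shows "\<exists>W (M :: 'm \<Rightarrow> complex^'b^'k option). open W \<and> p \<in> W \<and> smooth_map \<A> W M \<and> (\<forall>x\<in>W. frame (M x) (E x))"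
proof -
  obtain W s where W: "open W" "p \<in> W" "\<And>i. i < n \<Longrightarrow> smooth_map \<A> W (s i)"
    "\<And>x. x \<in> W \<Longrightarrow> E x = vec.span ((\<lambda>i. s i x) ` {..<n})"
    by (rule subbundle_local[OF assms(1), of p]) (rule that)
  obtain h :: "'b \<Rightarrow> nat" where h: "bij_betw h UNIV {..<n}"
    using finite_same_card_bij[of "UNIV :: 'b set" "{..<n}"] assms(2) by auto
  define M where "M x = (\<chi> i j. s (h j) x $ i)" for x
  have "smooth_map \<A> W M"
  proof (rule smooth_mapI)
    fix c assume c: "c \<in> \<A>"
    have "h j < n" for j using h by (auto simp: bij_betw_def)
    then show "smooth_on (snd c ` (fst c \<inter> W)) (\<lambda>z. M (coord_inv c z))"
      by (intro smooth_on_vec chart_open_image[OF c W(1)])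
        (simp add: M_def smooth_on_nth[OF chart_open_image[OF c W(1)] smooth_map_on[OF W(3) c]])
  qed
  moreover have "frame (M x) (E x)" if "x \<in> W" for x
    unfolding M_def using frame_of_spanning[OF h W(4)[OF that]] assms(1) by (auto simp: subbundle_def)
  ultimately show ?thesis using W(1,2) by blast
qed

lemma subbundle_splits:
  assumes "subbundle \<A> 4 V" "\<And>p. nondegenerate (V p)" shows "splits (V p)"
proof -
  obtain M :: "'m \<Rightarrow> complex^4^'a option" where "frame (M p) (V p)"
    using subbundle_frame[OF assms(1), of p, where 'b = 4] by auto
  then show ?thesis using frame_splits assms(2) by blast
qed

text \<open>In a smooth local frame the projection is given by Cramer's formula, whose denominator,
  the Gram determinant, has no zero.\<close>

lemma smooth_map_oproj:
  fixes V :: "'m \<Rightarrow> 'k::finite cvec set"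
  assumes "subbundle \<A> 4 V" "\<And>p. nondegenerate (V p)"
  shows "smooth_map \<A> UNIV (\<lambda>p. oproj (V p))"
proof (rule smooth_map_local)
  fix p
  obtain W and M :: "'m \<Rightarrow> complex^4^'k option" where W: "open W" "p \<in> W" "smooth_map \<A> W M"
    and F: "\<And>x. x \<in> W \<Longrightarrow> frame (M x) (V x)"
    using subbundle_frame[OF assms(1), of p, where 'b = 4] by auto
  have "smooth_map \<A> W (\<lambda>x. oproj (V x))"
  proof (rule smooth_mapI)
    fix c assume c: "c \<in> \<A>"
    let ?S = "snd c ` (fst c \<inter> W)"
    note op = chart_open_image[OF c W(1)]
    define m where "m z = M (coord_inv c z)" for z
    have m: "smooth_on ?S m" unfolding m_def using smooth_map_on[OF W(3) c] .
    have mij: "smooth_on ?S (\<lambda>z. m z $ i $ j)" for i j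
      by (intro smooth_on_nth op m)
    have col: "smooth_on ?S (\<lambda>z. column j (m z))" for j
      by (intro smooth_on_vec op) (simp add: column_def mij)
    have gr: "smooth_on ?S (\<lambda>z. gram (m z) (m z) $ i $ j)" for i j
      unfolding gram_def by (simp add: smooth_on_mink[OF op col col])
    have det: "det (gram (m z) (m z)) \<noteq> 0" if "z \<in> ?S" for z
      unfolding m_def using det_gram_nonzero[OF F assms(2)] coord_inv_in'[OF c that] by blast
    have fp: "smooth_on ?S (\<lambda>z. frame_proj (m z) u $ i)" for u i
    proof -
      have "smooth_on ?S (\<lambda>z. (\<chi> i j. if j = k then mink (column i (m z)) u else gram (m z) (m z) $ i $ j) $ i $ j)" for k i j
        by (cases "j = k") (simp_all add: gr smooth_on_mink[OF op col])
      then have "smooth_on ?S (\<lambda>z. m z $ i $ k * (det (\<chi> i j. if j = k then mink (column i (m z)) u else gram (m z) (m z) $ i $ j) / det (gram (m z) (m z))))" for k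
        by (intro smooth_on_mult smooth_on_divide smooth_on_det op mij gr det)
      then show ?thesis
        unfolding frame_proj_def by (simp add: matrix_vector_mult_def smooth_on_sum[OF op])
    qed
    have eq: "oproj (V (coord_inv c z)) $ i $ j = frame_proj (m z) (axis j 1) $ i" if "z \<in> ?S" for z i j
    proof -
      have "oproj (V (coord_inv c z)) *v axis j 1 = frame_proj (m z) (axis j 1)"
        unfolding m_def using oproj_frame[OF F assms(2)] coord_inv_in'[OF c that] by blast
      moreover have "oproj (V (coord_inv c z)) $ i $ j = (oproj (V (coord_inv c z)) *v axis j 1) $ i"
        by (simp add: matrix_vector_mult_def axis_def if_distrib cong: if_cong)
      ultimately show ?thesis by simp
    qed
    show "smooth_on ?S (\<lambda>z. oproj (V (coord_inv c z)))"
      by (intro smooth_on_vec op smooth_on_cong[OF op eq[symmetric] fp])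
  qed
  then show "\<exists>W. open W \<and> p \<in> W \<and> smooth_map \<A> W (\<lambda>p. oproj (V p))" using W by blast
qed

lemma subbundle_image:
  fixes E :: "'m \<Rightarrow> 'k::finite cvec set"
  assumes "subbundle \<A> n E" "smooth_map \<A> UNIV T" "\<And>p. T p \<in> orth_group"
  shows "subbundle \<A> n (\<lambda>p. (*v) (T p) ` E p)"
  unfolding subbundle_def
proof (intro conjI allI)
  fix p
  show "vec.subspace ((*v) (T p) ` E p)" "vec.dim ((*v) (T p) ` E p) = n"
    using orth_group_image[OF assms(3)] assms(1) by (auto simp: subbundle_def)
  obtain W s where W: "open W" "p \<in> W" "\<And>i. i < n \<Longrightarrow> smooth_map \<A> W (s i)"
    "\<And>x. x \<in> W \<Longrightarrow> E x = vec.span ((\<lambda>i. s i x) ` {..<n})"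
    by (rule subbundle_local[OF assms(1), of p]) (rule that)
  have "smooth_map \<A> W (\<lambda>x. T x *v s i x)" if "i < n" for i
    by (rule smooth_map_matrix_vector[OF W(1) smooth_map_subset[OF assms(2)] W(3)[OF that]]) simp
  moreover have "(*v) (T x) ` E x = vec.span ((\<lambda>i. T x *v s i x) ` {..<n})" if "x \<in> W" for x
    unfolding W(4)[OF that] vec.span_image[symmetric] by (simp add: image_image)
  ultimately show "\<exists>W s. open W \<and> p \<in> W \<and> (\<forall>i<n. smooth_map \<A> W (s i)) \<and>
      (\<forall>x\<in>W. (*v) (T x) ` E x = vec.span ((\<lambda>i. s i x) ` {..<n}))"
    using W(1,2) by (intro exI[of _ W] exI[of _ "\<lambda>i x. T x *v s i x"]) auto
qed

text \<open>The local section is the combination of two sections of L that is orthogonal to one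
  section of M. It spans the intersection wherever the pairing selected at p is nonzero, and that is
  an open condition.\<close>

lemma subbundle_meet:
  fixes L M V :: "'m \<Rightarrow> 'k::finite cvec set"
  assumes V: "\<And>p. vec.subspace (V p)" "\<And>p. vec.dim (V p) = 4" "\<And>p. nondegenerate (V p)"
    and L: "subbundle \<A> 2 L" "\<And>p. isotropic (L p)" "\<And>p. L p \<subseteq> V p"
    and M: "subbundle \<A> 2 M" "\<And>p. isotropic (M p)" "\<And>p. M p \<subseteq> V p"
    and LM: "\<And>p. vec.dim (L p \<inter> M p) = 1"
  shows "subbundle \<A> 1 (\<lambda>p. L p \<inter> M p)"
  unfolding subbundle_def
proof (intro conjI allI)
  fix p
  have sub: "vec.subspace (L p)" "vec.subspace (M p)" "vec.dim (L p) = 2" "vec.dim (M p) = 2" for p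
    using L M by (auto simp: subbundle_def)
  show "vec.subspace (L p \<inter> M p)" "vec.dim (L p \<inter> M p) = 1"
    using vec.subspace_inter[OF sub(1,2)] LM by auto
  have two: "{..<2::nat} = {0, 1}" by auto
  obtain W s where W: "open W" "p \<in> W" "\<And>i. i < 2 \<Longrightarrow> smooth_map \<A> W (s i)"
    "\<And>x. x \<in> W \<Longrightarrow> L x = vec.span ((\<lambda>i. s i x) ` {..<2::nat})"
    by (rule subbundle_local[OF L(1), of p]) (rule that)
  obtain W' t where W': "open W'" "p \<in> W'" "\<And>i. i < 2 \<Longrightarrow> smooth_map \<A> W' (t i)"
    "\<And>x. x \<in> W' \<Longrightarrow> M x = vec.span ((\<lambda>i. t i x) ` {..<2::nat})"
    by (rule subbundle_local[OF M(1), of p]) (rule that)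
  have Ls: "L x = vec.span {s 0 x, s 1 x}" if "x \<in> W" for x using W(4)[OF that] by (simp add: two)
  have Ms: "M x = vec.span {t 0 x, t 1 x}" if "x \<in> W'" for x using W'(4)[OF that] by (simp add: two)
  note im = isotropic_meet[OF V sub(1,3) L(2,3) sub(2,4) M(2,3) LM]
  have "\<exists>j<2. mink (s 0 p) (t j p) \<noteq> 0 \<or> mink (s 1 p) (t j p) \<noteq> 0"
    using im(1)[OF Ls[OF W(2)] Ms[OF W'(2)]] by (auto intro: exI[of _ 0] exI[of _ 1])
  then obtain j where j: "j < 2" "mink (s 0 p) (t j p) \<noteq> 0 \<or> mink (s 1 p) (t j p) \<noteq> 0" by blast
  define \<sigma> where "\<sigma> x = mink (s 1 x) (t j x) *s s 0 x - mink (s 0 x) (t j x) *s s 1 x" for x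
  let ?W = "W \<inter> W'"
  have opW: "open ?W" using W(1) W'(1) by blast
  have sm: "smooth_map \<A> ?W (s i)" "smooth_map \<A> ?W (t i)" if "i < 2" for i
    using smooth_map_subset[OF W(3)[OF that]] smooth_map_subset[OF W'(3)[OF that]] by auto
  have m: "smooth_map \<A> ?W (\<lambda>x. mink (s i x) (t j x))" if "i < 2" for i
    by (rule smooth_map_mink[OF opW sm(1)[OF that] sm(2)[OF j(1)]])
  have s\<sigma>: "smooth_map \<A> ?W \<sigma>"
    unfolding \<sigma>_def by (intro smooth_map_diff smooth_map_scale opW m sm) auto
  obtain c where c: "c \<in> \<A>" "p \<in> fst c" using chart_cover by blast
  have "\<exists>i<2. mink (s i p) (t j p) \<noteq> 0"
    using j(2) by (auto intro: exI[of _ 0] exI[of _ 1])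
  then obtain i where i: "i < 2" "mink (s i p) (t j p) \<noteq> 0" by blast
  define f where "f z = mink (s i (coord_inv c z)) (t j (coord_inv c z))" for z
  let ?S = "snd c ` (fst c \<inter> ?W)"
  have opS: "open ?S" by (rule chart_open_image[OF c(1) opW])
  have "continuous_on ?S f"
    unfolding f_def using smooth_on_continuous[OF smooth_map_on[OF m[OF i(1)] c(1)]] .
  then have opN: "open {z \<in> ?S. f z \<noteq> 0}"
  proof -
    have "open (f -` (- {0}) \<inter> ?S)"
      using continuous_on_open_vimage[OF opS, of f] \<open>continuous_on ?S f\<close> open_Compl[OF closed_singleton[of 0]]
      by blast
    moreover have "f -` (- {0}) \<inter> ?S = {z \<in> ?S. f z \<noteq> 0}" by blast
    ultimately show ?thesis by (simp only:)
  qed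
  \<comment> \<open>The neighbourhood lives on the surface, but smoothness is a notion in charts;
    its openness is therefore pulled back from the chart image.\<close>
  define N where "N = {x \<in> fst c \<inter> ?W. mink (s i x) (t j x) \<noteq> 0}"
  have Neq: "N = snd c -` {z \<in> ?S. f z \<noteq> 0} \<inter> fst c"
  proof (intro set_eqI iffI)
    fix x assume x: "x \<in> N"
    then have xW: "x \<in> fst c \<inter> ?W" and "x \<in> fst c" by (simp_all add: N_def)
    have "snd c x \<in> ?S" by (rule imageI[OF xW])
    then show "x \<in> snd c -` {z \<in> ?S. f z \<noteq> 0} \<inter> fst c"
      using x coord_inv_snd[OF c(1) \<open>x \<in> fst c\<close>] by (simp add: N_def f_def)
  next
    fix x assume x: "x \<in> snd c -` {z \<in> ?S. f z \<noteq> 0} \<inter> fst c"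
    then have xc: "x \<in> fst c" and xS: "snd c x \<in> ?S" and xf: "f (snd c x) \<noteq> 0" by blast+
    have "x \<in> ?W" using coord_inv_in'[OF c(1) xS] by (simp only: coord_inv_snd[OF c(1) xc])
    then show "x \<in> N" using xc xf by (simp add: N_def f_def coord_inv_snd[OF c(1) xc])
  qed
  have "continuous_on (fst c) (snd c)" using chart_homeo[OF c(1)] by (simp add: homeomorphism_def)
  then have "open (snd c -` B \<inter> fst c)" if "open B" for B
    using that continuous_on_open_vimage[OF chart_open(1)[OF c(1)], of "snd c"] by blast
  from this[OF opN] have opN': "open N" by (simp only: Neq)
  have pN: "p \<in> N" using i(2) c(2) W(2) W'(2) by (simp add: N_def)
  have smN: "smooth_map \<A> N \<sigma>" by (rule smooth_map_subset[OF s\<sigma>]) (auto simp: N_def)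
  have spN: "L x \<inter> M x = vec.span ((\<lambda>i. \<sigma> x) ` {..<1::nat})" if "x \<in> N" for x
  proof -
    have x: "x \<in> W" "x \<in> W'" "mink (s i x) (t j x) \<noteq> 0" using that by (auto simp: N_def)
    have "i = 0 \<or> i = 1" "j = 0 \<or> j = 1" using i(1) j(1) by auto
    then have "L x \<inter> M x = vec.span {\<sigma> x}"
      unfolding \<sigma>_def using x(3) by (intro im(2)[OF Ls[OF x(1)] Ms[OF x(2)]]) auto
    then show ?thesis by (simp add: lessThan_Suc)
  qed
  show "\<exists>W s. open W \<and> p \<in> W \<and> (\<forall>i<1. smooth_map \<A> W (s i)) \<and>
      (\<forall>x\<in>W. L x \<inter> M x = vec.span ((\<lambda>i. s i x) ` {..<1::nat}))"
  proof (rule exI[of _ N], rule exI[of _ "\<lambda>i. \<sigma>"])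
    have A: "\<forall>i<1::nat. smooth_map \<A> N \<sigma>" by (rule allI, rule impI, rule smN)
    have B: "\<forall>x\<in>N. L x \<inter> M x = vec.span ((\<lambda>i. \<sigma> x) ` {..<1::nat})" by (rule ballI, rule spN)
    show "open N \<and> p \<in> N \<and> (\<forall>i<1::nat. smooth_map \<A> N \<sigma>) \<and>
      (\<forall>x\<in>N. L x \<inter> M x = vec.span ((\<lambda>i. \<sigma> x) ` {..<1::nat}))"
      by (rule conjI[OF opN' conjI[OF pN conjI[OF A B]]])
  qed
qed

end

section \<open>The associated family of connections\<close>

text \<open>After multiplication by \<zeta>^2 the relation is a polynomial of degree at most 4 with
  infinitely many zeros. The subtracted ones move x3 and x4 into the middle coefficient.\<close>

lemma laurent_coeffs_zero:
  fixes x0 x1 x2 x3 x4 :: complex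
  assumes Z: "infinite Z" "0 \<notin> Z"
    and eq: "\<And>\<zeta>. \<zeta> \<in> Z \<Longrightarrow> x0 + inverse \<zeta> * x1 + \<zeta> * x2 + (inverse (\<zeta>\<^sup>2) - 1) * x3 + (\<zeta>\<^sup>2 - 1) * x4 = 0"
  shows "x1 = 0 \<and> x2 = 0 \<and> x3 = 0 \<and> x4 = 0"
proof -
  define P where "P = [:x3, x1, x0 - x3 - x4, x2, x4:]"
  have "poly P \<zeta> = 0" if "\<zeta> \<in> Z" for \<zeta>
  proof -
    have "\<zeta> \<noteq> 0" using that Z(2) by auto
    then have "poly P \<zeta> = \<zeta>\<^sup>2 * (x0 + inverse \<zeta> * x1 + \<zeta> * x2 + (inverse (\<zeta>\<^sup>2) - 1) * x3 + (\<zeta>\<^sup>2 - 1) * x4)"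
      by (simp add: P_def field_simps power2_eq_square)
    then show ?thesis using eq[OF that] by simp
  qed
  then have "Z \<subseteq> {\<zeta>. poly P \<zeta> = 0}" by blast
  then have "infinite {\<zeta>. poly P \<zeta> = 0}" using Z(1) by (rule infinite_super)
  then have "P = 0" using poly_roots_finite by blast
  then show ?thesis by (simp add: P_def)
qed

lemma laurent_mats_zero:
  fixes X0 X1 X2 X3 X4 :: "'k::finite cmat"
  assumes "infinite Z" "0 \<notin> Z"
    and eq: "\<And>\<zeta>. \<zeta> \<in> Z \<Longrightarrow> X0 + inverse \<zeta> \<odot> X1 + \<zeta> \<odot> X2 + (inverse (\<zeta>\<^sup>2) - 1) \<odot> X3 + (\<zeta>\<^sup>2 - 1) \<odot> X4 = 0"
  shows "X1 = 0" "X2 = 0" "X3 = 0" "X4 = 0"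
proof -
  have "X1 $ i $ j = 0 \<and> X2 $ i $ j = 0 \<and> X3 $ i $ j = 0 \<and> X4 $ i $ j = 0" for i j
  proof (rule laurent_coeffs_zero[OF assms(1,2)])
    fix \<zeta> assume "\<zeta> \<in> Z"
    from arg_cong[OF eq[OF this], of "\<lambda>X. X $ i $ j"]
    show "X0 $ i $ j + inverse \<zeta> * X1 $ i $ j + \<zeta> * X2 $ i $ j + (inverse (\<zeta>\<^sup>2) - 1) * X3 $ i $ j + (\<zeta>\<^sup>2 - 1) * X4 $ i $ j = 0"
      by simp
  qed
  then show "X1 = 0" "X2 = 0" "X3 = 0" "X4 = 0" by (simp_all add: vec_eq_iff)
qed

locale quadric_bundle = surface \<A> g
  for \<A> :: "'m::{t2_space,second_countable_topology} chart set" and g :: "'m metric" +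
  fixes V :: "'m \<Rightarrow> 'k::finite cvec set"
  assumes V: "subbundle \<A> 4 V" and V_nondeg: "\<And>p. nondegenerate (V p)"
begin

definition reflection :: "'m \<Rightarrow> 'k cmat" where
  "reflection p = 2 \<odot> oproj (V p) - mat 1"

lemma V_splits: "splits (V p)"
  by (rule subbundle_splits[OF V V_nondeg])

lemma reflection_eq: "reflection p = oproj (V p) - oproj (perp (V p))"
  by (simp add: reflection_def oproj_perp[OF V_splits] vec_eq_iff)

lemma reflection_reflection: "reflection p ** reflection p = mat 1"
  by (simp add: reflection_def matrix_ring_simps scale_mat_scale oproj_idem[OF V_splits] vec_eq_iff)

lemma reflection_vector: "reflection p *v x = 2 *s (oproj (V p) *v x) - x"
  by (simp add: reflection_def matrix_vector_mult_diff_rdistrib scale_mat_vector)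

lemma reflection_fix: "reflection p *v x = x \<longleftrightarrow> x \<in> V p"
proof -
  have "reflection p *v x = x \<longleftrightarrow> oproj (V p) *v x = x"
    by (auto simp: reflection_vector vec_eq_iff)
  then show ?thesis by (simp add: oproj_fix_iff[OF V_splits])
qed

lemma smooth_oproj: "smooth_map \<A> UNIV (\<lambda>p. oproj (V p))"
  by (rule smooth_map_oproj[OF V V_nondeg])

lemma smooth_reflection: "smooth_map \<A> UNIV reflection"
  unfolding reflection_def[abs_def]
  by (intro smooth_map_diff smooth_map_scale_mat smooth_oproj smooth_map_const) auto

abbreviation refl_at :: "'m chart \<Rightarrow> real^2 \<Rightarrow> 'k cmat" where
  "refl_at c z \<equiv> reflection (coord_inv c z)"

lemma refl_at: "c \<in> \<A> \<Longrightarrow> smooth_on (snd c ` fst c) (refl_at c)" "refl_at c y ** refl_at c y = mat 1"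
  using smooth_map_on_UNIV[OF smooth_reflection] reflection_reflection by auto

text \<open>Differentiating the projections inside D_V leaves d and a zeroth-order term; expressed
  through the reflection, twice the projection minus 1, that term is \<open>nform\<close>.\<close>

lemma conn_D_expand:
  assumes c: "c \<in> \<A>" "p \<in> fst c" and \<sigma>: "(\<lambda>z. \<sigma> (coord_inv c z)) differentiable (at (snd c p))"
  shows "conn_D V \<sigma> c p v = differential \<sigma> c p v - nform (refl_at c) (snd c p) v *v \<sigma> p"
proof -
  let ?P = "\<lambda>z. oproj (V (coord_inv c z))"
  let ?\<pi> = "oproj (V p)" and ?d = "differential (\<lambda>x. oproj (V x)) c p v" and ?s = "differential \<sigma> c p v"
  have dP: "?P differentiable (at (snd c p))"
    using smooth_map_differentiable[OF smooth_oproj _ c(1)] c(2) by simp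
  have p: "coord_inv c (snd c p) = p" by (rule coord_inv_snd[OF c])
  have 1: "differential (\<lambda>x. oproj (V x) *v \<sigma> x) c p v = ?\<pi> *v ?s + ?d *v \<sigma> p"
    by (rule differential_matrix_vector[OF dP \<sigma> c])
  have 2: "differential (\<lambda>x. oproj (perp (V x)) *v \<sigma> x) c p v = ?s - (?\<pi> *v ?s + ?d *v \<sigma> p)"
  proof -
    have e: "oproj (perp (V x)) *v \<sigma> x = \<sigma> x - oproj (V x) *v \<sigma> x" for x
      by (simp add: oproj_perp[OF V_splits] matrix_vector_mult_diff_rdistrib)
    show ?thesis
      unfolding 1[symmetric] unfolding differential_pd e
      by (rule pd_diff[OF \<sigma> differentiable_matrix_vector[OF dP \<sigma>]])
  qed
  have N: "nform (refl_at c) (snd c p) v = ?d - 2 \<odot> (?\<pi> ** ?d)"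
  proof -
    have "pd (refl_at c) (snd c p) v = 2 \<odot> ?d"
      unfolding reflection_def differential_pd
      by (simp add: pd_diff pd_scale_mat differentiable_scale_mat dP)
    then show ?thesis
      by (simp add: nform_def p reflection_def matrix_ring_simps scale_mat_scale scale_mat_diff)
        (simp add: vec_eq_iff)
  qed
  have idem: "?\<pi> *v (?\<pi> *v x) = ?\<pi> *v x" for x
    by (simp add: matrix_vector_mul_assoc oproj_idem[OF V_splits])
  show ?thesis
    unfolding conn_D_def unfolding 1 2 N unfolding oproj_perp[OF V_splits]
    by (simp add: matrix_vector_mult_diff_rdistrib matrix_vector_right_distrib matrix_vector_mult_diff_distrib
        idem scale_mat_vector matrix_vector_mul_assoc[symmetric])
      (simp add: vec_eq_iff)
qed

lemma form_N_nform:
  assumes c: "c \<in> \<A>" "p \<in> fst c"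
  shows "form_N V c p v = nform (refl_at c) (snd c p) v"
proof -
  have "form_N V c p v = matrix (\<lambda>u. nform (refl_at c) (snd c p) v *v u)"
    unfolding form_N_def by (simp add: conn_D_expand[OF c])
  then show ?thesis by simp
qed

lemma form_N_at:
  "c \<in> \<A> \<Longrightarrow> z \<in> snd c ` fst c \<Longrightarrow> form_N V c (coord_inv c z) v = nform (refl_at c) z v"
  by (simp add: form_N_nform coord_inv_in snd_coord_inv)

lemma conn_D_eq:
  assumes c: "c \<in> \<A>" "p \<in> fst c" and \<sigma>: "(\<lambda>z. \<sigma> (coord_inv c z)) differentiable (at (snd c p))"
  shows "conn_D V \<sigma> c p v = differential \<sigma> c p v - form_N V c p v *v \<sigma> p"
  using conn_D_expand[OF assms] by (simp add: form_N_nform[OF c])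

lemma linear_form_N:
  assumes c: "c \<in> \<A>" "p \<in> fst c" shows "linear (form_N V c p)"
proof -
  have "form_N V c p = nform (refl_at c) (snd c p)" using form_N_nform[OF c] by blast
  then show ?thesis
    using linear_nform[OF chart_open(2)[OF c(1)] refl_at(1)[OF c(1)] refl_at(2)] c(2) by simp
qed

lemma smooth_form_N:
  assumes c: "c \<in> \<A>" shows "smooth_on (snd c ` fst c) (\<lambda>z. form_N V c (coord_inv c z) v)"
  by (rule smooth_on_cong[OF chart_open(2)[OF c] _ smooth_nform[OF chart_open(2) refl_at(1) refl_at(2)]])
    (simp_all add: form_N_at c)

text \<open>The difference is D_V applied to \<sigma>, and D_V preserves V: the component of
  \<sigma> in the orthogonal complement is zero near p, hence so is its derivative.\<close>

lemma form_N_section: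
  assumes c: "c \<in> \<A>" "p \<in> fst c \<inter> W" and W: "open W" "smooth_map \<A> W \<sigma>" and \<sigma>: "\<And>x. x \<in> W \<Longrightarrow> \<sigma> x \<in> V x"
  shows "differential \<sigma> c p v - form_N V c p v *v \<sigma> p \<in> V p"
proof -
  have p: "p \<in> fst c" using c by blast
  have d\<sigma>: "(\<lambda>z. \<sigma> (coord_inv c z)) differentiable (at (snd c p))"
    by (rule smooth_map_differentiable[OF W(2,1) c])
  have "differential (\<lambda>x. oproj (perp (V x)) *v \<sigma> x) c p v = pd (\<lambda>z. 0) (snd c p) v"
    unfolding differential_pd
  proof (rule pd_cong[OF chart_open_image[OF c(1) W(1)]])
    fix z assume "z \<in> snd c ` (fst c \<inter> W)"
    then have "\<sigma> (coord_inv c z) \<in> V (coord_inv c z)" using \<sigma> coord_inv_in'[OF c(1)] by blast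
    then show "oproj (perp (V (coord_inv c z))) *v \<sigma> (coord_inv c z) = 0"
      by (simp add: oproj_perp[OF V_splits] matrix_vector_mult_diff_rdistrib oproj_fix[OF V_splits])
  qed (use c in blast)
  then have "conn_D V \<sigma> c p v = oproj (V p) *v differential (\<lambda>x. oproj (V x) *v \<sigma> x) c p v"
    by (simp add: conn_D_def)
  then show ?thesis
    using conn_D_eq[OF c(1) p d\<sigma>] oproj_in[OF V_splits, of p] by metis
qed

lemma ext_deriv_extd:
  assumes c: "c \<in> \<A>" "p \<in> fst c"
    and \<omega>: "\<And>v. (\<lambda>z. \<omega> c (coord_inv c z) v) differentiable (at (snd c p))"
  shows "ext_deriv (conn_D V) \<omega> c p v w
    = extd (\<lambda>z v. - form_N V c (coord_inv c z) v) (\<lambda>z v. \<omega> c (coord_inv c z) v) (snd c p) v w"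
proof -
  have e: "end_conn (conn_D V) (\<lambda>x. \<omega> c x w) c p v
    = pd (\<lambda>z. \<omega> c (coord_inv c z) w) (snd c p) v + lie (- form_N V c p v) (\<omega> c p w)" for v w
  proof -
    have 1: "conn_D V (\<lambda>x. \<omega> c x w *v u) c p v
      = pd (\<lambda>z. \<omega> c (coord_inv c z) w) (snd c p) v *v u - form_N V c p v *v (\<omega> c p w *v u)" for u
    proof -
      have "(\<lambda>z. \<omega> c (coord_inv c z) w *v u) differentiable (at (snd c p))"
        by (rule differentiable_matrix_vector[OF \<omega>]) simp
      moreover have "differential (\<lambda>x. \<omega> c x w *v u) c p v = pd (\<lambda>z. \<omega> c (coord_inv c z) w) (snd c p) v *v u"
        unfolding differential_pd using pd_matrix_vector[OF \<omega>, of "\<lambda>z. u"] by simp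
      ultimately show ?thesis using conn_D_eq[OF c] by simp
    qed
    have 2: "conn_D V (\<lambda>_. u) c p v = - (form_N V c p v *v u)" for u
      by (simp add: conn_D_eq[OF c] differential_pd)
    have "end_conn (conn_D V) (\<lambda>x. \<omega> c x w) c p v
      = matrix (\<lambda>u. (pd (\<lambda>z. \<omega> c (coord_inv c z) w) (snd c p) v + lie (- form_N V c p v) (\<omega> c p w)) *v u)"
      unfolding end_conn_def 1 2 lie_def
      by (rule arg_cong[where f = matrix])
        (simp add: fun_eq_iff matrix_vector_mult_add_rdistrib matrix_vector_mult_diff_rdistrib
          matrix_vector_mul_assoc matrix_minus_left matrix_minus_right matrix_vector_minus_left matrix_vector_minus_right)
    then show ?thesis by simp
  qed
  show ?thesis
    unfolding ext_deriv_def e extd_def wb_def by (simp add: coord_inv_snd[OF c])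
qed

text \<open>The Gauss and Codazzi equations. As D_V = d - N_V with d flat, the curvature of D_V is
  minus the bracket of N_V with itself, and N_V is closed for D_V.\<close>

lemma curv_minus_form_N:
  assumes c: "c \<in> \<A>" "p \<in> fst c"
  shows "curv (\<lambda>z v. - form_N V c (coord_inv c z) v) (snd c p) v w = - lie (form_N V c p v) (form_N V c p w)"
    and "extd (\<lambda>z v. - form_N V c (coord_inv c z) v) (\<lambda>z v. form_N V c (coord_inv c z) v) (snd c p) v w = 0"
proof -
  have z: "snd c p \<in> snd c ` fst c" using c by blast
  have d: "(\<lambda>z. form_N V c (coord_inv c z) v) differentiable (at (snd c p))" for v
    by (rule smooth_on_differentiable[OF chart_open(2)[OF c(1)] smooth_form_N[OF c(1)] z])
  have p: "coord_inv c (snd c p) = p" by (rule coord_inv_snd[OF c])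
  have pdN: "pd (\<lambda>z. form_N V c (coord_inv c z) w) (snd c p) v = pd (\<lambda>y. nform (refl_at c) y w) (snd c p) v" for v w
    by (rule pd_cong[OF chart_open(2)[OF c(1)] z form_N_at[OF c(1)]])
  have cod: "pd (\<lambda>z. form_N V c (coord_inv c z) w) (snd c p) v - pd (\<lambda>z. form_N V c (coord_inv c z) v) (snd c p) w
    = 2 \<odot> lie (form_N V c p v) (form_N V c p w)"
    unfolding pdN form_N_nform[OF c] by (rule nform_codazzi[OF chart_open(2)[OF c(1)] refl_at(1)[OF c(1)] refl_at(2) z])
  show "curv (\<lambda>z v. - form_N V c (coord_inv c z) v) (snd c p) v w = - lie (form_N V c p v) (form_N V c p w)"
    using cod unfolding curv_def by (simp add: pd_uminus[OF d] p lie_minus) (simp add: vec_eq_iff algebra_simps)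
  show "extd (\<lambda>z v. - form_N V c (coord_inv c z) v) (\<lambda>z v. form_N V c (coord_inv c z) v) (snd c p) v w = 0"
    using cod lie_commute[of "form_N V c p w" "form_N V c p v"]
    unfolding extd_def wb_def by (simp add: p lie_minus) (simp add: vec_eq_iff algebra_simps)
qed

text \<open>The connection form of the spectral family relative to d. It vanishes at \<zeta> =
  1.\<close>

definition lax :: "('m, 'k cmat) form1 \<Rightarrow> complex \<Rightarrow> ('m, 'k cmat) form1" where
  "lax q \<zeta> c p v = - form_N V c p v + (inverse \<zeta> \<odot> part10m g (form_N V) c p v + \<zeta> \<odot> part01m g (form_N V) c p v
      + (inverse (\<zeta>\<^sup>2) - 1) \<odot> part10m g q c p v + (\<zeta>\<^sup>2 - 1) \<odot> part01m g q c p v)"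

lemma conn_lambda_eq:
  assumes c: "c \<in> \<A>" "p \<in> fst c" and \<sigma>: "(\<lambda>z. \<sigma> (coord_inv c z)) differentiable (at (snd c p))"
  shows "conn_lambda g V q \<zeta> \<sigma> c p v = differential \<sigma> c p v + lax q \<zeta> c p v *v \<sigma> p"
  by (simp add: conn_lambda_def conn_D_eq[OF assms] lax_def matrix_vector_mult_add_rdistrib
      matrix_vector_mult_diff_rdistrib matrix_vector_minus_left)

end

context surface
begin

lemma rot90_J: "c \<in> \<A> \<Longrightarrow> p \<in> fst c \<Longrightarrow> linear (rot90 g c p)"
  "c \<in> \<A> \<Longrightarrow> p \<in> fst c \<Longrightarrow> rot90 g c p (rot90 g c p v) = - v"
  using linear_rot90[OF metric] rot90_props(4)[OF metric] by blast+

lemma smooth_typm: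
  fixes \<omega> :: "('m, 'k::finite cmat) form1"
  assumes c: "c \<in> \<A>" and lin: "\<And>p. p \<in> fst c \<Longrightarrow> linear (\<omega> c p)"
    and sm: "\<And>v. smooth_on (snd c ` fst c) (\<lambda>z. \<omega> c (coord_inv c z) v)"
  shows "smooth_on (snd c ` fst c) (\<lambda>z. typm \<iota> (rot90 g c (coord_inv c z)) (\<omega> c (coord_inv c z)) v)"
proof -
  note op = chart_open(2)[OF c]
  have sJ: "smooth_on (snd c ` fst c) (\<lambda>z. rot90 g c (coord_inv c z) v $ i)" for i
    by (rule smooth_on_nth[OF op smooth_rot90[OF metric c op]])
  \<comment> \<open>The hypothesis covers the values of \<omega> on constant vectors, so the moving
    vector J v is expanded in the standard basis.\<close>
  have "smooth_on (snd c ` fst c) (\<lambda>z. \<Sum>i\<in>UNIV. rot90 g c (coord_inv c z) v $ i *\<^sub>R \<omega> c (coord_inv c z) (axis i 1))"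
    by (intro smooth_on_sum op smooth_on_bilinear[OF op bounded_bilinear_scaleR sJ sm])
  then have "smooth_on (snd c ` fst c) (\<lambda>z. \<omega> c (coord_inv c z) (rot90 g c (coord_inv c z) v))"
  proof (rule smooth_on_cong[OF op, rotated])
    fix z assume "z \<in> snd c ` fst c"
    then have l: "linear (\<omega> c (coord_inv c z))" by (intro lin coord_inv_in)
    have "x = (\<Sum>i\<in>UNIV. x $ i *\<^sub>R axis i 1)" for x :: "real^2"
      by (simp add: vec_eq_iff axis_def if_distrib cong: if_cong)
    from arg_cong[OF this, of "\<omega> c (coord_inv c z)" "rot90 g c (coord_inv c z) v"]
    show "(\<Sum>i\<in>UNIV. rot90 g c (coord_inv c z) v $ i *\<^sub>R \<omega> c (coord_inv c z) (axis i 1))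
      = \<omega> c (coord_inv c z) (rot90 g c (coord_inv c z) v)"
      by (simp only: linear_sum[OF l] linear_cmul[OF l])
  qed
  then show ?thesis
    unfolding typed_part_def by (intro smooth_on_scale_mat smooth_on_diff op sm)
qed

lemma typm_rot90_transition:
  fixes \<omega> :: "('m, 'k::finite cmat) form1"
  assumes "one_form \<A> \<omega>" "c \<in> \<A>" "c' \<in> \<A>" "p \<in> fst c \<inter> fst c'"
  shows "typm \<iota> (rot90 g c p) (\<omega> c p) v = typm \<iota> (rot90 g c' p) (\<omega> c' p) (transition_deriv c c' p v)"
proof -
  have "\<omega> c p v = \<omega> c' p (transition_deriv c c' p v)" for v
    using assms unfolding one_form_def by blast
  then show ?thesis
    by (simp add: typed_part_def rot90_transition[OF metric oriented assms(2-4)])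
qed

end

section \<open>Harmonicity as flatness\<close>

lemma wb_commute: "wb \<alpha> \<beta> v w = wb \<beta> \<alpha> v w"
  using lie_commute[of "\<alpha> v" "\<beta> w"] lie_commute[of "\<alpha> w" "\<beta> v"] by (simp add: wb_def)

lemma wb_add_left: "wb (\<lambda>v. \<alpha> v + \<alpha>' v) \<beta> v w = wb \<alpha> \<beta> v w + wb \<alpha>' \<beta> v w"
  by (simp add: wb_def lie_simps)

lemma wb_combine_right:
  "wb \<alpha> (\<lambda>v. x \<odot> \<beta> v + y \<odot> \<gamma> v) v w = x \<odot> wb \<alpha> \<beta> v w + y \<odot> wb \<alpha> \<gamma> v w"
  by (simp add: wb_def lie_simps vec_eq_iff algebra_simps)

lemma typed_form_wb:
  fixes J :: "real^2 \<Rightarrow> real^2"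
  assumes J: "linear J" "\<And>v. J (J v) = - v"
    and \<alpha>: "linear \<alpha>" "\<And>v. \<alpha> (J v) = \<iota> \<odot> \<alpha> v" and \<beta>: "linear \<beta>" "\<And>v. \<beta> (J v) = \<iota> \<odot> \<beta> v"
  shows "wb \<alpha> \<beta> v w = 0"
proof -
  have "lie (\<alpha> v + \<beta> v) (\<alpha> w + \<beta> w) = 0"
    by (rule typed_form_lie[OF J linear_compose_add[OF \<alpha>(1) \<beta>(1)], where \<iota> = \<iota>])
      (simp add: \<alpha>(2) \<beta>(2) scale_mat_add)
  then show ?thesis
    using typed_form_lie[OF J \<alpha>, of v w] typed_form_lie[OF J \<beta>, of v w] lie_commute[of "\<beta> v" "\<alpha> w"]
    by (simp add: lie_simps wb_def)
qed

context quadric_bundle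
begin

abbreviation "N10 \<equiv> part10m g (form_N V)"
abbreviation "N01 \<equiv> part01m g (form_N V)"

context
  fixes q :: "('m, 'k cmat) form1" and c :: "'m chart" and p :: 'm
  assumes q: "one_form \<A> q" and c: "c \<in> \<A>" and p: "p \<in> fst c"
begin

lemma J_at: "linear (rot90 g c p)" "rot90 g c p (rot90 g c p v) = - v"
  using rot90_J[OF c p] by auto

lemma linear_q: "p' \<in> fst c \<Longrightarrow> linear (q c p')"
  and smooth_q: "smooth_on (snd c ` fst c) (\<lambda>z. q c (coord_inv c z) v)"
  using q c unfolding one_form_def by blast+

lemma linear_parts:
  "linear (N10 c p)" "linear (N01 c p)" "linear (part10m g q c p)" "linear (part01m g q c p)"
  using linear_typm[OF linear_form_N[OF c p] J_at(1)] linear_typm[OF linear_q[OF p] J_at(1)]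
  by (simp_all add: part10_typ[abs_def] part01m_typ[abs_def])

lemma type_parts:
  "N10 c p (rot90 g c p v) = \<i> \<odot> N10 c p v"
  "part10m g q c p (rot90 g c p v) = \<i> \<odot> part10m g q c p v"
  "N01 c p (rot90 g c p v) = (- \<i>) \<odot> N01 c p v"
  "part01m g q c p (rot90 g c p v) = (- \<i>) \<odot> part01m g q c p v"
  using typm_J[OF _ linear_form_N[OF c p] J_at(2)] typm_J[OF _ linear_q[OF p] J_at(2)]
  by (simp_all only: part10_typ part01m_typ) simp_all

lemma smooth_parts:
  "smooth_on (snd c ` fst c) (\<lambda>z. N10 c (coord_inv c z) v)"
  "smooth_on (snd c ` fst c) (\<lambda>z. N01 c (coord_inv c z) v)"
  "smooth_on (snd c ` fst c) (\<lambda>z. part10m g q c (coord_inv c z) v)"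
  "smooth_on (snd c ` fst c) (\<lambda>z. part01m g q c (coord_inv c z) v)"
  unfolding part10_typ part01m_typ
  by (intro smooth_typm c linear_form_N smooth_form_N linear_q smooth_q; assumption)+

lemma diff_parts:
  "(\<lambda>z. N10 c (coord_inv c z) v) differentiable (at (snd c p))"
  "(\<lambda>z. N01 c (coord_inv c z) v) differentiable (at (snd c p))"
  "(\<lambda>z. part10m g q c (coord_inv c z) v) differentiable (at (snd c p))"
  "(\<lambda>z. part01m g q c (coord_inv c z) v) differentiable (at (snd c p))"
  "(\<lambda>z. - form_N V c (coord_inv c z) v) differentiable (at (snd c p))"
  using p
  by (intro smooth_on_differentiable[OF chart_open(2)[OF c]] imageI smooth_parts
      smooth_on_uminus[OF chart_open(2)[OF c] smooth_form_N[OF c]]; assumption)+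

lemma split_N: "N10 c p' v + N01 c p' v = form_N V c p' v"
  and split_q: "part10m g q c p' v + part01m g q c p' v = q c p' v"
  by (simp_all only: part10_typ part01m_typ typm_sum)

text \<open>The term without \<zeta> cancels by the Gauss equation; it is written as an explicit 0
  to fit the five-coefficient pattern of \<open>laurent_mats_zero\<close>.\<close>

lemma curv_lax:
  assumes "\<zeta> \<noteq> 0"
  shows "curv (\<lambda>z v. lax q \<zeta> c (coord_inv c z) v) (snd c p) v w
    = 0 + inverse \<zeta> \<odot> (ext_deriv (conn_D V) N10 c p v w - wb (N10 c p) (part01m g q c p) v w
          + wb (part10m g q c p) (N01 c p) v w)
      + \<zeta> \<odot> (ext_deriv (conn_D V) N01 c p v w + wb (N10 c p) (part01m g q c p) v w
          - wb (part10m g q c p) (N01 c p) v w)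
      + (inverse (\<zeta>\<^sup>2) - 1) \<odot> (ext_deriv (conn_D V) (part10m g q) c p v w - wb (part10m g q c p) (part01m g q c p) v w)
      + (\<zeta>\<^sup>2 - 1) \<odot> (ext_deriv (conn_D V) (part01m g q) c p v w - wb (part10m g q c p) (part01m g q c p) v w)"
proof -
  let ?z = "snd c p"
  have cp: "coord_inv c ?z = p" by (rule coord_inv_snd[OF c p])
  have "lie (form_N V c p v) (form_N V c p w) = lie (N10 c p v + N01 c p v) (N10 c p w + N01 c p w)"
    by (simp add: split_N)
  also have "\<dots> = wb (N10 c p) (N01 c p) v w"
    using typed_form_lie[OF J_at linear_parts(1) type_parts(1), of v w]
      typed_form_lie[OF J_at linear_parts(2) type_parts(3), of v w] lie_commute[of "N01 c p v" "N10 c p w"]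
    by (simp add: lie_simps wb_def)
  finally have 0: "curv (\<lambda>z v. - form_N V c (coord_inv c z) v) ?z v w + wb (N10 c p) (N01 c p) v w = 0"
    by (simp add: curv_minus_form_N(1)[OF c p])
  show ?thesis
    unfolding ext_deriv_extd[where \<omega> = N10, OF c p diff_parts(1)] ext_deriv_extd[where \<omega> = N01, OF c p diff_parts(2)]
      ext_deriv_extd[where \<omega> = "part10m g q", OF c p diff_parts(3)] ext_deriv_extd[where \<omega> = "part01m g q", OF c p diff_parts(4)] lax_def
    using curv_lambda[where \<Theta> = "\<lambda>z v. - form_N V c (coord_inv c z) v" and n = "\<lambda>z v. N10 c (coord_inv c z) v"
        and m = "\<lambda>z v. N01 c (coord_inv c z) v" and a = "\<lambda>z v. part10m g q c (coord_inv c z) v"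
        and b = "\<lambda>z v. part01m g q c (coord_inv c z) v" and z = ?z and J = "rot90 g c p"
        and \<iota> = \<i> and \<kappa> = "- \<i>" and v = v and w = w and \<zeta> = \<zeta>]
      J_at linear_parts type_parts diff_parts assms 0
    unfolding cp by simp
qed

text \<open>The Codazzi equation split by type. Together with the equation for the Hodge dual, which
  involves the difference, it determines the derivatives of N10 and N01 separately.\<close>

lemma ext_deriv_N_sum: "ext_deriv (conn_D V) N10 c p v w + ext_deriv (conn_D V) N01 c p v w = 0"
proof -
  have "pd (\<lambda>z. form_N V c (coord_inv c z) w) (snd c p) v
    = pd (\<lambda>z. N10 c (coord_inv c z) w) (snd c p) v + pd (\<lambda>z. N01 c (coord_inv c z) w) (snd c p) v" for v w
    unfolding split_N[symmetric] by (rule pd_add[OF diff_parts(1,2)])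
  then show ?thesis
    using curv_minus_form_N(2)[OF c p, of v w] split_N
    unfolding ext_deriv_extd[where \<omega> = N10, OF c p diff_parts(1)] ext_deriv_extd[where \<omega> = N01, OF c p diff_parts(2)] extd_def
    by (simp add: wb_def lie_simps split_N[symmetric] algebra_simps)
qed

lemma hodge_N: "hodge g (form_N V) c p' v = (- \<i>) \<odot> N10 c p' v + \<i> \<odot> N01 c p' v"
  by (simp add: hodge_def part10_def part01_def vec_eq_iff field_simps)

lemma ext_deriv_hodge_N:
  "ext_deriv (conn_D V) (hodge g (form_N V)) c p v w
    = (- \<i>) \<odot> ext_deriv (conn_D V) N10 c p v w + \<i> \<odot> ext_deriv (conn_D V) N01 c p v w"
proof -
  have d: "(\<lambda>z. hodge g (form_N V) c (coord_inv c z) v) differentiable (at (snd c p))" for v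
    unfolding hodge_N by (intro differentiable_add differentiable_scale_mat diff_parts)
  have "pd (\<lambda>z. hodge g (form_N V) c (coord_inv c z) w) (snd c p) v
    = (- \<i>) \<odot> pd (\<lambda>z. N10 c (coord_inv c z) w) (snd c p) v + \<i> \<odot> pd (\<lambda>z. N01 c (coord_inv c z) w) (snd c p) v" for v w
    unfolding hodge_N by (simp add: pd_add pd_scale_mat differentiable_scale_mat diff_parts)
  note pdh = this
  have "hodge g (form_N V) c p' = (\<lambda>v. (- \<i>) \<odot> N10 c p' v + \<i> \<odot> N01 c p' v)" for p'
    by (rule ext) (rule hodge_N)
  then have wbh: "wb \<alpha> (hodge g (form_N V) c p') v w
    = (- \<i>) \<odot> wb \<alpha> (N10 c p') v w + \<i> \<odot> wb \<alpha> (N01 c p') v w" for \<alpha> p'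
    by (simp only: wb_combine_right)
  show ?thesis
    unfolding ext_deriv_extd[where \<omega> = "hodge g (form_N V)", OF c p d] ext_deriv_extd[where \<omega> = N10, OF c p diff_parts(1)] ext_deriv_extd[where \<omega> = N01, OF c p diff_parts(2)] extd_def
      pdh wbh
    by (simp add: vec_eq_iff algebra_simps)
qed

text \<open>The Hodge star acts as -\<i> on type (1,0) and as \<i> on type (0,1), and brackets of
  equal type vanish; two mixed terms are left.\<close>

lemma wedge_bracket_q_hodge:
  "wedge_bracket q (hodge g (form_N V)) c p v w
    = \<i> \<odot> (wb (part10m g q c p) (N01 c p) v w - wb (N10 c p) (part01m g q c p) v w)"
proof -
  have "wedge_bracket q (hodge g (form_N V)) c p v w
    = wb (\<lambda>v. part10m g q c p v + part01m g q c p v) (\<lambda>v. (- \<i>) \<odot> N10 c p v + \<i> \<odot> N01 c p v) v w"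
    by (simp add: wedge_bracket_def wb_def split_q hodge_N)
  moreover have "wb (part10m g q c p) (N10 c p) v w = 0" "wb (part01m g q c p) (N01 c p) v w = 0"
    using typed_form_wb[OF J_at linear_parts(3) type_parts(2) linear_parts(1) type_parts(1)]
      typed_form_wb[OF J_at linear_parts(4) type_parts(4) linear_parts(2) type_parts(3)] by auto
  ultimately show ?thesis
    by (simp add: wb_add_left wb_combine_right wb_commute[of "part01m g q c p" "N10 c p"] vec_eq_iff algebra_simps)
qed

lemma wedge_bracket_q_q:
  "(1/2) \<odot> wedge_bracket q q c p v w = wb (part10m g q c p) (part01m g q c p) v w"
proof -
  have "(1/2) \<odot> wedge_bracket q q c p v w = lie (q c p v) (q c p w)"
    using lie_commute[of "q c p w" "q c p v"] by (simp add: wedge_bracket_def vec_eq_iff)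
  also have "\<dots> = lie (part10m g q c p v + part01m g q c p v) (part10m g q c p w + part01m g q c p w)"
    by (simp add: split_q)
  also have "\<dots> = wb (part10m g q c p) (part01m g q c p) v w"
    using typed_form_lie[OF J_at linear_parts(3) type_parts(2), of v w]
      typed_form_lie[OF J_at linear_parts(4) type_parts(4), of v w]
      lie_commute[of "part01m g q c p v" "part10m g q c p w"]
    by (simp add: lie_simps wb_def)
  finally show ?thesis .
qed

end

text \<open>The Codazzi equation gives the sum and the harmonicity equation the difference of the
  derivatives of N10 and N01. Solving for both makes the coefficients of \<zeta> and \<zeta>^-1
  vanish; the equations for q take care of the other two.\<close>

lemma harmonic_flat:
  assumes h: "constrained_harmonic \<A> g V q" and c: "c \<in> \<A>" "p \<in> fst c" and \<zeta>: "\<zeta> \<noteq> 0"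
  shows "curv (\<lambda>z v. lax q \<zeta> c (coord_inv c z) v) (snd c p) v w = 0"
proof -
  note h' = h[unfolded constrained_harmonic_def]
  have form2_eqD: "\<alpha> c p v w = \<beta> c p v w" if "form2_eq \<A> \<alpha> \<beta>" "c \<in> \<A>" "p \<in> fst c"
    for \<alpha> \<beta> :: "('m, 'k cmat) form2" and c p v w
    using that unfolding form2_eq_def by (elim ballE allE) auto
  have q: "one_form \<A> q" by (rule conjunct1[OF h'])
  note f = q c
  have 1: "ext_deriv (conn_D V) (part10m g q) c p v w = wb (part10m g q c p) (part01m g q c p) v w"
    "ext_deriv (conn_D V) (part01m g q) c p v w = wb (part10m g q c p) (part01m g q c p) v w"
    using form2_eqD[OF conjunct1[OF conjunct2[OF conjunct2[OF h']]] c]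
      form2_eqD[OF conjunct1[OF conjunct2[OF conjunct2[OF conjunct2[OF h']]]] c]
    by (simp_all only: wedge_bracket_q_q[OF f])
  have "ext_deriv (conn_D V) (hodge g (form_N V)) c p v w = 2 \<odot> wedge_bracket q (hodge g (form_N V)) c p v w"
    by (rule form2_eqD[OF conjunct2[OF conjunct2[OF conjunct2[OF conjunct2[OF h']]]] c])
  then have e: "(- \<i>) \<odot> ext_deriv (conn_D V) N10 c p v w + \<i> \<odot> ext_deriv (conn_D V) N01 c p v w
    = 2 \<odot> (\<i> \<odot> (wb (part10m g q c p) (N01 c p) v w - wb (N10 c p) (part01m g q c p) v w))"
    unfolding ext_deriv_hodge_N[OF f] wedge_bracket_q_hodge[OF f] .
  define K L X Y where "K = ext_deriv (conn_D V) N10 c p v w" and "L = ext_deriv (conn_D V) N01 c p v w"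
    and "X = wb (part10m g q c p) (N01 c p) v w" and "Y = wb (N10 c p) (part01m g q c p) v w"
  have s: "K + L = 0" using ext_deriv_N_sum[OF f] by (simp add: K_def L_def)
  have "L $ i $ j = X $ i $ j - Y $ i $ j" for i j
  proof -
    have "- \<i> * K $ i $ j + \<i> * L $ i $ j = 2 * (\<i> * (X $ i $ j - Y $ i $ j))"
      using arg_cong[OF e, of "\<lambda>X. X $ i $ j"] by (simp add: K_def L_def X_def Y_def)
    moreover have "K $ i $ j = - L $ i $ j"
      using arg_cong[OF s, of "\<lambda>X. X $ i $ j"] by (simp add: eq_neg_iff_add_eq_0)
    ultimately have "2 * \<i> * L $ i $ j = 2 * \<i> * (X $ i $ j - Y $ i $ j)" by (simp add: algebra_simps)
    then show ?thesis by simp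
  qed
  then have L: "L = X - Y" by (simp add: vec_eq_iff)
  then have K: "K = Y - X" using s by (simp add: algebra_simps eq_neg_iff_add_eq_0[symmetric])
  show ?thesis
    unfolding curv_lax[OF f \<zeta>] 1 K_def[symmetric] L_def[symmetric] X_def[symmetric] Y_def[symmetric] K L by simp
qed

text \<open>Infinitely many values of \<zeta> already force the Laurent coefficients of the
  curvature to vanish, so flatness may be tested where r is defined.\<close>

lemma flat_harmonic:
  assumes q: "one_form \<A> q"
    and val: "\<And>c p v. c \<in> \<A> \<Longrightarrow> p \<in> fst c \<Longrightarrow>
        q c p v \<in> {X + Y | X Y. X \<in> wedge2 (V p) \<and> Y \<in> wedge2 (perp (V p))}"
    and Z: "infinite Z" "0 \<notin> Z"
    and flat: "\<And>c p v w \<zeta>. c \<in> \<A> \<Longrightarrow> p \<in> fst c \<Longrightarrow> \<zeta> \<in> Z \<Longrightarrow>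
        curv (\<lambda>z v. lax q \<zeta> c (coord_inv c z) v) (snd c p) v w = 0"
  shows "constrained_harmonic \<A> g V q"
proof -
  have main: "ext_deriv (conn_D V) (part10m g q) c p v w = (1/2) \<odot> wedge_bracket q q c p v w \<and>
    ext_deriv (conn_D V) (part01m g q) c p v w = (1/2) \<odot> wedge_bracket q q c p v w \<and>
    ext_deriv (conn_D V) (hodge g (form_N V)) c p v w = 2 \<odot> wedge_bracket q (hodge g (form_N V)) c p v w"
    if c: "c \<in> \<A>" "p \<in> fst c" for c p v w
  proof -
    note f = q c
    have "0 + inverse \<zeta> \<odot> (ext_deriv (conn_D V) N10 c p v w - wb (N10 c p) (part01m g q c p) v w
          + wb (part10m g q c p) (N01 c p) v w)
      + \<zeta> \<odot> (ext_deriv (conn_D V) N01 c p v w + wb (N10 c p) (part01m g q c p) v w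
          - wb (part10m g q c p) (N01 c p) v w)
      + (inverse (\<zeta>\<^sup>2) - 1) \<odot> (ext_deriv (conn_D V) (part10m g q) c p v w - wb (part10m g q c p) (part01m g q c p) v w)
      + (\<zeta>\<^sup>2 - 1) \<odot> (ext_deriv (conn_D V) (part01m g q) c p v w - wb (part10m g q c p) (part01m g q c p) v w) = 0"
      if "\<zeta> \<in> Z" for \<zeta>
    proof -
      have "\<zeta> \<noteq> 0" using that Z(2) by auto
      show ?thesis unfolding curv_lax[OF f \<open>\<zeta> \<noteq> 0\<close>, symmetric] by (rule flat[OF c that])
    qed
    from laurent_mats_zero[OF Z this]
    have z: "ext_deriv (conn_D V) N10 c p v w - wb (N10 c p) (part01m g q c p) v w
          + wb (part10m g q c p) (N01 c p) v w = 0"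
      "ext_deriv (conn_D V) N01 c p v w + wb (N10 c p) (part01m g q c p) v w
          - wb (part10m g q c p) (N01 c p) v w = 0"
      "ext_deriv (conn_D V) (part10m g q) c p v w - wb (part10m g q c p) (part01m g q c p) v w = 0"
      "ext_deriv (conn_D V) (part01m g q) c p v w - wb (part10m g q c p) (part01m g q c p) v w = 0"
      by blast+
    define X Y where "X = wb (part10m g q c p) (N01 c p) v w" and "Y = wb (N10 c p) (part01m g q c p) v w"
    have e: "ext_deriv (conn_D V) N10 c p v w = Y - X" "ext_deriv (conn_D V) N01 c p v w = X - Y"
      using z(1,2) by (simp_all add: X_def Y_def algebra_simps eq_diff_eq)
    have "ext_deriv (conn_D V) (hodge g (form_N V)) c p v w = 2 \<odot> wedge_bracket q (hodge g (form_N V)) c p v w"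
      unfolding ext_deriv_hodge_N[OF f] wedge_bracket_q_hodge[OF f] X_def[symmetric] Y_def[symmetric] e
      by (simp add: vec_eq_iff algebra_simps)
    then show ?thesis unfolding wedge_bracket_q_q[OF f] using z(3,4) by simp
  qed
  show ?thesis
    unfolding constrained_harmonic_def form2_eq_def
    by (intro conjI ballI allI q) (simp_all only: main val)
qed

end

section \<open>Gauged parts of the family\<close>

lemmas tendsto_matrix_mult = bounded_bilinear.tendsto[OF bounded_bilinear_matrix_mult]
lemmas tendsto_matrix_vector = bounded_bilinear.tendsto[OF bounded_bilinear_matrix_vector]
lemmas tendsto_scale_mat = bounded_bilinear.tendsto[OF bounded_bilinear_scale_mat]
lemmas tendsto_scale_vec = bounded_bilinear.tendsto[OF bounded_bilinear_scale]
lemmas tendsto_mink = bounded_bilinear.tendsto[OF bounded_bilinear_mink]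
lemmas tendsto_adj = bounded_linear.tendsto[OF bounded_linear_adj]

text \<open>The gauge-transformed \<open>(1,0)\<close>-part \<open>G\<close> has at most a double pole at \<open>0\<close> and is bounded at
  infinity, so Liouville's theorem leaves three coefficients, determined by the pole and by
  the values at \<open>1\<close> and \<open>-1\<close>.\<close>

lemma gauged_part:
  fixes G S dS :: "complex \<Rightarrow> 'k::finite cmat"
  assumes hol: "\<And>i j. (\<lambda>z. G z $ i $ j) holomorphic_on - {0}"
    and G0: "eventually (\<lambda>z. G z = S z ** (- N + inverse z \<odot> N + (inverse (z\<^sup>2) - 1) \<odot> q) ** adj (S z)
      - dS z ** adj (S z)) (at 0)"
    and Ginf: "eventually (\<lambda>z. G z = S z ** (- N + inverse z \<odot> N + (inverse (z\<^sup>2) - 1) \<odot> q) ** adj (S z)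
      - dS z ** adj (S z)) at_infinity"
    and S0: "(S \<longlongrightarrow> S0) (at 0)" and dS0: "(dS \<longlongrightarrow> dS0) (at 0)"
    and Sinf: "(S \<longlongrightarrow> Sinf) at_infinity" and dSinf: "(dS \<longlongrightarrow> dSinf) at_infinity"
    and G1: "G 1 = 0" and Gm: "G (- 1) = (- 2) \<odot> M"
  shows "\<And>z. z \<noteq> 0 \<Longrightarrow> G z = - M + inverse z \<odot> M + (inverse (z\<^sup>2) - 1) \<odot> (S0 ** q ** adj S0)"
    and "- M - S0 ** q ** adj S0 = Sinf ** (- N - q) ** adj Sinf - dSinf ** adj Sinf"
proof -
  \<comment> \<open>The coefficient of the double pole at 0. The matrix A0 defined next is the value
    at infinity, where N / z and q / z^2 have disappeared and - N - q remains.\<close>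
  define A2 where "A2 = S0 ** q ** adj S0"
  define A0 where "A0 = Sinf ** (- N - q) ** adj Sinf - dSinf ** adj Sinf"
  have "((\<lambda>z. S z ** ((- (z\<^sup>2)) \<odot> N + z \<odot> N + (1 - z\<^sup>2) \<odot> q) ** adj (S z) - z\<^sup>2 \<odot> (dS z ** adj (S z)))
    \<longlongrightarrow> S0 ** ((- (0\<^sup>2)) \<odot> N + 0 \<odot> N + (1 - 0\<^sup>2) \<odot> q) ** adj S0 - 0\<^sup>2 \<odot> (dS0 ** adj S0)) (at 0)"
    by (intro tendsto_diff tendsto_matrix_mult tendsto_add tendsto_scale_mat tendsto_adj S0 dS0 tendsto_intros)
  then have "((\<lambda>z. S z ** ((- (z\<^sup>2)) \<odot> N + z \<odot> N + (1 - z\<^sup>2) \<odot> q) ** adj (S z) - z\<^sup>2 \<odot> (dS z ** adj (S z)))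
    \<longlongrightarrow> A2) (at 0)"
    by (simp add: A2_def)
  moreover have "eventually (\<lambda>z. S z ** ((- (z\<^sup>2)) \<odot> N + z \<odot> N + (1 - z\<^sup>2) \<odot> q) ** adj (S z) - z\<^sup>2 \<odot> (dS z ** adj (S z))
    = z\<^sup>2 \<odot> G z) (at 0)"
    using G0 eventually_neq_at_within[of 0 0 UNIV]
  proof eventually_elim
    case (elim z)
    have h: "z\<^sup>2 \<odot> (S z ** X ** adj (S z) - Y) = S z ** (z\<^sup>2 \<odot> X) ** adj (S z) - z\<^sup>2 \<odot> Y" for X Y
      by (simp add: scale_mat_diff scale_mat_mult_left scale_mat_mult_right)
    have hv: "z\<^sup>2 \<odot> (- N + inverse z \<odot> N + (inverse (z\<^sup>2) - 1) \<odot> q) = (- (z\<^sup>2)) \<odot> N + z \<odot> N + (1 - z\<^sup>2) \<odot> q"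
      using elim(2) by (simp add: vec_eq_iff field_simps power2_eq_square)
    show ?case unfolding elim(1) h hv ..
  qed
  ultimately have l0: "((\<lambda>z. z\<^sup>2 \<odot> G z) \<longlongrightarrow> A2) (at 0)" by (rule Lim_transform_eventually)
  have i2: "((\<lambda>z::complex. inverse (z\<^sup>2)) \<longlongrightarrow> 0) at_infinity"
    using tendsto_mult[OF tendsto_inverse_0 tendsto_inverse_0] by (simp add: power2_eq_square)
  have "((\<lambda>z. S z ** (- N + inverse z \<odot> N + (inverse (z\<^sup>2) - 1) \<odot> q) ** adj (S z) - dS z ** adj (S z))
    \<longlongrightarrow> Sinf ** (- N + 0 \<odot> N + (0 - 1) \<odot> q) ** adj Sinf - dSinf ** adj Sinf) at_infinity"
    by (intro tendsto_diff tendsto_matrix_mult tendsto_add tendsto_scale_mat tendsto_adj Sinf dSinf tendsto_const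
        tendsto_inverse_0 i2)
  moreover have "- N + 0 \<odot> N + (0 - 1) \<odot> q = - N - q" by (simp add: vec_eq_iff)
  ultimately have "((\<lambda>z. S z ** (- N + inverse z \<odot> N + (inverse (z\<^sup>2) - 1) \<odot> q) ** adj (S z) - dS z ** adj (S z))
    \<longlongrightarrow> A0) at_infinity" by (simp only: A0_def)
  then have linf: "(G \<longlongrightarrow> A0) at_infinity"
    by (rule Lim_transform_eventually) (use Ginf in \<open>simp add: eq_commute\<close>)
  obtain A1 where A: "\<And>z. z \<noteq> 0 \<Longrightarrow> G z = A0 + inverse z \<odot> A1 + inverse (z\<^sup>2) \<odot> A2"
    using laurent_matrix[OF hol l0 linf] by blast
  \<comment> \<open>Two linear equations for A0 and A1: half their difference gives A1 = M, and then
    A0 = - M - A2. Compared with the definition of A0, the latter is the second claim.\<close>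
  have "A0 + A1 + A2 = 0" using A[of 1] G1 by simp
  moreover have "A0 - A1 + A2 = (- 2) \<odot> M" using A[of "- 1"] Gm by (simp add: vec_eq_iff)
  ultimately have e: "A0 $ i $ j + A1 $ i $ j + A2 $ i $ j = 0" "A0 $ i $ j - A1 $ i $ j + A2 $ i $ j = - 2 * M $ i $ j" for i j
    by (simp_all add: vec_eq_iff)
  have A1: "A1 $ i $ j = M $ i $ j" for i j
  proof -
    have "2 * A1 $ i $ j = 2 * M $ i $ j" using e[of i j] by algebra
    then show ?thesis by simp
  qed
  have A0: "A0 $ i $ j = - M $ i $ j - A2 $ i $ j" for i j
    using e(1)[of i j] A1[of i j] by algebra
  show "- M - S0 ** q ** adj S0 = Sinf ** (- N - q) ** adj Sinf - dSinf ** adj Sinf"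
    unfolding A0_def[symmetric] A2_def[symmetric] by (simp add: vec_eq_iff A0)
  show "G z = - M + inverse z \<odot> M + (inverse (z\<^sup>2) - 1) \<odot> (S0 ** q ** adj S0)" if "z \<noteq> 0" for z
    unfolding A[OF that] A2_def[symmetric] by (simp add: vec_eq_iff A0 A1 algebra_simps)
qed

text \<open>Near \<open>0\<close>, the function \<open>inverse z *s (A *v (S z *v u))\<close> has a limit that involves \<open>M *v (S0 *v u)\<close>;
  being odd, it can only tend to zero.\<close>

lemma gauged_part_kill:
  fixes G S dS :: "complex \<Rightarrow> 'k::finite cmat"
  assumes G: "\<And>z. z \<noteq> 0 \<Longrightarrow> G z = - M + inverse z \<odot> M + (inverse (z\<^sup>2) - 1) \<odot> A"
    and G0: "eventually (\<lambda>z. G z = S z ** (- N + inverse z \<odot> N + (inverse (z\<^sup>2) - 1) \<odot> q) ** adj (S z)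
      - dS z ** adj (S z)) (at 0)"
    and orth: "eventually (\<lambda>z. S z \<in> orth_group) (at 0)"
    and S0: "(S \<longlongrightarrow> S0) (at 0)" and dS0: "(dS \<longlongrightarrow> dS0) (at 0)"
    and even: "eventually (\<lambda>z. A *v (S (- z) *v u) = A *v (S z *v u)) (at 0)"
    and u: "N *v u = 0" "q *v u = 0"
  shows "M *v (S0 *v u) = 0"
proof -
  define E where "E z = inverse z *s (A *v (S z *v u))" for z
  define L where "L = - (M *v (S0 *v u))"
  have "((\<lambda>z. z *s (M *v (S z *v u)) - M *v (S z *v u) + z *s (A *v (S z *v u)) - z *s (dS z *v u))
    \<longlongrightarrow> 0 *s (M *v (S0 *v u)) - M *v (S0 *v u) + 0 *s (A *v (S0 *v u)) - 0 *s (dS0 *v u)) (at 0)"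
    by (intro tendsto_diff tendsto_add tendsto_scale_vec tendsto_matrix_vector S0 dS0 tendsto_const tendsto_ident_at)
  then have "((\<lambda>z. z *s (M *v (S z *v u)) - M *v (S z *v u) + z *s (A *v (S z *v u)) - z *s (dS z *v u)) \<longlongrightarrow> L) (at 0)"
    by (simp add: L_def)
  moreover have "eventually (\<lambda>z. z *s (M *v (S z *v u)) - M *v (S z *v u) + z *s (A *v (S z *v u)) - z *s (dS z *v u) = E z) (at 0)"
    using G0 orth eventually_neq_at_within[of 0 0 UNIV]
  proof eventually_elim
    case (elim z)
    have c: "adj (S z) *v (S z *v u) = u" by (simp add: matrix_vector_mul_assoc orth_group_adj_left[OF elim(2)])
    \<comment> \<open>N and q annihilate u, so only the derivative term of the gauged form is
      left.\<close>
    have 1: "G z *v (S z *v u) = - (dS z *v u)"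
      unfolding elim(1)
      by (simp add: matrix_vector_mult_diff_rdistrib matrix_vector_mul_assoc[symmetric] c
          matrix_vector_mult_add_rdistrib matrix_vector_minus_left scale_mat_vector u)
    have "G z *v (S z *v u) = - (M *v (S z *v u)) + inverse z *s (M *v (S z *v u))
      + (inverse (z\<^sup>2) - 1) *s (A *v (S z *v u))"
      unfolding G[OF elim(3)] 
      by (simp add: matrix_vector_mult_add_rdistrib matrix_vector_mult_diff_rdistrib matrix_vector_minus_left scale_mat_vector)
    then have eq: "- (dS z *v u) $ i = - (M *v (S z *v u)) $ i + inverse z * (M *v (S z *v u)) $ i
      + (inverse (z\<^sup>2) - 1) * (A *v (S z *v u)) $ i" for i
      unfolding 1 by (simp add: vec_eq_iff left_diff_distrib)
    \<comment> \<open>The two expressions for \<open>G z *v (S z *v u)\<close>, multiplied by z: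
      every term except E converges for an evident reason.\<close>
    have "z * (M *v (S z *v u)) $ i - (M *v (S z *v u)) $ i + z * (A *v (S z *v u)) $ i - z * (dS z *v u) $ i
      = inverse z * (A *v (S z *v u)) $ i" for i
    proof -
      define l where "l = inverse z"
      have "z * l = 1" "inverse (z\<^sup>2) = l * l" using elim(3) by (simp_all add: l_def power2_eq_square)
      with eq[of i] show ?thesis unfolding l_def[symmetric] by algebra
    qed
    then show ?case by (simp add: E_def vec_eq_iff)
  qed
  ultimately have E: "(E \<longlongrightarrow> L) (at 0)" by (rule Lim_transform_eventually)
  have "filterlim uminus (at 0) (at (0::complex))"
    using filtermap_at_minus[of "0::complex"] by (simp add: filterlim_def)
  then have "((\<lambda>z. E (- z)) \<longlongrightarrow> L) (at 0)" using E filterlim_compose by blast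
  moreover have "eventually (\<lambda>z. E (- z) = - E z) (at 0)"
    using even by eventually_elim (simp add: E_def vec_eq_iff)
  ultimately have "((\<lambda>z. - E z) \<longlongrightarrow> L) (at 0)" by (rule Lim_transform_eventually)
  moreover have "((\<lambda>z. - E z) \<longlongrightarrow> - L) (at 0)" using E by (rule tendsto_minus)
  ultimately have "L = - L" using tendsto_unique[OF trivial_limit_at] by blast
  then have "L = 0" by (simp add: vec_eq_iff)
  then show ?thesis by (simp add: L_def)
qed

section \<open>Dressing\<close>

lemma orth_group_limit:
  assumes lim: "(S \<longlongrightarrow> T) F" "F \<noteq> bot" and orth: "eventually (\<lambda>z. S z \<in> orth_group) F"
  shows "T \<in> orth_group"
  unfolding orth_group_def mem_Collect_eq
proof (intro allI)
  fix x y
  have "((\<lambda>z. mink (S z *v x) (S z *v y)) \<longlongrightarrow> mink (T *v x) (T *v y)) F"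
    by (intro tendsto_mink tendsto_matrix_vector lim tendsto_const)
  moreover have "eventually (\<lambda>z. mink (S z *v x) (S z *v y) = mink x y) F"
    using orth by eventually_elim (simp add: orth_group_mink)
  ultimately have "((\<lambda>z. mink x y) \<longlongrightarrow> mink (T *v x) (T *v y)) F" by (rule Lim_transform_eventually)
  then show "mink (T *v x) (T *v y) = mink x y" using tendsto_unique[OF lim(2) tendsto_const] by metis
qed

lemma Ad_Ad: "A \<in> orth_group \<Longrightarrow> B \<in> orth_group \<Longrightarrow> Ad A (Ad B X) = Ad (A ** B) X"
  by (simp add: Ad_def matrix_inv_mult_orth matrix_mul_assoc)

locale dressing = quadric_bundle \<A> g V
  for \<A> :: "'m::{t2_space,second_countable_topology} chart set" and g :: "'m metric"
    and V :: "'m \<Rightarrow> 'k::finite cvec set" +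
  fixes \<Delta>10 \<Delta>01 :: "'m \<Rightarrow> 'k cvec set" and q :: "('m, 'k cmat) form1"
    and r :: "complex \<Rightarrow> 'm \<Rightarrow> 'k cmat" and rinf :: "'m \<Rightarrow> 'k cmat" and D :: "complex set"
  assumes willmore: "constrained_Willmore \<A> g \<Delta>10 \<Delta>01 q"
    and V_qd: "qd_central_sphere_congruence \<A> g \<Delta>10 \<Delta>01 q V"
    and r_rational: "rational_family \<A> r D"
    and r_orth: "\<And>\<zeta> p. \<zeta> \<in> D \<Longrightarrow> r \<zeta> p \<in> orth_group"
    and D0: "0 \<in> D" and r_inf: "\<And>p. ((\<lambda>\<zeta>. r \<zeta> p) \<longlongrightarrow> rinf p) at_infinity" and D1: "1 \<in> D"
    and D_minus: "\<And>\<zeta>. \<zeta> \<in> D \<Longrightarrow> - \<zeta> \<in> D"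
    and r_twist: "\<And>\<zeta> p. \<zeta> \<in> D \<Longrightarrow> reflection p ** r \<zeta> p ** matrix_inv (reflection p) = r (- \<zeta>) p"
    and r_extends: "extends_by_metric_connections \<A> D (\<lambda>\<zeta>. gauge_conj (r \<zeta>) (conn_lambda g V q \<zeta>))"
    and r_det: "\<And>p. det_on4 (V p) (r 0 p) = det_on4 (V p) (rinf p)"
begin

text \<open>Everything later used about r is extracted here at once, so that the presentation P / Q
  does not reappear.\<close>

lemma rational_facts:
  shows D_ev: "open D" "eventually (\<lambda>\<zeta>. \<zeta> \<in> D) at_infinity"
    and D_inf: "infinite (D - {0})"
    and r_smooth: "\<zeta> \<in> D \<Longrightarrow> smooth_map \<A> UNIV (r \<zeta>)" and rinf_smooth: "smooth_map \<A> UNIV rinf"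
    and r_lim0: "((\<lambda>\<zeta>. r \<zeta> p) \<longlongrightarrow> r 0 p) (at 0)"
    and dr_lim0: "c \<in> \<A> \<Longrightarrow> p \<in> fst c \<Longrightarrow> ((\<lambda>\<zeta>. differential (r \<zeta>) c p v) \<longlongrightarrow> differential (r 0) c p v) (at 0)"
    and dr_liminf: "c \<in> \<A> \<Longrightarrow> p \<in> fst c \<Longrightarrow> ((\<lambda>\<zeta>. differential (r \<zeta>) c p v) \<longlongrightarrow> differential rinf c p v) at_infinity"
proof -
  obtain P and d :: nat and Q :: "complex poly" where Q: "Q \<noteq> 0" and P: "\<And>k. smooth_map \<A> UNIV (P k)"
    and D: "D = {\<zeta>. poly Q \<zeta> \<noteq> 0}"
    and r: "\<And>\<zeta> p. \<zeta> \<in> D \<Longrightarrow> r \<zeta> p = inverse (poly Q \<zeta>) \<odot> (\<Sum>k\<le>d. \<zeta> ^ k \<odot> P k p)"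
  proof -
    from r_rational obtain P :: "nat \<Rightarrow> 'm \<Rightarrow> 'k cmat" and d :: nat and Q :: "complex poly" where
      *: "Q \<noteq> 0 \<and> (\<forall>k. smooth_map \<A> UNIV (P k)) \<and>
        (\<forall>\<zeta>. poly Q \<zeta> = 0 \<longrightarrow> (\<exists>p. (\<Sum>k\<le>d. \<zeta> ^ k \<odot> P k p) \<noteq> 0)) \<and>
        D = {\<zeta>. poly Q \<zeta> \<noteq> 0} \<and>
        (\<forall>\<zeta>\<in>D. \<forall>p. r \<zeta> p = inverse (poly Q \<zeta>) \<odot> (\<Sum>k\<le>d. \<zeta> ^ k \<odot> P k p))"
      unfolding rational_family_def by (elim exE)
    show thesis by (rule that[of Q P d]) (use * in simp_all)
  qed
  have r': "r \<zeta> p = rat_mat Q d (\<lambda>k. P k p) \<zeta>" if "\<zeta> \<in> D" for \<zeta> p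
    by (simp add: r[OF that] rat_mat_def)
  have "D = - {\<zeta>. poly Q \<zeta> = 0}" by (auto simp: D)
  moreover have fin: "finite {\<zeta>. poly Q \<zeta> = 0}" using Q by (rule poly_roots_finite)
  ultimately show oD: "open D" by (simp add: finite_imp_closed open_Compl)
  show eD: "eventually (\<lambda>\<zeta>. \<zeta> \<in> D) at_infinity" using eventually_poly_nonzero[OF Q] by (simp add: D)
  have ev0: "eventually (\<lambda>\<zeta>. \<zeta> \<in> D) (at 0)" using oD D0 by (rule eventually_at_in_open')
  show "infinite (D - {0})"
  proof
    assume "finite (D - {0})"
    then have "finite (D - {0} \<union> insert 0 {\<zeta>. poly Q \<zeta> = 0})" using fin by simp
    moreover have "D - {0} \<union> insert 0 {\<zeta>. poly Q \<zeta> = 0} = UNIV" by (auto simp: D)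
    ultimately have "finite (UNIV :: complex set)" by (simp only:)
    then show False using infinite_UNIV_char_0[where 'a = complex] by simp
  qed
  have liminf: "(rat_mat Q d (\<lambda>k. P k p) \<longlongrightarrow> rinf p) at_infinity" for p
    by (rule Lim_transform_eventually[OF r_inf]) (use eD in eventually_elim, simp add: r')
  \<comment> \<open>A limit at every point bounds the degree of the numerator by that of Q uniformly
    over the surface, so the derivatives of the higher coefficients vanish too.\<close>
  have P0: "P k p = 0" if "k \<le> d" "degree Q < k" for k p
    using rat_mat_limit_infinity(1)[OF Q liminf] that by blast
  have rinf: "rinf p = rat_mat_inf Q d (\<lambda>k. P k p)" for p
    using rat_mat_limit_infinity(2)[OF Q liminf] by blast
  have sm: "smooth_on (snd c ` (fst c \<inter> UNIV)) (\<lambda>z. P k (coord_inv c z))" if "c \<in> \<A>" for c k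
    using smooth_map_on[OF P that] .
  have op: "open (snd c ` (fst c \<inter> UNIV))" if "c \<in> \<A>" for c using chart_open(2)[OF that] by simp
  show rs: "smooth_map \<A> UNIV (r \<zeta>)" if "\<zeta> \<in> D"
    by (rule smooth_mapI) (simp only: r'[OF that], rule smooth_on_rat_mat[OF op sm])
  show "smooth_map \<A> UNIV rinf"
    by (rule smooth_mapI) (simp only: rinf, rule smooth_on_rat_mat_inf[OF op sm])
  have Q0: "poly Q 0 \<noteq> 0" using D0 by (simp add: D)
  show "((\<lambda>\<zeta>. r \<zeta> p) \<longlongrightarrow> r 0 p) (at 0)"
    unfolding r'[OF D0]
    by (rule Lim_transform_eventually[OF rat_mat_tendsto[OF Q0]]) (use ev0 in eventually_elim, simp add: r')
  show "((\<lambda>\<zeta>. differential (r \<zeta>) c p v) \<longlongrightarrow> differential (r 0) c p v) (at 0)"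
    "((\<lambda>\<zeta>. differential (r \<zeta>) c p v) \<longlongrightarrow> differential rinf c p v) at_infinity"
    if c: "c \<in> \<A>" "p \<in> fst c"
  proof -
    let ?P = "\<lambda>k. pd (\<lambda>z. P k (coord_inv c z)) (snd c p) v"
    have dP: "(\<lambda>z. P k (coord_inv c z)) differentiable (at (snd c p))" for k
      using smooth_map_differentiable[OF P _ c(1)] c(2) by simp
    have dr: "differential (r \<zeta>) c p v = rat_mat Q d ?P \<zeta>" if "\<zeta> \<in> D" for \<zeta>
      unfolding differential_pd r'[OF that] by (rule pd_rat_mat[OF dP])
    show "((\<lambda>\<zeta>. differential (r \<zeta>) c p v) \<longlongrightarrow> differential (r 0) c p v) (at 0)"
      unfolding dr[OF D0]
      by (rule Lim_transform_eventually[OF rat_mat_tendsto[OF Q0]]) (use ev0 in eventually_elim, simp add: dr)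
    have "?P k = 0" if "k \<le> d" "degree Q < k" for k by (simp add: P0[OF that])
    then have "(rat_mat Q d ?P \<longlongrightarrow> rat_mat_inf Q d ?P) at_infinity" by (rule rat_mat_tendsto_infinity[OF Q])
    moreover have "differential rinf c p v = rat_mat_inf Q d ?P"
      unfolding differential_pd rinf by (rule pd_rat_mat_inf[OF dP])
    ultimately have "(rat_mat Q d ?P \<longlongrightarrow> differential rinf c p v) at_infinity" by simp
    then show "((\<lambda>\<zeta>. differential (r \<zeta>) c p v) \<longlongrightarrow> differential rinf c p v) at_infinity"
      by (rule Lim_transform_eventually) (use eD in eventually_elim, simp add: dr)
  qed
qed

lemma ev_D: "eventually (\<lambda>\<zeta>. \<zeta> \<in> D) (at 0)"
  by (rule eventually_at_in_open'[OF D_ev(1) D0])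

lemma ev_D_nonzero: "eventually (\<lambda>\<zeta>. \<zeta> \<in> D \<and> \<zeta> \<noteq> 0) (at 0)" "eventually (\<lambda>\<zeta>. \<zeta> \<in> D \<and> \<zeta> \<noteq> 0) at_infinity"
proof -
  show "eventually (\<lambda>\<zeta>. \<zeta> \<in> D \<and> \<zeta> \<noteq> 0) (at 0)"
    using ev_D eventually_neq_at_within[of 0 0 UNIV] by eventually_elim simp
  have "eventually (\<lambda>\<zeta> :: complex. \<zeta> \<noteq> 0) at_infinity"
    unfolding eventually_at_infinity by (rule exI[of _ 1]) auto
  with D_ev(2) show "eventually (\<lambda>\<zeta>. \<zeta> \<in> D \<and> \<zeta> \<noteq> 0) at_infinity" by eventually_elim simp
qed

lemma rinf_orth: "rinf p \<in> orth_group"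
  by (rule orth_group_limit[OF r_inf trivial_limit_at_infinity])
    (use D_ev(2) in eventually_elim, simp add: r_orth)

lemma reflection_r:
  assumes "\<zeta> \<in> D" shows "reflection p ** r \<zeta> p = r (- \<zeta>) p ** reflection p"
proof -
  have "matrix_inv (reflection p) = reflection p" by (rule matrix_inv_unique[OF reflection_reflection])
  then have "r (- \<zeta>) p ** reflection p = reflection p ** r \<zeta> p ** (reflection p ** reflection p)"
    using r_twist[OF assms, of p] by (simp add: matrix_mul_assoc)
  then show ?thesis by (simp add: reflection_reflection)
qed

text \<open>The twisting condition in the limit, where \<zeta> and -\<zeta> tend to the same point
  of the sphere.\<close>

lemma reflection_rinf: "reflection p ** rinf p = rinf p ** reflection p"
proof -
  have "((\<lambda>\<zeta>. reflection p ** r \<zeta> p) \<longlongrightarrow> reflection p ** rinf p) at_infinity"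
    by (intro tendsto_matrix_mult r_inf tendsto_const)
  moreover have "eventually (\<lambda>\<zeta>. reflection p ** r \<zeta> p = r (- \<zeta>) p ** reflection p) at_infinity"
    using D_ev(2) by eventually_elim (rule reflection_r)
  ultimately have 1: "((\<lambda>\<zeta>. r (- \<zeta>) p ** reflection p) \<longlongrightarrow> reflection p ** rinf p) at_infinity"
    by (rule Lim_transform_eventually)
  have "filterlim uminus at_infinity (at_infinity :: complex filter)"
    unfolding filterlim_iff eventually_at_infinity by (metis norm_minus_cancel)
  then have "((\<lambda>\<zeta>. r (- \<zeta>) p) \<longlongrightarrow> rinf p) at_infinity" using r_inf filterlim_compose by blast
  then have "((\<lambda>\<zeta>. r (- \<zeta>) p ** reflection p) \<longlongrightarrow> rinf p ** reflection p) at_infinity"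
    by (intro tendsto_matrix_mult tendsto_const)
  then show ?thesis using 1 tendsto_unique[OF trivial_limit_at_infinity] by blast
qed

definition S :: "complex \<Rightarrow> 'm \<Rightarrow> 'k cmat" where
  "S \<zeta> p = matrix_inv (r 1 p) ** r \<zeta> p"

definition Sinf :: "'m \<Rightarrow> 'k cmat" where
  "Sinf p = matrix_inv (r 1 p) ** rinf p"

definition Vhat :: "'m \<Rightarrow> 'k cvec set" where
  "Vhat p = (*v) (matrix_inv (r 1 p)) ` V p"

lemma r1_inv: "matrix_inv (r 1 p) \<in> orth_group" "r 1 p ** matrix_inv (r 1 p) = mat 1"
    "matrix_inv (r 1 p) ** r 1 p = mat 1" "smooth_map \<A> UNIV (\<lambda>p. matrix_inv (r 1 p))"
  using orth_group_matrix_inv[OF r_orth[OF D1]] matrix_inv_right[OF r_orth[OF D1]] matrix_inv_left[OF r_orth[OF D1]]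
    smooth_map_inv_orth[OF open_UNIV r_smooth[OF D1] r_orth[OF D1]] by auto

lemma S_orth: "\<zeta> \<in> D \<Longrightarrow> S \<zeta> p \<in> orth_group" and Sinf_orth: "Sinf p \<in> orth_group"
  unfolding S_def Sinf_def by (intro orth_group_mult r1_inv(1) r_orth rinf_orth; assumption)+

lemma S_smooth: "\<zeta> \<in> D \<Longrightarrow> smooth_map \<A> UNIV (S \<zeta>)" and Sinf_smooth: "smooth_map \<A> UNIV Sinf"
  unfolding S_def[abs_def] Sinf_def[abs_def]
  by (intro smooth_map_matrix_mult open_UNIV r1_inv(4) r_smooth rinf_smooth; assumption)+

lemma S_1: "S 1 p = mat 1"
  by (simp add: S_def r1_inv)

lemma S_lim: "((\<lambda>\<zeta>. S \<zeta> p) \<longlongrightarrow> S 0 p) (at 0)" "((\<lambda>\<zeta>. S \<zeta> p) \<longlongrightarrow> Sinf p) at_infinity"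
  unfolding S_def Sinf_def by (intro tendsto_matrix_mult tendsto_const r_lim0 r_inf)+

lemma dS_lim:
  assumes c: "c \<in> \<A>" "p \<in> fst c"
  shows "((\<lambda>\<zeta>. differential (S \<zeta>) c p v) \<longlongrightarrow> differential (S 0) c p v) (at 0)"
    and "((\<lambda>\<zeta>. differential (S \<zeta>) c p v) \<longlongrightarrow> differential Sinf c p v) at_infinity"
proof -
  have d: "(\<lambda>z. f (coord_inv c z)) differentiable (at (snd c p))" if "smooth_map \<A> UNIV f" for f :: "'m \<Rightarrow> 'k cmat"
    using smooth_map_differentiable[OF that open_UNIV c(1)] c(2) by simp
  let ?R = "\<lambda>p. matrix_inv (r 1 p)"
  have e: "differential (S \<zeta>) c p v = ?R p ** differential (r \<zeta>) c p v + differential ?R c p v ** r \<zeta> p" if "\<zeta> \<in> D" for \<zeta>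
    unfolding S_def[abs_def] by (rule differential_matrix_mult[OF d[OF r1_inv(4)] d[OF r_smooth[OF that]] c])
  have ei: "differential Sinf c p v = ?R p ** differential rinf c p v + differential ?R c p v ** rinf p"
    unfolding Sinf_def[abs_def] by (rule differential_matrix_mult[OF d[OF r1_inv(4)] d[OF rinf_smooth] c])
  have "((\<lambda>\<zeta>. ?R p ** differential (r \<zeta>) c p v + differential ?R c p v ** r \<zeta> p)
    \<longlongrightarrow> differential (S 0) c p v) (at 0)"
    unfolding e[OF D0] by (intro tendsto_add tendsto_matrix_mult tendsto_const dr_lim0 c r_lim0)
  then show "((\<lambda>\<zeta>. differential (S \<zeta>) c p v) \<longlongrightarrow> differential (S 0) c p v) (at 0)"
    by (rule Lim_transform_eventually) (use ev_D in eventually_elim, simp add: e)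
  have "((\<lambda>\<zeta>. ?R p ** differential (r \<zeta>) c p v + differential ?R c p v ** r \<zeta> p)
    \<longlongrightarrow> differential Sinf c p v) at_infinity"
    unfolding ei by (intro tendsto_add tendsto_matrix_mult tendsto_const dr_liminf c r_inf)
  then show "((\<lambda>\<zeta>. differential (S \<zeta>) c p v) \<longlongrightarrow> differential Sinf c p v) at_infinity"
    by (rule Lim_transform_eventually) (use D_ev(2) in eventually_elim, simp add: e)
qed

lemma Vhat_bundle: "subbundle \<A> 4 Vhat" "nondegenerate (Vhat p)"
proof -
  show "subbundle \<A> 4 Vhat"
    unfolding Vhat_def[abs_def] by (rule subbundle_image[OF V r1_inv(4) r1_inv(1)])
  have "splits (Vhat p)" unfolding Vhat_def by (rule splits_image(1)[OF r1_inv(1) V_splits])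
  then show "nondegenerate (Vhat p)" by (simp add: splits_def)
qed

end

sublocale dressing \<subseteq> hat: quadric_bundle \<A> g Vhat
  by unfold_locales (rule Vhat_bundle)+

context dressing
begin

lemma hat_reflection: "hat.reflection p = matrix_inv (r 1 p) ** reflection p ** r 1 p"
proof -
  have "oproj (Vhat p) = matrix_inv (r 1 p) ** oproj (V p) ** r 1 p"
    unfolding Vhat_def splits_image(2)[OF r1_inv(1) V_splits] matrix_inv_matrix_inv[OF r_orth[OF D1]] ..
  then show ?thesis
    by (simp add: hat.reflection_def reflection_def matrix_ring_simps r1_inv(3))
qed

text \<open>For S the twisting condition relates two different reflections, that of Vhat on the left
  and that of V on the right.\<close>

lemma hat_reflection_S: "\<zeta> \<in> D \<Longrightarrow> hat.reflection p ** S \<zeta> p = S (- \<zeta>) p ** reflection p"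
  using reflection_r[of \<zeta> p] by (simp add: hat_reflection S_def matrix_mul_assoc[symmetric])
    (metis matrix_mul_assoc matrix_mul_lid r1_inv(2))

lemma hat_reflection_Sinf: "hat.reflection p ** Sinf p = Sinf p ** reflection p"
  using reflection_rinf[of p] by (simp add: hat_reflection Sinf_def matrix_mul_assoc[symmetric])
    (metis matrix_mul_assoc matrix_mul_lid r1_inv(2))

text \<open>V and Vhat are the fixed spaces of reflections that T intertwines. It follows that
  \<open>S 0\<close> and \<open>Sinf\<close> carry V to the same bundle as the inverse of
  \<open>r 1\<close> does.\<close>

lemma Vhat_image:
  assumes T: "T \<in> orth_group" and com: "hat.reflection p ** T = T ** reflection p"
  shows "Vhat p = (*v) T ` V p"
proof -
  have a: "hat.reflection p *v (T *v x) = T *v (reflection p *v x)" for x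
    by (simp add: matrix_vector_mul_assoc com)
  have "T *v x \<in> Vhat p \<longleftrightarrow> x \<in> V p" for x
  proof -
    have "T *v (reflection p *v x) = T *v x \<longleftrightarrow> reflection p *v x = x"
      by (metis T matrix_inv_left matrix_vector_mul_assoc matrix_vector_mul_lid)
    then show ?thesis unfolding hat.reflection_fix[symmetric] reflection_fix[symmetric] a .
  qed
  moreover have "x = T *v (matrix_inv T *v x)" for x
    by (simp add: matrix_vector_mul_assoc matrix_inv_right[OF T])
  ultimately show ?thesis by (metis (no_types, lifting) image_iff set_eqI)
qed

lemma Vhat_S0: "Vhat p = (*v) (S 0 p) ` V p" and Vhat_Sinf: "Vhat p = (*v) (Sinf p) ` V p"
  using Vhat_image[OF S_orth[OF D0]] hat_reflection_S[OF D0] Vhat_image[OF Sinf_orth hat_reflection_Sinf] by simp_all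

lemma r_preserves: "(*v) (r 0 p) ` V p \<subseteq> V p" "(*v) (rinf p) ` V p \<subseteq> V p"
proof -
  have "T *v x \<in> V p" if "reflection p ** T = T ** reflection p" "x \<in> V p" for T x
    using that(2) unfolding reflection_fix[symmetric]
    by (simp add: matrix_vector_mul_assoc that(1)) (simp add: matrix_vector_mul_assoc[symmetric])
  then show "(*v) (r 0 p) ` V p \<subseteq> V p" "(*v) (rinf p) ` V p \<subseteq> V p"
    using reflection_r[OF D0, of p] reflection_rinf[of p] by auto
qed

end

lemma filterlim_inverse_at_0: "filterlim inverse (at (0::complex)) at_infinity"
proof -
  have "eventually (\<lambda>z :: complex. inverse z \<noteq> 0) at_infinity"
    unfolding eventually_at_infinity by (rule exI[of _ 1]) auto
  then show ?thesis using tendsto_inverse_0 by (simp add: filterlim_at)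
qed

section \<open>The gauged connection form and its two types\<close>

context dressing
begin

lemma q_form: "one_form \<A> q"
  and surf: "complexified_surface \<A> g \<Delta>10 \<Delta>01"
  using willmore by (simp_all add: constrained_Willmore_def)

lemma q10_wedge: "c \<in> \<A> \<Longrightarrow> p \<in> fst c \<Longrightarrow> part10m g q c p v \<in> wedge2 (\<Delta>01 p)"
  and q01_wedge: "c \<in> \<A> \<Longrightarrow> p \<in> fst c \<Longrightarrow> part01m g q c p v \<in> wedge2 (\<Delta>10 p)"
  using willmore unfolding constrained_Willmore_def by blast+

lemma csc: "central_sphere_congruence \<A> g \<Delta>10 \<Delta>01 V" and harmonic: "constrained_harmonic \<A> g V q"
  using V_qd by (simp_all add: qd_central_sphere_congruence_def)

lemma \<Delta>10: "vec.subspace (\<Delta>10 p)" "vec.dim (\<Delta>10 p) = 2" "isotropic (\<Delta>10 p)" "\<Delta>10 p \<subseteq> V p"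
  and \<Delta>01: "vec.subspace (\<Delta>01 p)" "vec.dim (\<Delta>01 p) = 2" "isotropic (\<Delta>01 p)" "\<Delta>01 p \<subseteq> V p"
  and \<Delta>_meet: "vec.dim (\<Delta>10 p \<inter> \<Delta>01 p) = 1"
proof -
  show s: "vec.subspace (\<Delta>10 p)" "vec.dim (\<Delta>10 p) = 2" "isotropic (\<Delta>10 p)"
    "vec.subspace (\<Delta>01 p)" "vec.dim (\<Delta>01 p) = 2" "isotropic (\<Delta>01 p)" "vec.dim (\<Delta>10 p \<inter> \<Delta>01 p) = 1"
    using surf by (simp_all add: complexified_surface_def subbundle_def)
  have sum: "{x + y | x y. x \<in> \<Delta>10 p \<and> y \<in> \<Delta>01 p} \<subseteq> V p"
    using csc by (simp add: central_sphere_congruence_def)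
  show "\<Delta>10 p \<subseteq> V p"
  proof
    fix x assume "x \<in> \<Delta>10 p"
    then have "x + 0 \<in> {x + y | x y. x \<in> \<Delta>10 p \<and> y \<in> \<Delta>01 p}" using vec.subspace_0[OF s(4)] by blast
    then show "x \<in> V p" using sum by auto
  qed
  show "\<Delta>01 p \<subseteq> V p"
  proof
    fix x assume "x \<in> \<Delta>01 p"
    then have "0 + x \<in> {x + y | x y. x \<in> \<Delta>10 p \<and> y \<in> \<Delta>01 p}" using vec.subspace_0[OF s(1)] by blast
    then show "x \<in> V p" using sum by auto
  qed
qed

lemma V_dim: "vec.subspace (V p)" "vec.dim (V p) = 4"
  using V by (simp_all add: subbundle_def)

lemma N10_kill: "c \<in> \<A> \<Longrightarrow> p \<in> fst c \<Longrightarrow> u \<in> \<Delta>01 p \<Longrightarrow> N10 c p v *v u = 0"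
  and N01_kill: "c \<in> \<A> \<Longrightarrow> p \<in> fst c \<Longrightarrow> u \<in> \<Delta>10 p \<Longrightarrow> N01 c p v *v u = 0"
  using csc unfolding central_sphere_congruence_def by blast+

definition gauged :: "complex \<Rightarrow> ('m, 'k cmat) form1" where
  "gauged \<zeta> c p v = S \<zeta> p ** lax q \<zeta> c p v ** matrix_inv (S \<zeta> p)
    + S \<zeta> p ** differential (\<lambda>x. matrix_inv (S \<zeta> x)) c p v"

lemma diff_at:
  assumes "c \<in> \<A>" "p \<in> fst c" "smooth_map \<A> UNIV f"
  shows "(\<lambda>z. f (coord_inv c z)) differentiable (at (snd c p))"
  using smooth_map_differentiable[OF assms(3) open_UNIV assms(1)] assms(2) by simp

lemma smooth_S_inv: "\<zeta> \<in> D \<Longrightarrow> smooth_map \<A> UNIV (\<lambda>x. matrix_inv (S \<zeta> x))"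
  by (rule smooth_map_inv_orth[OF open_UNIV S_smooth S_orth])

lemma smooth_r_inv: "\<zeta> \<in> D \<Longrightarrow> smooth_map \<A> UNIV (\<lambda>x. matrix_inv (r \<zeta> x))"
  by (rule smooth_map_inv_orth[OF open_UNIV r_smooth r_orth])

text \<open>The hypothesis concerns the gauge by r; the further gauge by the inverse of
  \<open>r 1\<close> does not depend on \<zeta> and so preserves holomorphy. Connection forms are
  recovered by evaluating the connections on constant sections.\<close>

lemma gauged_extension:
  assumes c: "c \<in> \<A>" "p \<in> fst c"
  obtains G :: "complex \<Rightarrow> real^2 \<Rightarrow> 'k cmat" where "\<And>v i j. (\<lambda>\<zeta>. G \<zeta> v $ i $ j) holomorphic_on - {0}"
    and "\<And>\<zeta> v. \<zeta> \<in> D \<Longrightarrow> \<zeta> \<noteq> 0 \<Longrightarrow> G \<zeta> v = gauged \<zeta> c p v"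
proof -
  from r_extends obtain \<Gamma> :: "complex \<Rightarrow> ('m, 'k cmat) form1" where
    *: "(\<forall>\<zeta>. \<zeta> \<noteq> 0 \<longrightarrow> one_form \<A> (\<Gamma> \<zeta>) \<and> metric_connection \<A> (conn (\<Gamma> \<zeta>))) \<and>
        (\<forall>c\<in>\<A>. \<forall>p\<in>fst c. \<forall>v i j. (\<lambda>\<zeta>. \<Gamma> \<zeta> c p v $ i $ j) holomorphic_on - {0}) \<and>
        (\<forall>\<zeta>\<in>D - {0}. \<forall>W \<sigma>. open W \<longrightarrow> smooth_map \<A> W \<sigma> \<longrightarrow>
           (\<forall>c\<in>\<A>. \<forall>p\<in>fst c \<inter> W. \<forall>v. conn (\<Gamma> \<zeta>) \<sigma> c p v = gauge_conj (r \<zeta>) (conn_lambda g V q \<zeta>) \<sigma> c p v))"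
    unfolding extends_by_metric_connections_def by (elim exE)
  have hol: "(\<lambda>\<zeta>. \<Gamma> \<zeta> c p v $ i $ j) holomorphic_on - {0}" for v i j
    using * c by simp
  have eq: "conn (\<Gamma> \<zeta>) \<sigma> c p v = gauge_conj (r \<zeta>) (conn_lambda g V q \<zeta>) \<sigma> c p v"
    if "\<zeta> \<in> D" "\<zeta> \<noteq> 0" "smooth_map \<A> UNIV \<sigma>" for \<zeta> \<sigma> v
    using *[THEN conjunct2, THEN conjunct2, rule_format, of \<zeta> UNIV \<sigma> c p v] that c by simp
  let ?R = "matrix_inv (r 1 p)" and ?dr1 = "differential (r 1) c p"
  define G where "G \<zeta> v = ?R ** \<Gamma> \<zeta> c p v ** r 1 p + ?R ** ?dr1 v" for \<zeta> v
  have "(\<lambda>\<zeta>. G \<zeta> v $ i $ j) holomorphic_on - {0}" for v i j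
  proof -
    have "(\<lambda>\<zeta>. (\<Sum>k\<in>UNIV. (\<Sum>l\<in>UNIV. ?R $ i $ l * \<Gamma> \<zeta> c p v $ l $ k) * r 1 p $ k $ j) + (?R ** ?dr1 v) $ i $ j)
      holomorphic_on - {0}"
      by (intro holomorphic_intros hol)
    then show ?thesis by (simp add: G_def matrix_matrix_mult_def)
  qed
  moreover have "G \<zeta> v = gauged \<zeta> c p v" if \<zeta>: "\<zeta> \<in> D" "\<zeta> \<noteq> 0" for \<zeta> v
  proof -
    note d = diff_at[OF c]
    let ?ri = "\<lambda>x. matrix_inv (r \<zeta> x)"
    have \<Gamma>: "\<Gamma> \<zeta> c p v = r \<zeta> p ** (differential ?ri c p v + lax q \<zeta> c p v ** ?ri p)"
    proof (rule matrix_eq_vectorI)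
      fix u
      have sm: "smooth_map \<A> UNIV (\<lambda>x. ?ri x *v u)"
        by (intro smooth_map_matrix_vector open_UNIV smooth_r_inv \<zeta> smooth_map_const)
      have "differential (\<lambda>x. ?ri x *v u) c p v = differential ?ri c p v *v u"
        using differential_matrix_vector[OF d[OF smooth_r_inv[OF \<zeta>(1)]] d[OF smooth_map_const] c, of u v]
        by (simp add: differential_pd)
      then have "conn_lambda g V q \<zeta> (\<lambda>x. ?ri x *v u) c p v = differential ?ri c p v *v u + lax q \<zeta> c p v *v (?ri p *v u)"
        by (simp add: conn_lambda_eq[OF c d[OF sm]])
      moreover have "conn (\<Gamma> \<zeta>) (\<lambda>_. u) c p v = \<Gamma> \<zeta> c p v *v u"
        by (simp add: conn_def differential_pd)
      ultimately show "\<Gamma> \<zeta> c p v *v u = (r \<zeta> p ** (differential ?ri c p v + lax q \<zeta> c p v ** ?ri p)) *v u"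
        using eq[OF \<zeta> smooth_map_const[of UNIV u], of v]
        by (simp add: gauge_conj_def matrix_vector_mul_assoc[symmetric] matrix_vector_mult_add_rdistrib)
    qed
    have Si: "matrix_inv (S \<zeta> x) = ?ri x ** r 1 x" for x
      unfolding S_def by (simp add: matrix_inv_mult_orth[OF r1_inv(1) r_orth[OF \<zeta>(1)]] matrix_inv_matrix_inv[OF r_orth[OF D1]])
    have dSi: "differential (\<lambda>x. matrix_inv (S \<zeta> x)) c p v = ?ri p ** ?dr1 v + differential ?ri c p v ** r 1 p"
      unfolding Si by (rule differential_matrix_mult[OF d[OF smooth_r_inv[OF \<zeta>(1)]] d[OF r_smooth[OF D1]] c])
    have "?R ** r \<zeta> p ** ?ri p ** ?dr1 v = ?R ** ?dr1 v"
      using matrix_inv_right[OF r_orth[OF \<zeta>(1)], of p] by (metis matrix_mul_assoc matrix_mul_rid)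
    then show ?thesis
      unfolding G_def gauged_def \<Gamma> unfolding dSi unfolding Si unfolding S_def by (simp add: matrix_ring_simps)
  qed
  ultimately show thesis by (rule that)
qed

text \<open>Differentiating S S^-1 = 1 moves the derivative from the inverse to S, whose limits at
  both ends are given by \<open>dS_lim\<close>, and \<open>adj\<close> removes the remaining
  inverses.\<close>

lemma gauged_eq:
  assumes c: "c \<in> \<A>" "p \<in> fst c" and \<zeta>: "\<zeta> \<in> D"
  shows "gauged \<zeta> c p v = S \<zeta> p ** lax q \<zeta> c p v ** adj (S \<zeta> p) - differential (S \<zeta>) c p v ** adj (S \<zeta> p)"
proof -
  have "differential (\<lambda>x. S \<zeta> x ** matrix_inv (S \<zeta> x)) c p v
    = S \<zeta> p ** differential (\<lambda>x. matrix_inv (S \<zeta> x)) c p v + differential (S \<zeta>) c p v ** matrix_inv (S \<zeta> p)"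
    by (rule differential_matrix_mult[OF diff_at[OF c S_smooth[OF \<zeta>]] diff_at[OF c smooth_S_inv[OF \<zeta>]] c])
  moreover have "differential (\<lambda>x. S \<zeta> x ** matrix_inv (S \<zeta> x)) c p v = 0"
    by (simp add: matrix_inv_right[OF S_orth[OF \<zeta>]] differential_pd)
  ultimately have "S \<zeta> p ** differential (\<lambda>x. matrix_inv (S \<zeta> x)) c p v = - (differential (S \<zeta>) c p v ** matrix_inv (S \<zeta> p))"
    by (simp add: eq_neg_iff_add_eq_0)
  then show ?thesis by (simp add: gauged_def matrix_inv_orth[OF S_orth[OF \<zeta>]])
qed

lemma gauged_1: "c \<in> \<A> \<Longrightarrow> p \<in> fst c \<Longrightarrow> gauged 1 c p v = 0"
  using split_N[OF q_form, of c p p v] by (simp add: gauged_def S_1 lax_def differential_pd)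

text \<open>At \<zeta> = -1 the original connection is D_V - N_V, which is d conjugated by the
  reflection of V. By twisting at 1, S (-1) is the reflection of Vhat times that of V, so the gauged
  connection is d conjugated by the reflection of Vhat, the value at -1 of the family of
  Vhat.\<close>

lemma gauged_minus_1:
  assumes c: "c \<in> \<A>" "p \<in> fst c"
  shows "gauged (- 1) c p v = (- 2) \<odot> form_N Vhat c p v"
proof -
  let ?h = "hat.reflection" and ?d = "differential reflection c p v" and ?dh = "differential hat.reflection c p v"
  have S: "S (- 1) x = ?h x ** reflection x" for x
    using hat_reflection_S[OF D1, of x] reflection_reflection[of x]
    by (simp add: S_1) (metis matrix_mul_assoc matrix_mul_rid)
  have Si: "matrix_inv (S (- 1) x) = reflection x ** ?h x" for x
    by (rule matrix_inv_unique) (simp add: S matrix_mul_assoc; metis matrix_mul_assoc matrix_mul_rid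
        reflection_reflection hat.reflection_reflection)
  have dSi: "differential (\<lambda>x. matrix_inv (S (- 1) x)) c p v = reflection p ** ?dh + ?d ** ?h p"
    unfolding Si by (rule differential_matrix_mult[OF diff_at[OF c smooth_reflection] diff_at[OF c hat.smooth_reflection] c])
  have N: "form_N V c p v = (- 1/2) \<odot> (reflection p ** ?d)" "form_N Vhat c p v = (- 1/2) \<odot> (?h p ** ?dh)"
    by (simp_all add: form_N_nform[OF c] hat.form_N_nform[OF c] nform_def coord_inv_snd[OF c] differential_pd)
  have lax: "lax q (- 1) c p v = reflection p ** ?d"
    using split_N[OF q_form c, of p v] by (simp add: lax_def vec_eq_iff N(1)) (simp add: eq_neg_iff_add_eq_0 field_simps)
  have anti: "?d ** reflection p = - (reflection p ** ?d)"
    using rho_pd[OF chart_open(2)[OF c(1)] refl_at(1)[OF c(1)] refl_at(2), of "snd c p" v] c(2)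
    by (simp add: differential_pd coord_inv_snd[OF c])
  have rr: "reflection p ** (reflection p ** X) = X" for X
    by (simp add: matrix_mul_assoc reflection_reflection)
  have "gauged (- 1) c p v = ?h p ** (reflection p ** (reflection p ** ?d)) ** reflection p ** ?h p
    + ?h p ** (reflection p ** (reflection p ** ?dh)) + ?h p ** (reflection p ** ?d) ** ?h p"
    unfolding gauged_def lax unfolding dSi unfolding Si unfolding S by (simp add: matrix_ring_simps)
  also have "\<dots> = ?h p ** (?d ** reflection p) ** ?h p + ?h p ** ?dh + ?h p ** (reflection p ** ?d) ** ?h p"
    by (simp only: rr) (simp add: matrix_mul_assoc)
  also have "\<dots> = ?h p ** ?dh" by (simp add: anti matrix_ring_simps)
  finally show ?thesis by (simp add: N(2) scale_mat_scale)
qed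

lemma typm_lax:
  assumes c: "c \<in> \<A>" "p \<in> fst c"
  shows "typm \<i> (rot90 g c p) (lax q \<zeta> c p) v = - N10 c p v + inverse \<zeta> \<odot> N10 c p v + (inverse (\<zeta>\<^sup>2) - 1) \<odot> part10m g q c p v"
    and "typm (- \<i>) (rot90 g c p) (lax q \<zeta> c p) v = - N01 c p v + \<zeta> \<odot> N01 c p v + (\<zeta>\<^sup>2 - 1) \<odot> part01m g q c p v"
proof -
  note t = type_parts[OF q_form c]
  have l: "lax q \<zeta> c p = (\<lambda>v. - form_N V c p v + (inverse \<zeta> \<odot> N10 c p v + \<zeta> \<odot> N01 c p v
      + (inverse (\<zeta>\<^sup>2) - 1) \<odot> part10m g q c p v + (\<zeta>\<^sup>2 - 1) \<odot> part01m g q c p v))"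
    by (rule ext) (simp add: lax_def)
  have 1: "typm \<i> (rot90 g c p) (N10 c p) v = N10 c p v" "typm (- \<i>) (rot90 g c p) (N10 c p) v = 0"
    "typm \<i> (rot90 g c p) (part10m g q c p) v = part10m g q c p v" "typm (- \<i>) (rot90 g c p) (part10m g q c p) v = 0"
    using typm_same[of \<i> "N10 c p" "rot90 g c p" v] typm_same[of \<i> "part10m g q c p" "rot90 g c p" v] t(1,2) by simp_all
  have 2: "typm (- \<i>) (rot90 g c p) (N01 c p) v = N01 c p v" "typm \<i> (rot90 g c p) (N01 c p) v = 0"
    "typm (- \<i>) (rot90 g c p) (part01m g q c p) v = part01m g q c p v" "typm \<i> (rot90 g c p) (part01m g q c p) v = 0"
    using typm_same[of "- \<i>" "N01 c p" "rot90 g c p" v] typm_same[of "- \<i>" "part01m g q c p" "rot90 g c p" v] t(3,4) by simp_all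
  show "typm \<i> (rot90 g c p) (lax q \<zeta> c p) v = - N10 c p v + inverse \<zeta> \<odot> N10 c p v + (inverse (\<zeta>\<^sup>2) - 1) \<odot> part10m g q c p v"
    unfolding l typm_add typm_minus typm_scale 1 2 by (simp add: part10_typ)
  show "typm (- \<i>) (rot90 g c p) (lax q \<zeta> c p) v = - N01 c p v + \<zeta> \<odot> N01 c p v + (\<zeta>\<^sup>2 - 1) \<odot> part01m g q c p v"
    unfolding l typm_add typm_minus typm_scale 1 2 by (simp add: part01m_typ)
qed

lemma typm_gauged:
  assumes c: "c \<in> \<A>" "p \<in> fst c" and \<zeta>: "\<zeta> \<in> D"
  shows "typm \<iota> J (gauged \<zeta> c p) v = S \<zeta> p ** typm \<iota> J (lax q \<zeta> c p) v ** adj (S \<zeta> p)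
    - typm \<iota> J (differential (S \<zeta>) c p) v ** adj (S \<zeta> p)"
proof -
  have e: "gauged \<zeta> c p = (\<lambda>v. S \<zeta> p ** lax q \<zeta> c p v ** adj (S \<zeta> p) - mat 1 ** differential (S \<zeta>) c p v ** adj (S \<zeta> p))"
    by (rule ext) (simp add: gauged_eq[OF c \<zeta>])
  show ?thesis unfolding e typm_diff typm_mult by simp
qed

lemma tendsto_typm:
  assumes "\<And>v. ((\<lambda>x. f x v) \<longlongrightarrow> h v) F"
  shows "((\<lambda>x. typm \<iota> J (f x) v) \<longlongrightarrow> typm \<iota> J h v) F"
  unfolding typed_part_def by (intro tendsto_scale_mat tendsto_diff tendsto_const assms)

text \<open>\<open>S (- \<zeta>) p *v u\<close> is the mirror image of
  \<open>S \<zeta> p *v u\<close> in Vhat. Both have the same component in Vhat, and a bivector of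
  Vhat sees nothing else.\<close>

lemma hat_even:
  assumes "A \<in> wedge2 (Vhat p)" "\<zeta> \<in> D" "u \<in> V p"
  shows "A *v (S (- \<zeta>) p *v u) = A *v (S \<zeta> p *v u)"
proof -
  let ?x = "S \<zeta> p *v u"
  have "A *v (?x - oproj (Vhat p) *v ?x) = 0"
    by (rule wedge2_kill_perp[OF assms(1) oproj_perp_in[OF hat.V_splits]])
  then have "A *v (hat.reflection p *v ?x) = A *v ?x"
    by (simp add: hat.reflection_vector matrix_vector_mult_diff_distrib matrix_vector_scale vec_eq_iff)
  moreover have "hat.reflection p *v ?x = S (- \<zeta>) p *v u"
    using hat_reflection_S[OF assms(2), of p] assms(3)
    by (simp add: matrix_vector_mul_assoc) (simp add: matrix_vector_mul_assoc[symmetric] reflection_fix[THEN iffD2])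
  ultimately show ?thesis by simp
qed

abbreviation "hN10 \<equiv> part10m g (form_N Vhat)"
abbreviation "hN01 \<equiv> part01m g (form_N Vhat)"

lemma Ad_adj: "T \<in> orth_group \<Longrightarrow> Ad T X = T ** X ** adj T"
  by (simp add: Ad_def matrix_inv_orth)

lemma Ad_q10_Vhat: "c \<in> \<A> \<Longrightarrow> p \<in> fst c \<Longrightarrow> Ad (S 0 p) (part10m g q c p v) \<in> wedge2 (Vhat p)"
  using Ad_wedge2[OF S_orth[OF D0] q10_wedge] wedge2_mono[of "(*v) (S 0 p) ` \<Delta>01 p" "Vhat p"]
    \<Delta>01(4)[of p] Vhat_S0[of p] by blast

lemma Ad_q01_Vhat: "c \<in> \<A> \<Longrightarrow> p \<in> fst c \<Longrightarrow> Ad (Sinf p) (part01m g q c p v) \<in> wedge2 (Vhat p)"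
  using Ad_wedge2[OF Sinf_orth q01_wedge] wedge2_mono[of "(*v) (Sinf p) ` \<Delta>10 p" "Vhat p"]
    \<Delta>10(4)[of p] Vhat_Sinf[of p] by blast

text \<open>\<open>gauged_part\<close> and \<open>gauged_part_kill\<close> with the pole at 0. The
  latter applies to u in \<Delta>01: N10 kills u by the definition of a central sphere congruence,
  and the (1,0)-part of q does because its values are bivectors of the isotropic plane that contains
  u.\<close>

lemma hat_parts10:
  assumes c: "c \<in> \<A>" "p \<in> fst c"
  shows "\<And>\<zeta>. \<zeta> \<in> D \<Longrightarrow> \<zeta> \<noteq> 0 \<Longrightarrow> typm \<i> (rot90 g c p) (gauged \<zeta> c p) v
      = - hN10 c p v + inverse \<zeta> \<odot> hN10 c p v + (inverse (\<zeta>\<^sup>2) - 1) \<odot> Ad (S 0 p) (part10m g q c p v)"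
    and "- hN10 c p v - Ad (S 0 p) (part10m g q c p v)
      = Sinf p ** (- N10 c p v - part10m g q c p v) ** adj (Sinf p)
        - typm \<i> (rot90 g c p) (differential Sinf c p) v ** adj (Sinf p)"
    and "\<And>u. u \<in> \<Delta>01 p \<Longrightarrow> hN10 c p v *v (S 0 p *v u) = 0"
proof -
  let ?J = "rot90 g c p"
  obtain G where hol: "\<And>v i j. (\<lambda>\<zeta>. G \<zeta> v $ i $ j) holomorphic_on - {0}"
    and G: "\<And>\<zeta> v. \<zeta> \<in> D \<Longrightarrow> \<zeta> \<noteq> 0 \<Longrightarrow> G \<zeta> v = gauged \<zeta> c p v"
    using gauged_extension[OF c] by blast
  define H where "H \<zeta> = typm \<i> ?J (G \<zeta>) v" for \<zeta>
  have HG: "H \<zeta> = typm \<i> ?J (gauged \<zeta> c p) v" if "\<zeta> \<in> D" "\<zeta> \<noteq> 0" for \<zeta>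
    using G[OF that] by (simp add: H_def typed_part_def)
  have Hhol: "(\<lambda>\<zeta>. H \<zeta> $ i $ j) holomorphic_on - {0}" for i j
    unfolding H_def typed_part_def scale_mat_nth vector_minus_component by (intro holomorphic_intros hol)
  let ?rhs = "\<lambda>\<zeta>. S \<zeta> p ** (- N10 c p v + inverse \<zeta> \<odot> N10 c p v + (inverse (\<zeta>\<^sup>2) - 1) \<odot> part10m g q c p v) ** adj (S \<zeta> p)
      - typm \<i> ?J (differential (S \<zeta>) c p) v ** adj (S \<zeta> p)"
  have Heq: "H \<zeta> = ?rhs \<zeta>" if "\<zeta> \<in> D \<and> \<zeta> \<noteq> 0" for \<zeta>
    using that by (simp add: HG typm_gauged[OF c] typm_lax[OF c])
  have ev0: "eventually (\<lambda>\<zeta>. H \<zeta> = ?rhs \<zeta>) (at 0)" using ev_D_nonzero(1) by eventually_elim (rule Heq)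
  have evinf: "eventually (\<lambda>\<zeta>. H \<zeta> = ?rhs \<zeta>) at_infinity" using ev_D_nonzero(2) by eventually_elim (rule Heq)
  have H1: "H 1 = 0"
    unfolding HG[OF D1 one_neq_zero] by (simp add: typed_part_def gauged_1[OF c])
  have "- 1 \<in> D" using D_minus[OF D1] .
  then have Hm: "H (- 1) = (- 2) \<odot> hN10 c p v"
    by (simp add: HG typed_part_def gauged_minus_1[OF c] part10_typ vec_eq_iff)
  note dl = tendsto_typm[OF dS_lim(1)[OF c], where \<iota> = \<i> and J = ?J and v = v]
    tendsto_typm[OF dS_lim(2)[OF c], where \<iota> = \<i> and J = ?J and v = v]
  note gp = gauged_part[OF Hhol ev0 evinf S_lim(1) dl(1) S_lim(2) dl(2) H1 Hm]
  show "typm \<i> ?J (gauged \<zeta> c p) v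
      = - hN10 c p v + inverse \<zeta> \<odot> hN10 c p v + (inverse (\<zeta>\<^sup>2) - 1) \<odot> Ad (S 0 p) (part10m g q c p v)"
    if "\<zeta> \<in> D" "\<zeta> \<noteq> 0" for \<zeta>
    unfolding HG[OF that, symmetric] Ad_adj[OF S_orth[OF D0]] by (rule gp(1)[OF that(2)])
  show "- hN10 c p v - Ad (S 0 p) (part10m g q c p v)
      = Sinf p ** (- N10 c p v - part10m g q c p v) ** adj (Sinf p)
        - typm \<i> ?J (differential Sinf c p) v ** adj (Sinf p)"
    unfolding Ad_adj[OF S_orth[OF D0]] by (rule gp(2))
  show "hN10 c p v *v (S 0 p *v u) = 0" if u: "u \<in> \<Delta>01 p" for u
  proof (rule gauged_part_kill[OF gp(1) ev0 _ S_lim(1) dl(1)])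
    show "eventually (\<lambda>\<zeta>. S \<zeta> p \<in> orth_group) (at 0)" using ev_D by eventually_elim (rule S_orth)
    have w: "S 0 p ** part10m g q c p v ** adj (S 0 p) \<in> wedge2 (Vhat p)"
      using Ad_q10_Vhat[OF c] by (simp add: Ad_adj[OF S_orth[OF D0]])
    show "eventually (\<lambda>\<zeta>. (S 0 p ** part10m g q c p v ** adj (S 0 p)) *v (S (- \<zeta>) p *v u)
        = (S 0 p ** part10m g q c p v ** adj (S 0 p)) *v (S \<zeta> p *v u)) (at 0)"
      using ev_D by eventually_elim (rule hat_even[OF w], use u \<Delta>01(4) in auto)
    show "N10 c p v *v u = 0" by (rule N10_kill[OF c u])
    show "part10m g q c p v *v u = 0" by (rule wedge2_kill_isotropic[OF \<Delta>01(3) q10_wedge[OF c] u])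
  qed
qed

text \<open>This type has its pole at infinity. Replacing \<zeta> by 1/z exchanges the two ends, and
  with them the roles of \<open>S 0\<close> and \<open>Sinf\<close>.\<close>

lemma hat_parts01:
  assumes c: "c \<in> \<A>" "p \<in> fst c"
  shows "\<And>\<zeta>. \<zeta> \<in> D \<Longrightarrow> \<zeta> \<noteq> 0 \<Longrightarrow> typm (- \<i>) (rot90 g c p) (gauged \<zeta> c p) v
      = - hN01 c p v + \<zeta> \<odot> hN01 c p v + (\<zeta>\<^sup>2 - 1) \<odot> Ad (Sinf p) (part01m g q c p v)"
    and "- hN01 c p v - Ad (Sinf p) (part01m g q c p v)
      = S 0 p ** (- N01 c p v - part01m g q c p v) ** adj (S 0 p)
        - typm (- \<i>) (rot90 g c p) (differential (S 0) c p) v ** adj (S 0 p)"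
    and "\<And>u. u \<in> \<Delta>10 p \<Longrightarrow> hN01 c p v *v (Sinf p *v u) = 0"
proof -
  let ?J = "rot90 g c p"
  obtain G where hol: "\<And>v i j. (\<lambda>\<zeta>. G \<zeta> v $ i $ j) holomorphic_on - {0}"
    and G: "\<And>\<zeta> v. \<zeta> \<in> D \<Longrightarrow> \<zeta> \<noteq> 0 \<Longrightarrow> G \<zeta> v = gauged \<zeta> c p v"
    using gauged_extension[OF c] by blast
  define H where "H z = typm (- \<i>) ?J (G (inverse z)) v" for z
  have HG: "H z = typm (- \<i>) ?J (gauged (inverse z) c p) v" if "inverse z \<in> D" "z \<noteq> 0" for z
    using G[OF that(1)] that(2) by (simp add: H_def typed_part_def)
  have Hhol: "(\<lambda>z. H z $ i $ j) holomorphic_on - {0}" for i j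
  proof -
    have "(\<lambda>z. G (inverse z) w $ i $ j) holomorphic_on - {0}" for w
    proof -
      have "(inverse :: complex \<Rightarrow> complex) holomorphic_on - {0}" by (intro holomorphic_intros) auto
      moreover have "inverse ` (- {0 :: complex}) \<subseteq> - {0}" by auto
      ultimately show ?thesis using holomorphic_on_compose_gen[OF _ hol[of w i j]] by (simp add: o_def)
    qed
    then show ?thesis
      unfolding H_def typed_part_def scale_mat_nth vector_minus_component by (intro holomorphic_intros)
  qed
  let ?rhs = "\<lambda>z. S (inverse z) p ** (- N01 c p v + inverse z \<odot> N01 c p v + (inverse (z\<^sup>2) - 1) \<odot> part01m g q c p v) ** adj (S (inverse z) p)
      - typm (- \<i>) ?J (differential (S (inverse z)) c p) v ** adj (S (inverse z) p)"
  have Heq: "H z = ?rhs z" if "inverse z \<in> D \<and> inverse z \<noteq> 0" for z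
    using that by (simp add: HG typm_gauged[OF c] typm_lax[OF c] power_inverse)
  have evD: "eventually (\<lambda>z. inverse z \<in> D \<and> inverse z \<noteq> 0) (at 0)" "eventually (\<lambda>z. inverse z \<in> D \<and> inverse z \<noteq> 0) at_infinity"
    using eventually_compose_filterlim[OF ev_D_nonzero(2) filterlim_inverse_at_infinity]
      eventually_compose_filterlim[OF ev_D_nonzero(1) filterlim_inverse_at_0] by blast+
  have ev0: "eventually (\<lambda>z. H z = ?rhs z) (at 0)" using evD(1) by eventually_elim (rule Heq)
  have evinf: "eventually (\<lambda>z. H z = ?rhs z) at_infinity" using evD(2) by eventually_elim (rule Heq)
  have H1: "H 1 = 0" using HG[of 1] D1 by (simp add: typed_part_def gauged_1[OF c])
  have "- 1 \<in> D" using D_minus[OF D1] .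
  then have Hm: "H (- 1) = (- 2) \<odot> hN01 c p v"
    by (simp add: HG typed_part_def gauged_minus_1[OF c] part01m_typ vec_eq_iff)
  have Sl: "((\<lambda>z. S (inverse z) p) \<longlongrightarrow> Sinf p) (at 0)" "((\<lambda>z. S (inverse z) p) \<longlongrightarrow> S 0 p) at_infinity"
    by (rule filterlim_compose[OF S_lim(2) filterlim_inverse_at_infinity])
      (rule filterlim_compose[OF S_lim(1) filterlim_inverse_at_0])
  have dl: "((\<lambda>z. typm (- \<i>) ?J (differential (S (inverse z)) c p) v) \<longlongrightarrow> typm (- \<i>) ?J (differential Sinf c p) v) (at 0)"
    "((\<lambda>z. typm (- \<i>) ?J (differential (S (inverse z)) c p) v) \<longlongrightarrow> typm (- \<i>) ?J (differential (S 0) c p) v) at_infinity"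
    by (rule filterlim_compose[OF tendsto_typm[OF dS_lim(2)[OF c]] filterlim_inverse_at_infinity])
      (rule filterlim_compose[OF tendsto_typm[OF dS_lim(1)[OF c]] filterlim_inverse_at_0])
  note gp = gauged_part[OF Hhol ev0 evinf Sl(1) dl(1) Sl(2) dl(2) H1 Hm]
  show "typm (- \<i>) ?J (gauged \<zeta> c p) v
      = - hN01 c p v + \<zeta> \<odot> hN01 c p v + (\<zeta>\<^sup>2 - 1) \<odot> Ad (Sinf p) (part01m g q c p v)"
    if "\<zeta> \<in> D" "\<zeta> \<noteq> 0" for \<zeta>
    using gp(1)[of "inverse \<zeta>"] HG[of "inverse \<zeta>"] that by (simp add: Ad_adj[OF Sinf_orth] power_inverse)
  show "- hN01 c p v - Ad (Sinf p) (part01m g q c p v)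
      = S 0 p ** (- N01 c p v - part01m g q c p v) ** adj (S 0 p)
        - typm (- \<i>) ?J (differential (S 0) c p) v ** adj (S 0 p)"
    unfolding Ad_adj[OF Sinf_orth] by (rule gp(2))
  show "hN01 c p v *v (Sinf p *v u) = 0" if u: "u \<in> \<Delta>10 p" for u
  proof (rule gauged_part_kill[OF gp(1) ev0 _ Sl(1) dl(1)])
    show "eventually (\<lambda>z. S (inverse z) p \<in> orth_group) (at 0)" using evD(1) by eventually_elim (simp add: S_orth)
    have w: "Sinf p ** part01m g q c p v ** adj (Sinf p) \<in> wedge2 (Vhat p)"
      using Ad_q01_Vhat[OF c] by (simp add: Ad_adj[OF Sinf_orth])
    show "eventually (\<lambda>z. (Sinf p ** part01m g q c p v ** adj (Sinf p)) *v (S (inverse (- z)) p *v u)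
        = (Sinf p ** part01m g q c p v ** adj (Sinf p)) *v (S (inverse z) p *v u)) (at 0)"
      using evD(1) by eventually_elim (use hat_even[OF w, of "inverse _" u] u \<Delta>10(4) in auto)
    show "N01 c p v *v u = 0" by (rule N01_kill[OF c u])
    show "part01m g q c p v *v u = 0" by (rule wedge2_kill_isotropic[OF \<Delta>10(3) q01_wedge[OF c] u])
  qed
qed

end

section \<open>Isotropic line and plane bundles\<close>

context quadric_bundle
begin

text \<open>N_V anticommutes with the reflection and so maps its fixed space into the eigenspace of
  -1.\<close>

lemma form_N_perp:
  assumes c: "c \<in> \<A>" "p \<in> fst c" and u: "u \<in> V p"
  shows "form_N V c p v *v u \<in> perp (V p)"
proof -
  let ?d = "pd (refl_at c) (snd c p) v"
  have p: "coord_inv c (snd c p) = p" by (rule coord_inv_snd[OF c])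
  have anti: "?d ** reflection p = - (reflection p ** ?d)"
    using rho_pd[OF chart_open(2)[OF c(1)] refl_at(1)[OF c(1)] refl_at(2), of "snd c p" v] c(2) by (simp add: p)
  have N: "form_N V c p v = (- 1/2) \<odot> (reflection p ** ?d)"
    by (simp add: form_N_nform[OF c] nform_def p)
  have rr: "reflection p ** (reflection p ** X) = X" for X
    by (simp add: matrix_mul_assoc reflection_reflection)
  have "reflection p ** form_N V c p v = (- 1/2) \<odot> ?d"
    by (simp only: N scale_mat_mult_right rr)
  moreover have "form_N V c p v ** reflection p = (- 1/2) \<odot> (reflection p ** (?d ** reflection p))"
    by (simp only: N scale_mat_mult_left matrix_mul_assoc)
  moreover have "\<dots> = - ((- 1/2) \<odot> ?d)"
    by (simp only: anti matrix_minus_right rr scale_mat_minus)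
  ultimately have "reflection p ** form_N V c p v = - (form_N V c p v ** reflection p)"
    by simp
  then have "reflection p *v (form_N V c p v *v u) = - (form_N V c p v *v (reflection p *v u))"
    by (simp add: matrix_vector_mul_assoc matrix_vector_minus_left)
  then have "oproj (V p) *v (form_N V c p v *v u) = 0"
    using u by (simp add: reflection_fix[THEN iffD2] reflection_vector[of p "form_N V c p v *v u"] vec_eq_iff)
  then show ?thesis by (simp add: oproj_kill_iff[OF V_splits])
qed

lemma typm_vector: "typm \<iota> J \<omega> v *v u = typv \<iota> J (\<lambda>v. \<omega> v *v u) v"
  by (simp add: typed_part_def scale_mat_vector matrix_vector_mult_diff_rdistrib vec_eq_iff right_diff_distrib)

lemma mink_sections:
  assumes c: "c \<in> \<A>" "p \<in> fst c \<inter> W" and W: "open W" "smooth_map \<A> W \<sigma>" "smooth_map \<A> W \<tau>"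
    and iso: "\<And>x. x \<in> W \<Longrightarrow> mink (\<sigma> x) (\<tau> x) = 0"
  shows "mink (typv \<iota> J (differential \<sigma> c p) v) (\<tau> p) = - mink (\<sigma> p) (typv \<iota> J (differential \<tau> c p) v)"
proof -
  have p: "p \<in> fst c" using c by blast
  have d: "(\<lambda>z. \<sigma> (coord_inv c z)) differentiable (at (snd c p))" "(\<lambda>z. \<tau> (coord_inv c z)) differentiable (at (snd c p))"
    by (rule smooth_map_differentiable[OF W(2,1) c] smooth_map_differentiable[OF W(3,1) c])+
  have 0: "mink (\<sigma> p) (differential \<tau> c p v) + mink (differential \<sigma> c p v) (\<tau> p) = 0" for v
  proof -
    have "pd (\<lambda>z. mink (\<sigma> (coord_inv c z)) (\<tau> (coord_inv c z))) (snd c p) v = pd (\<lambda>z. 0) (snd c p) v"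
      by (rule pd_cong[OF chart_open_image[OF c(1) W(1)]]) (use c iso coord_inv_in'[OF c(1)] in auto)
    then show ?thesis
      unfolding differential_pd using pd_bilinear[OF bounded_bilinear_mink d] by (simp add: coord_inv_snd[OF c(1) p])
  qed
  have "mink (\<sigma> p) (differential \<tau> c p v) = - mink (differential \<sigma> c p v) (\<tau> p)" for v
    using 0[of v] by (simp add: eq_neg_iff_add_eq_0)
  then show ?thesis by (simp add: typed_part_def mink_simps)
qed

text \<open>In other words the part of D_V of the given type preserves E. By maximality only
  orthogonality to E is needed, and N_V contributes nothing to it. The line E \<inter> F has a
  spanning section a whose derivative of this type stays in E, and isotropy shifts derivatives
  between the two factors of a pairing.\<close>

lemma isotropic_section:
  fixes E F :: "'m \<Rightarrow> 'k cvec set"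
  assumes E: "subbundle \<A> 2 E" "\<And>p. isotropic (E p)" "\<And>p. E p \<subseteq> V p"
    and maximal: "\<And>p x. x \<in> V p \<Longrightarrow> (\<And>y. y \<in> E p \<Longrightarrow> mink x y = 0) \<Longrightarrow> x \<in> E p"
    and EF: "subbundle \<A> 1 (\<lambda>p. E p \<inter> F p)"
    and deriv: "\<And>W a. open W \<Longrightarrow> smooth_map \<A> W a \<Longrightarrow> (\<And>x. x \<in> W \<Longrightarrow> a x \<in> E x \<inter> F x) \<Longrightarrow> p \<in> W \<Longrightarrow>
      typv \<iota> (rot90 g c p) (differential a c p) v \<in> E p"
    and c: "c \<in> \<A>" "p \<in> fst c \<inter> W" and W: "open W" "smooth_map \<A> W \<tau>" "\<And>x. x \<in> W \<Longrightarrow> \<tau> x \<in> E x"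
  shows "typv \<iota> (rot90 g c p) (differential \<tau> c p) v - typm \<iota> (rot90 g c p) (form_N V c p) v *v \<tau> p \<in> E p"
proof (rule maximal)
  let ?J = "rot90 g c p"
  have p: "p \<in> fst c" "p \<in> W" using c by auto
  have sV: "vec.subspace (V p)" using V by (simp add: subbundle_def)
  have sE: "vec.subspace (E p)" "vec.dim (E p) = 2" using E(1) by (simp_all add: subbundle_def)
  have iso: "mink x y = 0" if "x \<in> E p'" "y \<in> E p'" for x y p' using E(2)[of p'] that by (auto simp: isotropic_def)
  have "differential \<tau> c p v - form_N V c p v *v \<tau> p \<in> V p" for v
    by (rule form_N_section[OF c W(1,2)]) (use W(3) E(3) in blast)
  note h = this
  have "typv \<iota> ?J (\<lambda>v. differential \<tau> c p v - form_N V c p v *v \<tau> p) v \<in> V p"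
    unfolding typed_part_def by (rule vec.subspace_scale[OF sV vec.subspace_diff[OF sV h vec.subspace_scale[OF sV h]]])
  also have "typv \<iota> ?J (\<lambda>v. differential \<tau> c p v - form_N V c p v *v \<tau> p) v
    = typv \<iota> ?J (differential \<tau> c p) v - typm \<iota> ?J (form_N V c p) v *v \<tau> p"
    unfolding typm_vector by (simp add: typed_part_def vec_eq_iff algebra_simps)
  finally show "typv \<iota> ?J (differential \<tau> c p) v - typm \<iota> ?J (form_N V c p) v *v \<tau> p \<in> V p" .
  fix y assume y: "y \<in> E p"
  have "mink (form_N V c p w *v \<tau> p) y = 0" for w
    using form_N_perp[OF c(1) p(1), of "\<tau> p" w] W(3)[OF p(2)] E(3) y by (auto simp: perp_def)
  then have "mink (typm \<iota> ?J (form_N V c p) v *v \<tau> p) y = 0"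
    unfolding typm_vector by (simp add: typed_part_def mink_simps)
  moreover have "mink (typv \<iota> ?J (differential \<tau> c p) v) y = 0"
  proof -
    obtain W1 s where W1: "open W1" "p \<in> W1" "\<And>i. i < 1 \<Longrightarrow> smooth_map \<A> W1 (s i)"
      "\<And>x. x \<in> W1 \<Longrightarrow> E x \<inter> F x = vec.span ((\<lambda>i. s i x) ` {..<1::nat})"
      by (rule subbundle_local[OF EF, of p]) (rule that)
    define a where "a = s 0"
    have EFa: "E x \<inter> F x = vec.span {a x}" if "x \<in> W1" for x
      using W1(4)[OF that] by (simp add: a_def lessThan_Suc)
    have sa: "smooth_map \<A> W1 a" using W1(3)[of 0] by (simp add: a_def)
    have aEF: "a x \<in> E x \<inter> F x" if "x \<in> W1" for x
      unfolding EFa[OF that] by (rule vec.span_base) simp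
    have a0: "a p \<noteq> 0"
    proof
      assume "a p = 0"
      then have "E p \<inter> F p = vec.span {}" using EFa[OF W1(2)] by simp
      then have "vec.dim (E p \<inter> F p) = 0"
        using vec.dim_span_eq_card_independent[OF vec.independent_empty] by simp
      moreover have "vec.dim (E p \<inter> F p) = 1" using EF unfolding subbundle_def by blast
      ultimately show False by simp
    qed
    have ap: "a p \<in> E p" using aEF[OF W1(2)] by blast
    let ?da = "typv \<iota> ?J (differential a c p) v" and ?dt = "typv \<iota> ?J (differential \<tau> c p) v"
    have da: "?da \<in> E p" by (rule deriv[OF W1(1) sa aEF W1(2)])
    let ?W = "W \<inter> W1"
    have oW: "open ?W" using W(1) W1(1) by blast
    have pW: "p \<in> fst c \<inter> ?W" using p W1(2) by blast
    have sm: "smooth_map \<A> ?W \<tau>" "smooth_map \<A> ?W a"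
      by (rule smooth_map_subset[OF W(2)] smooth_map_subset[OF sa], blast)+
    have ta: "mink ?dt (a p) = 0"
    proof -
      have "mink ?dt (a p) = - mink (\<tau> p) ?da"
        by (rule mink_sections[OF c(1) pW oW sm]) (use W(3) aEF iso in blast)
      then show ?thesis using iso[OF W(3)[OF p(2)] da] by simp
    qed
    have tt: "mink ?dt (\<tau> p) = 0"
    proof -
      have "mink ?dt (\<tau> p) = - mink (\<tau> p) ?dt"
        by (rule mink_sections[OF c(1) pW oW sm(1) sm(1)]) (use W(3) iso in blast)
      then show ?thesis by (simp add: mink_commute[of "\<tau> p"] eq_neg_iff_add_eq_0)
    qed
    show ?thesis
    proof (cases "\<tau> p \<in> vec.span {a p}")
      case True
      \<comment> \<open>Here \<tau> and a fail to span E at p. So y is extended to a section b of E,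
        the derivative is shifted from \<tau> to b, \<tau> p is replaced by a multiple of a p, and
        the derivative is shifted on to a.\<close>
      then obtain k where k: "\<tau> p = k *s a p" by (auto simp: vec.span_singleton)
      obtain W2 t where W2: "open W2" "p \<in> W2" "\<And>i. i < 2 \<Longrightarrow> smooth_map \<A> W2 (t i)"
        "\<And>x. x \<in> W2 \<Longrightarrow> E x = vec.span ((\<lambda>i. t i x) ` {..<2::nat})"
        by (rule subbundle_local[OF E(1), of p]) (rule that)
      have two: "{..<2::nat} = {0, 1}" by auto
      have Et: "E x = vec.span {t 0 x, t 1 x}" if "x \<in> W2" for x using W2(4)[OF that] by (simp add: two)
      obtain y0 y1 where y01: "y = y0 *s t 0 p + y1 *s t 1 p"
        using y unfolding Et[OF W2(2)] vec_span_insert_iff by blast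
      define b where "b x = y0 *s t 0 x + y1 *s t 1 x" for x
      have bE: "b x \<in> E x" if "x \<in> W2" for x
        unfolding Et[OF that] vec_span_insert_iff b_def by blast
      have sb: "smooth_map \<A> W2 b"
        unfolding b_def by (intro smooth_map_add smooth_map_scale W2(1,3) smooth_map_const) auto
      let ?W' = "?W \<inter> W2"
      have oW': "open ?W'" using oW W2(1) by blast
      have pW': "p \<in> fst c \<inter> ?W'" using pW W2(2) by blast
      have sm': "smooth_map \<A> ?W' \<tau>" "smooth_map \<A> ?W' a" "smooth_map \<A> ?W' b"
        by (rule smooth_map_subset[OF W(2)] smooth_map_subset[OF sa] smooth_map_subset[OF sb], blast)+
      have yb: "y = b p" by (simp add: y01 b_def)
      have "mink ?dt y = - mink (\<tau> p) (typv \<iota> ?J (differential b c p) v)"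
        unfolding yb by (rule mink_sections[OF c(1) pW' oW' sm'(1,3)]) (use W(3) bE iso in blast)
      also have "\<dots> = - k * mink (a p) (typv \<iota> ?J (differential b c p) v)" by (simp add: k mink_simps)
      also have "mink (a p) (typv \<iota> ?J (differential b c p) v) = - mink ?da (b p)"
        using mink_sections[OF c(1) pW' oW' sm'(2,3), of \<iota> ?J v] aEF bE iso by (metis (no_types, lifting) IntD1 IntD2 add.inverse_inverse)
      also have "mink ?da (b p) = 0" by (rule iso[OF da bE[OF W2(2)]])
      finally show ?thesis by simp
    next
      case False
      have "\<tau> p \<noteq> a p" using False vec.span_base[of "a p" "{a p}"] by auto
      moreover have "vec.independent {\<tau> p, a p}"
        using False a0 by (intro vec.independent_insertI vec.independent_empty) auto
      ultimately have "vec.span {\<tau> p, a p} = E p"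
        using W(3)[OF p(2)] ap sE by (intro span_eq_of_card) auto
      then obtain x z where "y = x *s \<tau> p + z *s a p" using y vec_span_insert_iff by blast
      then show ?thesis by (simp add: mink_simps ta tt)
    qed
  qed
  ultimately show "mink (typv \<iota> ?J (differential \<tau> c p) v - typm \<iota> ?J (form_N V c p) v *v \<tau> p) y = 0"
    by (simp add: mink_simps)
qed

text \<open>Write \<sigma> = T \<tau>. The gauged form annihilates \<sigma> at p, which replaces the
  derivative of T on \<tau> by - T (n + a) \<tau>; hence the derivative of \<sigma> is T applied to
  the covariant derivative of \<tau> minus a \<tau>, a vector of E.\<close>

lemma transported_derivative:
  fixes E :: "'m \<Rightarrow> 'k cvec set" and T :: "'m \<Rightarrow> 'k cmat"
  assumes T: "smooth_map \<A> UNIV T" "\<And>p. T p \<in> orth_group"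
    and c: "c \<in> \<A>" "p \<in> fst c \<inter> W" and W: "open W" "smooth_map \<A> W \<sigma>" "\<And>x. x \<in> W \<Longrightarrow> \<sigma> x \<in> (*v) (T x) ` E x"
    and zero: "(T p ** (- n - a) ** adj (T p) - typm \<iota> J (differential T c p) v ** adj (T p)) *v \<sigma> p = 0"
    and sec: "\<And>\<tau>. smooth_map \<A> W \<tau> \<Longrightarrow> (\<And>x. x \<in> W \<Longrightarrow> \<tau> x \<in> E x) \<Longrightarrow>
      typv \<iota> J (differential \<tau> c p) v - n *v \<tau> p \<in> E p"
    and a: "\<And>u. u \<in> E p \<Longrightarrow> a *v u \<in> E p" and sE: "vec.subspace (E p)"
  shows "typv \<iota> J (differential \<sigma> c p) v \<in> (*v) (T p) ` E p"
proof -
  have p: "p \<in> fst c" "p \<in> W" using c by auto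
  define \<tau> where "\<tau> x = adj (T x) *v \<sigma> x" for x
  have TT: "adj (T x) *v (T x *v u) = u" "T x *v (adj (T x) *v u) = u" for x u
    by (simp_all add: matrix_vector_mul_assoc orth_group_adj_left[OF T(2)] orth_group_adj_right[OF T(2)])
  have s\<tau>: "smooth_map \<A> W \<tau>"
    unfolding \<tau>_def by (intro smooth_map_matrix_vector smooth_map_bounded_linear[OF _ bounded_linear_adj] W
        smooth_map_subset[OF T(1)] subset_UNIV)
  have \<tau>E: "\<tau> x \<in> E x" if "x \<in> W" for x using W(3)[OF that] by (auto simp: \<tau>_def TT)
  have dT: "(\<lambda>z. T (coord_inv c z)) differentiable (at (snd c p))"
    using smooth_map_differentiable[OF T(1) open_UNIV c(1)] p by simp
  have d\<tau>: "(\<lambda>z. \<tau> (coord_inv c z)) differentiable (at (snd c p))"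
    by (rule smooth_map_differentiable[OF s\<tau> W(1) c])
  have \<sigma>: "\<sigma> = (\<lambda>x. T x *v \<tau> x)" by (simp add: \<tau>_def TT)
  have "differential \<sigma> c p v = T p *v differential \<tau> c p v + differential T c p v *v \<tau> p" for v
    unfolding \<sigma> by (rule differential_matrix_vector[OF dT d\<tau> c(1) p(1)])
  then have "typv \<iota> J (differential \<sigma> c p) v = T p *v typv \<iota> J (differential \<tau> c p) v + typm \<iota> J (differential T c p) v *v \<tau> p"
    by (simp add: typed_part_def scale_mat_vector matrix_vector_mult_diff_rdistrib matrix_vector_mult_diff_distrib
        matrix_vector_scale)
  moreover have "T p *v (- (n *v \<tau> p) - a *v \<tau> p) = typm \<iota> J (differential T c p) v *v \<tau> p"
    using zero by (simp add: matrix_vector_mult_diff_rdistrib matrix_vector_mul_assoc[symmetric] \<tau>_def matrix_vector_minus_left)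
  ultimately have "typv \<iota> J (differential \<sigma> c p) v
    = T p *v ((typv \<iota> J (differential \<tau> c p) v - n *v \<tau> p) - a *v \<tau> p)"
    by (simp add: matrix_vector_mult_diff_distrib matrix_vector_right_distrib[symmetric] matrix_vector_minus_right)
  moreover have "(typv \<iota> J (differential \<tau> c p) v - n *v \<tau> p) - a *v \<tau> p \<in> E p"
    by (intro vec.subspace_diff[OF sE] sec s\<tau> \<tau>E a p(2))
  ultimately show ?thesis by blast
qed

end

text \<open>A chart with empty domain offers no base point at which \<open>smooth_parts\<close>
  could be applied.\<close>

lemma Ck_on_empty: "Ck_on k {} f"
  by (induction k arbitrary: f) (auto simp: differentiable_on_def)

section \<open>The transformed surface and its central sphere congruence\<close>

context dressing
begin

definition qhat :: "('m, 'k cmat) form1" where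
  "qhat c p v = Ad (S 0 p) (part10m g q c p v) + Ad (Sinf p) (part01m g q c p v)"

text \<open>Conjugation commutes with complex scaling and does not involve the tangent vector, so it
  preserves the type of a form.\<close>

lemma qhat_parts:
  assumes c: "c \<in> \<A>" "p \<in> fst c"
  shows "part10m g qhat c p v = Ad (S 0 p) (part10m g q c p v)"
    and "part01m g qhat c p v = Ad (Sinf p) (part01m g q c p v)"
proof -
  let ?J = "rot90 g c p"
  note t = type_parts(2,4)[OF q_form c]
  have e: "qhat c p = (\<lambda>v. Ad (S 0 p) (part10m g q c p v) + Ad (Sinf p) (part01m g q c p v))"
    by (rule ext) (simp add: qhat_def)
  have a: "Ad (S 0 p) (part10m g q c p (?J v)) = \<i> \<odot> Ad (S 0 p) (part10m g q c p v)" for v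
    by (simp add: t(1) Ad_scale_mat)
  have b: "Ad (Sinf p) (part01m g q c p (?J v)) = (- \<i>) \<odot> Ad (Sinf p) (part01m g q c p v)" for v
    by (simp add: t(2) Ad_scale_mat)
  show "part10m g qhat c p v = Ad (S 0 p) (part10m g q c p v)"
    unfolding part10_typ[of _ _ qhat] e typm_add
    using typm_same[of \<i> "\<lambda>v. Ad (S 0 p) (part10m g q c p v)" ?J v, OF _ a]
      typm_same[of "- \<i>" "\<lambda>v. Ad (Sinf p) (part01m g q c p v)" ?J v, OF _ b] by simp
  show "part01m g qhat c p v = Ad (Sinf p) (part01m g q c p v)"
    unfolding part01m_typ[of _ qhat] e typm_add
    using typm_same[of \<i> "\<lambda>v. Ad (S 0 p) (part10m g q c p v)" ?J v, OF _ a]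
      typm_same[of "- \<i>" "\<lambda>v. Ad (Sinf p) (part01m g q c p v)" ?J v, OF _ b] by simp
qed

lemma qhat_form: "one_form \<A> qhat"
  unfolding one_form_def
proof (intro conjI ballI allI)
  fix c p assume c: "c \<in> \<A>" "p \<in> fst c"
  have e: "qhat c p = (\<lambda>v. Ad (S 0 p) (part10m g q c p v) + Ad (Sinf p) (part01m g q c p v))"
    by (rule ext) (simp add: qhat_def)
  note l = linear_parts(3,4)[OF q_form c]
  show "linear (qhat c p)"
    unfolding e using linear_compose[OF l(1) linear_Ad[of "S 0 p"]] linear_compose[OF l(2) linear_Ad[of "Sinf p"]]
    by (simp add: o_def linear_compose_add)
next
  fix c v assume c: "c \<in> \<A>"
  let ?U = "snd c ` fst c"
  note op = chart_open(2)[OF c]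
  have sm: "smooth_on ?U (\<lambda>z. part10m g q c (coord_inv c z) v)" "smooth_on ?U (\<lambda>z. part01m g q c (coord_inv c z) v)"
    using smooth_parts(3,4)[OF q_form c] by (cases "fst c = {}"; auto simp: smooth_on_def intro: Ck_on_empty)+
  have ss: "smooth_on ?U (\<lambda>z. T (coord_inv c z) ** X (coord_inv c z) ** adj (T (coord_inv c z)))"
    if "smooth_map \<A> UNIV T" "smooth_on ?U (\<lambda>z. X (coord_inv c z))" for T X :: "'m \<Rightarrow> 'k cmat"
    by (intro smooth_on_matrix_mult smooth_on_bounded_linear[OF _ bounded_linear_adj] op
        smooth_map_on_UNIV[OF that(1) c] that(2))
  show "smooth_on ?U (\<lambda>z. qhat c (coord_inv c z) v)"
    unfolding qhat_def Ad_adj[OF S_orth[OF D0]] Ad_adj[OF Sinf_orth]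
    by (intro smooth_on_add op ss S_smooth Sinf_smooth D0 sm)
next
  fix c c' p v assume c: "c \<in> \<A>" "c' \<in> \<A>" "p \<in> fst c \<inter> fst c'"
  show "qhat c p v = qhat c' p (transition_deriv c c' p v)"
    unfolding qhat_def part10_typ part01m_typ typm_rot90_transition[OF q_form c] ..
qed

text \<open>The coefficients found for the two types are exactly those of the spectral family of
  Vhat and \<open>qhat\<close>, and a form is the sum of its types.\<close>

lemma hat_lax:
  assumes c: "c \<in> \<A>" "p \<in> fst c" and \<zeta>: "\<zeta> \<in> D" "\<zeta> \<noteq> 0"
  shows "hat.lax qhat \<zeta> c p v = gauged \<zeta> c p v"
proof -
  have "gauged \<zeta> c p v = typm \<i> (rot90 g c p) (gauged \<zeta> c p) v + typm (- \<i>) (rot90 g c p) (gauged \<zeta> c p) v"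
    by (simp add: typm_sum)
  also have "\<dots> = (- hN10 c p v + inverse \<zeta> \<odot> hN10 c p v + (inverse (\<zeta>\<^sup>2) - 1) \<odot> part10m g qhat c p v)
    + (- hN01 c p v + \<zeta> \<odot> hN01 c p v + (\<zeta>\<^sup>2 - 1) \<odot> part01m g qhat c p v)"
    by (simp add: hat_parts10(1)[OF c \<zeta>] hat_parts01(1)[OF c \<zeta>] qhat_parts[OF c])
  also have "\<dots> = hat.lax qhat \<zeta> c p v"
    unfolding hat.lax_def hat.split_N[OF qhat_form c, symmetric] by (simp add: vec_eq_iff)
  finally show ?thesis by simp
qed

lemma qhat_wedge:
  assumes c: "c \<in> \<A>" "p \<in> fst c"
  shows "part10m g qhat c p v \<in> wedge2 ((*v) (S 0 p) ` \<Delta>01 p)"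
    and "part01m g qhat c p v \<in> wedge2 ((*v) (Sinf p) ` \<Delta>10 p)"
  unfolding qhat_parts[OF c]
  using Ad_wedge2[OF S_orth[OF D0] q10_wedge[OF c]] Ad_wedge2[OF Sinf_orth q01_wedge[OF c]] by blast+

lemma wedge2_add: "X \<in> wedge2 E \<Longrightarrow> Y \<in> wedge2 E \<Longrightarrow> X + Y \<in> wedge2 E"
  unfolding wedge2_def by (rule span_add)

text \<open>For \<zeta> in the infinite set D - {0} the new family is a gauge transform of the flat
  old one, so its curvature is a conjugate of 0.\<close>

lemma hat_harmonic: "constrained_harmonic \<A> g Vhat qhat"
proof (rule hat.flat_harmonic[OF qhat_form _ D_inf])
  fix c p v assume c: "c \<in> \<A>" "p \<in> fst c"
  have "qhat c p v \<in> wedge2 (Vhat p)"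
    unfolding qhat_def by (intro wedge2_add Ad_q10_Vhat Ad_q01_Vhat c)
  then have "qhat c p v + 0 \<in> {X + Y | X Y. X \<in> wedge2 (Vhat p) \<and> Y \<in> wedge2 (perp (Vhat p))}"
    using wedge2_zero by blast
  then show "qhat c p v \<in> {X + Y | X Y. X \<in> wedge2 (Vhat p) \<and> Y \<in> wedge2 (perp (Vhat p))}" by simp
next
  fix c p v w \<zeta> assume c: "c \<in> \<A>" "p \<in> fst c" and \<zeta>': "\<zeta> \<in> D - {0}"
  then have \<zeta>: "\<zeta> \<in> D" "\<zeta> \<noteq> 0" by auto
  let ?z = "snd c p" and ?U = "snd c ` fst c"
  let ?S = "\<lambda>z. S \<zeta> (coord_inv c z)" and ?T = "\<lambda>z. matrix_inv (S \<zeta> (coord_inv c z))"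
  have z: "?z \<in> ?U" using c by blast
  note op = chart_open(2)[OF c(1)]
  have "curv (\<lambda>z v. hat.lax qhat \<zeta> c (coord_inv c z) v) ?z v w
    = curv (\<lambda>z v. ?S z ** lax q \<zeta> c (coord_inv c z) v ** ?T z + ?S z ** pd ?T z v) ?z v w"
  proof (rule curv_cong[OF op z])
    fix y v assume y: "y \<in> ?U"
    show "hat.lax qhat \<zeta> c (coord_inv c y) v = ?S y ** lax q \<zeta> c (coord_inv c y) v ** ?T y + ?S y ** pd ?T y v"
      unfolding hat_lax[OF c(1) coord_inv_in[OF y] \<zeta>] gauged_def differential_pd snd_coord_inv[OF y] ..
  qed
  also have "\<dots> = ?S ?z ** curv (\<lambda>z v. lax q \<zeta> c (coord_inv c z) v) ?z v w ** ?T ?z"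
  proof (rule curv_gauge[OF op z])
    show "smooth_on ?U ?S" "smooth_on ?U ?T"
      using smooth_map_on_UNIV[OF S_smooth[OF \<zeta>(1)] c(1)] smooth_map_on_UNIV[OF smooth_S_inv[OF \<zeta>(1)] c(1)] .
    show "?S y ** ?T y = mat 1" "?T y ** ?S y = mat 1" for y
      using matrix_inv_right[OF S_orth[OF \<zeta>(1)]] matrix_inv_left[OF S_orth[OF \<zeta>(1)]] by blast+
    show "(\<lambda>z. lax q \<zeta> c (coord_inv c z) v) differentiable (at ?z)" for v
      unfolding lax_def by (intro differentiable_add differentiable_scale_mat diff_parts[OF q_form c])
  qed
  also have "\<dots> = 0" by (simp add: harmonic_flat[OF harmonic c \<zeta>(2)])
  finally show "curv (\<lambda>z v. hat.lax qhat \<zeta> c (coord_inv c z) v) ?z v w = 0" .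
qed simp

definition \<Delta>hat10 :: "'m \<Rightarrow> 'k cvec set" where "\<Delta>hat10 p = (*v) (Sinf p) ` \<Delta>10 p"

definition \<Delta>hat01 :: "'m \<Rightarrow> 'k cvec set" where "\<Delta>hat01 p = (*v) (S 0 p) ` \<Delta>01 p"

lemma \<Delta>hat_Vhat: "\<Delta>hat10 p \<subseteq> Vhat p" "\<Delta>hat01 p \<subseteq> Vhat p"
  unfolding \<Delta>hat10_def \<Delta>hat01_def using \<Delta>10(4)[of p] \<Delta>01(4)[of p] Vhat_S0[of p] Vhat_Sinf[of p] by blast+

lemma \<Delta>hat_isotropic: "isotropic (\<Delta>hat10 p)" "isotropic (\<Delta>hat01 p)"
  unfolding \<Delta>hat10_def \<Delta>hat01_def
  using orth_group_image(3)[OF Sinf_orth \<Delta>10(3)] orth_group_image(3)[OF S_orth[OF D0] \<Delta>01(3)] .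

lemma \<Delta>hat_bundles: "subbundle \<A> 2 \<Delta>hat10" "subbundle \<A> 2 \<Delta>hat01"
proof -
  have s: "subbundle \<A> 2 \<Delta>10" "subbundle \<A> 2 \<Delta>01" using surf by (simp_all add: complexified_surface_def)
  show "subbundle \<A> 2 \<Delta>hat10" "subbundle \<A> 2 \<Delta>hat01"
    unfolding \<Delta>hat10_def[abs_def] \<Delta>hat01_def[abs_def]
    using subbundle_image[OF s(1) Sinf_smooth Sinf_orth] subbundle_image[OF s(2) S_smooth[OF D0] S_orth[OF D0]] .
qed

text \<open>The determinant condition enters here: \<open>rinf\<close> and \<open>r 0\<close>
  preserve V and permute its two families of isotropic planes alike. The common factor, the inverse
  of \<open>r 1\<close>, is injective and does not change dimensions.\<close>

lemma \<Delta>hat_meet: "vec.dim (\<Delta>hat10 p \<inter> \<Delta>hat01 p) = 1"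
proof -
  let ?R = "matrix_inv (r 1 p)"
  have "vec.dim ((*v) (rinf p) ` \<Delta>10 p \<inter> (*v) (r 0 p) ` \<Delta>01 p) = 1"
    by (rule opposite_families[OF V_dim V_nondeg \<Delta>10 \<Delta>01 \<Delta>_meet rinf_orth r_preserves(2) r_orth[OF D0] r_preserves(1)])
      (simp add: r_det)
  moreover have "\<Delta>hat10 p \<inter> \<Delta>hat01 p = (*v) ?R ` ((*v) (rinf p) ` \<Delta>10 p \<inter> (*v) (r 0 p) ` \<Delta>01 p)"
  proof -
    have "inj ((*v) ?R)"
      by (rule inj_on_inverseI[of _ "(*v) (r 1 p)"]) (simp add: matrix_vector_mul_assoc r1_inv(2))
    then show ?thesis
      unfolding \<Delta>hat10_def \<Delta>hat01_def
      by (simp add: image_Int image_image Sinf_def S_def matrix_vector_mul_assoc)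
  qed
  ultimately show ?thesis by (simp add: orth_group_image(2)[OF r1_inv(1)])
qed

lemma hat_central: "central_sphere_congruence \<A> g \<Delta>hat10 \<Delta>hat01 Vhat"
  unfolding central_sphere_congruence_def
proof (intro conjI allI ballI)
  show "subbundle \<A> 4 Vhat" by (rule Vhat_bundle)
  show "nondegenerate (Vhat p)" for p by (rule Vhat_bundle)
  show "{x + y | x y. x \<in> \<Delta>hat10 p \<and> y \<in> \<Delta>hat01 p} \<subseteq> Vhat p" for p
    using \<Delta>hat_Vhat[of p] hat.V_splits[of p] by (auto simp: splits_def intro!: vec.subspace_add)
  fix c p v u assume c: "c \<in> \<A>" "p \<in> fst c"
  show "hN10 c p v *v u = 0" if "u \<in> \<Delta>hat01 p" using that hat_parts10(3)[OF c] by (auto simp: \<Delta>hat01_def)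
  show "hN01 c p v *v u = 0" if "u \<in> \<Delta>hat10 p" using that hat_parts01(3)[OF c] by (auto simp: \<Delta>hat10_def)
qed

lemma \<Delta>_deriv:
  assumes "open W" "smooth_map \<A> W \<sigma>" "\<And>x. x \<in> W \<Longrightarrow> \<sigma> x \<in> \<Delta>10 x \<inter> \<Delta>01 x" "c \<in> \<A>" "p \<in> fst c \<inter> W"
  shows "typv \<i> (rot90 g c p) (differential \<sigma> c p) v \<in> \<Delta>10 p"
    "typv (- \<i>) (rot90 g c p) (differential \<sigma> c p) v \<in> \<Delta>01 p"
proof -
  have "part10v g (differential \<sigma>) c p v \<in> \<Delta>10 p \<and> part01v g (differential \<sigma>) c p v \<in> \<Delta>01 p"
    using surf[unfolded complexified_surface_def, THEN conjunct2, THEN conjunct2, THEN conjunct2, THEN conjunct2, rule_format, of W \<sigma> c p v] assms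
    by simp
  then show "typv \<i> (rot90 g c p) (differential \<sigma> c p) v \<in> \<Delta>10 p"
    "typv (- \<i>) (rot90 g c p) (differential \<sigma> c p) v \<in> \<Delta>01 p"
    by (simp_all add: part10_typ part01v_typ)
qed

lemma \<Delta>_bundles: "subbundle \<A> 2 \<Delta>10" "subbundle \<A> 2 \<Delta>01" "subbundle \<A> 1 (\<lambda>p. \<Delta>10 p \<inter> \<Delta>01 p)"
  using surf by (simp_all add: complexified_surface_def)

lemma \<Delta>_meet': "vec.dim (\<Delta>01 p \<inter> \<Delta>10 p) = 1"
  using \<Delta>_meet by (simp add: Int_commute)

text \<open>At infinity the gauged (1,0)-part equals - hN10 minus the (1,0)-part of
  \<open>qhat\<close>, and both terms kill the new \<Delta>01, which contains \<sigma>. The same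
  value is the gauge by \<open>Sinf\<close> of - N10 minus the (1,0)-part of q, so the derivative is
  carried over from \<Delta>10, which the (1,0)-parts of D_V and of q preserve.\<close>

lemma hat_deriv10:
  assumes W: "open W" "smooth_map \<A> W \<sigma>" "\<And>x. x \<in> W \<Longrightarrow> \<sigma> x \<in> \<Delta>hat10 x \<inter> \<Delta>hat01 x" and c: "c \<in> \<A>" "p \<in> fst c \<inter> W"
  shows "part10v g (differential \<sigma>) c p v \<in> \<Delta>hat10 p"
proof -
  have p: "p \<in> fst c" "p \<in> W" using c by auto
  have "typv \<i> (rot90 g c p) (differential \<sigma> c p) v \<in> (*v) (Sinf p) ` \<Delta>10 p"
  proof (rule transported_derivative[OF Sinf_smooth Sinf_orth c W(1,2), where n = "N10 c p v" and a = "part10m g q c p v"])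
    show "\<sigma> x \<in> (*v) (Sinf x) ` \<Delta>10 x" if "x \<in> W" for x using W(3)[OF that] by (simp add: \<Delta>hat10_def)
    have \<sigma>p: "\<sigma> p \<in> \<Delta>hat01 p" using W(3)[OF p(2)] by blast
    have "(- hN10 c p v - Ad (S 0 p) (part10m g q c p v)) *v \<sigma> p = 0"
    proof -
      have "hN10 c p v *v \<sigma> p = 0" using hat_parts10(3)[OF c(1) p(1)] \<sigma>p by (auto simp: \<Delta>hat01_def)
      moreover have "Ad (S 0 p) (part10m g q c p v) *v \<sigma> p = 0"
        using wedge2_kill_isotropic[OF \<Delta>hat_isotropic(2) _ \<sigma>p] qhat_wedge(1)[OF c(1) p(1)]
        by (simp add: \<Delta>hat01_def qhat_parts[OF c(1) p(1)])
      ultimately show ?thesis by (simp add: matrix_vector_mult_diff_rdistrib matrix_vector_minus_left)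
    qed
    then show "(Sinf p ** (- N10 c p v - part10m g q c p v) ** adj (Sinf p)
        - typm \<i> (rot90 g c p) (differential Sinf c p) v ** adj (Sinf p)) *v \<sigma> p = 0"
      unfolding hat_parts10(2)[OF c(1) p(1)] .
    show "typv \<i> (rot90 g c p) (differential \<tau> c p) v - N10 c p v *v \<tau> p \<in> \<Delta>10 p"
      if \<tau>: "smooth_map \<A> W \<tau>" "\<And>x. x \<in> W \<Longrightarrow> \<tau> x \<in> \<Delta>10 x" for \<tau>
      unfolding part10_typ[of _ _ "form_N V"]
    proof (rule isotropic_section[OF \<Delta>_bundles(1) \<Delta>10(3,4) _ \<Delta>_bundles(3) _ c W(1) \<tau>])
      show "x \<in> \<Delta>10 p" if "x \<in> V p" "\<And>y. y \<in> \<Delta>10 p \<Longrightarrow> mink x y = 0" for p x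
        by (rule isotropic_maximal[OF V_dim V_nondeg \<Delta>10 \<Delta>01 \<Delta>_meet that])
      show "typv \<i> (rot90 g c p) (differential a c p) v \<in> \<Delta>10 p"
        if "open W'" "smooth_map \<A> W' a" "\<And>x. x \<in> W' \<Longrightarrow> a x \<in> \<Delta>10 x \<inter> \<Delta>01 x" "p \<in> W'" for W' a
        by (rule \<Delta>_deriv(1)[OF that(1,2,3) c(1)]) (use p(1) that(4) in auto)
    qed
    show "part10m g q c p v *v u \<in> \<Delta>10 p" if "u \<in> \<Delta>10 p" for u
      using wedge2_swap_family[OF V_dim V_nondeg \<Delta>10 \<Delta>01 \<Delta>_meet q10_wedge[OF c(1) p(1)] that] by blast
    show "vec.subspace (\<Delta>10 p)" by (rule \<Delta>10(1))
  qed
  then show ?thesis by (simp add: part10_typ \<Delta>hat10_def)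
qed

text \<open>The mirror image of \<open>hat_deriv10\<close>: the (0,1)-part is bounded at 0, and
  \<open>S 0\<close> carries \<Delta>01 to the new plane.\<close>

lemma hat_deriv01:
  assumes W: "open W" "smooth_map \<A> W \<sigma>" "\<And>x. x \<in> W \<Longrightarrow> \<sigma> x \<in> \<Delta>hat10 x \<inter> \<Delta>hat01 x" and c: "c \<in> \<A>" "p \<in> fst c \<inter> W"
  shows "part01v g (differential \<sigma>) c p v \<in> \<Delta>hat01 p"
proof -
  have p: "p \<in> fst c" "p \<in> W" using c by auto
  have line: "subbundle \<A> 1 (\<lambda>p. \<Delta>01 p \<inter> \<Delta>10 p)" using \<Delta>_bundles(3) by (simp add: Int_commute)
  have "typv (- \<i>) (rot90 g c p) (differential \<sigma> c p) v \<in> (*v) (S 0 p) ` \<Delta>01 p"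
  proof (rule transported_derivative[OF S_smooth[OF D0] S_orth[OF D0] c W(1,2), where n = "N01 c p v" and a = "part01m g q c p v"])
    show "\<sigma> x \<in> (*v) (S 0 x) ` \<Delta>01 x" if "x \<in> W" for x using W(3)[OF that] by (simp add: \<Delta>hat01_def)
    have \<sigma>p: "\<sigma> p \<in> \<Delta>hat10 p" using W(3)[OF p(2)] by blast
    have "(- hN01 c p v - Ad (Sinf p) (part01m g q c p v)) *v \<sigma> p = 0"
    proof -
      have "hN01 c p v *v \<sigma> p = 0" using hat_parts01(3)[OF c(1) p(1)] \<sigma>p by (auto simp: \<Delta>hat10_def)
      moreover have "Ad (Sinf p) (part01m g q c p v) *v \<sigma> p = 0"
        using wedge2_kill_isotropic[OF \<Delta>hat_isotropic(1) _ \<sigma>p] qhat_wedge(2)[OF c(1) p(1)]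
        by (simp add: \<Delta>hat10_def qhat_parts[OF c(1) p(1)])
      ultimately show ?thesis by (simp add: matrix_vector_mult_diff_rdistrib matrix_vector_minus_left)
    qed
    then show "(S 0 p ** (- N01 c p v - part01m g q c p v) ** adj (S 0 p)
        - typm (- \<i>) (rot90 g c p) (differential (S 0) c p) v ** adj (S 0 p)) *v \<sigma> p = 0"
      unfolding hat_parts01(2)[OF c(1) p(1)] .
    show "typv (- \<i>) (rot90 g c p) (differential \<tau> c p) v - N01 c p v *v \<tau> p \<in> \<Delta>01 p"
      if \<tau>: "smooth_map \<A> W \<tau>" "\<And>x. x \<in> W \<Longrightarrow> \<tau> x \<in> \<Delta>01 x" for \<tau>
      unfolding part01m_typ[of _ "form_N V"]
    proof (rule isotropic_section[OF \<Delta>_bundles(2) \<Delta>01(3,4) _ line _ c W(1) \<tau>])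
      show "x \<in> \<Delta>01 p" if "x \<in> V p" "\<And>y. y \<in> \<Delta>01 p \<Longrightarrow> mink x y = 0" for p x
        by (rule isotropic_maximal[OF V_dim V_nondeg \<Delta>01 \<Delta>10 \<Delta>_meet' that])
      show "typv (- \<i>) (rot90 g c p) (differential a c p) v \<in> \<Delta>01 p"
        if "open W'" "smooth_map \<A> W' a" "\<And>x. x \<in> W' \<Longrightarrow> a x \<in> \<Delta>01 x \<inter> \<Delta>10 x" "p \<in> W'" for W' a
        by (rule \<Delta>_deriv(2)[OF that(1,2) _ c(1)]) (use p(1) that(3,4) in auto)
    qed
    show "part01m g q c p v *v u \<in> \<Delta>01 p" if "u \<in> \<Delta>01 p" for u
      using wedge2_swap_family[OF V_dim V_nondeg \<Delta>01 \<Delta>10 \<Delta>_meet' q01_wedge[OF c(1) p(1)] that] by blast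
    show "vec.subspace (\<Delta>01 p)" by (rule \<Delta>01(1))
  qed
  then show ?thesis by (simp add: part01v_typ \<Delta>hat01_def)
qed

lemma hat_surface: "complexified_surface \<A> g \<Delta>hat10 \<Delta>hat01"
  unfolding complexified_surface_def
proof (intro conjI allI impI ballI)
  show "subbundle \<A> 2 \<Delta>hat10" "subbundle \<A> 2 \<Delta>hat01" by (rule \<Delta>hat_bundles)+
  show "isotropic (\<Delta>hat10 p)" "isotropic (\<Delta>hat01 p)" for p by (rule \<Delta>hat_isotropic)+
  have "vec.subspace (Vhat p)" "vec.dim (Vhat p) = 4" for p
    using Vhat_bundle(1) by (simp_all add: subbundle_def)
  then show "subbundle \<A> 1 (\<lambda>p. \<Delta>hat10 p \<inter> \<Delta>hat01 p)"
    by (rule subbundle_meet[OF _ _ Vhat_bundle(2) \<Delta>hat_bundles(1) \<Delta>hat_isotropic(1) \<Delta>hat_Vhat(1)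
        \<Delta>hat_bundles(2) \<Delta>hat_isotropic(2) \<Delta>hat_Vhat(2) \<Delta>hat_meet])
next
  fix W \<sigma> c p v
  assume W: "open W" "smooth_map \<A> W \<sigma>" and \<sigma>: "\<forall>x\<in>W. \<sigma> x \<in> \<Delta>hat10 x \<inter> \<Delta>hat01 x"
    and c: "c \<in> \<A>" "p \<in> fst c \<inter> W"
  show "part10v g (differential \<sigma>) c p v \<in> \<Delta>hat10 p" "part01v g (differential \<sigma>) c p v \<in> \<Delta>hat01 p"
    by (rule hat_deriv10[OF W _ c] hat_deriv01[OF W _ c], use \<sigma> in simp)+
qed

lemma dressed:
  "constrained_Willmore \<A> g \<Delta>hat10 \<Delta>hat01 qhat \<and> qd_central_sphere_congruence \<A> g \<Delta>hat10 \<Delta>hat01 qhat Vhat"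
proof -
  have qd: "qd_central_sphere_congruence \<A> g \<Delta>hat10 \<Delta>hat01 qhat Vhat"
    unfolding qd_central_sphere_congruence_def by (rule conjI[OF hat_central hat_harmonic])
  moreover have "part10m g qhat c p v \<in> wedge2 (\<Delta>hat01 p) \<and> part01m g qhat c p v \<in> wedge2 (\<Delta>hat10 p)"
    if "c \<in> \<A>" "p \<in> fst c" for c p v
    unfolding \<Delta>hat10_def \<Delta>hat01_def by (rule conjI[OF qhat_wedge[OF that]])
  ultimately show ?thesis
    unfolding constrained_Willmore_def using hat_surface qhat_form by blast
qed

end

theorem theorem6p25:
  fixes \<A> :: "'m::{t2_space,second_countable_topology} chart set"
    and g :: "'m metric"
    and n :: nat
    and \<Delta>10 \<Delta>01 V hat\<Delta>10 hat\<Delta>01 :: "'m \<Rightarrow> 'k::finite cvec set"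
    and q hatq10 hatq01 hatq :: "('m, 'k cmat) form1"
    and \<rho> rinf :: "'m \<Rightarrow> 'k cmat"
    and r :: "complex \<Rightarrow> 'm \<Rightarrow> 'k cmat"
    and D :: "complex set"
  assumes "n \<ge> 3" and "CARD('k) = n + 1"
    and "oriented_surface \<A>" and "riemannian_metric \<A> g"
    and "constrained_Willmore \<A> g \<Delta>10 \<Delta>01 q"
    and "qd_central_sphere_congruence \<A> g \<Delta>10 \<Delta>01 q V"
    and "\<rho> = (\<lambda>p. oproj (V p) - oproj (perp (V p)))"
    and "rational_family \<A> r D"
    and "\<forall>\<zeta>\<in>D. \<forall>p. r \<zeta> p \<in> orth_group"
    and "0 \<in> D" and "\<forall>p. invertible (r 0 p)"
    and "\<forall>p. ((\<lambda>\<zeta>. r \<zeta> p) \<longlongrightarrow> rinf p) at_infinity" and "\<forall>p. invertible (rinf p)"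
    and "1 \<in> D"
    and "\<forall>\<zeta>\<in>D. - \<zeta> \<in> D \<and> (\<forall>p. \<rho> p ** r \<zeta> p ** matrix_inv (\<rho> p) = r (- \<zeta>) p)"
    and "extends_by_metric_connections \<A> D (\<lambda>\<zeta>. gauge_conj (r \<zeta>) (conn_lambda g V q \<zeta>))"
    and "\<forall>p. det_on4 (V p) (r 0 p) = det_on4 (V p) (rinf p)"
    and "hat\<Delta>10 = map_bundle rinf \<Delta>10"
    and "hat\<Delta>01 = map_bundle (r 0) \<Delta>01"
    and "hatq10 = (\<lambda>c p v. Ad (r 0 p) (part10m g q c p v))"
    and "hatq01 = (\<lambda>c p v. Ad (rinf p) (part01m g q c p v))"
    and "hatq = (\<lambda>c p v. hatq10 c p v + hatq01 c p v)"
  shows "constrained_Willmore \<A> g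
           (map_bundle (\<lambda>p. matrix_inv (r 1 p)) hat\<Delta>10)
           (map_bundle (\<lambda>p. matrix_inv (r 1 p)) hat\<Delta>01)
           (\<lambda>c p v. Ad (matrix_inv (r 1 p)) (hatq c p v)) \<and>
         qd_central_sphere_congruence \<A> g
           (map_bundle (\<lambda>p. matrix_inv (r 1 p)) hat\<Delta>10)
           (map_bundle (\<lambda>p. matrix_inv (r 1 p)) hat\<Delta>01)
           (\<lambda>c p v. Ad (matrix_inv (r 1 p)) (hatq c p v))
           (map_bundle (\<lambda>p. matrix_inv (r 1 p)) V)"
proof -
  interpret surface \<A> g
    by unfold_locales (rule assms(3,4))+
  have csc: "central_sphere_congruence \<A> g \<Delta>10 \<Delta>01 V"
    using assms(6) by (simp add: qd_central_sphere_congruence_def)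
  interpret quadric_bundle \<A> g V
    by unfold_locales (use csc in \<open>simp_all add: central_sphere_congruence_def\<close>)
  have \<rho>: "\<rho> p = reflection p" for p
    by (simp add: assms(7) reflection_eq)
  interpret dressing \<A> g V \<Delta>10 \<Delta>01 q r rinf D
    by unfold_locales (use assms(5,6,8,9,10,12,14,15,16,17) \<rho> in auto)
  have "map_bundle (\<lambda>p. matrix_inv (r 1 p)) hat\<Delta>10 = \<Delta>hat10"
    "map_bundle (\<lambda>p. matrix_inv (r 1 p)) hat\<Delta>01 = \<Delta>hat01"
    "map_bundle (\<lambda>p. matrix_inv (r 1 p)) V = Vhat"
    by (simp_all add: fun_eq_iff map_bundle_def assms(18,19) \<Delta>hat10_def \<Delta>hat01_def Vhat_def Sinf_def S_def
        image_image matrix_vector_mul_assoc)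
  \<comment> \<open>Successive conjugations compose, so the inverse of \<open>r 1\<close> after
    \<open>r 0\<close> or \<open>rinf\<close> is conjugation by \<open>S 0\<close> or
    \<open>Sinf\<close>.\<close>
  moreover have "(\<lambda>c p v. Ad (matrix_inv (r 1 p)) (hatq c p v)) = qhat"
    by (simp add: fun_eq_iff assms(20-22) qhat_def Ad_add Ad_Ad r1_inv(1) r_orth[OF D0] rinf_orth S_def Sinf_def)
  ultimately show ?thesis using dressed by simp
qed

end
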